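(* Let $(R,\mathfrak m)$ be a universally catenary, analytically unramified Noetherian local ring. Suppose $g\in R[t]$ has Dedekind--Mertens number $\mu_R(g)=k$. Assume that $\dim(R/\mathfrak p)\ge k$ for all minimal primes $\mathfrak p$ of $R$. Then $\mu_R(c(g))\le k$, where $\mu_R(c(g))$ is the minimal number of generators of the content ideal $c(g)$. Therefore $\mu_R(c(g))=\widetilde\mu_R(g)=\mu_R(g)$, where $\widetilde\mu_R(g)$ is the polarized Dedekind--Mertens number of $g$.
   Context: Rings are commutative with identity and $t$ is an indeterminate. For $f\in R[t]$, the content ideal $c(f)$ is the ideal of $R$ generated by the coefficients of $f$. For an ideal $I$ of a ring, $I^0$ is the whole ring. The Dedekind--Mertens number $\mu_R(g)$ of $g\in R[t]$ is the smallest positive integer $k$ such that $c(fg)\,c(f)^{k-1}=c(f)^k c(g)$ for every $f\in R[t]$. (By the classical Dedekind--Mertens Lemma, such $k$ exists.) The polarized Dedekind--Mertens number $\widetilde\mu_R(g)$ is the smallest positive integer $k$ such that $$\sum_{i=1}^k c(f_ig)\,c(f_1)\cdots\widehat{c(f_i)}\cdots c(f_k)=c(f_1)\cdots c(f_k)\,c(g)$$ for all $f_1,\dots,f_k\in R[t]$, where $\widehat{c(f_i)}$ means that the factor $c(f_i)$ is omitted (an empty product of ideals is $R$). For an ideal $I$ of the local ring $R$, $\mu_R(I)$ denotes the minimal number of generators of $I$. A Noetherian local ring is analytically unramified if its $\mathfrak m$-adic completion is reduced.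
   Formalization: The equality of the minimal number of generators of c(g) with the Dedekind–Mertens numbers is asserted only for g ≠ 0, since for g = 0 (e.g. over K[[x]]) c(g) needs 0 generators while both Dedekind–Mertens numbers are 1. *)

theory Defs
  imports
    "HOL-Algebra.Algebra"
    "HOL-Library.Extended_Nat"
begin

locale local_ring = cring R for R (structure) + fixes \<mm>
  assumes maximal: "maximalideal \<mm> R"
    and maximal_unique: "maximalideal \<nn> R \<Longrightarrow> \<nn> = \<mm>"

definition reduced_ring :: "('a, 'b) ring_scheme \<Rightarrow> bool"
  where "reduced_ring R \<longleftrightarrow>
    (\<forall>x \<in> carrier R. \<forall>n::nat. x [^]\<^bsub>R\<^esub> n = \<zero>\<^bsub>R\<^esub> \<longrightarrow> x = \<zero>\<^bsub>R\<^esub>)"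

definition minimal_prime :: "('a, 'b) ring_scheme \<Rightarrow> 'a set \<Rightarrow> bool"
  where "minimal_prime R \<pp> \<longleftrightarrow>
    primeideal \<pp> R \<and> (\<forall>\<qq>. primeideal \<qq> R \<and> \<qq> \<subseteq> \<pp> \<longrightarrow> \<qq> = \<pp>)"

definition prime_chain :: "('a, 'b) ring_scheme \<Rightarrow> nat \<Rightarrow> (nat \<Rightarrow> 'a set) \<Rightarrow> bool"
  where "prime_chain R n P \<longleftrightarrow> (\<forall>i\<le>n. primeideal (P i) R) \<and> (\<forall>i<n. P i \<subset> P (Suc i))"

text \<open>The zero ring has no primes and gets dimension 0 here (supremum of the empty set).\<close>

definition krull_dim :: "('a, 'b) ring_scheme \<Rightarrow> enat"
  where "krull_dim R = Sup {enat n | n. \<exists>P. prime_chain R n P}"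

definition saturated_prime_chain ::
    "('a, 'b) ring_scheme \<Rightarrow> nat \<Rightarrow> (nat \<Rightarrow> 'a set) \<Rightarrow> bool"
  where "saturated_prime_chain R n P \<longleftrightarrow> prime_chain R n P \<and>
    (\<forall>i<n. \<not> (\<exists>\<qq>. primeideal \<qq> R \<and> P i \<subset> \<qq> \<and> \<qq> \<subset> P (Suc i)))"

definition catenary :: "('a, 'b) ring_scheme \<Rightarrow> bool"
  where "catenary R \<longleftrightarrow>
    (\<forall>\<pp> \<qq>. primeideal \<pp> R \<and> primeideal \<qq> R \<and> \<pp> \<subseteq> \<qq> \<longrightarrow>
      (\<exists>b. \<forall>n P. prime_chain R n P \<and> P 0 = \<pp> \<and> P n = \<qq> \<longrightarrow> n \<le> b) \<and>
      (\<forall>n P n' P'.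
        saturated_prime_chain R n P \<and> P 0 = \<pp> \<and> P n = \<qq> \<and>
        saturated_prime_chain R n' P' \<and> P' 0 = \<pp> \<and> P' n' = \<qq> \<longrightarrow> n = n'))"

definition finitely_generated_algebra ::
    "('a, 'b) ring_scheme \<Rightarrow> ('c, 'd) ring_scheme \<Rightarrow> bool"
  where "finitely_generated_algebra R A \<longleftrightarrow> cring A \<and>
    (\<exists>\<phi> \<in> ring_hom R A. \<exists>G. finite G \<and> G \<subseteq> carrier A \<and>
      generate_ring A (\<phi> ` carrier R \<union> G) = carrier A)"

text \<open>
  HOL cannot quantify over the carrier type of the algebra inside a definition.  A finitely
  generated \<open>R\<close>-algebra has at most \<open>max |R| \<aleph>\<^sub>0\<close> elements, hence is isomorphic to one whose
  carrier is a set of lists over \<open>'a\<close>; so \<open>'a list\<close> represents all of them up to isomorphism.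
\<close>

definition universally_catenary :: "('a, 'b) ring_scheme \<Rightarrow> bool"
  where "universally_catenary R \<longleftrightarrow>
    (\<forall>A :: 'a list ring. finitely_generated_algebra R A \<longrightarrow> catenary A)"

text \<open>
  The inverse limit of the rings \<open>R/I\<^sup>n\<close>.  The transition map \<open>R/I\<^sup>n\<^sup>+\<^sup>1 \<rightarrow> R/I\<^sup>n\<close> sends a coset of
  \<open>I\<^sup>n\<^sup>+\<^sup>1\<close> to the unique coset of \<open>I\<^sup>n\<close> containing it, so compatibility of a sequence is inclusion.
  Powers of ideals are taken in the library's semiring of ideals, whose unit is \<open>carrier R\<close>.
\<close>

definition adic_completion :: "('a, 'b) ring_scheme \<Rightarrow> 'a set \<Rightarrow> (nat \<Rightarrow> 'a set) ring"
  where "adic_completion R I =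
    (let Q = (\<lambda>n::nat. R Quot (I [^]\<^bsub>ideals_set R\<^esub> n)) in
     \<lparr> carrier = {x. \<forall>n. x n \<in> carrier (Q n) \<and> x (Suc n) \<subseteq> x n},
       monoid.mult = (\<lambda>x y n. x n \<otimes>\<^bsub>Q n\<^esub> y n),
       one = (\<lambda>n. \<one>\<^bsub>Q n\<^esub>),
       ring.zero = (\<lambda>n. \<zero>\<^bsub>Q n\<^esub>),
       ring.add = (\<lambda>x y n. x n \<oplus>\<^bsub>Q n\<^esub> y n) \<rparr>)"

definition analytically_unramified :: "('a, 'b) ring_scheme \<Rightarrow> 'a set \<Rightarrow> bool"
  where "analytically_unramified R \<mm> \<longleftrightarrow> reduced_ring (adic_completion R \<mm>)"

definition min_num_gens :: "('a, 'b) ring_scheme \<Rightarrow> 'a set \<Rightarrow> nat"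
  where "min_num_gens R I =
    (LEAST n. \<exists>A. A \<subseteq> carrier R \<and> finite A \<and> card A = n \<and> I = Idl\<^bsub>R\<^esub> A)"

definition content_ideal :: "('a, 'b) ring_scheme \<Rightarrow> (nat \<Rightarrow> 'a) \<Rightarrow> 'a set"
  where "content_ideal R f = Idl\<^bsub>R\<^esub> (range (coeff (UP R) f))"

definition dedekind_mertens_number :: "('a, 'b) ring_scheme \<Rightarrow> (nat \<Rightarrow> 'a) \<Rightarrow> nat"
  where "dedekind_mertens_number R g =
    (LEAST k. 1 \<le> k \<and> (\<forall>f \<in> carrier (UP R).
      content_ideal R (f \<otimes>\<^bsub>UP R\<^esub> g) \<cdot>\<^bsub>R\<^esub> (content_ideal R f [^]\<^bsub>ideals_set R\<^esub> (k - 1)) =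
      (content_ideal R f [^]\<^bsub>ideals_set R\<^esub> k) \<cdot>\<^bsub>R\<^esub> content_ideal R g))"

text \<open>
  Finite sums and products of ideals are \<open>finsum\<close> and \<open>finprod\<close> in the library's semiring of
  ideals; the empty product is \<open>carrier R\<close>.
\<close>

definition polarized_dedekind_mertens_number ::
    "('a, 'b) ring_scheme \<Rightarrow> (nat \<Rightarrow> 'a) \<Rightarrow> nat"
  where "polarized_dedekind_mertens_number R g =
    (LEAST k. 1 \<le> k \<and> (\<forall>f \<in> {1..k} \<rightarrow> carrier (UP R).
      (\<Oplus>\<^bsub>ideals_set R\<^esub> i \<in> {1..k}.
         content_ideal R (f i \<otimes>\<^bsub>UP R\<^esub> g) \<cdot>\<^bsub>R\<^esub>
         (\<Otimes>\<^bsub>ideals_set R\<^esub> j \<in> {1..k} - {i}. content_ideal R (f j))) =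
      (\<Otimes>\<^bsub>ideals_set R\<^esub> j \<in> {1..k}. content_ideal R (f j)) \<cdot>\<^bsub>R\<^esub> content_ideal R g))"

end

theory Submission
 imports Defs
begin

text \<open>
 Let \<open>I = c(g)\<close>.  Call the coefficient \<open>g\<^sub>j\<close> a pivot if it does not lie in \<open>(g\<^sub>i : i < j) + \<mm>I\<close>; there are
 at most \<open>\<mu>(I)\<close> pivots, and in the polarized identity each factor \<open>f\<^sub>i\<close> disposes of one of them, up to
 Nakayama's lemma.  Hence the polarized number is at most \<open>max 1 \<mu>(I)\<close>, and specializing \<open>f\<^sub>1 = \<dots> = f\<^sub>k\<close>
 bounds the Dedekind--Mertens number \<open>k\<close> by the polarized one.  It remains to see that \<open>\<mu>(I) \<le> k\<close>.

 If all components have dimension at least two, there are \<open>x, y \<in> \<mm>\<close> such that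
 \<open>u(xy)\<^sup>n \<in> (x\<^sup>n\<^sup>+\<^sup>G, y\<^sup>n\<^sup>+\<^sup>G)\<close> forces \<open>u\<close> into a high power of \<open>\<mm>\<close> once \<open>G\<close> is large: catenarity makes \<open>u\<close> integral
 over \<open>\<mm>\<^sup>G\<close>, and in an analytically unramified ring such elements are \<open>\<mm>\<close>-adically small.  Let the
 coefficients of \<open>f\<close> be monomials \<open>x\<^sup>a y\<^sup>D\<^sup>-\<^sup>a\<close> with very sparse exponents \<open>a\<close>.  Then the products of \<open>k\<close> coefficients
 of \<open>f\<close> with the minimal generators of \<open>I\<close> are minimal generators of \<open>c(f)\<^sup>kI = c(fg)c(f)\<^sup>k\<^sup>-\<^sup>1\<close>, and a count of
 generators on both sides yields \<open>\<mu>(I) \<le> k\<close>.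

 For \<open>k = 1\<close> there may be one-dimensional components.  Modulo the others the previous argument still
 shows that \<open>I\<close> is principal.  If \<open>a \<in> I\<close> avoids the minimal primes not containing \<open>I\<close>, then \<open>a\<close> lies in every
 prime \<open>Q\<close> of \<open>R[t]\<close> with \<open>g \<in> Q \<subseteq> \<mm>R[t]\<close>; over a one-dimensional component this is Krull's principal ideal
 theorem.  Therefore \<open>ba\<^sup>r = hg\<close> with \<open>b \<notin> \<mm>R[t]\<close>, so \<open>c(h)I = (a\<^sup>r)\<close>, and \<open>I\<close> is principal because \<open>R\<close> is reduced.
\<close>

text \<open>Why the generator count decides: let n = deg g and let f have degree d = kn. Then c(fg)
  c(f)^(k-1) has at most (d+n+1) C(k-1+d, k-1) generators, while c(f)^k I needs \<mu>(I) C(k+d, k)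
  of them if the coefficients of f are independent enough. The quotient of the two binomials is
  (k+d)/k = n+1, and kn+n+1 < (k+1)(n+1), so \<mu>(I) > k is impossible. The obstacle is the
  independence. If x, y were a regular sequence, a relation between monomials could be separated
  term by term, but R need not be Cohen-Macaulay. The substitute is the estimate for u(xy)^n in
  (x^(n+G), y^(n+G)): it only places u in a prescribed power of \<mm>, and Artin-Rees makes this
  enough, because I meets a high power of \<mm> inside \<mm>I. Localizations are avoided throughout
  by carrying multipliers outside the prime in question, and Rees algebras are subsets of
  R[t].\<close>

no_notation Sum_Type.Plus (infixr \<open><+>\<close> 65)
no_notation var (\<open>X\<index>\<close>)

section \<open>Ideals of commutative rings\<close>

text \<open>Folded into a constant so that simplification does not open the record
  \<open>ideals_set R\<close>; \<open>ipow_0\<close> and \<open>ipow_Suc\<close> are its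
  interface.\<close>

definition (in ring) ipow :: "'a set \<Rightarrow> nat \<Rightarrow> 'a set"
 where "ipow I n = I [^]\<^bsub>ideals_set R\<^esub> n"

context cring
begin

lemma ideal_add: "ideal I R \<Longrightarrow> a \<in> I \<Longrightarrow> b \<in> I \<Longrightarrow> a \<oplus> b \<in> I"
 by (simp add: additive_subgroup.a_closed ideal.axioms(1))

lemma ideal_zero: "ideal I R \<Longrightarrow> \<zero> \<in> I"
 by (simp add: additive_subgroup.zero_closed ideal.axioms(1))

lemma ideal_uminus: "ideal I R \<Longrightarrow> a \<in> I \<Longrightarrow> \<ominus> a \<in> I"
 by (simp add: additive_subgroup.a_inv_closed ideal.axioms(1))

lemma ideal_minus: "ideal I R \<Longrightarrow> a \<in> I \<Longrightarrow> b \<in> I \<Longrightarrow> a \<ominus> b \<in> I"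
 by (simp add: a_minus_def ideal_add ideal_uminus)

lemma ideal_mult_l: "ideal I R \<Longrightarrow> a \<in> I \<Longrightarrow> r \<in> carrier R \<Longrightarrow> r \<otimes> a \<in> I"
 by (simp add: ideal.I_l_closed)

lemma ideal_mult_r: "ideal I R \<Longrightarrow> a \<in> I \<Longrightarrow> r \<in> carrier R \<Longrightarrow> a \<otimes> r \<in> I"
 by (simp add: ideal.I_r_closed)

lemma ideal_carr: "ideal I R \<Longrightarrow> a \<in> I \<Longrightarrow> a \<in> carrier R"
 by (simp add: ideal.Icarr)

lemma ideal_subset_carr: "ideal I R \<Longrightarrow> I \<subseteq> carrier R"
 by (auto simp: ideal.Icarr)

lemmas ideal_rules = ideal_add ideal_zero ideal_uminus ideal_minus ideal_mult_l ideal_mult_r ideal_carr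

lemma ideal_diff_cancel:
 assumes "ideal I R" "a \<ominus> b \<in> I" "b \<in> I" "a \<in> carrier R"
 shows "a \<in> I"
proof -
 have b: "b \<in> carrier R" using assms(1,3) by (rule ideal_carr)
 have "a = (a \<ominus> b) \<oplus> b" using assms(4) b by algebra
 then show ?thesis using ideal_add[OF assms(1,2,3)] by simp
qed

lemma idealI':
 assumes "I \<subseteq> carrier R" "\<zero> \<in> I"
  and "\<And>a b. a \<in> I \<Longrightarrow> b \<in> I \<Longrightarrow> a \<oplus> b \<in> I"
  and "\<And>a r. a \<in> I \<Longrightarrow> r \<in> carrier R \<Longrightarrow> r \<otimes> a \<in> I"
 shows "ideal I R"
proof (rule idealI)
 show "ring R" by (rule ring_axioms)
 show "subgroup I (add_monoid R)"
 proof (unfold_locales)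
  show "I \<subseteq> carrier (add_monoid R)" using assms(1) by simp
  show "\<And>x y. x \<in> I \<Longrightarrow> y \<in> I \<Longrightarrow> x \<otimes>\<^bsub>add_monoid R\<^esub> y \<in> I" using assms(3) by simp
  show "\<one>\<^bsub>add_monoid R\<^esub> \<in> I" using assms(2) by simp
  fix x assume x: "x \<in> I"
  then have xc: "x \<in> carrier R" using assms(1) by auto
  have "\<ominus> x = (\<ominus> \<one>) \<otimes> x" using xc by algebra
  then have "\<ominus> x \<in> I" using assms(4)[OF x, of "\<ominus> \<one>"] by simp
  then show "inv\<^bsub>add_monoid R\<^esub> x \<in> I" by (simp add: a_inv_def)
 qed
 fix a x assume a: "a \<in> I" and x: "x \<in> carrier R"
 show "x \<otimes> a \<in> I" using assms(4) a x by blast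
 then show "a \<otimes> x \<in> I" using m_comm[of a x] a x assms(1) by auto
qed

lemma mem_set_add: "x \<in> I <+> J \<longleftrightarrow> (\<exists>i\<in>I. \<exists>j\<in>J. x = i \<oplus> j)"
 by (auto simp: set_add_def')

lemma set_add_upper1: "ideal I R \<Longrightarrow> ideal J R \<Longrightarrow> I \<subseteq> I <+> J"
proof
 fix x assume "ideal I R" "ideal J R" "x \<in> I"
 then show "x \<in> I <+> J" unfolding mem_set_add
  by (intro bexI[of _ x] bexI[of _ \<zero>]) (auto simp: ideal_rules)
qed

lemma set_add_upper2: "ideal I R \<Longrightarrow> ideal J R \<Longrightarrow> J \<subseteq> I <+> J"
proof
 fix x assume "ideal I R" "ideal J R" "x \<in> J"
 then show "x \<in> I <+> J" unfolding mem_set_add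
  by (intro bexI[of _ x] bexI[of _ \<zero>]) (auto simp: ideal_rules)
qed

lemma set_add_least: "ideal K R \<Longrightarrow> I \<subseteq> K \<Longrightarrow> J \<subseteq> K \<Longrightarrow> I <+> J \<subseteq> K"
 by (auto simp: mem_set_add intro!: ideal_add)

lemma set_add_mono: "I \<subseteq> I' \<Longrightarrow> J \<subseteq> J' \<Longrightarrow> I <+> J \<subseteq> I' <+> J'"
 by (fastforce simp: mem_set_add)

lemma cgen_iff: "x \<in> PIdl a \<longleftrightarrow> (\<exists>r\<in>carrier R. x = r \<otimes> a)"
 by (auto simp: cgenideal_def)

lemma mem_add_cgen: "x \<in> I <+> PIdl a \<longleftrightarrow> (\<exists>i\<in>I. \<exists>r\<in>carrier R. x = i \<oplus> r \<otimes> a)"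
 unfolding mem_set_add by (metis cgen_iff)

lemma Idl_insert:
 assumes "a \<in> carrier R" "A \<subseteq> carrier R"
 shows "Idl (insert a A) = Idl A <+> PIdl a"
proof
 have 1: "ideal (Idl A <+> PIdl a) R"
  using assms by (simp add: add_ideals cgenideal_ideal genideal_ideal)
 have "a \<in> Idl A <+> PIdl a"
  using set_add_upper2[of "Idl A" "PIdl a"] assms by (auto simp: cgenideal_ideal genideal_ideal cgenideal_self)
 moreover have "A \<subseteq> Idl A <+> PIdl a"
  using set_add_upper1[of "Idl A" "PIdl a"] assms genideal_self[of A] by (auto simp: cgenideal_ideal genideal_ideal)
 ultimately show "Idl (insert a A) \<subseteq> Idl A <+> PIdl a"
  using genideal_minimal[OF 1] by auto
 have 2: "ideal (Idl (insert a A)) R" using assms by (simp add: genideal_ideal)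
 have 3: "insert a A \<subseteq> Idl (insert a A)" using assms by (intro genideal_self) auto
 show "Idl A <+> PIdl a \<subseteq> Idl (insert a A)"
  using set_add_least[OF 2 genideal_minimal[OF 2] cgenideal_minimal[OF 2]] 3 by auto
qed

lemma Idl_mono: "A \<subseteq> B \<Longrightarrow> B \<subseteq> carrier R \<Longrightarrow> Idl A \<subseteq> Idl B"
 using genideal_minimal[of "Idl B" A] genideal_ideal[of B] genideal_self[of B] by auto

lemma Idl_empty: "Idl {} = {\<zero>}"
 using genideal_minimal[OF zeroideal, of "{}"] ideal_zero[OF genideal_ideal[of "{}"]] by auto

lemma ideal_prod_subset:
 assumes "ideal K R" "\<And>i j. i \<in> I \<Longrightarrow> j \<in> J \<Longrightarrow> i \<otimes> j \<in> K"
 shows "I \<cdot> J \<subseteq> K"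
proof
 fix x assume "x \<in> I \<cdot> J"
 then show "x \<in> K"
  by (induct rule: ideal_prod.induct) (auto intro: assms ideal_add)
qed

lemma ideal_prod_mono: "I \<subseteq> I' \<Longrightarrow> J \<subseteq> J' \<Longrightarrow> I \<cdot> J \<subseteq> I' \<cdot> J'"
proof
 fix x assume a: "I \<subseteq> I'" "J \<subseteq> J'" "x \<in> I \<cdot> J"
 from a(3) show "x \<in> I' \<cdot> J'"
  by (induct rule: ideal_prod.induct) (use a in \<open>auto intro: ideal_prod.intros\<close>)
qed

lemma ideal_prod_le1: "ideal I R \<Longrightarrow> ideal J R \<Longrightarrow> I \<cdot> J \<subseteq> I"
 using ideal_prod_inter by blast

lemma ideal_prod_le2: "ideal I R \<Longrightarrow> ideal J R \<Longrightarrow> I \<cdot> J \<subseteq> J"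
 using ideal_prod_inter by blast

lemma ideal_prod_one_left: "ideal I R \<Longrightarrow> carrier R \<cdot> I = I"
 using ideal_prod_commute[OF oneideal] ideal_prod_one by simp

lemma ideal_prod_left_comm:
 "ideal I R \<Longrightarrow> ideal J R \<Longrightarrow> ideal K R \<Longrightarrow> I \<cdot> (J \<cdot> K) = J \<cdot> (I \<cdot> K)"
 by (metis ideal_prod_assoc ideal_prod_commute)

lemma PIdl_prod:
 assumes "a \<in> carrier R" "ideal I R"
 shows "x \<in> (PIdl a) \<cdot> I \<longleftrightarrow> (\<exists>i\<in>I. x = a \<otimes> i)"
proof
 assume "x \<in> (PIdl a) \<cdot> I"
 then show "\<exists>i\<in>I. x = a \<otimes> i"
 proof (induct rule: ideal_prod.induct)
  case (prod i j)
  then obtain r where r: "r \<in> carrier R" "i = r \<otimes> a" by (auto simp: cgen_iff)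
  have "j \<in> carrier R" using assms(2) prod by (simp add: ideal_carr)
  then have "i \<otimes> j = a \<otimes> (r \<otimes> j)" using r assms(1) by algebra
  then show ?case using ideal_mult_l[OF assms(2)] prod r by auto
 next
  case (sum s1 s2)
  then obtain i j where ij: "i \<in> I" "s1 = a \<otimes> i" "j \<in> I" "s2 = a \<otimes> j" by auto
  have "s1 \<oplus> s2 = a \<otimes> (i \<oplus> j)" using ij assms by (simp add: ideal_carr r_distr)
  then show ?case using ideal_add[OF assms(2)] ij by auto
 qed
next
 assume "\<exists>i\<in>I. x = a \<otimes> i"
 then show "x \<in> (PIdl a) \<cdot> I" using cgenideal_self[OF assms(1)] by (auto intro: ideal_prod.prod)
qed

lemma ipow_0 [simp]: "ipow I 0 = carrier R"
 by (simp add: ipow_def) (simp add: ideals_set_def)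

lemma ipow_Suc: "ipow I (Suc n) = ipow I n \<cdot> I"
 by (simp add: ipow_def) (simp add: ideals_set_def)

lemma ipow_ideal: "ideal I R \<Longrightarrow> ideal (ipow I n) R"
 by (induct n) (auto simp: ipow_Suc oneideal ideal_prod_is_ideal)

lemma ipow_1: "ideal I R \<Longrightarrow> ipow I (Suc 0) = I"
 by (simp add: ipow_Suc ideal_prod_one_left)

lemma ipow_add: "ideal I R \<Longrightarrow> ipow I (m + n) = ipow I m \<cdot> ipow I n"
 by (induct n) (auto simp: ipow_Suc ideal_prod_one ipow_ideal ideal_prod_assoc)

lemma ipow_mult: "ideal I R \<Longrightarrow> ipow I (m * n) = ipow (ipow I m) n"
proof (induct n)
 case (Suc n)
 have "ipow I (m * Suc n) = ipow I (m * n + m)" by (simp add: add.commute)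
 then show ?case using Suc by (simp only: ipow_add ipow_Suc)
qed simp

lemma ipow_decr: "ideal I R \<Longrightarrow> m \<le> n \<Longrightarrow> ipow I n \<subseteq> ipow I m"
 using ipow_add[of I m "n - m"] ideal_prod_le1[of "ipow I m" "ipow I (n-m)"] by (auto simp: ipow_ideal)

lemma ipow_mono: "I \<subseteq> J \<Longrightarrow> ipow I n \<subseteq> ipow J n"
proof (induct n)
 case (Suc n) then show ?case unfolding ipow_Suc by (intro ideal_prod_mono) auto
qed simp

lemma ipow_mult_mem: "ideal I R \<Longrightarrow> a \<in> ipow I m \<Longrightarrow> b \<in> ipow I n \<Longrightarrow> a \<otimes> b \<in> ipow I (m + n)"
 by (simp add: ipow_add ideal_prod.prod)

lemma pow_mem_ipow: "ideal I R \<Longrightarrow> a \<in> I \<Longrightarrow> a [^] n \<in> ipow I n"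
 by (induct n) (auto simp: ipow_Suc intro: ideal_prod.prod)

lemma ipow_prod: "ideal I R \<Longrightarrow> ideal J R \<Longrightarrow> ipow (I \<cdot> J) n = ipow I n \<cdot> ipow J n"
proof (induct n)
 case 0 then show ?case by (simp add: ideal_prod_one oneideal)
next
 case (Suc n)
 note [simp] = Suc(2,3) ipow_ideal ideal_prod_is_ideal
 have "ipow (I \<cdot> J) (Suc n) = (ipow I n \<cdot> ipow J n) \<cdot> (I \<cdot> J)" using Suc by (simp add: ipow_Suc)
 also have "\<dots> = ipow I n \<cdot> (ipow J n \<cdot> (I \<cdot> J))" by (simp add: ideal_prod_assoc)
 also have "ipow J n \<cdot> (I \<cdot> J) = I \<cdot> (ipow J n \<cdot> J)" by (rule ideal_prod_left_comm) simp_all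
 finally show ?case by (simp add: ipow_Suc ideal_prod_assoc)
qed

lemma ipow_PIdl: "a \<in> carrier R \<Longrightarrow> ipow (PIdl a) n = PIdl (a [^] n)"
proof (induct n)
 case 0 then show ?case using genideal_one cgenideal_eq_genideal[of \<one>] by simp
next
 case (Suc n)
 have "x \<in> (PIdl (a [^] n)) \<cdot> (PIdl a) \<longleftrightarrow> x \<in> PIdl (a [^] Suc n)" for x
 proof
  assume "x \<in> (PIdl (a [^] n)) \<cdot> (PIdl a)"
  then obtain r where r: "r \<in> carrier R" "x = a [^] n \<otimes> (r \<otimes> a)"
   using Suc(2) by (auto simp: PIdl_prod cgenideal_ideal cgen_iff)
  then show "x \<in> PIdl (a [^] Suc n)"
   using Suc(2) m_lcomm[of "a [^] n" r a] by (auto simp: cgen_iff)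
 next
  assume "x \<in> PIdl (a [^] Suc n)"
  then obtain r where r: "r \<in> carrier R" "x = r \<otimes> (a [^] n \<otimes> a)"
   using Suc(2) by (auto simp: cgen_iff)
  then have "x = a [^] n \<otimes> (r \<otimes> a)" using Suc(2) m_lcomm[of "a [^] n" r a] by simp
  then show "x \<in> (PIdl (a [^] n)) \<cdot> (PIdl a)"
   using Suc(2) r(1) cgenideal_self[of "a [^] n"] by (simp add: ideal_prod.prod ideal_mult_l cgenideal_ideal cgenideal_self)
 qed
 then show ?case using Suc by (auto simp: ipow_Suc)
qed

lemma ideal_add_prod:
 assumes "ideal I R" "ideal J R" "ideal T R" 
 shows "(I <+> J) \<cdot> T = I \<cdot> T <+> J \<cdot> T"
 using assms by (simp add: ideal_prod_distr)

text \<open>The binomial theorem for ideals as a membership test. The extra factor T makes the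
  induction close: one factor of (I+J)^(n+1) is distributed and absorbed into T.\<close>

lemma ipow_set_add_subset:
 assumes I: "ideal I R" and J: "ideal J R" and Z: "ideal Z R"
 shows "ideal T R \<Longrightarrow> (\<And>i j. i + j = n \<Longrightarrow> ipow I i \<cdot> (ipow J j \<cdot> T) \<subseteq> Z) \<Longrightarrow> ipow (I <+> J) n \<cdot> T \<subseteq> Z"
proof (induct n arbitrary: T)
 case 0
 then show ?case using 0(2)[of 0 0] by (simp add: ideal_prod_one_left)
next
 case (Suc n)
 note [simp] = I J Suc(2) ipow_ideal ideal_prod_is_ideal add_ideals
 have "ipow (I <+> J) (Suc n) \<cdot> T = ipow (I <+> J) n \<cdot> (I \<cdot> T) <+> ipow (I <+> J) n \<cdot> (J \<cdot> T)"
  by (simp add: ipow_Suc ideal_prod_assoc ideal_add_prod ideal_prod_r_distr)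
 moreover have "ipow (I <+> J) n \<cdot> (I \<cdot> T) \<subseteq> Z"
 proof (rule Suc(1))
  fix i j assume "i + j = n"
  then have "ipow I (Suc i) \<cdot> (ipow J j \<cdot> T) \<subseteq> Z" using Suc(3)[of "Suc i" j] by simp
  moreover have "ipow I (Suc i) \<cdot> (ipow J j \<cdot> T) = ipow I i \<cdot> (ipow J j \<cdot> (I \<cdot> T))"
   using ideal_prod_left_comm[of I "ipow J j" T] by (simp add: ipow_Suc ideal_prod_assoc)
  ultimately show "ipow I i \<cdot> (ipow J j \<cdot> (I \<cdot> T)) \<subseteq> Z" by simp
 qed simp
 moreover have "ipow (I <+> J) n \<cdot> (J \<cdot> T) \<subseteq> Z"
 proof (rule Suc(1))
  fix i j assume "i + j = n"
  then have "ipow I i \<cdot> (ipow J (Suc j) \<cdot> T) \<subseteq> Z" using Suc(3)[of i "Suc j"] by simp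
  then show "ipow I i \<cdot> (ipow J j \<cdot> (J \<cdot> T)) \<subseteq> Z" by (simp add: ipow_Suc ideal_prod_assoc)
 qed simp
 ultimately show ?case using set_add_least[OF Z] by simp
qed

lemma prime_ideal: "primeideal P R \<Longrightarrow> ideal P R" by (rule primeideal.axioms(1))

lemma prime_mult: "primeideal P R \<Longrightarrow> a \<in> carrier R \<Longrightarrow> b \<in> carrier R \<Longrightarrow> a \<otimes> b \<in> P \<Longrightarrow> a \<in> P \<or> b \<in> P"
 by (simp add: primeideal.I_prime)

lemma prime_pow: "primeideal P R \<Longrightarrow> a \<in> carrier R \<Longrightarrow> a [^] (n::nat) \<in> P \<Longrightarrow> a \<in> P"
proof (induct n)
 case 0
 then have "P = carrier R" using ideal.one_imp_carrier[OF prime_ideal] by simp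
 then show ?case using primeideal.I_notcarr[OF 0(1)] by simp
next
 case (Suc n) then show ?case using prime_mult[of P "a [^] n" a] by auto
qed

lemma prime_one: "primeideal P R \<Longrightarrow> \<one> \<notin> P"
 using ideal.one_imp_carrier[OF prime_ideal] primeideal.I_notcarr by blast

lemma prime_ipow: "primeideal P R \<Longrightarrow> ideal I R \<Longrightarrow> ipow I n \<subseteq> P \<Longrightarrow> I \<subseteq> P"
proof
 fix a assume a: "primeideal P R" "ideal I R" "ipow I n \<subseteq> P" "a \<in> I"
 then have "a [^] n \<in> P" using pow_mem_ipow by blast
 then show "a \<in> P" using prime_pow a ideal_carr by blast
qed

lemma primeidealI': 
 assumes "ideal P R" "\<one> \<notin> P" "\<And>a b. a \<in> carrier R \<Longrightarrow> b \<in> carrier R \<Longrightarrow> a \<otimes> b \<in> P \<Longrightarrow> a \<in> P \<or> b \<in> P"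
 shows "primeideal P R"
 using assms by (intro primeidealI) (auto intro: is_cring)

end

section \<open>Prime ideals in Noetherian rings\<close>

lemma (in noetherian_ring) ex_maximal_ideal_in:
 assumes "S \<subseteq> {I. ideal I R}" "S \<noteq> {}"
 obtains M where "M \<in> S" "\<And>X. X \<in> S \<Longrightarrow> M \<subseteq> X \<Longrightarrow> X = M"
proof -
 have "\<exists>M\<in>S. \<forall>X\<in>S. M \<subseteq> X \<longrightarrow> X = M"
 proof (rule subset_Zorn)
  fix C assume C: "subset.chain S C"
  show "\<exists>U\<in>S. \<forall>X\<in>C. X \<subseteq> U"
  proof (cases "C = {}")
   case True then show ?thesis using assms(2) by auto
  next
   case False
   have "subset.chain {I. ideal I R} C" using C assms(1) unfolding pred_on.chain_def by auto
   then have "\<Union>C \<in> C" using ideal_chain_is_trivial False by simp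
   then show ?thesis by (meson C Union_upper pred_on.chain_def subsetCE)
  qed
 qed
 then show ?thesis using that by blast
qed

lemma (in noetherian_ring) ideal_induct [consumes 1, case_names step]:
 assumes "ideal I R"
  and step: "\<And>I. ideal I R \<Longrightarrow> (\<And>J. ideal J R \<Longrightarrow> I \<subset> J \<Longrightarrow> P J) \<Longrightarrow> P I"
 shows "P I"
proof (rule ccontr)
 assume "\<not> P I"
 then have ne: "{J. ideal J R \<and> \<not> P J} \<noteq> {}" using assms(1) by auto
 obtain M where M: "M \<in> {J. ideal J R \<and> \<not> P J}"
  "\<And>X. X \<in> {J. ideal J R \<and> \<not> P J} \<Longrightarrow> M \<subseteq> X \<Longrightarrow> X = M"
  by (rule ex_maximal_ideal_in[OF _ ne]) auto
 have "P M" by (rule step) (use M in auto)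
 then show False using M by auto
qed

locale noetherian_cring = noetherian_ring + cring

lemma noetherian_cringI: "noetherian_ring R \<Longrightarrow> cring R \<Longrightarrow> noetherian_cring R"
 by (simp add: noetherian_cring_def)

section \<open>Nakayama's lemma at a prime, and prime avoidance\<close>

context cring
begin

text \<open>Nakayama's lemma for the localization at P, with denominators s outside P written out.
  The induction removes one generator at a time: a relation s a = w + q a with q in P gives (s - q)
  a = w, where s - q is again outside P and w involves only the other generators.\<close>

lemma nakayama_prime:
 assumes P: "primeideal P R" and N': "ideal N' R"
 shows "finite A \<Longrightarrow> A \<subseteq> carrier R \<Longrightarrow>
  (\<And>a. a \<in> A \<Longrightarrow> \<exists>s\<in>carrier R - P. s \<otimes> a \<in> N' <+> P \<cdot> (Idl A)) \<Longrightarrow>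
  \<exists>s'\<in>carrier R - P. \<forall>a\<in>Idl A. s' \<otimes> a \<in> N'"
proof (induct A rule: finite_induct)
 case empty
 then show ?case using prime_one[OF P] by (intro bexI[of _ \<one>]) (auto simp: Idl_empty ideal_zero[OF N'])
next
 case (insert a A)
 note [simp] = prime_ideal[OF P]
 have ac: "a \<in> carrier R" and A: "A \<subseteq> carrier R" using insert by auto
 let ?J = "Idl A"
 have J: "ideal ?J R" using A by (simp add: genideal_ideal)
 have PJ: "ideal (P \<cdot> ?J) R" and NPJ: "ideal (N' <+> P \<cdot> ?J) R"
  using J N' by (auto simp: ideal_prod_is_ideal add_ideals)
 have step: "\<exists>s\<in>carrier R - P. \<exists>q\<in>P. \<exists>w\<in>N' <+> P \<cdot> ?J. s \<otimes> b = w \<oplus> q \<otimes> a" if b: "b \<in> insert a A" for b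
 proof -
  obtain s where s: "s \<in> carrier R" "s \<notin> P" and "s \<otimes> b \<in> N' <+> P \<cdot> (Idl (insert a A))" using insert(5)[OF b] by auto
  note this(3)
  also have "P \<cdot> (Idl (insert a A)) = P \<cdot> ?J <+> P \<cdot> (PIdl a)"
   using J ac A by (simp add: Idl_insert ideal_prod_r_distr cgenideal_ideal)
  finally obtain n x y where n: "n \<in> N'" "x \<in> P \<cdot> ?J" "y \<in> P \<cdot> (PIdl a)" "s \<otimes> b = n \<oplus> (x \<oplus> y)"
   by (auto simp: mem_set_add)
  have "y \<in> (PIdl a) \<cdot> P" using n(3) ideal_prod_commute[of P "PIdl a"] ac by (simp add: cgenideal_ideal)
  then obtain q where q: "q \<in> P" "y = a \<otimes> q" using ac by (auto simp: PIdl_prod)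
  have qc: "q \<in> carrier R" using q by (meson \<open>ideal P R\<close> ideal_carr)
  have nc: "n \<in> carrier R" "x \<in> carrier R" using n N' PJ ideal_carr by blast+
  have "s \<otimes> b = (n \<oplus> x) \<oplus> q \<otimes> a" using n(4) q(2) qc nc ac by algebra
  moreover have "n \<oplus> x \<in> N' <+> P \<cdot> ?J" using n by (auto simp: mem_set_add)
  ultimately show ?thesis using q(1) s by (intro bexI[of _ s] bexI[of _ q] bexI[of _ "n \<oplus> x"]) simp_all
 qed
 obtain s q w where s: "s \<in> carrier R" "s \<notin> P" and qw: "q \<in> P" "w \<in> N' <+> P \<cdot> ?J" "s \<otimes> a = w \<oplus> q \<otimes> a" using step[of a] by auto
 have qc: "q \<in> carrier R" and wc: "w \<in> carrier R" using qw NPJ ideal_carr \<open>ideal P R\<close> by blast+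
 define t where "t = s \<ominus> q"
 have t: "t \<in> carrier R" "t \<notin> P"
  using s qc qw(1) ideal_diff_cancel[of P s q] by (auto simp: t_def)
 have ta: "t \<otimes> a = w" 
 proof -
  have "t \<otimes> a = (s \<otimes> a) \<ominus> q \<otimes> a" unfolding t_def using s qc ac by algebra
  also have "\<dots> = w" unfolding qw(3) using wc qc ac by algebra
  finally show ?thesis .
 qed
 \<comment> \<open>Multiplying the relation for b by t replaces t a by w, so the remaining
   generators satisfy the hypothesis without a.\<close>
 have "\<exists>s'\<in>carrier R - P. \<forall>a\<in>?J. s' \<otimes> a \<in> N'"
 proof (rule insert(3)[OF A])
  fix b assume b: "b \<in> A"
  then obtain s p v where s: "s \<in> carrier R" "s \<notin> P" and pv: "p \<in> P" "v \<in> N' <+> P \<cdot> ?J" "s \<otimes> b = v \<oplus> p \<otimes> a" using step[of b] by auto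
  have c: "b \<in> carrier R" "p \<in> carrier R" "v \<in> carrier R" using b A pv NPJ ideal_carr \<open>ideal P R\<close> by blast+
  have "t \<otimes> s \<otimes> b = t \<otimes> (s \<otimes> b)" using t s c by algebra
  also have "\<dots> = t \<otimes> v \<oplus> p \<otimes> (t \<otimes> a)" unfolding pv(3) using t c ac by algebra
  also have "\<dots> = t \<otimes> v \<oplus> p \<otimes> w" by (simp add: ta)
  finally have "t \<otimes> s \<otimes> b \<in> N' <+> P \<cdot> ?J"
   using NPJ t c pv qw by (simp add: ideal_rules)
  moreover have "t \<otimes> s \<in> carrier R - P" using t s P by (auto dest: prime_mult)
  ultimately show "\<exists>s\<in>carrier R - P. s \<otimes> b \<in> N' <+> P \<cdot> ?J" by auto
 qed
 then obtain s' where s': "s' \<in> carrier R" "s' \<notin> P" "\<And>a. a \<in> ?J \<Longrightarrow> s' \<otimes> a \<in> N'" by auto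
 have "s' \<otimes> (t \<otimes> a) \<in> N'"
 proof -
  obtain n x where nx: "n \<in> N'" "x \<in> P \<cdot> ?J" "w = n \<oplus> x" using qw(2) by (auto simp: mem_set_add)
  have "x \<in> ?J" using nx ideal_prod_le2[of P ?J] J by auto
  then have "s' \<otimes> n \<oplus> s' \<otimes> x \<in> N'" using s' nx N' by (simp add: ideal_rules)
  then show ?thesis using ta nx s' N' J \<open>x \<in> ?J\<close> by (simp add: r_distr ideal_carr)
 qed
 then have 1: "(s' \<otimes> t) \<otimes> a \<in> N'" using s' t ac by (simp add: m_assoc)
 have "(s' \<otimes> t) \<otimes> z \<in> N'" if z: "z \<in> Idl (insert a A)" for z
 proof -
  obtain j r where jr: "j \<in> ?J" "r \<in> carrier R" "z = j \<oplus> r \<otimes> a"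
   using z ac A by (auto simp: Idl_insert mem_add_cgen)
  have jc: "j \<in> carrier R" using jr J ideal_carr by blast
  have "(s' \<otimes> t) \<otimes> z = t \<otimes> (s' \<otimes> j) \<oplus> r \<otimes> ((s' \<otimes> t) \<otimes> a)"
   unfolding jr(3) using s' t jr jc ac by algebra
  then show ?thesis using s'(3)[OF jr(1)] 1 N' t jr(2) by (simp add: ideal_rules)
 qed
 moreover have "s' \<otimes> t \<in> carrier R - P" using s' t P by (auto dest: prime_mult)
 ultimately show ?case by blast
qed

definition minover :: "'a set \<Rightarrow> 'a set \<Rightarrow> bool"
 where "minover X P \<longleftrightarrow> primeideal P R \<and> X \<subseteq> P \<and> (\<forall>Q. primeideal Q R \<and> X \<subseteq> Q \<and> Q \<subseteq> P \<longrightarrow> Q = P)"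

text \<open>Induction on the number of primes: x avoids all of them except P, and if x lies in P it
  is corrected by z i with i in I outside P and z in all other primes but not in P. Such a z exists
  when no other prime lies inside P; comparable primes are treated first by dropping the smaller
  one.\<close>

lemma prime_avoidance:
 "finite F \<Longrightarrow> (\<And>P. P \<in> F \<Longrightarrow> primeideal P R) \<Longrightarrow> ideal I R \<Longrightarrow> (\<And>P. P \<in> F \<Longrightarrow> \<not> I \<subseteq> P) \<Longrightarrow> \<exists>x\<in>I. x \<notin> \<Union>F"
proof (induct "card F" arbitrary: F rule: less_induct)
 case less
 show ?case
 proof (cases "F = {}")
  case True then show ?thesis using ideal_zero[OF less(4)] by auto
 next
  case False
  then obtain P where P: "P \<in> F" by auto
  let ?F = "F - {P}"
  have lt: "card ?F < card F" using P less(2) by (meson card_Diff1_less)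
  obtain x where x: "x \<in> I" "x \<notin> \<Union>?F" using less(1)[OF lt] less(2-5) by (metis Diff_iff finite_Diff)
  show ?thesis
  proof (cases "\<exists>Q\<in>?F. P \<subseteq> Q")
   case True
   then show ?thesis using x P by blast
  next
   case noP: False
   show ?thesis
   proof (cases "\<exists>Q\<in>?F. Q \<subseteq> P")
    case True
    then obtain Q where Q: "Q \<in> ?F" "Q \<subseteq> P" by auto
    have "card (F - {Q}) < card F" using Q less(2) by (meson DiffD1 card_Diff1_less)
    then obtain y where y: "y \<in> I" "y \<notin> \<Union>(F - {Q})" using less(1)[of "F - {Q}"] less(2-5) by (metis Diff_iff finite_Diff)
    then have "y \<notin> Q" using Q P by auto
    then show ?thesis using y by auto
   next
    case False
    have ex: "\<exists>z\<in>carrier R. z \<notin> P \<and> (\<forall>Q\<in>G. z \<in> Q)" if "finite G" "G \<subseteq> ?F" for G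
     using that
    proof (induct G rule: finite_induct)
     case empty then show ?case using prime_one[OF less(3)[OF P]] by auto
    next
     case (insert Q G)
     then obtain z where z: "z \<in> carrier R" "z \<notin> P" "\<forall>Q\<in>G. z \<in> Q" by auto
     obtain q where q: "q \<in> Q" "q \<notin> P" using False insert by blast
     have G: "\<And>Q'. Q' \<in> insert Q G \<Longrightarrow> ideal Q' R" using insert less(3) prime_ideal by blast
     have qc: "q \<in> carrier R" using G q ideal_carr by blast
     have "z \<otimes> q \<notin> P" using prime_mult[OF less(3)[OF P] z(1) qc] z q by auto
     moreover have "z \<otimes> q \<in> Q'" if "Q' \<in> insert Q G" for Q'
      using that z q G[OF that] qc by (cases "Q' = Q") (auto intro: ideal_mult_l ideal_mult_r)
     ultimately show ?case using z qc by blast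
    qed
    obtain z where z: "z \<in> carrier R" "z \<notin> P" "\<forall>Q\<in>?F. z \<in> Q"
     using ex[of ?F] less(2) by auto
    obtain i where i: "i \<in> I" "i \<notin> P" using less(5)[OF P] by auto
    have ic: "i \<in> carrier R" and xc: "x \<in> carrier R" using i x less(4) ideal_carr by blast+
    have zi: "z \<otimes> i \<notin> P" using prime_mult[OF less(3)[OF P] z(1) ic] z i by auto
    have ziI: "z \<otimes> i \<in> I" using i z less(4) by (simp add: ideal_mult_l)
    show ?thesis
    proof (cases "x \<in> P")
     case False then show ?thesis using x by auto
    next
     case True
     have "x \<oplus> z \<otimes> i \<notin> Q" if Q: "Q \<in> F" for Q
     proof
      assume a: "x \<oplus> z \<otimes> i \<in> Q"
      have Qi: "ideal Q R" using less(3) Q prime_ideal by auto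
      show False
      proof (cases "Q = P")
       case True
       have "z \<otimes> i = (x \<oplus> z \<otimes> i) \<ominus> x" using z(1) ic xc by algebra
       then show False using zi a \<open>x \<in> P\<close> Qi True ideal_minus by metis
      next
       case False
       then have "z \<otimes> i \<in> Q" using z Q Qi ic by (simp add: ideal_mult_r)
       moreover have "x = (x \<oplus> z \<otimes> i) \<ominus> z \<otimes> i" using z(1) ic xc by algebra
       ultimately have "x \<in> Q" using a Qi ideal_minus by metis
       then show False using x Q False by auto
      qed
     qed
     then show ?thesis using ideal_add[OF less(4) x(1) ziI] by blast
    qed
   qed
  qed
 qed
qed

end

section \<open>Primes minimal over an ideal: existence, finiteness, nilpotency\<close>

context noetherian_cring
begin

text \<open>An ideal maximal among those missing a multiplicative set is prime. The maximality is
  kept in the conclusion because \<open>nilpotent_of_asymptotic\<close> needs that every larger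
  ideal meets S.\<close>

lemma ex_prime_disjoint:
 assumes S: "S \<subseteq> carrier R" "\<one> \<in> S" "\<And>a b. a \<in> S \<Longrightarrow> b \<in> S \<Longrightarrow> a \<otimes> b \<in> S"
  and X: "ideal X R" "X \<inter> S = {}"
 shows "\<exists>P. primeideal P R \<and> X \<subseteq> P \<and> P \<inter> S = {} \<and> (\<forall>Y. ideal Y R \<and> P \<subset> Y \<longrightarrow> Y \<inter> S \<noteq> {})"
proof -
 let ?C = "{Y. ideal Y R \<and> X \<subseteq> Y \<and> Y \<inter> S = {}}"
 obtain P where "P \<in> ?C" and max: "\<And>Y. Y \<in> ?C \<Longrightarrow> P \<subseteq> Y \<Longrightarrow> Y = P"
  by (rule ex_maximal_ideal_in[of ?C]) (use X in auto)
 then have P: "ideal P R" "X \<subseteq> P" "P \<inter> S = {}" by auto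
 have meets: "Y \<inter> S \<noteq> {}" if "ideal Y R" "P \<subset> Y" for Y using that max[of Y] P by auto
 have "primeideal P R"
 proof (rule primeidealI')
  show "ideal P R" by fact
  show "\<one> \<notin> P" using P S by auto
  fix a b assume ab: "a \<in> carrier R" "b \<in> carrier R" "a \<otimes> b \<in> P"
  show "a \<in> P \<or> b \<in> P"
  proof (rule ccontr)
   assume n: "\<not> (a \<in> P \<or> b \<in> P)"
   have m: "\<exists>p\<in>P. \<exists>r\<in>carrier R. p \<oplus> r \<otimes> c \<in> S" if c: "c \<in> carrier R" "c \<notin> P" for c
   proof -
    have "ideal (P <+> PIdl c) R" using P c by (simp add: add_ideals cgenideal_ideal)
    moreover have "P \<subset> P <+> PIdl c"
     using set_add_upper1[of P "PIdl c"] set_add_upper2[of P "PIdl c"] P c cgenideal_self[of c] cgenideal_ideal[of c] by auto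
    ultimately show ?thesis using meets by (metis Int_emptyI mem_add_cgen)
   qed
   obtain p r where p: "p \<in> P" "r \<in> carrier R" "p \<oplus> r \<otimes> a \<in> S" using m ab n by metis
   obtain q t where q: "q \<in> P" "t \<in> carrier R" "q \<oplus> t \<otimes> b \<in> S" using m ab n by metis
   have c: "p \<in> carrier R" "q \<in> carrier R" using p q P ideal_carr by blast+
   have "(p \<oplus> r \<otimes> a) \<otimes> (q \<oplus> t \<otimes> b) = (q \<oplus> t \<otimes> b) \<otimes> p \<oplus> ((r \<otimes> a) \<otimes> q \<oplus> (r \<otimes> t) \<otimes> (a \<otimes> b))"
    using c p(2) q(2) ab by algebra
   also have "\<dots> \<in> P" using c p q ab P by (simp add: ideal_rules)
   finally show False using S(3)[OF p(3) q(3)] P by auto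
  qed
 qed
 then show ?thesis using P(2,3) meets by (intro exI[of _ P] conjI allI impI) auto
qed

text \<open>Noetherian induction: if a b lies in X but neither factor does, every prime over X
  contains X + (a) or X + (b), and both are larger than X. The primes found need not be minimal over
  X yet.\<close>

lemma ex_finite_primes_over:
 assumes "ideal X R"
 shows "\<exists>F. finite F \<and> (\<forall>P\<in>F. primeideal P R \<and> X \<subseteq> P) \<and> (\<forall>P. primeideal P R \<and> X \<subseteq> P \<longrightarrow> (\<exists>Q\<in>F. Q \<subseteq> P))"
 using assms
proof (induct rule: ideal_induct)
 case (step X)
 show ?case
 proof (cases "primeideal X R \<or> \<one> \<in> X")
  case True
  then show ?thesis
  proof
   assume "primeideal X R" then show ?thesis by (intro exI[of _ "{X}"]) auto
  next
   assume "\<one> \<in> X" then show ?thesis using prime_one by (intro exI[of _ "{}"]) auto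
  qed
 next
  case False
  then obtain a b where ab: "a \<in> carrier R" "b \<in> carrier R" "a \<otimes> b \<in> X" "a \<notin> X" "b \<notin> X"
   using primeidealI'[OF step(1)] by auto
  have s: "X \<subset> X <+> PIdl c" "ideal (X <+> PIdl c) R" if "c \<in> carrier R" "c \<notin> X" for c
   using set_add_upper1[of X "PIdl c"] set_add_upper2[of X "PIdl c"] step(1) that cgenideal_self[of c] cgenideal_ideal[of c]
   by (auto intro: add_ideals)
  obtain F where F: "finite F" "\<forall>P\<in>F. primeideal P R \<and> X <+> PIdl a \<subseteq> P" "\<forall>P. primeideal P R \<and> X <+> PIdl a \<subseteq> P \<longrightarrow> (\<exists>Q\<in>F. Q \<subseteq> P)"
   using step(2)[OF s(2,1)[OF ab(1,4)]] by auto
  obtain G where G: "finite G" "\<forall>P\<in>G. primeideal P R \<and> X <+> PIdl b \<subseteq> P" "\<forall>P. primeideal P R \<and> X <+> PIdl b \<subseteq> P \<longrightarrow> (\<exists>Q\<in>G. Q \<subseteq> P)"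
   using step(2)[OF s(2,1)[OF ab(2,5)]] by auto
  have "\<exists>Q\<in>F \<union> G. Q \<subseteq> P" if P: "primeideal P R" "X \<subseteq> P" for P
  proof -
   have "a \<in> P \<or> b \<in> P" using prime_mult[OF P(1)] ab P by auto
   then have "X <+> PIdl a \<subseteq> P \<or> X <+> PIdl b \<subseteq> P"
    using P prime_ideal[OF P(1)] set_add_least cgenideal_minimal by meson
   then show ?thesis
   proof
    assume "X <+> PIdl a \<subseteq> P"
    then obtain Q where "Q \<in> F" "Q \<subseteq> P" using F(3) P(1) by auto
    then show ?thesis by auto
   next
    assume "X <+> PIdl b \<subseteq> P"
    then obtain Q where "Q \<in> G" "Q \<subseteq> P" using G(3) P(1) by auto
    then show ?thesis by auto
   qed
  qed
  moreover have "\<forall>P\<in>F \<union> G. primeideal P R \<and> X \<subseteq> P"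
   using F(2) G(2) s(1)[OF ab(1,4)] s(1)[OF ab(2,5)] by (meson UnE order.trans psubset_imp_subset)
  ultimately show ?thesis using F(1) G(1) by (intro exI[of _ "F \<union> G"]) simp
 qed
qed

lemma finite_minover:
 assumes "ideal X R"
 shows "\<exists>F. finite F \<and> (\<forall>P\<in>F. minover X P) \<and> (\<forall>P. primeideal P R \<and> X \<subseteq> P \<longrightarrow> (\<exists>Q\<in>F. Q \<subseteq> P))"
proof -
 obtain F where F: "finite F" "\<And>P. P\<in>F \<Longrightarrow> primeideal P R \<and> X \<subseteq> P" "\<And>P. primeideal P R \<Longrightarrow> X \<subseteq> P \<Longrightarrow> \<exists>Q\<in>F. Q \<subseteq> P"
  using ex_finite_primes_over[OF assms] by meson
 let ?F = "{Q\<in>F. \<forall>Q'\<in>F. Q' \<subseteq> Q \<longrightarrow> Q' = Q}"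
 have min: "\<exists>Q\<in>?F. Q \<subseteq> P" if P: "P \<in> F" for P
 proof -
  have "finite {Q\<in>F. Q \<subseteq> P}" "{Q\<in>F. Q \<subseteq> P} \<noteq> {}" using F P by auto
  from finite_has_minimal[OF this] obtain Q where Q: "Q \<in> F" "Q \<subseteq> P" "\<And>Q'. Q' \<in> F \<Longrightarrow> Q' \<subseteq> P \<Longrightarrow> Q' \<subseteq> Q \<Longrightarrow> Q' = Q" by (metis (mono_tags, lifting) mem_Collect_eq)
  have "Q' = Q" if "Q' \<in> F" "Q' \<subseteq> Q" for Q'
   using Q(3)[OF that(1) _ that(2)] that(2) Q(2) by (meson order_trans)
  then show ?thesis using Q(1,2) by (intro bexI[of _ Q]) simp_all
 qed
 show ?thesis
 proof (intro exI[of _ ?F] conjI ballI allI impI)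
  show "finite ?F" using F by simp
  show "\<exists>Q\<in>?F. Q \<subseteq> P" if "primeideal P R \<and> X \<subseteq> P" for P
   using F(3)[of P] that min by (meson order_trans)
  fix P assume P: "P \<in> ?F"
  show "minover X P"
   unfolding minover_def
  proof (intro conjI allI impI)
   show "primeideal P R" "X \<subseteq> P" using P F(2) by simp_all
   fix Q assume Q: "primeideal Q R \<and> X \<subseteq> Q \<and> Q \<subseteq> P"
   then have "\<exists>Q'\<in>F. Q' \<subseteq> Q" by (intro F(3)) simp_all
   then obtain Q' where Q': "Q' \<in> F" "Q' \<subseteq> Q" by (elim bexE)
   have "Q' \<subseteq> P" using Q Q'(2) by (meson order_trans)
   then have "Q' = P" using P Q'(1) by simp
   then show "Q = P" using Q Q'(2) by (simp add: subset_antisym)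
  qed
 qed
qed

lemma ex_minover:
 assumes "ideal X R" "primeideal P R" "X \<subseteq> P"
 shows "\<exists>Q. minover X Q \<and> Q \<subseteq> P"
 using finite_minover[OF assms(1)] assms(2,3) by meson

text \<open>The local ring of R/X at P has only one prime, so p is nilpotent there. Concretely, a
  prime over X that misses all s p^n with s outside P would lie in P, hence equal P, although P
  contains p.\<close>

lemma minover_pow:
 assumes X: "ideal X R" and P: "minover X P" and p: "p \<in> P"
 shows "\<exists>s\<in>carrier R - P. \<exists>n::nat. s \<otimes> p [^] n \<in> X"
proof (rule ccontr)
 assume n: "\<not> ?thesis"
 have Pp: "primeideal P R" "X \<subseteq> P" using P by (auto simp: minover_def)
 have pc: "p \<in> carrier R" using Pp p prime_ideal ideal_carr by blast
 let ?S = "{s \<otimes> p [^] n | s n::nat. s \<in> carrier R - P}"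
 have S1: "?S \<subseteq> carrier R" using pc by auto
 have S2: "\<one> \<in> ?S" using prime_one[OF Pp(1)] pc by (intro CollectI exI[of _ \<one>] exI[of _ 0]) auto
 have S3: "a \<otimes> b \<in> ?S" if "a \<in> ?S" "b \<in> ?S" for a b
 proof -
  from that(1) obtain s n where s: "a = s \<otimes> p [^] (n::nat)" "s \<in> carrier R - P" by (elim CollectE exE conjE)
  from that(2) obtain t m where t: "b = t \<otimes> p [^] (m::nat)" "t \<in> carrier R - P" by (elim CollectE exE conjE)
  note st = s t
  have "a \<otimes> b = (s \<otimes> t) \<otimes> p [^] (n + m)"
   using st pc by (simp add: nat_pow_mult[symmetric] m_ac)
  moreover have "s \<otimes> t \<in> carrier R - P" using st prime_mult[OF Pp(1), of s t] by auto
  ultimately show ?thesis by (intro CollectI exI conjI)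
 qed
 have S4: "X \<inter> ?S = {}" using n by auto
 obtain Q where Q: "primeideal Q R" "X \<subseteq> Q" "Q \<inter> ?S = {}"
  using ex_prime_disjoint[OF S1 S2 S3 X S4] by auto
 have "Q \<subseteq> P"
 proof
  fix s assume s: "s \<in> Q"
  show "s \<in> P"
  proof (rule ccontr)
   assume "s \<notin> P"
   then have "s \<otimes> p [^] (0::nat) \<in> ?S" using ideal_carr[OF prime_ideal[OF Q(1)] s] by (intro CollectI exI[of _ s] exI[of _ 0] conjI) auto
   moreover have "s \<otimes> p [^] (0::nat) = s" using s Q prime_ideal ideal_carr by (metis nat_pow_0 r_one)
   ultimately show False using Q s by auto
  qed
 qed
 then have "Q = P" using P Q by (auto simp: minover_def)
 moreover have "\<one> \<otimes> p [^] (1::nat) \<in> ?S" using prime_one[OF Pp(1)] by (intro CollectI exI[of _ \<one>] exI[of _ 1] conjI) auto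
 moreover have "\<one> \<otimes> p [^] (1::nat) = p" using pc by simp
 ultimately show False using Q p by auto
qed

text \<open>P is finitely generated, so the exponents and multipliers that
  \<open>minover_pow\<close> gives for single elements can be made uniform.\<close>

lemma minover_ipow:
 assumes X: "ideal X R" and P: "minover X P"
 shows "\<exists>s\<in>carrier R - P. \<exists>n. \<forall>z\<in>ipow P n. s \<otimes> z \<in> X"
proof -
 have Pp: "primeideal P R" using P by (auto simp: minover_def)
 have "\<exists>s\<in>carrier R - P. \<exists>n. \<forall>z\<in>ipow (Idl A) n. s \<otimes> z \<in> X" if "finite A" "A \<subseteq> P" for A
  using that
 proof (induct A rule: finite_induct)
  case empty
  have "ipow (Idl {}) 1 = {\<zero>}" using ipow_1[of "{\<zero>}"] zeroideal by (simp add: Idl_empty)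
  then show ?case using prime_one[OF Pp] ideal_zero[OF X] by (intro bexI[of _ \<one>] exI[of _ 1]) auto
 next
  case (insert a A)
  obtain s n where s: "s \<in> carrier R" "s \<notin> P" "\<And>z. z \<in> ipow (Idl A) n \<Longrightarrow> s \<otimes> z \<in> X" using insert by auto
  obtain t and m :: nat where t: "t \<in> carrier R" "t \<notin> P" "t \<otimes> a [^] m \<in> X" using minover_pow[OF X P, of a] insert(4) by auto
  have c: "a \<in> carrier R" "A \<subseteq> carrier R" using insert Pp prime_ideal ideal_carr by blast+
  note [simp] = genideal_ideal[OF c(2)] cgenideal_ideal[OF c(1)] ipow_ideal ideal_prod_is_ideal
  let ?Z = "{z\<in>carrier R. (s \<otimes> t) \<otimes> z \<in> X}"
  have Z: "ideal ?Z R"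
   by (rule idealI') (use s t X in \<open>auto simp: ideal_rules r_distr\<close>, metis ideal_mult_l m_closed m_lcomm)
  have "ipow (Idl A <+> PIdl a) (n + m) \<cdot> carrier R \<subseteq> ?Z"
  proof (rule ipow_set_add_subset)
   fix i j assume ij: "i + j = n + m"
   have "ipow (Idl A) i \<cdot> ipow (PIdl a) j \<subseteq> ?Z"
   proof (rule ideal_prod_subset[OF Z])
    fix x y assume xy: "x \<in> ipow (Idl A) i" "y \<in> ipow (PIdl a) j"
    have xc: "x \<in> carrier R" by (rule ideal_carr[OF ipow_ideal xy(1)]) simp
    have yc: "y \<in> carrier R" by (rule ideal_carr[OF ipow_ideal xy(2)]) simp
    show "x \<otimes> y \<in> ?Z"
    proof (cases "n \<le> i")
     case True
     then have "x \<in> ipow (Idl A) n" using xy ipow_decr[of "Idl A" n i] by auto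
     then have "(t \<otimes> y) \<otimes> (s \<otimes> x) \<in> X" using s t yc by (simp add: ideal_mult_l[OF X])
     moreover have "(t \<otimes> y) \<otimes> (s \<otimes> x) = (s \<otimes> t) \<otimes> (x \<otimes> y)" using s t xc yc by algebra
     ultimately show ?thesis using xc yc by simp
    next
     case False
     then have "y \<in> ipow (PIdl a) m" using xy ij ipow_decr[of "PIdl a" m j] by auto
     then obtain r where r: "r \<in> carrier R" "y = r \<otimes> a [^] m" using c by (auto simp: ipow_PIdl cgen_iff)
     have "(s \<otimes> x \<otimes> r) \<otimes> (t \<otimes> a [^] m) \<in> X" using s t r xc by (simp add: ideal_mult_l[OF X])
     moreover have "(s \<otimes> x \<otimes> r) \<otimes> (t \<otimes> a [^] m) = (s \<otimes> t) \<otimes> (x \<otimes> y)"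
      using s t xc r c by (simp add: m_ac)
     ultimately show ?thesis using xc yc by simp
    qed
   qed
   then show "ipow (Idl A) i \<cdot> (ipow (PIdl a) j \<cdot> carrier R) \<subseteq> ?Z" by (simp add: ideal_prod_one)
  qed (use Z oneideal in auto)
  then have "\<forall>z\<in>ipow (Idl (insert a A)) (n + m). (s \<otimes> t) \<otimes> z \<in> X"
   using c by (auto simp: Idl_insert ideal_prod_one add_ideals)
  then show ?case using s t prime_mult[OF Pp, of s t] by blast
 qed
 moreover obtain A where "A \<subseteq> carrier R" "finite A" "P = Idl A"
  using finetely_gen[OF prime_ideal[OF Pp]] by auto
 ultimately show ?thesis using genideal_self by metis
qed

end

section \<open>Krull's principal ideal theorem\<close>

text \<open>\<open>psat P I\<close> says that I is contracted from the localization at P, and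
  \<open>sat P I\<close> is the contraction of the extension of I. Ideals of the local ring are thus
  represented by ideals of R.\<close>

definition (in ring) psat :: "'a set \<Rightarrow> 'a set \<Rightarrow> bool"
 where "psat P I \<longleftrightarrow> (\<forall>z\<in>carrier R. \<forall>s\<in>carrier R - P. s \<otimes> z \<in> I \<longrightarrow> z \<in> I)"

definition (in ring) sat :: "'a set \<Rightarrow> 'a set \<Rightarrow> 'a set"
 where "sat P I = {z\<in>carrier R. \<exists>s\<in>carrier R - P. s \<otimes> z \<in> I}"

context cring
begin

lemma sat_ideal:
 assumes P: "primeideal P R" and I: "ideal I R"
 shows "ideal (sat P I) R"
proof (rule idealI')
 show "sat P I \<subseteq> carrier R" by (auto simp: sat_def)
 show "\<zero> \<in> sat P I" using prime_one[OF P] ideal_zero[OF I] by (auto simp: sat_def)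
 fix a b assume "a \<in> sat P I" "b \<in> sat P I"
 then obtain s t where st: "s \<in> carrier R - P" "t \<in> carrier R - P" "s \<otimes> a \<in> I" "t \<otimes> b \<in> I"
  and c: "a \<in> carrier R" "b \<in> carrier R" by (auto simp: sat_def)
 have "(s \<otimes> t) \<otimes> (a \<oplus> b) = t \<otimes> (s \<otimes> a) \<oplus> s \<otimes> (t \<otimes> b)" using st(1,2)[THEN DiffD1] c by algebra
 also have "\<dots> \<in> I" using st I by (simp add: ideal_rules)
 finally show "a \<oplus> b \<in> sat P I" using st c prime_mult[OF P, of s t] by (auto simp: sat_def)
next
 fix a r assume "a \<in> sat P I" and r: "r \<in> carrier R"
 then obtain s where s: "s \<in> carrier R - P" "s \<otimes> a \<in> I" and c: "a \<in> carrier R" by (auto simp: sat_def)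
 have "s \<otimes> (r \<otimes> a) = r \<otimes> (s \<otimes> a)" using s(1)[THEN DiffD1] r c by algebra
 also have "\<dots> \<in> I" using s I r by (simp add: ideal_rules)
 finally show "r \<otimes> a \<in> sat P I" using s r c by (auto simp: sat_def)
qed

lemma sat_psat:
 assumes P: "primeideal P R"
 shows "psat P (sat P I)"
 unfolding psat_def
proof (intro ballI impI)
 fix z s assume z: "z \<in> carrier R" and s: "s \<in> carrier R - P" and "s \<otimes> z \<in> sat P I"
 then obtain t where t: "t \<in> carrier R - P" "t \<otimes> (s \<otimes> z) \<in> I" by (auto simp: sat_def)
 then have "(t \<otimes> s) \<otimes> z \<in> I" using s z by (simp add: m_assoc)
 moreover have "t \<otimes> s \<in> carrier R - P" using s t prime_mult[OF P, of t s] by auto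
 ultimately show "z \<in> sat P I" using z unfolding sat_def by (intro CollectI conjI bexI)
qed

lemma sat_upper: "primeideal P R \<Longrightarrow> ideal I R \<Longrightarrow> I \<subseteq> sat P I"
 unfolding sat_def using prime_one ideal_carr by (auto intro!: bexI[of _ \<one>])

lemma sat_mono: "I \<subseteq> J \<Longrightarrow> sat P I \<subseteq> sat P J"
 by (auto simp: sat_def)

lemma psatD: "psat P I \<Longrightarrow> z \<in> carrier R \<Longrightarrow> s \<in> carrier R \<Longrightarrow> s \<notin> P \<Longrightarrow> s \<otimes> z \<in> I \<Longrightarrow> z \<in> I"
 by (auto simp: psat_def)

end

context noetherian_cring
begin

text \<open>When I contains P^N, the ring (R/I) localized at P is Artinian, and C is a descending
  chain of its ideals. The Noetherian induction adds an element a with P a inside I: either all C n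
  contain a and hence the larger ideal I', or some C m does not, and then the chain is recovered
  from the chain of the C n + (a), which becomes stationary.\<close>

lemma psat_dcc:
 fixes C :: "nat \<Rightarrow> 'a set"
 assumes P: "primeideal P R" and I: "ideal I R"
 shows "psat P I \<Longrightarrow> (\<And>z. z \<in> ipow P N \<Longrightarrow> z \<in> I) \<Longrightarrow>
  (\<And>n. ideal (C n) R) \<Longrightarrow> (\<And>n. psat P (C n)) \<Longrightarrow> (\<And>n. I \<subseteq> C n) \<Longrightarrow> (\<And>n. C (Suc n) \<subseteq> C n) \<Longrightarrow>
  \<exists>n0. \<forall>n\<ge>n0. C n = C n0"
 using I
proof (induct arbitrary: C rule: ideal_induct)
 case (step I)
 note I = step(1) and sI = step(3) and N = step(4) and C = step(5-8)
 have desc: "C n \<subseteq> C m" if "m \<le> n" for m n using lift_Suc_antimono_le[of C, OF C(4) that] .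
 show ?case
 proof (cases "I = carrier R")
  case True
  then have "C n = carrier R" for n using C(3)[of n] ideal_subset_carr[OF C(1)[of n]] by simp
  then show ?thesis by simp
 next
  case False
  define i where "i = (LEAST i. ipow P i \<subseteq> I)"
  have i: "ipow P i \<subseteq> I" unfolding i_def by (rule LeastI[of _ N]) (use N in auto)
  have "i \<noteq> 0" using i False ideal_subset_carr[OF I] by (intro notI) auto
  then obtain i' where i': "i = Suc i'" by (cases i) auto
  have "\<not> ipow P i' \<subseteq> I" using not_less_Least[of i' "\<lambda>i. ipow P i \<subseteq> I"] i' by (simp add: i_def)
  then obtain a where a: "a \<in> ipow P i'" "a \<notin> I" by auto
  have ac: "a \<in> carrier R" using a(1) ideal_carr[OF ipow_ideal[OF prime_ideal[OF P]]] by simp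
  have pa: "p \<otimes> a \<in> I" if "p \<in> P" for p
  proof -
   have pc: "p \<in> carrier R" using that by (rule ideal_carr[OF prime_ideal[OF P]])
   have "a \<otimes> p \<in> ipow P i" unfolding i' ipow_Suc using a(1) that by (rule ideal_prod.prod)
   then show ?thesis using i m_comm[OF pc ac] by auto
  qed
  define I' where "I' = sat P (I <+> PIdl a)"
  note ci = cgenideal_ideal[OF ac]
  have I': "ideal I' R" "psat P I'" "I <+> PIdl a \<subseteq> I'"
   unfolding I'_def using P by (simp_all add: sat_ideal sat_psat sat_upper add_ideals I ci)
  have aI': "a \<in> I'" using set_add_upper2[OF I ci] cgenideal_self[OF ac] I'(3) by auto
  have II': "I \<subseteq> I'" using set_add_upper1[OF I ci] I'(3) by auto
  then have lt: "I \<subset> I'" using aI' a(2) by auto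
  have IH: "\<exists>n0. \<forall>n\<ge>n0. D n = D n0" if "\<And>n. ideal (D n) R" "\<And>n. psat P (D n)" "\<And>n. I' \<subseteq> D n" "\<And>n. D (Suc n) \<subseteq> D n"
   for D :: "nat \<Rightarrow> 'a set"
  proof (rule step(2)[OF I'(1) lt I'(2), of D])
   show "z \<in> I'" if "z \<in> ipow P N" for z using N[OF that] II' by auto
  qed (use that in simp_all)
  have min: "I' \<subseteq> D" if D: "ideal D R" "psat P D" "I \<subseteq> D" "a \<in> D" for D
  proof
   fix z assume "z \<in> I'"
   then obtain s where s: "s \<in> carrier R" "s \<notin> P" "s \<otimes> z \<in> I <+> PIdl a" "z \<in> carrier R" by (auto simp: I'_def sat_def)
   have "I <+> PIdl a \<subseteq> D" by (rule set_add_least[OF D(1) D(3) cgenideal_minimal[OF D(1,4)]])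
   then show "z \<in> D" using psatD[OF D(2)] s by blast
  qed
  show ?thesis
  proof (cases "\<forall>n. a \<in> C n")
   case True
   show ?thesis by (rule IH) (use C True min in auto)
  next
   case False
   then obtain m where m: "a \<notin> C m" by auto
   have nr: "r \<in> P" if "n \<ge> m" "r \<in> carrier R" "r \<otimes> a \<in> C n" for n r
    using psatD[OF C(2)[of n] ac that(2) _ that(3)] desc[OF that(1)] m by auto
   let ?D = "\<lambda>n. sat P (C n <+> PIdl a)"
   have "\<exists>n0. \<forall>n\<ge>n0. ?D n = ?D n0"
   proof (rule IH)
    fix n
    show "ideal (?D n) R" "psat P (?D n)" using P C(1) ci by (simp_all add: sat_ideal sat_psat add_ideals)
    show "I' \<subseteq> ?D n" unfolding I'_def by (intro sat_mono set_add_mono C(3) order_refl)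
    show "?D (Suc n) \<subseteq> ?D n" by (intro sat_mono set_add_mono C(4) order_refl)
   qed
   then obtain n0 where n0: "\<And>n. n \<ge> n0 \<Longrightarrow> ?D n = ?D n0" by auto
   \<comment> \<open>The modular law: in s c = c' + r a the element r a lies in C (max n0 m), which
     does not contain a. So r is in P, and r a lies in I and therefore in C n.\<close>
   have eq: "C (max n0 m) \<subseteq> C n" if n: "n \<ge> max n0 m" for n
   proof
    fix c assume c: "c \<in> C (max n0 m)"
    have cc: "c \<in> carrier R" using c C(1) ideal_carr by blast
    have "c \<in> ?D (max n0 m)"
     using c set_add_upper1[OF C(1) ci] sat_upper[OF P add_ideals[OF C(1) ci]] by blast
    then have "c \<in> ?D n" using n0[of n] n0[of "max n0 m"] n by simp
    then obtain s c' r where s: "s \<in> carrier R" "s \<notin> P" "c' \<in> C n" "r \<in> carrier R" "s \<otimes> c = c' \<oplus> r \<otimes> a"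
     by (auto simp: sat_def mem_add_cgen)
    have c'c: "c' \<in> carrier R" using s C(1) ideal_carr by blast
    have eq: "r \<otimes> a = s \<otimes> c \<ominus> c'" unfolding s(5) using c'c s(4) ac by algebra
    have "c' \<in> C (max n0 m)" using s(3) desc[OF n] by auto
    then have "s \<otimes> c \<ominus> c' \<in> C (max n0 m)" by (intro ideal_minus ideal_mult_l C(1) c s(1))
    then have "r \<otimes> a \<in> C (max n0 m)" by (simp only: eq)
    then have "r \<in> P" using nr[of "max n0 m" r] s(4) by simp
    then have "r \<otimes> a \<in> C n" using pa C(3) by auto
    then have "s \<otimes> c \<in> C n" unfolding s(5) using s(3) C(1) by (simp add: ideal_add)
    then show "c \<in> C n" using psatD[OF C(2)] cc s by blast
   qed
   have "C n = C (max n0 m)" if "n \<ge> max n0 m" for n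
    using eq[OF that] desc[OF that] by (rule subset_antisym[rotated])
   then show ?thesis by blast
  qed
 qed
qed

text \<open>Krull's theorem for the domain R/q, by symbolic powers: S n is the contraction of q1^n +
  q from the localization at q1. The chain condition at P makes the S n equal modulo t; Nakayama at
  P gives S n = S (n+1), and Nakayama at q1 then gives q1^n \<subseteq> q.\<close>

theorem krull_principal_ideal:
 assumes q: "primeideal q R" and q1: "primeideal q1 R" and less: "q \<subset> q1" "q1 \<subset> P"
  and t: "t \<in> carrier R" and P: "minover (q <+> PIdl t) P"
 shows False
proof -
 note iq = prime_ideal[OF q] and iq1 = prime_ideal[OF q1] and ct = cgenideal_ideal[OF t]
 have Pp: "primeideal P R" and qt: "q <+> PIdl t \<subseteq> P" using P by (auto simp: minover_def)
 note iqt = add_ideals[OF iq ct]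
 have t1: "t \<notin> q1"
 proof
  assume "t \<in> q1"
  then have "q <+> PIdl t \<subseteq> q1" using less(1) by (intro set_add_least iq1 cgenideal_minimal) auto
  then have "q1 = P" using P q1 less(2) by (auto simp: minover_def)
  then show False using less by auto
 qed
 define Y where "Y n = ipow q1 n <+> q" for n
 have iY: "ideal (Y n) R" for n unfolding Y_def by (intro add_ideals ipow_ideal iq1 iq)
 define S where "S n = sat q1 (Y n)" for n
 have iS: "ideal (S n) R" and pS: "psat q1 (S n)" and YS: "Y n \<subseteq> S n" for n
  unfolding S_def by (simp_all add: sat_ideal sat_psat sat_upper q1 iY)
 have qY: "q \<subseteq> Y n" for n unfolding Y_def by (rule set_add_upper2[OF ipow_ideal[OF iq1] iq])
 have Sdec: "S (Suc n) \<subseteq> S n" for n unfolding S_def Y_def by (intro sat_mono set_add_mono ipow_decr iq1 order_refl) simp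
 define C where "C n = sat P (S n <+> PIdl t)" for n
 have iSt: "ideal (S n <+> PIdl t) R" for n by (intro add_ideals iS ct)
 have "\<exists>n0. \<forall>n\<ge>n0. C n = C n0"
 proof -
  obtain s N where s: "s \<in> carrier R" "s \<notin> P" "\<And>z. z \<in> ipow P N \<Longrightarrow> s \<otimes> z \<in> q <+> PIdl t"
   using minover_ipow[OF iqt P] by auto
  have sN: "z \<in> sat P (q <+> PIdl t)" if "z \<in> ipow P N" for z
   unfolding sat_def using s that ideal_carr[OF ipow_ideal[OF prime_ideal[OF Pp]] that] by auto
  show ?thesis
  proof (rule psat_dcc[OF Pp sat_ideal[OF Pp iqt] sat_psat[OF Pp] sN])
   fix n
   show "ideal (C n) R" "psat P (C n)" unfolding C_def by (simp_all add: sat_ideal sat_psat Pp iSt)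
   have "q \<subseteq> S n" using qY YS by (rule order_trans)
   then show "sat P (q <+> PIdl t) \<subseteq> C n" unfolding C_def by (intro sat_mono set_add_mono order_refl)
   show "C (Suc n) \<subseteq> C n" unfolding C_def by (intro sat_mono set_add_mono order_refl Sdec)
  qed
 qed
 then obtain n where n: "C (Suc n) = C n" by (metis Suc_n_not_le_n nat_le_linear)
 \<comment> \<open>If s a = b + c t with a in S n and b in S (n+1), then t c lies in S n, and so
   does c because t is outside q1. Hence S n is S (n+1) plus t S n, up to multipliers outside P, and
   t lies in P.\<close>
 have "S n \<subseteq> S (Suc n)"
 proof -
  obtain A where A: "finite A" "A \<subseteq> carrier R" "S n = Idl A" using finetely_gen[OF iS[of n]] by auto
  have "\<exists>s'\<in>carrier R - P. \<forall>a\<in>Idl A. s' \<otimes> a \<in> S (Suc n)"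
  proof (rule nakayama_prime[OF Pp iS A(1,2)])
   fix a assume "a \<in> A"
   then have a: "a \<in> S n" using A genideal_self by auto
   then have "a \<in> C n" unfolding C_def using set_add_upper1[OF iS ct] sat_upper[OF Pp iSt] by blast
   then have "a \<in> C (Suc n)" using n by simp
   then obtain s b c where s: "s \<in> carrier R - P" "b \<in> S (Suc n)" "c \<in> carrier R" "s \<otimes> a = b \<oplus> c \<otimes> t"
    by (auto simp: C_def sat_def mem_add_cgen)
   have bn: "b \<in> S n" using s(2) Sdec by auto
   have bc: "b \<in> carrier R" using bn iS ideal_carr by blast
   have eq: "t \<otimes> c = s \<otimes> a \<ominus> b" unfolding s(4) using bc s(3) t by algebra
   have "s \<otimes> a \<ominus> b \<in> S n" by (rule ideal_minus[OF iS ideal_mult_l[OF iS a] bn]) (use s in simp)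
   then have "t \<otimes> c \<in> S n" by (simp only: eq)
   then have "c \<in> S n" using psatD[OF pS s(3) t t1] by simp
   moreover have "t \<in> P" using qt set_add_upper2[OF iq ct] cgenideal_self[OF t] by auto
   ultimately have "t \<otimes> c \<in> P \<cdot> (Idl A)" unfolding A(3) by (intro ideal_prod.prod)
   then have "s \<otimes> a \<in> S (Suc n) <+> P \<cdot> (Idl A)"
    unfolding s(4) mem_set_add using s(2,3) t m_comm[of c t] by auto
   then show "\<exists>s\<in>carrier R - P. s \<otimes> a \<in> S (Suc n) <+> P \<cdot> (Idl A)" using s(1) by (rule bexI)
  qed
  then obtain s' where s': "s' \<in> carrier R" "s' \<notin> P" "\<And>a. a \<in> S n \<Longrightarrow> s' \<otimes> a \<in> S (Suc n)" using A(3) by auto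
  have "s' \<notin> q1" using s' less by auto
  then show ?thesis using s' psatD[OF pS] iS ideal_carr by (metis subsetI)
 qed
 then have sub: "ipow q1 n \<subseteq> S (Suc n)"
  using set_add_upper1[OF ipow_ideal[OF iq1] iq, of n] YS[of n] unfolding Y_def by blast
 obtain A where A: "finite A" "A \<subseteq> carrier R" "ipow q1 n = Idl A" using finetely_gen[OF ipow_ideal[OF iq1, of n]] by auto
 have "\<exists>s'\<in>carrier R - q1. \<forall>a\<in>Idl A. s' \<otimes> a \<in> q"
 proof (rule nakayama_prime[OF q1 iq A(1,2)])
  fix a assume "a \<in> A"
  then have "a \<in> S (Suc n)" using A(3) genideal_self[OF A(2)] sub by auto
  then obtain s where s: "s \<in> carrier R - q1" "s \<otimes> a \<in> Y (Suc n)" by (auto simp: S_def sat_def)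
  have "Y (Suc n) = q <+> q1 \<cdot> (Idl A)"
   unfolding Y_def ipow_Suc A(3)[symmetric]
   using ideal_prod_commute[OF ipow_ideal[OF iq1] iq1, of n] add_ideals[OF iq iq1]
    set_add_comm[of "q1 \<cdot> ipow q1 n" q] ideal_subset_carr[OF iq] ideal_subset_carr[OF ideal_prod_is_ideal[OF iq1 ipow_ideal[OF iq1]]]
   by simp
  then show "\<exists>s\<in>carrier R - q1. s \<otimes> a \<in> q <+> q1 \<cdot> (Idl A)" using s by auto
 qed
 then obtain s' where s': "s' \<in> carrier R" "s' \<notin> q1" "\<And>a. a \<in> ipow q1 n \<Longrightarrow> s' \<otimes> a \<in> q" using A(3) by auto
 have "ipow q1 n \<subseteq> q"
 proof
  fix a assume a: "a \<in> ipow q1 n"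
  then have "s' \<in> q \<or> a \<in> q" using prime_mult[OF q s'(1) _ s'(3)[OF a]] ideal_carr[OF ipow_ideal[OF iq1] a] by simp
  then show "a \<in> q" using s'(2) less by auto
 qed
 then show False using prime_ipow[OF q iq1] less by blast
qed

end

section \<open>Noetherian subrings and the Hilbert basis theorem\<close>

context cring
begin

text \<open>Subrings and their modules are plain subsets of an ambient ring, so that the Rees
  algebra can be treated inside R[t] without a ring structure of its own.\<close>

definition subr :: "'a set \<Rightarrow> bool"
 where "subr A \<longleftrightarrow> A \<subseteq> carrier R \<and> \<zero> \<in> A \<and> \<one> \<in> A \<and> (\<forall>a\<in>A. \<forall>b\<in>A. a \<oplus> b \<in> A \<and> a \<otimes> b \<in> A) \<and> (\<forall>a\<in>A. \<ominus> a \<in> A)"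

definition submod :: "'a set \<Rightarrow> 'a set \<Rightarrow> bool"
 where "submod A I \<longleftrightarrow> I \<subseteq> carrier R \<and> \<zero> \<in> I \<and> (\<forall>a\<in>I. \<forall>b\<in>I. a \<oplus> b \<in> I) \<and> (\<forall>a\<in>A. \<forall>x\<in>I. a \<otimes> x \<in> I)"

text \<open>Finite generation is a universal property here: every submodule containing F contains I.
  The submodule generated by F never has to be constructed.\<close>

definition noeth_subr :: "'a set \<Rightarrow> bool"
 where "noeth_subr A \<longleftrightarrow> subr A \<and>
  (\<forall>I. submod A I \<and> I \<subseteq> A \<longrightarrow> (\<exists>F. finite F \<and> F \<subseteq> I \<and> (\<forall>J. submod A J \<and> F \<subseteq> J \<longrightarrow> I \<subseteq> J)))"

lemma submod_carr: "submod A I \<Longrightarrow> x \<in> I \<Longrightarrow> x \<in> carrier R"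
 by (auto simp: submod_def)

lemma submod_uminus: "subr A \<Longrightarrow> submod A I \<Longrightarrow> x \<in> I \<Longrightarrow> \<ominus> x \<in> I"
proof -
 assume a: "subr A" "submod A I" "x \<in> I"
 then have "(\<ominus> \<one>) \<otimes> x \<in> I" by (auto simp: subr_def submod_def)
 moreover have "(\<ominus> \<one>) \<otimes> x = \<ominus> x" using a by (auto simp: submod_def l_minus subset_iff)
 ultimately show ?thesis by simp
qed

lemma submod_minus: "subr A \<Longrightarrow> submod A I \<Longrightarrow> x \<in> I \<Longrightarrow> y \<in> I \<Longrightarrow> x \<ominus> y \<in> I"
 using submod_uminus[of A I y] by (auto simp: submod_def a_minus_def)

lemma noeth_subr_seq_stable:
 assumes A: "noeth_subr A" and I: "\<And>n::nat. submod A (I n)" "\<And>n. I n \<subseteq> A" "\<And>n. I n \<subseteq> I (Suc n)"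
 shows "\<exists>N. \<forall>n. I n \<subseteq> I N"
proof -
 have mono: "I m \<subseteq> I n" if "m \<le> n" for m n using lift_Suc_mono_le[of I, OF I(3) that] .
 have "submod A (\<Union>n. I n)"
  unfolding submod_def
 proof (intro conjI ballI)
  show "(\<Union>n. I n) \<subseteq> carrier R" using submod_carr[OF I(1)] by blast
  show "\<zero> \<in> (\<Union>n. I n)" using I(1) by (auto simp: submod_def)
  fix a assume a: "a \<in> (\<Union>n. I n)"
  then obtain n where n: "a \<in> I n" by auto
  { fix b assume "b \<in> (\<Union>n. I n)"
   then obtain m where "b \<in> I m" by auto
   then have "a \<in> I (max n m)" "b \<in> I (max n m)" using n mono[of n "max n m"] mono[of m "max n m"] by auto
   then have "a \<oplus> b \<in> I (max n m)" using I(1) by (auto simp: submod_def)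
   then show "a \<oplus> b \<in> (\<Union>n. I n)" by auto }
 next
  fix a x assume a: "a \<in> A" "x \<in> (\<Union>n. I n)"
  then obtain n where "x \<in> I n" by auto
  then have "a \<otimes> x \<in> I n" using I(1)[of n] a(1) by (auto simp: submod_def)
  then show "a \<otimes> x \<in> (\<Union>n. I n)" by auto
 qed
 moreover have "(\<Union>n. I n) \<subseteq> A" using I(2) by auto
 ultimately obtain F where F: "finite F" "F \<subseteq> (\<Union>n. I n)" "\<And>J. submod A J \<Longrightarrow> F \<subseteq> J \<Longrightarrow> (\<Union>n. I n) \<subseteq> J"
  using A unfolding noeth_subr_def by meson
 have "\<exists>N. G \<subseteq> I N" if "finite G" "G \<subseteq> (\<Union>n. I n)" for G
  using that
 proof (induct G rule: finite_induct)
  case (insert g G)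
  then obtain N m where "G \<subseteq> I N" "g \<in> I m" by auto
  then have "insert g G \<subseteq> I (max N m)" using mono[of N "max N m"] mono[of m "max N m"] by auto
  then show ?case by blast
 qed simp
 then obtain N where "F \<subseteq> I N" using F by metis
 then have "(\<Union>n. I n) \<subseteq> I N" using F(3) I(1) by simp
 then show ?thesis by blast
qed

text \<open>The values at b of the polynomials over A of degree less than n. Since b may satisfy
  relations over A, n bounds a representation and is not a degree of the element.\<close>

fun pdeg :: "'a set \<Rightarrow> 'a \<Rightarrow> nat \<Rightarrow> 'a set"
 where "pdeg A b 0 = {\<zero>}"
 | "pdeg A b (Suc n) = {x \<oplus> a \<otimes> b [^] n | x a. x \<in> pdeg A b n \<and> a \<in> A}"

definition adj :: "'a set \<Rightarrow> 'a \<Rightarrow> 'a set"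
 where "adj A b = (\<Union>n. pdeg A b n)"

lemma pdeg_submod:
 assumes A: "subr A" and b: "b \<in> carrier R"
 shows "submod A (pdeg A b n)"
proof (induct n)
 case 0
 have "A \<subseteq> carrier R" using A by (simp add: subr_def)
 then show ?case by (auto simp: submod_def)
next
 case (Suc n)
 have Ac: "A \<subseteq> carrier R" using A by (simp add: subr_def)
 have Dc: "pdeg A b n \<subseteq> carrier R" using Suc by (simp add: submod_def)
 show ?case
  unfolding submod_def
 proof (intro conjI ballI)
  show "pdeg A b (Suc n) \<subseteq> carrier R" using Ac Dc b by auto
  have "\<zero> = \<zero> \<oplus> \<zero> \<otimes> b [^] n" using b by simp
  then show "\<zero> \<in> pdeg A b (Suc n)" using A Suc unfolding pdeg.simps subr_def submod_def by blast
 next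
  fix u v assume "u \<in> pdeg A b (Suc n)" "v \<in> pdeg A b (Suc n)"
  then obtain x a y c where *: "u = x \<oplus> a \<otimes> b [^] n" "x \<in> pdeg A b n" "a \<in> A"
   "v = y \<oplus> c \<otimes> b [^] n" "y \<in> pdeg A b n" "c \<in> A" by auto
  have cc: "x \<in> carrier R" "y \<in> carrier R" "a \<in> carrier R" "c \<in> carrier R" using * Ac Dc by auto
  have "u \<oplus> v = (x \<oplus> y) \<oplus> (a \<oplus> c) \<otimes> b [^] n"
   unfolding * using cc nat_pow_closed[OF b, of n] by algebra
  moreover have "x \<oplus> y \<in> pdeg A b n" "a \<oplus> c \<in> A" using * A Suc by (auto simp: submod_def subr_def)
  ultimately show "u \<oplus> v \<in> pdeg A b (Suc n)" by auto
 next
  fix r u assume r: "r \<in> A" and "u \<in> pdeg A b (Suc n)"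
  then obtain x a where *: "u = x \<oplus> a \<otimes> b [^] n" "x \<in> pdeg A b n" "a \<in> A" by auto
  have cc: "x \<in> carrier R" "a \<in> carrier R" "r \<in> carrier R" using * Ac Dc r by auto
  have "r \<otimes> u = r \<otimes> x \<oplus> (r \<otimes> a) \<otimes> b [^] n"
   unfolding * using cc nat_pow_closed[OF b, of n] by algebra
  moreover have "r \<otimes> x \<in> pdeg A b n" "r \<otimes> a \<in> A" using * A Suc r by (auto simp: submod_def subr_def)
  ultimately show "r \<otimes> u \<in> pdeg A b (Suc n)" by auto
 qed
qed

lemma pdeg_Suc_mono:
 assumes A: "subr A" and b: "b \<in> carrier R"
 shows "pdeg A b n \<subseteq> pdeg A b (Suc n)"
proof
 fix x assume x: "x \<in> pdeg A b n"
 then have "x \<in> carrier R" using pdeg_submod[OF A b, of n] by (auto simp: submod_def)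
 then have "x = x \<oplus> \<zero> \<otimes> b [^] n" using b by simp
 then show "x \<in> pdeg A b (Suc n)" using x A unfolding pdeg.simps subr_def by blast
qed

lemma pdeg_mono: "subr A \<Longrightarrow> b \<in> carrier R \<Longrightarrow> m \<le> n \<Longrightarrow> pdeg A b m \<subseteq> pdeg A b n"
 using lift_Suc_mono_le[of "pdeg A b" m n] pdeg_Suc_mono by blast

lemma pdeg_mult_b:
 assumes A: "subr A" and b: "b \<in> carrier R"
 shows "x \<in> pdeg A b n \<Longrightarrow> b [^] m \<otimes> x \<in> pdeg A b (n + m)"
proof (induct n arbitrary: x)
 case 0
 then show ?case using pdeg_submod[OF A b, of m] b by (simp add: submod_def)
next
 case (Suc n)
 have Ac: "A \<subseteq> carrier R" using A by (simp add: subr_def)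
 obtain y a where *: "x = y \<oplus> a \<otimes> b [^] n" "y \<in> pdeg A b n" "a \<in> A" using Suc(2) by auto
 have cc: "y \<in> carrier R" "a \<in> carrier R" using * Ac pdeg_submod[OF A b, of n] by (auto simp: submod_def)
 have "b [^] m \<otimes> x = b [^] m \<otimes> y \<oplus> a \<otimes> (b [^] n \<otimes> b [^] m)"
  unfolding * using cc nat_pow_closed[OF b, of n] nat_pow_closed[OF b, of m] by algebra
 then have "b [^] m \<otimes> x = b [^] m \<otimes> y \<oplus> a \<otimes> b [^] (n + m)" using b by (simp add: nat_pow_mult)
 then show ?case using Suc(1)[OF *(2)] *(3) by auto
qed

lemma adj_closed:
 assumes A: "subr A" and b: "b \<in> carrier R"
 shows "subr (adj A b)" and "A \<subseteq> adj A b" and "b \<in> adj A b"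
proof -
 have Ac: "A \<subseteq> carrier R" using A by (simp add: subr_def)
 note sm = pdeg_submod[OF A b]
 have Dc: "\<And>n x. x \<in> pdeg A b n \<Longrightarrow> x \<in> carrier R" by (rule submod_carr[OF sm])
 have add: "x \<oplus> y \<in> adj A b" if xy: "x \<in> adj A b" "y \<in> adj A b" for x y
 proof -
  obtain n m where "x \<in> pdeg A b n" "y \<in> pdeg A b m" using xy unfolding adj_def by (elim UN_E)
  then have "x \<in> pdeg A b (max n m)" "y \<in> pdeg A b (max n m)"
   using pdeg_mono[OF A b, of n "max n m"] pdeg_mono[OF A b, of m "max n m"] by auto
  then have "x \<oplus> y \<in> pdeg A b (max n m)" using sm by (auto simp: submod_def)
  then show ?thesis by (auto simp: adj_def)
 qed
 have smul: "a \<otimes> x \<in> adj A b" if ax: "a \<in> A" "x \<in> adj A b" for a x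
 proof -
  obtain n where "x \<in> pdeg A b n" using ax(2) unfolding adj_def by (elim UN_E)
  then have "a \<otimes> x \<in> pdeg A b n" using sm[of n] ax(1) by (simp add: submod_def)
  then show ?thesis unfolding adj_def by blast
 qed
 have mult: "x \<otimes> y \<in> adj A b" if x: "x \<in> pdeg A b n" and y: "y \<in> adj A b" for x y n
  using x
 proof (induct n arbitrary: x)
  case 0
  obtain m where m: "y \<in> pdeg A b m" using y by (auto simp: adj_def)
  have "\<zero> \<in> pdeg A b 0" by simp
  then show ?case using 0 Dc[OF m] by (auto simp: adj_def intro: exI[of _ 0])
 next
  case (Suc n)
  obtain z a where *: "x = z \<oplus> a \<otimes> b [^] n" "z \<in> pdeg A b n" "a \<in> A" using Suc(2) by auto
  obtain m where m: "y \<in> pdeg A b m" using y by (auto simp: adj_def)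
  have cc: "z \<in> carrier R" "a \<in> carrier R" "y \<in> carrier R" using * Ac Dc m by auto
  have "x \<otimes> y = z \<otimes> y \<oplus> a \<otimes> (b [^] n \<otimes> y)"
   unfolding * using cc nat_pow_closed[OF b, of n] by algebra
  moreover have "b [^] n \<otimes> y \<in> adj A b" using pdeg_mult_b[OF A b m, of n] by (auto simp: adj_def)
  ultimately show ?case using add[OF Suc(1)[OF *(2)] smul[OF *(3)]] by simp
 qed
 have A1: "a \<in> pdeg A b (Suc 0)" if "a \<in> A" for a
  using that Ac by (auto intro!: exI[of _ a])
 then show AA: "A \<subseteq> adj A b" unfolding adj_def by blast
 have "\<one> \<in> pdeg A b (Suc 0)" using A1 A by (simp add: subr_def)
 from pdeg_mult_b[OF A b this, of 1] have "b \<in> pdeg A b (Suc 0 + 1)" using b by simp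
 then show "b \<in> adj A b" unfolding adj_def by blast
 show "subr (adj A b)"
  unfolding subr_def
 proof (intro conjI ballI)
  show "adj A b \<subseteq> carrier R" using Dc by (auto simp: adj_def)
  show "\<zero> \<in> adj A b" "\<one> \<in> adj A b" using AA A by (auto simp: subr_def)
  fix x assume x: "x \<in> adj A b"
  then have xc: "x \<in> carrier R" using Dc by (auto simp: adj_def)
  have "(\<ominus> \<one>) \<otimes> x \<in> adj A b" using smul[of "\<ominus> \<one>" x] A x by (auto simp: subr_def)
  then show "\<ominus> x \<in> adj A b" using xc by (simp add: l_minus)
  fix y assume y: "y \<in> adj A b"
  show "x \<oplus> y \<in> adj A b" using add x y .
  show "x \<otimes> y \<in> adj A b" using x y mult by (auto simp: adj_def)
 qed
qed

lemma adj_minimal: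
 assumes "subr S" "A \<subseteq> S" "b \<in> S"
 shows "adj A b \<subseteq> S"
proof -
 have pow: "b [^] n \<in> S" for n :: nat using assms by (induct n) (auto simp: subr_def)
 have cl: "x \<oplus> a \<otimes> b [^] n \<in> S" if "x \<in> S" "a \<in> S" for x a and n :: nat
  using that pow[of n] assms(1) unfolding subr_def by metis
 have "pdeg A b n \<subseteq> S" for n
 proof (induct n)
  case 0 then show ?case using assms by (auto simp: subr_def)
 next
  case (Suc n)
  show ?case
  proof
   fix z assume "z \<in> pdeg A b (Suc n)"
   then obtain x a where "z = x \<oplus> a \<otimes> b [^] n" "x \<in> pdeg A b n" "a \<in> A" by auto
   then show "z \<in> S" using cl[of x a n] Suc assms(2) by auto
  qed
 qed
 then show ?thesis by (auto simp: adj_def)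
qed

text \<open>Hilbert's argument with representations in place of polynomials: \<open>Ld n\<close>
  collects the top coefficients of expressions x + a b^n in I. Multiplication by b makes
  \<open>Ld\<close> increasing, so it is constant from some N on, and lifts of generators of
  \<open>Ld 0\<close> up to \<open>Ld N\<close> generate I.\<close>

theorem hilbert_basis:
 assumes nA: "noeth_subr A" and b: "b \<in> carrier R"
 shows "noeth_subr (adj A b)"
 unfolding noeth_subr_def
proof (intro conjI allI impI)
 have A: "subr A" using nA by (simp add: noeth_subr_def)
 then have Ac: "A \<subseteq> carrier R" by (simp add: subr_def)
 note sm = pdeg_submod[OF A b]
 have Dc: "\<And>n x. x \<in> pdeg A b n \<Longrightarrow> x \<in> carrier R" by (rule submod_carr[OF sm])
 let ?S = "adj A b"
 show S: "subr ?S" using adj_closed[OF A b] by simp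
 have AS: "A \<subseteq> ?S" and bS: "b \<in> ?S" using adj_closed[OF A b] by simp_all
 have powS: "b [^] n \<in> ?S" for n :: nat using S bS by (induct n) (auto simp: subr_def)
 \<comment> \<open>Stated for every submodule, because it is also applied to I \<inter> J at the
   end.\<close>
 have lead: "submod A {a\<in>A. \<exists>x\<in>pdeg A b n. x \<oplus> a \<otimes> b [^] n \<in> I}" if I: "submod ?S I" for I n
  unfolding submod_def
 proof (intro conjI ballI)
  show "{a\<in>A. \<exists>x\<in>pdeg A b n. x \<oplus> a \<otimes> b [^] n \<in> I} \<subseteq> carrier R" using Ac by auto
  show "\<zero> \<in> {a\<in>A. \<exists>x\<in>pdeg A b n. x \<oplus> a \<otimes> b [^] n \<in> I}"
   using A sm[of n] I b by (auto simp: subr_def submod_def intro!: bexI[of _ \<zero>])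
 next
  fix u v assume "u \<in> {a\<in>A. \<exists>x\<in>pdeg A b n. x \<oplus> a \<otimes> b [^] n \<in> I}" "v \<in> {a\<in>A. \<exists>x\<in>pdeg A b n. x \<oplus> a \<otimes> b [^] n \<in> I}"
  then obtain x y where *: "u \<in> A" "v \<in> A" "x \<in> pdeg A b n" "y \<in> pdeg A b n" "x \<oplus> u \<otimes> b [^] n \<in> I" "y \<oplus> v \<otimes> b [^] n \<in> I" by auto
  have cc: "u \<in> carrier R" "v \<in> carrier R" "x \<in> carrier R" "y \<in> carrier R" using * Ac Dc by auto
  have "(x \<oplus> y) \<oplus> (u \<oplus> v) \<otimes> b [^] n = (x \<oplus> u \<otimes> b [^] n) \<oplus> (y \<oplus> v \<otimes> b [^] n)"
   using cc nat_pow_closed[OF b, of n] by algebra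
  also have "\<dots> \<in> I" using * I by (auto simp: submod_def)
  finally show "u \<oplus> v \<in> {a\<in>A. \<exists>x\<in>pdeg A b n. x \<oplus> a \<otimes> b [^] n \<in> I}"
   using * A sm[of n] by (auto simp: subr_def submod_def intro!: bexI[of _ "x \<oplus> y"])
 next
  fix r u assume r: "r \<in> A" and "u \<in> {a\<in>A. \<exists>x\<in>pdeg A b n. x \<oplus> a \<otimes> b [^] n \<in> I}"
  then obtain x where *: "u \<in> A" "x \<in> pdeg A b n" "x \<oplus> u \<otimes> b [^] n \<in> I" by auto
  have cc: "u \<in> carrier R" "x \<in> carrier R" "r \<in> carrier R" using * r Ac Dc by auto
  have "(r \<otimes> x) \<oplus> (r \<otimes> u) \<otimes> b [^] n = r \<otimes> (x \<oplus> u \<otimes> b [^] n)"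
   using cc nat_pow_closed[OF b, of n] by algebra
  also have "\<dots> \<in> I" using * I r AS by (auto simp: submod_def)
  finally show "r \<otimes> u \<in> {a\<in>A. \<exists>x\<in>pdeg A b n. x \<oplus> a \<otimes> b [^] n \<in> I}"
   using * A sm[of n] r by (auto simp: subr_def submod_def intro!: bexI[of _ "r \<otimes> x"])
 qed
 fix I assume "submod ?S I \<and> I \<subseteq> ?S"
 then have I: "submod ?S I" and IS: "I \<subseteq> ?S" by auto
 define Ld where "Ld n = {a\<in>A. \<exists>x\<in>pdeg A b n. x \<oplus> a \<otimes> b [^] n \<in> I}" for n
 have Ldm: "submod A (Ld n)" and LdA: "Ld n \<subseteq> A" for n using lead[OF I] by (auto simp: Ld_def)
 have LdS: "Ld n \<subseteq> Ld (Suc n)" for n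
 proof
  fix a assume "a \<in> Ld n"
  then obtain x where x: "a \<in> A" "x \<in> pdeg A b n" "x \<oplus> a \<otimes> b [^] n \<in> I" by (auto simp: Ld_def)
  have cc: "a \<in> carrier R" "x \<in> carrier R" using x Ac Dc by auto
  have "b \<otimes> x \<oplus> a \<otimes> (b [^] n \<otimes> b) = b \<otimes> (x \<oplus> a \<otimes> b [^] n)"
   using cc b nat_pow_closed[OF b, of n] by algebra
  also have "\<dots> \<in> I" using x I bS by (auto simp: submod_def)
  finally have "b \<otimes> x \<oplus> a \<otimes> b [^] Suc n \<in> I" by simp
  moreover have "b \<otimes> x \<in> pdeg A b (Suc n)" using pdeg_mult_b[OF A b x(2), of 1] b by simp
  ultimately show "a \<in> Ld (Suc n)" using x by (auto simp: Ld_def)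
 qed
 obtain N where N: "\<And>n. Ld n \<subseteq> Ld N" using noeth_subr_seq_stable[of A Ld, OF nA Ldm LdA LdS] by auto
 have "\<forall>n. \<exists>F. finite F \<and> F \<subseteq> Ld n \<and> (\<forall>J. submod A J \<and> F \<subseteq> J \<longrightarrow> Ld n \<subseteq> J)"
  using nA Ldm LdA unfolding noeth_subr_def by blast
 then obtain F where F: "\<And>n. finite (F n)" "\<And>n. F n \<subseteq> Ld n" "\<And>n J. submod A J \<Longrightarrow> F n \<subseteq> J \<Longrightarrow> Ld n \<subseteq> J"
  by metis
 have "\<forall>n. \<forall>a\<in>F n. \<exists>x\<in>pdeg A b n. x \<oplus> a \<otimes> b [^] n \<in> I" using F(2) by (auto simp: Ld_def)
 then obtain e where e: "\<And>n a. a \<in> F n \<Longrightarrow> e n a \<in> pdeg A b n \<and> e n a \<oplus> a \<otimes> b [^] n \<in> I" by metis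
 define G where "G = (\<Union>n\<in>{..N}. (\<lambda>a. e n a \<oplus> a \<otimes> b [^] n) ` F n)"
 have "I \<subseteq> J" if J: "submod ?S J" and GJ: "G \<subseteq> J" for J
 proof -
  have IJ: "submod ?S (I \<inter> J)" using I J by (auto simp: submod_def)
  have "I \<inter> pdeg A b n \<subseteq> J" for n
  proof (induct n)
   case 0 then show ?case using J by (auto simp: submod_def)
  next
   case (Suc n)
   show ?case
   proof
    fix z assume z: "z \<in> I \<inter> pdeg A b (Suc n)"
    then obtain x a where *: "z = x \<oplus> a \<otimes> b [^] n" "x \<in> pdeg A b n" "a \<in> A" by auto
    have "a \<in> Ld n" using z * by (auto simp: Ld_def)
    \<comment> \<open>Beyond N a top coefficient for the exponent n is already one for N; the
      missing power b^(n-m) is multiplied on afterwards.\<close>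
    define m where "m = min n N"
    have am: "a \<in> Ld m" using \<open>a \<in> Ld n\<close> N by (auto simp: m_def min_def)
    let ?K = "{a\<in>A. \<exists>x\<in>pdeg A b m. x \<oplus> a \<otimes> b [^] m \<in> I \<inter> J}"
    have "F m \<subseteq> ?K"
    proof
     fix a' assume a': "a' \<in> F m"
     have "e m a' \<oplus> a' \<otimes> b [^] m \<in> G" using a' by (auto simp: G_def m_def)
     then show "a' \<in> ?K" using a' e[OF a'] F(2)[of m] LdA[of m] GJ by auto
    qed
    then have "a \<in> ?K" by (rule subsetD[OF F(3)[OF lead[OF IJ]] am])
    then obtain x' where x': "x' \<in> pdeg A b m" "x' \<oplus> a \<otimes> b [^] m \<in> I \<inter> J" by auto
    have cc: "a \<in> carrier R" "x \<in> carrier R" "x' \<in> carrier R" using x' * Ac Dc by auto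
    have nm: "n = m + (n - m)" by (simp add: m_def)
    have "b [^] m \<otimes> b [^] (n - m) = b [^] n" using b nm nat_pow_mult by metis
    then have "b [^] (n - m) \<otimes> x' \<oplus> a \<otimes> b [^] n = b [^] (n - m) \<otimes> x' \<oplus> a \<otimes> (b [^] m \<otimes> b [^] (n - m))" by simp
    also have "\<dots> = b [^] (n - m) \<otimes> (x' \<oplus> a \<otimes> b [^] m)"
     using cc nat_pow_closed[OF b, of m] nat_pow_closed[OF b, of "n - m"] by algebra
    also have "\<dots> \<in> I \<inter> J" using x' IJ powS by (simp add: submod_def)
    finally have w: "b [^] (n - m) \<otimes> x' \<oplus> a \<otimes> b [^] n \<in> I \<inter> J" (is "?w \<in> _") .
    have x'': "b [^] (n - m) \<otimes> x' \<in> pdeg A b n" using pdeg_mult_b[OF A b x'(1), of "n - m"] nm by simp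
    have eq: "z \<ominus> ?w = x \<ominus> b [^] (n - m) \<otimes> x'"
     unfolding * using cc nat_pow_closed[OF b, of n] nat_pow_closed[OF b, of "n - m"] by algebra
    have "z \<ominus> ?w \<in> I" using submod_minus[OF S I] z w by auto
    moreover have "z \<ominus> ?w \<in> pdeg A b n" unfolding eq by (rule submod_minus[OF A sm *(2) x''])
    ultimately have "z \<ominus> ?w \<in> J" using Suc by auto
    then have "(z \<ominus> ?w) \<oplus> ?w \<in> J" using J w by (auto simp: submod_def)
    moreover have "(z \<ominus> ?w) \<oplus> ?w = z"
     unfolding * using cc nat_pow_closed[OF b, of n] nat_pow_closed[OF b, of "n - m"] by algebra
    ultimately show "z \<in> J" by simp
   qed
  qed
  then show ?thesis using IS unfolding adj_def by blast
 qed
 moreover have "finite G" using F(1) by (auto simp: G_def)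
 moreover have "G \<subseteq> I" using e by (auto simp: G_def)
 ultimately show "\<exists>F. finite F \<and> F \<subseteq> I \<and> (\<forall>J. submod ?S J \<and> F \<subseteq> J \<longrightarrow> I \<subseteq> J)" by blast
qed

lemma submod_carrier_iff: "submod (carrier R) I \<longleftrightarrow> ideal I R"
proof
 assume "submod (carrier R) I"
 then show "ideal I R" by (intro idealI') (auto simp: submod_def)
next
 assume "ideal I R"
 then show "submod (carrier R) I" using ideal_subset_carr[of I] by (auto simp: submod_def ideal_rules)
qed

lemma noeth_subr_carrier: "noeth_subr (carrier R) \<longleftrightarrow> noetherian_ring R"
proof
 assume n: "noeth_subr (carrier R)"
 show "noetherian_ring R"
 proof (rule noetherian_ringI)
  fix I assume I: "ideal I R"
  then have "submod (carrier R) I \<and> I \<subseteq> carrier R" using submod_carrier_iff ideal_subset_carr by auto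
  then obtain F where F: "finite F" "F \<subseteq> I" "\<And>J. ideal J R \<Longrightarrow> F \<subseteq> J \<Longrightarrow> I \<subseteq> J"
   using n unfolding noeth_subr_def submod_carrier_iff by meson
  have Fc: "F \<subseteq> carrier R" using F(2) ideal_subset_carr[OF I] by auto
  have "I = Idl F" using F(3)[OF genideal_ideal[OF Fc] genideal_self[OF Fc]] genideal_minimal[OF I F(2)] by auto
  then show "\<exists>A\<subseteq>carrier R. finite A \<and> I = Idl A" using F Fc by auto
 qed
next
 assume "noetherian_ring R"
 then interpret noetherian_ring R .
 have "\<exists>F. finite F \<and> F \<subseteq> I \<and> (\<forall>J. ideal J R \<and> F \<subseteq> J \<longrightarrow> I \<subseteq> J)" if I: "ideal I R" for I
 proof -
  obtain F where F: "F \<subseteq> carrier R" "finite F" "I = Idl F" using finetely_gen[OF I] by auto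
  then show ?thesis using genideal_self genideal_minimal by (intro exI[of _ F]) auto
 qed
 then show "noeth_subr (carrier R)" by (auto simp: noeth_subr_def submod_carrier_iff subr_def)
qed

text \<open>The minimality clause is what later bounds the coefficients of the elements of the Rees
  algebra.\<close>

lemma noeth_subr_adjoin_finite:
 "finite F \<Longrightarrow> noeth_subr A \<Longrightarrow> F \<subseteq> carrier R \<Longrightarrow>
  \<exists>S. noeth_subr S \<and> A \<subseteq> S \<and> F \<subseteq> S \<and> (\<forall>T. subr T \<and> A \<subseteq> T \<and> F \<subseteq> T \<longrightarrow> S \<subseteq> T)"
proof (induct F rule: finite_induct)
 case empty then show ?case by (intro exI[of _ A]) auto
next
 case (insert b F)
 then obtain S where S: "noeth_subr S" "A \<subseteq> S" "F \<subseteq> S" "\<forall>T. subr T \<and> A \<subseteq> T \<and> F \<subseteq> T \<longrightarrow> S \<subseteq> T" by auto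
 have bc: "b \<in> carrier R" using insert by simp
 have s: "subr S" using S by (simp add: noeth_subr_def)
 show ?case
  by (rule exI[of _ "adj S b"])
   (use hilbert_basis[OF S(1) bc] adj_closed[OF s bc] S adj_minimal in auto)
qed

end

section \<open>The Artin--Rees lemma\<close>

context UP_cring
begin

abbreviation (input) mult_P (infixl \<open>\<otimes>\<^sub>P\<close> 70) where "x \<otimes>\<^sub>P y \<equiv> x \<otimes>\<^bsub>P\<^esub> y"
abbreviation (input) add_P (infixl \<open>\<oplus>\<^sub>P\<close> 65) where "x \<oplus>\<^sub>P y \<equiv> x \<oplus>\<^bsub>P\<^esub> y"
abbreviation (input) minus_P (infixl \<open>\<ominus>\<^sub>P\<close> 65) where "x \<ominus>\<^sub>P y \<equiv> x \<ominus>\<^bsub>P\<^esub> y"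
abbreviation (input) uminus_P (\<open>\<ominus>\<^sub>P _\<close> [81] 80) where "\<ominus>\<^sub>P x \<equiv> \<ominus>\<^bsub>P\<^esub> x"
abbreviation (input) zero_P (\<open>\<zero>\<^sub>P\<close>) where "\<zero>\<^sub>P \<equiv> \<zero>\<^bsub>P\<^esub>"
abbreviation (input) one_P (\<open>\<one>\<^sub>P\<close>) where "\<one>\<^sub>P \<equiv> \<one>\<^bsub>P\<^esub>"
abbreviation (input) set_add_P (infixl \<open><+>\<^sub>P\<close> 60) where "I <+>\<^sub>P J \<equiv> I <+>\<^bsub>P\<^esub> J"
abbreviation (input) cgenideal_P (\<open>PIdl\<^sub>P _\<close> [80] 79) where "PIdl\<^sub>P a \<equiv> PIdl\<^bsub>P\<^esub> a"
abbreviation (input) cf where "cf \<equiv> up_ring.coeff P"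
abbreviation (input) mon where "mon \<equiv> up_ring.monom P"

lemma subr_const: "P.subr ((\<lambda>a. mon a 0) ` carrier R)"
 unfolding P.subr_def
 by (auto simp: monom_add[symmetric] monom_mult[symmetric] monom_a_inv[symmetric] simp del: monom_add monom_mult monom_a_inv
   intro!: image_eqI[of "\<zero>\<^sub>P" _ \<zero>] image_eqI[of "\<one>\<^sub>P" _ \<one>])

lemma noeth_subr_const:
 assumes "noetherian_ring R"
 shows "P.noeth_subr ((\<lambda>a. mon a 0) ` carrier R)"
 unfolding P.noeth_subr_def
proof (intro conjI allI impI subr_const)
 let ?c = "\<lambda>a. mon a 0"
 interpret N: noetherian_ring R by fact
 fix I assume I: "P.submod (?c ` carrier R) I \<and> I \<subseteq> ?c ` carrier R"
 have pull: "ideal {a\<in>carrier R. ?c a \<in> J} R" if J: "P.submod (?c ` carrier R) J" for J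
 proof (rule R.idealI')
  show "\<zero> \<in> {a\<in>carrier R. ?c a \<in> J}" using J by (simp add: P.submod_def)
  show "a \<oplus> b \<in> {a\<in>carrier R. ?c a \<in> J}" if "a \<in> {a\<in>carrier R. ?c a \<in> J}" "b \<in> {a\<in>carrier R. ?c a \<in> J}" for a b
   using J that by (simp add: P.submod_def)
  show "r \<otimes> a \<in> {a\<in>carrier R. ?c a \<in> J}" if "a \<in> {a\<in>carrier R. ?c a \<in> J}" "r \<in> carrier R" for a r
  proof -
   have "?c r \<otimes>\<^sub>P ?c a \<in> J" using J that by (auto simp: P.submod_def)
   moreover have "?c r \<otimes>\<^sub>P ?c a = ?c (r \<otimes> a)" using that monom_mult[of r a 0 0] by simp
   ultimately show ?thesis using that by simp
  qed
 qed auto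
 obtain F where F: "F \<subseteq> carrier R" "finite F" "{a\<in>carrier R. ?c a \<in> I} = genideal R F"
  using N.finetely_gen[OF pull] I by blast
 have "I \<subseteq> J" if J: "P.submod (?c ` carrier R) J \<and> ?c ` F \<subseteq> J" for J
 proof
  fix z assume "z \<in> I"
  then obtain a where a: "a \<in> carrier R" "z = ?c a" "?c a \<in> I" using I by auto
  then have "a \<in> genideal R F" using F(3) by auto
  also have "genideal R F \<subseteq> {a\<in>carrier R. ?c a \<in> J}"
   using R.genideal_minimal[OF pull[OF conjunct1[OF J]], of F] J F by auto
  finally show "z \<in> J" using a by auto
 qed
 moreover have "?c ` F \<subseteq> I" using F R.genideal_self[OF F(1)] by auto
 ultimately show "\<exists>F. finite F \<and> F \<subseteq> I \<and> (\<forall>J. P.submod (?c ` carrier R) J \<and> F \<subseteq> J \<longrightarrow> I \<subseteq> J)"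
  using F(2) by (intro exI[of _ "?c ` F"]) auto
qed

lemma monom_Suc_eq: "a \<in> carrier R \<Longrightarrow> mon a (Suc n) = mon a n \<otimes>\<^sub>P mon \<one> 1"
 using monom_mult[of a \<one> n 1] by simp

text \<open>Only the monomials of p itself have to lie in S. This matters for the Rees algebra,
  which contains a t^n only for a in \<bb>^n.\<close>

lemma subr_contains_all_monoms:
 assumes S: "P.subr S" and m: "\<And>n. mon (cf p n) n \<in> S" and p: "p \<in> carrier P"
 shows "p \<in> S"
proof -
 have "(\<forall>i\<ge>n. cf q i = \<zero>) \<longrightarrow> (\<forall>i<n. mon (cf q i) i \<in> S) \<longrightarrow> q \<in> S" if "q \<in> carrier P" for q n
  using that
 proof (induct n arbitrary: q)
  case 0
  have "q = \<zero>\<^sub>P" if "\<forall>i. cf q i = \<zero>" by (rule up_eqI) (use that 0 in auto)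
  then show ?case using S by (auto simp: P.subr_def)
 next
  case (Suc n)
  show ?case
  proof (intro impI)
   assume a: "\<forall>i\<ge>Suc n. cf q i = \<zero>" "\<forall>i<Suc n. mon (cf q i) i \<in> S"
   let ?m = "mon (cf q n) n"
   have mc: "?m \<in> carrier P" using Suc(2) by simp
   let ?r = "q \<ominus>\<^sub>P ?m"
   have rc: "?r \<in> carrier P" using Suc(2) mc by simp
   have co: "cf ?r i = (if i = n then \<zero> else cf q i)" for i
    using Suc(2) mc by (simp add: R.minus_eq R.r_neg coeff_minus)
   have "?r \<in> S"
   proof (rule Suc(1)[OF rc, rule_format])
    fix i assume "n \<le> i" then show "cf ?r i = \<zero>" using a(1) unfolding co by auto
   next
    fix i assume "i < n" then show "mon (cf ?r i) i \<in> S" using a(2) unfolding co by auto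
   qed
   then have "?r \<oplus>\<^sub>P ?m \<in> S" using S a(2) by (auto simp: P.subr_def)
   moreover have "?r \<oplus>\<^sub>P ?m = q" using Suc(2) mc P.minus_eq P.a_assoc P.l_neg P.r_zero P.a_inv_closed by metis
   ultimately show "q \<in> S" by simp
  qed
 qed
 from this[OF p, of "Suc (deg R p)"] show ?thesis using m p deg_aboveD[of p] by (simp add: Suc_le_eq)
qed

theorem noetherian_UP:
 assumes "noetherian_ring R"
 shows "noetherian_ring P"
proof -
 let ?C = "(\<lambda>a. mon a 0) ` carrier R"
 let ?S = "P.adj ?C (mon \<one> 1)"
 have tc: "mon \<one> 1 \<in> carrier P" by simp
 have nS: "P.noeth_subr ?S" by (rule P.hilbert_basis[OF noeth_subr_const[OF assms] tc])
 then have S: "P.subr ?S" by (simp add: P.noeth_subr_def)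
 have CS: "?C \<subseteq> ?S" "mon \<one> 1 \<in> ?S" using P.adj_closed[OF subr_const tc] by simp_all
 have "mon a n \<in> ?S" if a: "a \<in> carrier R" for a n
 proof (induct n)
  case 0 then show ?case using CS a by auto
 next
  case (Suc n) then show ?case using monom_Suc_eq[OF a, of n] S CS by (simp add: P.subr_def)
 qed
 then have "carrier P \<subseteq> ?S" using subr_contains_all_monoms[OF S] by auto
 then have "?S = carrier P" using S by (auto simp: P.subr_def)
 then show ?thesis using nS P.noeth_subr_carrier by simp
qed

lemma finsum_ideal:
 assumes I: "ideal I R" shows "finite A \<Longrightarrow> (\<And>i. i \<in> A \<Longrightarrow> f i \<in> I) \<Longrightarrow> finsum R f A \<in> I"
proof (induct A rule: finite_induct)
 case empty then show ?case using R.ideal_zero[OF I] by simp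
next
 case (insert x A)
 have "f \<in> A \<rightarrow> carrier R" "f x \<in> carrier R" using insert R.ideal_carr[OF I] by auto
 then show ?case using insert R.ideal_add[OF I] by simp
qed

lemma coeff_mult_mem:
 assumes "p \<in> carrier P" "q \<in> carrier P" "ideal I R"
  and "\<And>i. i \<le> n \<Longrightarrow> cf p i \<otimes> cf q (n - i) \<in> I"
 shows "cf (p \<otimes>\<^sub>P q) n \<in> I"
 unfolding coeff_mult[OF assms(1,2)] by (rule finsum_ideal[OF assms(3)]) (use assms(4) in auto)

text \<open>The Rees algebra, the sum of all \<bb>^n t^n, is generated over R by finitely many
  elements of degree one, hence Noetherian. The sum of all L n t^n is an ideal of it, and c bounds
  the degrees of finitely many generators. General filtrations L are allowed because the proofs of
  \<open>noetherian_A\<close> and \<open>integral_of_almost_integral\<close> need others than I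
  \<inter> \<bb>^n.\<close>

theorem rees_filtration:
 assumes noeth: "noetherian_ring R" and \<bb>: "ideal \<bb> R"
  and L: "\<And>n. ideal (L n) R" "\<And>n. L n \<subseteq> R.ipow \<bb> n" "\<And>n. \<bb> \<cdot> L n \<subseteq> L (Suc n)"
 shows "\<exists>c. \<forall>n\<ge>c. L n \<subseteq> R.ipow \<bb> (n - c) \<cdot> L c"
proof -
 let ?C = "(\<lambda>a. mon a 0) ` carrier R"
 note ip = R.ipow_ideal[OF \<bb>]
 obtain F where F: "F \<subseteq> carrier R" "finite F" "\<bb> = genideal R F"
  using noetherian_ring.finetely_gen[OF noeth \<bb>] by auto
 let ?F = "(\<lambda>a. mon a 1) ` F"
 \<comment> \<open>S is the smallest subring containing the constants and the x t with x in F. It is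
   the Rees algebra: its n-th coefficients lie in \<bb>^n (\<open>ST\<close>), and it contains a t^n
   for every a in \<bb>^n (\<open>mS\<close>).\<close>
 have "\<exists>S. P.noeth_subr S \<and> ?C \<subseteq> S \<and> ?F \<subseteq> S \<and> (\<forall>T. P.subr T \<and> ?C \<subseteq> T \<and> ?F \<subseteq> T \<longrightarrow> S \<subseteq> T)"
  by (rule P.noeth_subr_adjoin_finite[OF _ noeth_subr_const[OF noeth]]) (use F in auto)
 then obtain S where S: "P.noeth_subr S" "?C \<subseteq> S" "?F \<subseteq> S" "\<And>T. P.subr T \<Longrightarrow> ?C \<subseteq> T \<Longrightarrow> ?F \<subseteq> T \<Longrightarrow> S \<subseteq> T" by auto
 have sS: "P.subr S" using S(1) by (simp add: P.noeth_subr_def)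
 then have Sc: "S \<subseteq> carrier P" by (simp add: P.subr_def)
 let ?T = "{p\<in>carrier P. \<forall>n. cf p n \<in> R.ipow \<bb> n}"
 have "P.subr ?T"
  unfolding P.subr_def
 proof (intro conjI ballI)
  fix p q assume p: "p \<in> ?T" and q: "q \<in> ?T"
  show "p \<oplus>\<^sub>P q \<in> ?T" using p q R.ideal_add[OF ip] by simp
  show "\<ominus>\<^sub>P p \<in> ?T" using p R.ideal_uminus[OF ip] by simp
  have "cf (p \<otimes>\<^sub>P q) n \<in> R.ipow \<bb> n" for n
  proof (rule coeff_mult_mem)
   fix i assume "i \<le> n"
   then show "cf p i \<otimes> cf q (n - i) \<in> R.ipow \<bb> n"
    using R.ipow_mult_mem[OF \<bb>, of "cf p i" i "cf q (n-i)" "n-i"] p q by simp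
  qed (use p q ip in auto)
  then show "p \<otimes>\<^sub>P q \<in> ?T" using p q by simp
 qed (use R.ideal_zero[OF ip] in auto)
 moreover have "?C \<subseteq> ?T" using R.ideal_zero[OF ip] by auto
 moreover have "?F \<subseteq> ?T"
 proof -
  have "F \<subseteq> \<bb>" using F R.genideal_self by auto
  then have "cf (mon x 1) n \<in> R.ipow \<bb> n" if "x \<in> F" for x n
   using that subsetD[OF F(1) that] R.ideal_zero[OF ip] R.ipow_1[OF \<bb>] by auto
  then show ?thesis using F(1) by auto
 qed
 ultimately have ST: "S \<subseteq> ?T" by (rule S(4))
 have mS: "a \<in> R.ipow \<bb> n \<Longrightarrow> mon a n \<in> S" for a n
 proof (induct n arbitrary: a)
  case 0 then show ?case using S(2) by auto
 next
  case (Suc n)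
  have m1: "mon e 1 \<in> S" if "e \<in> \<bb>" for e
  proof -
   have "ideal {e\<in>carrier R. mon e 1 \<in> S} R"
   proof (rule R.idealI')
    show "\<zero> \<in> {e\<in>carrier R. mon e 1 \<in> S}" using sS by (simp add: P.subr_def)
    show "a \<oplus> b \<in> {e\<in>carrier R. mon e 1 \<in> S}"
     if "a \<in> {e\<in>carrier R. mon e 1 \<in> S}" "b \<in> {e\<in>carrier R. mon e 1 \<in> S}" for a b
     using that sS by (simp add: P.subr_def)
    show "r \<otimes> a \<in> {e\<in>carrier R. mon e 1 \<in> S}"
     if "a \<in> {e\<in>carrier R. mon e 1 \<in> S}" "r \<in> carrier R" for a r
    proof -
     have "mon r 0 \<otimes>\<^sub>P mon a 1 \<in> S" using that sS S(2) by (auto simp: P.subr_def)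
     then show ?thesis using that monom_mult[of r a 0 1] by simp
    qed
   qed auto
   moreover have "F \<subseteq> {e\<in>carrier R. mon e 1 \<in> S}" using S(3) F(1) by auto
   ultimately have "genideal R F \<subseteq> {e\<in>carrier R. mon e 1 \<in> S}" by (rule R.genideal_minimal)
   then show ?thesis using that F(3) by auto
  qed
  have "a \<in> R.ipow \<bb> n \<cdot> \<bb>" using Suc(2) by (simp add: R.ipow_Suc)
  then show ?case
  proof (induct rule: ideal_prod.induct)
   case (prod i j)
   have c: "i \<in> carrier R" "j \<in> carrier R" using prod R.ideal_carr[OF ip] R.ideal_carr[OF \<bb>] by auto
   have "mon i n \<otimes>\<^sub>P mon j 1 \<in> S" using sS Suc(1)[OF prod(1)] m1[OF prod(2)] by (simp add: P.subr_def)
   then show ?case using monom_mult[OF c, of n 1] by simp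
  next
   case (sum s t)
   have "s \<in> carrier R" "t \<in> carrier R" using sum R.ideal_prod_in_carrier[OF ip \<bb>] by auto
   then show ?case using sum sS by (simp add: P.subr_def)
  qed
 qed
 define LL where "LL = {p\<in>carrier P. \<forall>n. cf p n \<in> L n}"
 have LLS: "LL \<subseteq> S"
 proof
  fix p assume p: "p \<in> LL"
  show "p \<in> S"
  proof (rule subr_contains_all_monoms[OF sS mS])
   show "cf p n \<in> R.ipow \<bb> n" for n using subsetD[OF L(2)] p by (simp add: LL_def)
   show "p \<in> carrier P" using p by (simp add: LL_def)
  qed
 qed
 have bL: "R.ipow \<bb> i \<cdot> L j \<subseteq> L (i + j)" for i j
 proof (induct i)
  case 0 then show ?case using L(1) by (simp add: R.ideal_prod_one_left)
 next
  case (Suc i)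
  have "R.ipow \<bb> (Suc i) \<cdot> L j = \<bb> \<cdot> (R.ipow \<bb> i \<cdot> L j)"
   using R.ideal_prod_commute[OF ip \<bb>] R.ideal_prod_assoc[OF \<bb> ip L(1)] by (simp add: R.ipow_Suc)
  also have "\<dots> \<subseteq> \<bb> \<cdot> L (i + j)" by (rule R.ideal_prod_mono[OF order_refl Suc])
  finally show ?case using L(3) by auto
 qed
 have bLm: "a \<otimes> b \<in> L n" if "a \<in> R.ipow \<bb> (n - i)" "b \<in> L i" "i \<le> n" for a b n i
  using bL[of "n - i" i] ideal_prod.prod[OF that(1,2), of R] that(3) by auto
 have "P.submod S LL"
  unfolding P.submod_def
 proof (intro conjI ballI)
  show "LL \<subseteq> carrier P" by (auto simp: LL_def)
  show "\<zero>\<^sub>P \<in> LL" using R.ideal_zero[OF L(1)] by (simp add: LL_def)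
  show "a \<oplus>\<^sub>P b \<in> LL" if "a \<in> LL" "b \<in> LL" for a b using that R.ideal_add[OF L(1)] by (simp add: LL_def)
  fix h p assume h: "h \<in> S" and p: "p \<in> LL"
  have hc: "h \<in> carrier P" and pc: "p \<in> carrier P" using h p Sc by (auto simp: LL_def)
  have "cf (h \<otimes>\<^sub>P p) n \<in> L n" for n
  proof (rule coeff_mult_mem[OF hc pc L(1)])
   fix i assume "i \<le> n"
   then show "cf h i \<otimes> cf p (n - i) \<in> L n"
    using bLm[of "cf h i" n "n-i" "cf p (n-i)"] h p ST by (auto simp: LL_def)
  qed
  then show "h \<otimes>\<^sub>P p \<in> LL" using hc pc by (simp add: LL_def)
 qed
 then obtain G where G: "finite G" "G \<subseteq> LL" "\<And>J. P.submod S J \<Longrightarrow> G \<subseteq> J \<Longrightarrow> LL \<subseteq> J"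
  using S(1) LLS unfolding P.noeth_subr_def by meson
 obtain c where c: "\<And>p. p \<in> G \<Longrightarrow> deg R p \<le> c" using finite_nat_set_iff_bounded_le[of "deg R ` G"] G(1) by auto
 define M where "M n = R.ipow \<bb> (n - c) \<cdot> L c" for n
 have iM: "ideal (M n) R" for n unfolding M_def by (intro R.ideal_prod_is_ideal ip L)
 \<comment> \<open>The claim turned into a submodule: from index c on, coefficients come from L c.
   It contains the generators, since their coefficients beyond c vanish and the one at c lies in L c
   itself.\<close>
 define J where "J = {p\<in>LL. \<forall>n\<ge>c. cf p n \<in> M n}"
 have "P.submod S J"
  unfolding P.submod_def
 proof (intro conjI ballI)
  show "J \<subseteq> carrier P" by (auto simp: J_def LL_def)
  show "\<zero>\<^sub>P \<in> J" using R.ideal_zero[OF L(1)] R.ideal_zero[OF iM] by (simp add: LL_def J_def)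
  show "a \<oplus>\<^sub>P b \<in> J" if "a \<in> J" "b \<in> J" for a b
   using that R.ideal_add[OF L(1)] R.ideal_add[OF iM] by (simp add: LL_def J_def)
  fix h p assume h: "h \<in> S" and p: "p \<in> J"
  have hc: "h \<in> carrier P" and pc: "p \<in> carrier P" using h p Sc by (auto simp: LL_def J_def)
  have "h \<otimes>\<^sub>P p \<in> LL" using \<open>P.submod S LL\<close> h p by (auto simp: P.submod_def J_def)
  moreover have "cf (h \<otimes>\<^sub>P p) n \<in> M n" if n: "n \<ge> c" for n
  proof (rule coeff_mult_mem[OF hc pc iM])
   fix i assume i: "i \<le> n"
   have hi: "cf h i \<in> R.ipow \<bb> i" using h ST by auto
   show "cf h i \<otimes> cf p (n - i) \<in> M n"
   proof (cases "n - i \<ge> c")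
    case True
    then have "cf p (n - i) \<in> M (n - i)" using p by (auto simp: J_def)
    then have "cf h i \<otimes> cf p (n - i) \<in> R.ipow \<bb> i \<cdot> M (n - i)" using hi by (rule ideal_prod.prod[rotated])
    also have "R.ipow \<bb> i \<cdot> M (n - i) = R.ipow \<bb> (i + (n - i - c)) \<cdot> L c"
     unfolding M_def R.ipow_add[OF \<bb>] using R.ideal_prod_assoc[OF ip ip L(1)] by simp
    also have "i + (n - i - c) = n - c" using True i by simp
    finally show ?thesis by (simp add: M_def)
   next
    case False
    have eq: "i = (n - c) + (c - (n - i))" using False i n by simp
    have "cf h i \<in> R.ipow \<bb> (n - c) \<cdot> R.ipow \<bb> (c - (n - i))"
     using hi R.ipow_add[OF \<bb>, of "n - c" "c - (n - i)"] eq by simp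
    then have "cf h i \<otimes> cf p (n - i) \<in> (R.ipow \<bb> (n - c) \<cdot> R.ipow \<bb> (c - (n - i))) \<cdot> L (n - i)"
     by (rule ideal_prod.prod) (use p in \<open>auto simp: J_def LL_def\<close>)
    also have "\<dots> = R.ipow \<bb> (n - c) \<cdot> (R.ipow \<bb> (c - (n - i)) \<cdot> L (n - i))"
     by (rule R.ideal_prod_assoc[OF ip ip L(1)])
    also have "\<dots> \<subseteq> R.ipow \<bb> (n - c) \<cdot> L c"
     using bL[of "c - (n - i)" "n - i"] False by (intro R.ideal_prod_mono) auto
    finally show ?thesis by (simp add: M_def)
   qed
  qed
  ultimately show "h \<otimes>\<^sub>P p \<in> J" by (simp add: J_def)
 qed
 moreover have "G \<subseteq> J"
 proof
  fix p assume p: "p \<in> G"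
  then have pL: "p \<in> LL" using G by auto
  have "cf p n \<in> M n" if n: "n \<ge> c" for n
  proof (cases "n = c")
   case True
   then show ?thesis using pL L(1) by (auto simp: LL_def M_def R.ideal_prod_one_left)
  next
   case False
   then have "cf p n = \<zero>" using c[OF p] n pL by (intro deg_aboveD) (auto simp: LL_def)
   then show ?thesis using R.ideal_zero[OF iM] by simp
  qed
  then show "p \<in> J" using pL by (simp add: J_def)
 qed
 ultimately have LJ: "LL \<subseteq> J" by (rule G(3))
 have "L n \<subseteq> R.ipow \<bb> (n - c) \<cdot> L c" if n: "n \<ge> c" for n
 proof
  fix a assume a: "a \<in> L n"
  then have ac: "a \<in> carrier R" using L(1) R.ideal_carr by blast
  have "mon a n \<in> LL" using a ac R.ideal_zero[OF L(1)] by (simp add: LL_def)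
  then have "mon a n \<in> J" using LJ by auto
  then have "cf (mon a n) n \<in> M n" using n by (simp add: J_def)
  then show "a \<in> R.ipow \<bb> (n - c) \<cdot> L c" using ac by (simp add: M_def)
 qed
 then show ?thesis by blast
qed

end

context noetherian_cring
begin

lemma UP_cring_R: "UP_cring R"
 by (simp add: UP_cring_def cring_axioms)

lemma noetherian_cring_UP: "noetherian_cring (UP R)"
proof -
 interpret U: UP_cring R "UP R" by (rule UP_cring_R)
 show ?thesis using U.noetherian_UP noetherian_ring_axioms U.P.cring_axioms by (simp add: noetherian_cringI)
qed

lemma rees_filtration':
 assumes \<bb>: "ideal \<bb> R"
  and L: "\<And>n. ideal (L n) R" "\<And>n. L n \<subseteq> ipow \<bb> n" "\<And>n. \<bb> \<cdot> L n \<subseteq> L (Suc n)"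
 shows "\<exists>c. \<forall>n\<ge>c. L n \<subseteq> ipow \<bb> (n - c) \<cdot> L c"
proof -
 interpret U: UP_cring R "UP R" by (rule UP_cring_R)
 show ?thesis using U.rees_filtration[OF noetherian_ring_axioms \<bb>, of L] L by blast
qed

theorem artin_rees:
 assumes \<bb>: "ideal \<bb> R" and I: "ideal I R"
 shows "\<exists>c. \<forall>n\<ge>c. I \<inter> ipow \<bb> n \<subseteq> ipow \<bb> (n - c) \<cdot> I"
proof -
 note ip = ipow_ideal[OF \<bb>]
 have iI: "ideal (I \<inter> ipow \<bb> n) R" for n by (intro i_intersect I ip)
 have "\<exists>c. \<forall>n\<ge>c. I \<inter> ipow \<bb> n \<subseteq> ipow \<bb> (n - c) \<cdot> (I \<inter> ipow \<bb> c)"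
 proof (rule rees_filtration'[OF \<bb> iI])
  fix n
  show "\<bb> \<cdot> (I \<inter> ipow \<bb> n) \<subseteq> I \<inter> ipow \<bb> (Suc n)"
  proof (rule ideal_prod_subset[OF iI])
   fix i j assume "i \<in> \<bb>" "j \<in> I \<inter> ipow \<bb> n"
   then show "i \<otimes> j \<in> I \<inter> ipow \<bb> (Suc n)"
    using ipow_mult_mem[OF \<bb>, of i 1 j n] ipow_1[OF \<bb>] I ideal_carr[OF \<bb>] by (auto intro: ideal_mult_l)
  qed
 qed auto
 then obtain c where c: "\<And>n. n \<ge> c \<Longrightarrow> I \<inter> ipow \<bb> n \<subseteq> ipow \<bb> (n - c) \<cdot> (I \<inter> ipow \<bb> c)" by auto
 have "ipow \<bb> (n - c) \<cdot> (I \<inter> ipow \<bb> c) \<subseteq> ipow \<bb> (n - c) \<cdot> I" for n by (intro ideal_prod_mono) auto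
 then show ?thesis using c by blast
qed

end

section \<open>Completions of Noetherian local rings\<close>

locale noeth_local = noetherian_cring R for R (structure) + fixes \<mm>
 assumes maxideal: "maximalideal \<mm> R"
  and maxideal_unique: "maximalideal \<nn> R \<Longrightarrow> \<nn> = \<mm>"
begin

lemma mm_prime: "primeideal \<mm> R"
 using maximalideal_prime[OF maxideal] .

lemma mm_ideal: "ideal \<mm> R" by (rule prime_ideal[OF mm_prime])

lemma proper_ideal_sub_mm:
 assumes "ideal I R" "\<one> \<notin> I" shows "I \<subseteq> \<mm>"
proof -
 let ?C = "{J. ideal J R \<and> I \<subseteq> J \<and> \<one> \<notin> J}"
 obtain M where M: "M \<in> ?C" "\<And>Y. Y \<in> ?C \<Longrightarrow> M \<subseteq> Y \<Longrightarrow> Y = M"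
  by (rule ex_maximal_ideal_in[of ?C]) (use assms in auto)
 have "maximalideal M R"
 proof (rule maximalidealI)
  show "ideal M R" "carrier R \<noteq> M" using M(1) by auto
  fix J assume J: "ideal J R" "M \<subseteq> J" "J \<subseteq> carrier R"
  show "J = M \<or> J = carrier R"
  proof (cases "\<one> \<in> J")
   case True then show ?thesis using ideal.one_imp_carrier[OF J(1)] by simp
  next
   case False
   then have "J \<in> ?C" using J(1,2) M(1) by auto
   then show ?thesis using M(2) J(2) by simp
  qed
 qed
 then show ?thesis using maxideal_unique M(1) by auto
qed

lemma mm_unit:
 assumes "s \<in> carrier R" "s \<notin> \<mm>" shows "\<exists>b\<in>carrier R. b \<otimes> s = \<one>"
proof (rule ccontr)
 assume n: "\<not> ?thesis"
 have "\<one> \<notin> PIdl s" using n by (metis cgen_iff)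
 then have "PIdl s \<subseteq> \<mm>" using proper_ideal_sub_mm cgenideal_ideal assms(1) by blast
 then show False using assms cgenideal_self by blast
qed

text \<open>Elements outside \<mm> are units, so localizing at \<mm> changes nothing; this turns the
  results on \<open>psat\<close> into results on R itself.\<close>

lemma mm_psat: "ideal I R \<Longrightarrow> psat \<mm> I"
 unfolding psat_def
proof (intro ballI impI)
 fix z s assume I: "ideal I R" and z: "z \<in> carrier R" and s: "s \<in> carrier R - \<mm>" and sz: "s \<otimes> z \<in> I"
 obtain b where b: "b \<in> carrier R" "b \<otimes> s = \<one>" using mm_unit s by auto
 have "b \<otimes> (s \<otimes> z) \<in> I" by (rule ideal_mult_l[OF I sz b(1)])
 moreover have "b \<otimes> (s \<otimes> z) = z" using b s z by (simp add: m_assoc[symmetric])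
 ultimately show "z \<in> I" by simp
qed

lemma nakayama:
 assumes "ideal N R" "ideal N' R" "N \<subseteq> N' <+> \<mm> \<cdot> N"
 shows "N \<subseteq> N'"
proof -
 obtain A where A: "A \<subseteq> carrier R" "finite A" "N = Idl A" using finetely_gen[OF assms(1)] by auto
 have "\<exists>s'\<in>carrier R - \<mm>. \<forall>a\<in>Idl A. s' \<otimes> a \<in> N'"
 proof (rule nakayama_prime[OF mm_prime assms(2) A(2,1)])
  fix a assume "a \<in> A"
  then have "a \<in> N" using A(3) genideal_self[OF A(1)] by auto
  then have "\<one> \<otimes> a \<in> N' <+> \<mm> \<cdot> (Idl A)" using assms(3) A(3) ideal_carr[OF assms(1)] by auto
  then show "\<exists>s\<in>carrier R - \<mm>. s \<otimes> a \<in> N' <+> \<mm> \<cdot> (Idl A)"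
   using prime_one[OF mm_prime] by (intro bexI[of _ \<one>]) auto
 qed
 then obtain s where s: "s \<in> carrier R" "s \<notin> \<mm>" "\<And>a. a \<in> N \<Longrightarrow> s \<otimes> a \<in> N'" using A(3) by auto
 show ?thesis
 proof
  fix a assume "a \<in> N"
  then show "a \<in> N'" using psatD[OF mm_psat[OF assms(2)] ideal_carr[OF assms(1)] s(1,2) s(3)] by simp
 qed
qed

lemma krull_intersection:
 assumes "\<And>n. x \<in> ipow \<mm> n" shows "x = \<zero>"
proof -
 let ?I = "\<Inter>n. ipow \<mm> n"
 have I: "ideal ?I R" by (rule i_Intersect) (auto intro: ipow_ideal mm_ideal)
 obtain c where c: "\<And>n. n \<ge> c \<Longrightarrow> ?I \<inter> ipow \<mm> n \<subseteq> ipow \<mm> (n - c) \<cdot> ?I" using artin_rees[OF mm_ideal I] by auto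
 have "?I \<subseteq> \<mm> \<cdot> ?I" using c[of "Suc c"] ipow_1[OF mm_ideal] by auto
 then have "?I \<subseteq> {\<zero>} <+> \<mm> \<cdot> ?I"
  using set_add_upper2[OF zeroideal ideal_prod_is_ideal[OF mm_ideal I]] by blast
 then have "?I \<subseteq> {\<zero>}" by (rule nakayama[OF I zeroideal])
 then show ?thesis using assms by auto
qed

text \<open>Up to the shift L, the j-th power of I lies in \<mm>^(Gj): the elements of I have
  asymptotic order at least G. Ideals integral over \<mm>^G have this property, and being a
  condition on powers modulo powers of \<mm> it survives limits in the completion.\<close>

definition asym_int :: "nat \<Rightarrow> 'a set \<Rightarrow> bool"
 where "asym_int G I \<longleftrightarrow> ideal I R \<and> (\<exists>L. \<forall>j. ipow I (L + j) \<subseteq> ipow \<mm> (G * j))"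

text \<open>The shifts add up. Closure under sums yields, by the Noetherian property, a greatest
  such ideal for each G, which plays the part of the integral closure of \<mm>^G.\<close>

lemma asym_int_add:
 assumes "asym_int G I" "asym_int G J" shows "asym_int G (I <+> J)"
proof -
 obtain L L' where I: "ideal I R" "\<And>j. ipow I (L + j) \<subseteq> ipow \<mm> (G * j)"
  and J: "ideal J R" "\<And>j. ipow J (L' + j) \<subseteq> ipow \<mm> (G * j)" using assms by (auto simp: asym_int_def)
 note im = ipow_ideal[OF mm_ideal]
 have I': "ipow I i \<subseteq> ipow \<mm> (G * (i - L))" for i
  using I(2)[of "i - L"] im[of 0] ideal_subset_carr[OF ipow_ideal[OF I(1)], of i] by (cases "L \<le> i") auto
 have J': "ipow J i \<subseteq> ipow \<mm> (G * (i - L'))" for i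
  using J(2)[of "i - L'"] im[of 0] ideal_subset_carr[OF ipow_ideal[OF J(1)], of i] by (cases "L' \<le> i") auto
 have "ipow (I <+> J) ((L + L') + j) \<subseteq> ipow \<mm> (G * j)" for j
 proof -
  have "ipow (I <+> J) ((L + L') + j) \<cdot> carrier R \<subseteq> ipow \<mm> (G * j)"
  proof (rule ipow_set_add_subset[OF I(1) J(1) im oneideal])
   fix a b assume ab: "a + b = L + L' + j"
   have "ipow I a \<cdot> (ipow J b \<cdot> carrier R) = ipow I a \<cdot> ipow J b" using ideal_prod_one[OF ipow_ideal[OF J(1)]] by simp
   also have "\<dots> \<subseteq> ipow \<mm> (G * (a - L)) \<cdot> ipow \<mm> (G * (b - L'))" by (intro ideal_prod_mono I' J')
   also have "\<dots> = ipow \<mm> (G * ((a - L) + (b - L')))" by (simp add: ipow_add[OF mm_ideal, symmetric] algebra_simps)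
   also have "\<dots> \<subseteq> ipow \<mm> (G * j)" using ab by (intro ipow_decr mm_ideal) auto
   finally show "ipow I a \<cdot> (ipow J b \<cdot> carrier R) \<subseteq> ipow \<mm> (G * j)" .
  qed
  then show ?thesis using ideal_prod_one[OF ipow_ideal[OF add_ideals[OF I(1) J(1)]]] by simp
 qed
 then show ?thesis using I(1) J(1) by (auto simp: asym_int_def intro: add_ideals)
qed

lemma asym_int_Suc: "asym_int (Suc G) I \<Longrightarrow> asym_int G I"
 unfolding asym_int_def
proof (elim conjE exE, intro conjI exI allI)
 fix L j assume "ideal I R" "\<forall>j. ipow I (L + j) \<subseteq> ipow \<mm> (Suc G * j)"
 moreover have "ipow \<mm> (Suc G * j) \<subseteq> ipow \<mm> (G * j)" by (intro ipow_decr mm_ideal) simp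
 ultimately show "ipow I (L + j) \<subseteq> ipow \<mm> (G * j)" by blast
qed

lemma ex_greatest_asym_int: "\<exists>C. asym_int G C \<and> (\<forall>I. asym_int G I \<longrightarrow> I \<subseteq> C)"
proof -
 have "asym_int G {\<zero>}"
 proof -
  have "ipow {\<zero>} (1 + j) \<subseteq> ipow \<mm> (G * j)" for j
   using ideal_zero[OF ipow_ideal[OF mm_ideal]] ideal_prod_zero[OF ipow_ideal[OF zeroideal]] by (simp add: ipow_Suc)
  then show ?thesis unfolding asym_int_def using zeroideal by blast
 qed
 then have "{I. asym_int G I} \<noteq> {}" by auto
 moreover have "{I. asym_int G I} \<subseteq> {I. ideal I R}" by (auto simp: asym_int_def)
 ultimately obtain C where C: "C \<in> {I. asym_int G I}" "\<And>I. I \<in> {I. asym_int G I} \<Longrightarrow> C \<subseteq> I \<Longrightarrow> I = C"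
  using ex_maximal_ideal_in by metis
 have "I \<subseteq> C" if "asym_int G I" for I
 proof -
  have i: "ideal I R" "ideal C R" using that C(1) by (auto simp: asym_int_def)
  have "C <+> I = C" using C asym_int_add[OF _ that] set_add_upper1[OF i(2,1)] by auto
  then show ?thesis using set_add_upper2[OF i(2,1)] by simp
 qed
 then show ?thesis using C(1) by auto
qed

end

text \<open>The \<mm>-adic completion described by a filtration H instead of the inverse limit: H n
  contracts to \<mm>^n (\<open>H_iota\<close>), R is dense (\<open>H_approx\<close>), and A is
  separated (\<open>H_sep\<close>) and complete (\<open>H_complete\<close>). That H n lies in the
  n-th power of H 1 is not assumed but derived in \<open>H_ipow\<close>.\<close>

locale adic = noeth_local R \<mm> + A: cring A
 for R (structure) and \<mm> and A :: "('c, 'd) ring_scheme" +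
 fixes \<iota> :: "'a \<Rightarrow> 'c" and H :: "nat \<Rightarrow> 'c set"
 assumes iota: "\<iota> \<in> ring_hom R A"
  and H_ideal: "ideal (H n) A"
  and H_0: "H 0 = carrier A"
  and H_Suc: "H (Suc n) \<subseteq> H n"
  and H_mult: "x \<in> H i \<Longrightarrow> y \<in> H j \<Longrightarrow> x \<otimes>\<^bsub>A\<^esub> y \<in> H (i + j)"
  and H_iota: "a \<in> carrier R \<Longrightarrow> \<iota> a \<in> H n \<longleftrightarrow> a \<in> ipow \<mm> n"
  and H_approx: "x \<in> carrier A \<Longrightarrow> \<exists>a\<in>carrier R. x \<ominus>\<^bsub>A\<^esub> \<iota> a \<in> H n"
  and H_sep: "(\<And>n. x \<in> H n) \<Longrightarrow> x = \<zero>\<^bsub>A\<^esub>"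
  and H_complete: "(\<And>n. f n \<in> carrier A) \<Longrightarrow> (\<And>n. f (Suc n) \<ominus>\<^bsub>A\<^esub> f n \<in> H n) \<Longrightarrow>
   \<exists>s\<in>carrier A. \<forall>n. s \<ominus>\<^bsub>A\<^esub> f n \<in> H n"
begin

abbreviation (input) mult_A (infixl \<open>\<otimes>\<^sub>A\<close> 70) where "x \<otimes>\<^sub>A y \<equiv> x \<otimes>\<^bsub>A\<^esub> y"
abbreviation (input) add_A (infixl \<open>\<oplus>\<^sub>A\<close> 65) where "x \<oplus>\<^sub>A y \<equiv> x \<oplus>\<^bsub>A\<^esub> y"
abbreviation (input) minus_A (infixl \<open>\<ominus>\<^sub>A\<close> 65) where "x \<ominus>\<^sub>A y \<equiv> x \<ominus>\<^bsub>A\<^esub> y"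
abbreviation (input) uminus_A (\<open>\<ominus>\<^sub>A _\<close> [81] 80) where "\<ominus>\<^sub>A x \<equiv> \<ominus>\<^bsub>A\<^esub> x"
abbreviation (input) zero_A (\<open>\<zero>\<^sub>A\<close>) where "\<zero>\<^sub>A \<equiv> \<zero>\<^bsub>A\<^esub>"
abbreviation (input) one_A (\<open>\<one>\<^sub>A\<close>) where "\<one>\<^sub>A \<equiv> \<one>\<^bsub>A\<^esub>"
abbreviation (input) set_add_A (infixl \<open><+>\<^sub>A\<close> 60) where "I <+>\<^sub>A J \<equiv> I <+>\<^bsub>A\<^esub> J"
abbreviation (input) cgenideal_A (\<open>PIdl\<^sub>A _\<close> [80] 79) where "PIdl\<^sub>A a \<equiv> PIdl\<^bsub>A\<^esub> a"
abbreviation (input) pow_A (infixr \<open>[^]\<^sub>A\<close> 75) where "x [^]\<^sub>A n \<equiv> x [^]\<^bsub>A\<^esub> (n::nat)"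
abbreviation (input) ideal_prod_A (infixl \<open>\<cdot>\<^sub>A\<close> 80) where "I \<cdot>\<^sub>A J \<equiv> I \<cdot>\<^bsub>A\<^esub> J"

lemma iota_simps [simp]:
 "a \<in> carrier R \<Longrightarrow> \<iota> a \<in> carrier A"
 "a \<in> carrier R \<Longrightarrow> b \<in> carrier R \<Longrightarrow> \<iota> (a \<oplus> b) = \<iota> a \<oplus>\<^sub>A \<iota> b"
 "a \<in> carrier R \<Longrightarrow> b \<in> carrier R \<Longrightarrow> \<iota> (a \<otimes> b) = \<iota> a \<otimes>\<^sub>A \<iota> b"
 "\<iota> \<one> = \<one>\<^sub>A"
 using iota by (auto simp: ring_hom_def)

lemma iota_zero [simp]: "\<iota> \<zero> = \<zero>\<^sub>A"
 using ring_hom_zero[OF iota ring_axioms A.ring_axioms] .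

lemma H_decr: "m \<le> n \<Longrightarrow> H n \<subseteq> H m"
 using lift_Suc_antimono_le[of H m n] H_Suc by blast

lemma H_carr: "x \<in> H n \<Longrightarrow> x \<in> carrier A"
 using A.ideal_carr[OF H_ideal] .

fun psum :: "(nat \<Rightarrow> 'c) \<Rightarrow> nat \<Rightarrow> 'c"
 where "psum z 0 = \<zero>\<^sub>A" | "psum z (Suc n) = psum z n \<oplus>\<^sub>A z n"

lemma psum_carr: "(\<And>i. z i \<in> carrier A) \<Longrightarrow> psum z n \<in> carrier A"
 by (induct n) auto

lemma psum_add: "(\<And>i. z i \<in> carrier A) \<Longrightarrow> (\<And>i. w i \<in> carrier A) \<Longrightarrow>
  psum (\<lambda>i. z i \<oplus>\<^sub>A w i) n = psum z n \<oplus>\<^sub>A psum w n"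
proof (induct n)
 case (Suc n)
 then show ?case using psum_carr[of z n] psum_carr[of w n] by (simp add: A.a_ac)
qed simp

lemma psum_smult: "(\<And>i. z i \<in> carrier A) \<Longrightarrow> g \<in> carrier A \<Longrightarrow>
  psum (\<lambda>i. z i \<otimes>\<^sub>A g) n = psum z n \<otimes>\<^sub>A g"
 by (induct n) (auto simp: psum_carr A.l_distr)

text \<open>For each generator the coefficients of the terms form a convergent series of their own,
  so the sum of the series is again a combination of the generators. The induction splits off one
  generator.\<close>

lemma limit_in_Idl:
 "finite F \<Longrightarrow> F \<subseteq> carrier A \<Longrightarrow> (\<And>n. z n \<in> H n \<cdot>\<^sub>A genideal A F) \<Longrightarrow>
  \<exists>w\<in>genideal A F. \<forall>n. w \<ominus>\<^sub>A psum z n \<in> H n"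
proof (induct F arbitrary: z rule: finite_induct)
 case empty
 have "z n = \<zero>\<^sub>A" for n using empty(2)[of n] A.ideal_prod_zero[OF H_ideal] by (simp add: A.Idl_empty)
 then have "psum z n = \<zero>\<^sub>A" for n by (induct n) auto
 then show ?case using A.ideal_zero[OF H_ideal] by (auto simp: A.Idl_empty A.minus_eq)
next
 case (insert g F)
 have g: "g \<in> carrier A" and F: "F \<subseteq> carrier A" using insert by auto
 note iF = A.genideal_ideal[OF F]
 have "\<exists>z' e. z' \<in> H n \<cdot>\<^sub>A genideal A F \<and> e \<in> H n \<and> z n = z' \<oplus>\<^sub>A e \<otimes>\<^sub>A g" for n
 proof -
  have "z n \<in> H n \<cdot>\<^sub>A genideal A F <+>\<^sub>A H n \<cdot>\<^sub>A (PIdl\<^sub>A g)"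
   using insert(5)[of n] A.Idl_insert[OF g F] A.ideal_prod_r_distr[OF H_ideal iF A.cgenideal_ideal[OF g]] by simp
  then obtain x y where xy: "x \<in> H n \<cdot>\<^sub>A genideal A F" "y \<in> H n \<cdot>\<^sub>A (PIdl\<^sub>A g)" "z n = x \<oplus>\<^sub>A y"
   unfolding A.mem_set_add by blast
  have "y \<in> (PIdl\<^sub>A g) \<cdot>\<^sub>A H n" using xy(2) A.ideal_prod_commute[OF H_ideal A.cgenideal_ideal[OF g]] by simp
  then obtain e where e: "e \<in> H n" "y = g \<otimes>\<^sub>A e" using A.PIdl_prod[OF g H_ideal] by blast
  then show ?thesis using xy A.m_comm[OF g H_carr[OF e(1)]] by metis
 qed
 then obtain z' e where ze: "\<And>n. z' n \<in> H n \<cdot>\<^sub>A genideal A F" "\<And>n. e n \<in> H n" "\<And>n. z n = z' n \<oplus>\<^sub>A e n \<otimes>\<^sub>A g"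
  by metis
 obtain w where w: "w \<in> genideal A F" "\<And>n. w \<ominus>\<^sub>A psum z' n \<in> H n" using insert(3)[OF F ze(1)] by auto
 have ec: "e n \<in> carrier A" for n using ze(2) H_carr by blast
 have z'c: "z' n \<in> carrier A" for n using ze(1) A.ideal_prod_in_carrier[OF H_ideal iF] by blast
 note pc = psum_carr[of e, OF ec] psum_carr[of z', OF z'c]
 have "\<exists>s\<in>carrier A. \<forall>n. s \<ominus>\<^sub>A psum e n \<in> H n"
 proof (rule H_complete[OF pc(1)])
  fix n
  have "psum e (Suc n) \<ominus>\<^sub>A psum e n = e n" unfolding psum.simps using pc(1)[of n] ec[of n] by algebra
  then show "psum e (Suc n) \<ominus>\<^sub>A psum e n \<in> H n" using ze(2) by simp
 qed
 then obtain s where s: "s \<in> carrier A" "\<And>n. s \<ominus>\<^sub>A psum e n \<in> H n" by auto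
 have wc: "w \<in> carrier A" using w iF A.ideal_carr by blast
 have "(w \<oplus>\<^sub>A s \<otimes>\<^sub>A g) \<ominus>\<^sub>A psum z n \<in> H n" for n
 proof -
  have "psum z n = psum z' n \<oplus>\<^sub>A psum (\<lambda>i. e i \<otimes>\<^sub>A g) n"
  proof -
   have "z = (\<lambda>i. z' i \<oplus>\<^sub>A e i \<otimes>\<^sub>A g)" using ze(3) by auto
   then show ?thesis using psum_add[of z' "\<lambda>i. e i \<otimes>\<^sub>A g" n] z'c ec g by simp
  qed
  also have "psum (\<lambda>i. e i \<otimes>\<^sub>A g) n = psum e n \<otimes>\<^sub>A g" by (rule psum_smult[OF ec g])
  finally have "(w \<oplus>\<^sub>A s \<otimes>\<^sub>A g) \<ominus>\<^sub>A psum z n = (w \<ominus>\<^sub>A psum z' n) \<oplus>\<^sub>A (s \<ominus>\<^sub>A psum e n) \<otimes>\<^sub>A g"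
   using wc s(1) g pc[of n] by (simp only:) algebra
  also have "\<dots> \<in> H n" by (intro A.ideal_add[OF H_ideal] A.ideal_mult_r[OF H_ideal] w s g)
  finally show ?thesis .
 qed
 moreover have "w \<oplus>\<^sub>A s \<otimes>\<^sub>A g \<in> genideal A (insert g F)"
  using A.Idl_insert[OF g F] w(1) s(1) by (auto simp: A.mem_add_cgen)
 ultimately show ?case by blast
qed

text \<open>Successive approximation: each step subtracts an element of H (n-c) times (F) and moves
  the remainder one level deeper. The subtracted elements form a series as in
  \<open>limit_in_Idl\<close>, and its sum is x because A is separated.\<close>

lemma approx_Idl:
 assumes F: "finite F" "F \<subseteq> carrier A" and I: "ideal I A" and FI: "F \<subseteq> I"
  and step: "\<And>n x. n \<ge> c \<Longrightarrow> x \<in> I \<Longrightarrow> x \<in> H n \<Longrightarrow> \<exists>z\<in>H (n - c) \<cdot>\<^sub>A genideal A F. x \<ominus>\<^sub>A z \<in> H (Suc n)"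
 shows "I \<inter> H c \<subseteq> genideal A F"
proof
 fix x assume x: "x \<in> I \<inter> H c"
 note iF = A.genideal_ideal[OF F(2)]
 have FI': "genideal A F \<subseteq> I" by (rule A.genideal_minimal[OF I FI])
 have zI: "z \<in> I" if "z \<in> H n \<cdot>\<^sub>A genideal A F" for z n
  using that A.ideal_prod_le2[OF H_ideal iF] FI' by blast
 have "\<forall>n y. \<exists>z. y \<in> I \<longrightarrow> y \<in> H (c + n) \<longrightarrow> z \<in> H n \<cdot>\<^sub>A genideal A F \<and> y \<ominus>\<^sub>A z \<in> H (Suc (c + n))"
  using step[of "c + _"] by fastforce
 then obtain Z where Z: "\<And>n y. y \<in> I \<Longrightarrow> y \<in> H (c + n) \<Longrightarrow> Z n y \<in> H n \<cdot>\<^sub>A genideal A F \<and> y \<ominus>\<^sub>A Z n y \<in> H (Suc (c + n))"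
  by metis
 define y where "y = rec_nat x (\<lambda>n v. v \<ominus>\<^sub>A Z n v)"
 have y0: "y 0 = x" and yS: "y (Suc n) = y n \<ominus>\<^sub>A Z n (y n)" for n by (simp_all add: y_def)
 have y: "y n \<in> I \<and> y n \<in> H (c + n)" for n
 proof (induct n)
  case 0 then show ?case using x y0 by simp
 next
  case (Suc n)
  then show ?case using Z[of "y n" n] zI A.ideal_minus[OF I] yS by auto
 qed
 define z where "z n = Z n (y n)" for n
 have z: "z n \<in> H n \<cdot>\<^sub>A genideal A F" for n using Z y by (simp add: z_def)
 have zc: "z n \<in> carrier A" for n using zI[OF z] A.ideal_carr[OF I] by blast
 have xc: "x \<in> carrier A" using x H_carr by blast
 have py: "x \<ominus>\<^sub>A psum z n = y n" for n
 proof (induct n)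
  case 0 then show ?case using y0 xc by (simp add: A.minus_eq)
 next
  case (Suc n)
  have "x \<ominus>\<^sub>A psum z (Suc n) = (x \<ominus>\<^sub>A psum z n) \<ominus>\<^sub>A z n"
   unfolding psum.simps using xc zc[of n] psum_carr[of z n, OF zc] by algebra
  then show ?case unfolding Suc yS using z_def[of n] by metis
 qed
 obtain w where w: "w \<in> genideal A F" "\<And>n. w \<ominus>\<^sub>A psum z n \<in> H n" using limit_in_Idl[OF F z] by auto
 have wc: "w \<in> carrier A" using w iF A.ideal_carr by blast
 have "x \<ominus>\<^sub>A w \<in> H n" for n
 proof -
  have "x \<ominus>\<^sub>A w = (x \<ominus>\<^sub>A psum z n) \<ominus>\<^sub>A (w \<ominus>\<^sub>A psum z n)"
   using xc wc psum_carr[of z n, OF zc] by algebra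
  moreover have "x \<ominus>\<^sub>A psum z n \<in> H n" using py y H_decr[of n "c + n"] by auto
  ultimately show ?thesis using A.ideal_minus[OF H_ideal _ w(2)] by simp
 qed
 then have "x \<ominus>\<^sub>A w = \<zero>\<^sub>A" by (rule H_sep)
 then have "x = w" using xc wc by simp
 then show "x \<in> genideal A F" using w by simp
qed

text \<open>The initial forms of I in degree n make up an ideal of R, and these ideals form a
  filtration as in \<open>rees_filtration\<close>. Lifts to I of their generators for n \<le> c
  generate I.\<close>

theorem noetherian_A: "noetherian_ring A"
proof (rule A.noetherian_ringI)
 fix I assume I: "ideal I A"
 note im = ipow_ideal[OF mm_ideal]
 have im1: "\<iota> p \<in> H 1" if "p \<in> \<mm>" for p
  using H_iota[of p 1] that ideal_carr[OF mm_ideal that] ipow_1[OF mm_ideal] by simp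
 \<comment> \<open>Initial forms are represented in R rather than in the associated graded ring: a
   is in K I n if \<iota> a agrees modulo H (n+1) with some element of I \<inter> H n. In particular
   K I n contains \<mm>^(n+1).\<close>
 define K where "K I n = {a\<in>carrier R. \<exists>x\<in>I \<inter> H n. x \<ominus>\<^sub>A \<iota> a \<in> H (Suc n)}" for I n
 have Kid: "ideal (K I n) R" if I: "ideal I A" for I n
 proof (rule idealI')
  show "K I n \<subseteq> carrier R" by (auto simp: K_def)
  show "\<zero> \<in> K I n" using A.ideal_zero[OF I] A.ideal_zero[OF H_ideal]
   by (auto simp: K_def A.minus_eq intro!: bexI[of _ "\<zero>\<^sub>A"])
  fix a b assume "a \<in> K I n" "b \<in> K I n"
  then obtain x y where xy: "a \<in> carrier R" "b \<in> carrier R" "x \<in> I" "x \<in> H n" "x \<ominus>\<^sub>A \<iota> a \<in> H (Suc n)"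
   "y \<in> I" "y \<in> H n" "y \<ominus>\<^sub>A \<iota> b \<in> H (Suc n)" by (auto simp: K_def)
  have c: "x \<in> carrier A" "y \<in> carrier A" using xy H_carr by auto
  have "(x \<oplus>\<^sub>A y) \<ominus>\<^sub>A \<iota> (a \<oplus> b) = (x \<ominus>\<^sub>A \<iota> a) \<oplus>\<^sub>A (y \<ominus>\<^sub>A \<iota> b)"
   using c iota_simps(1)[OF xy(1)] iota_simps(1)[OF xy(2)] unfolding iota_simps(2)[OF xy(1,2)] by algebra
  then have "(x \<oplus>\<^sub>A y) \<ominus>\<^sub>A \<iota> (a \<oplus> b) \<in> H (Suc n)" using A.ideal_add[OF H_ideal xy(5,8)] by simp
  then show "a \<oplus> b \<in> K I n"
   using xy A.ideal_add[OF I xy(3,6)] A.ideal_add[OF H_ideal xy(4,7)] by (auto simp: K_def)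
 next
  fix a r assume "a \<in> K I n" and r: "r \<in> carrier R"
  then obtain x where x: "a \<in> carrier R" "x \<in> I" "x \<in> H n" "x \<ominus>\<^sub>A \<iota> a \<in> H (Suc n)" by (auto simp: K_def)
  have c: "x \<in> carrier A" using x H_carr by auto
  have "(\<iota> r \<otimes>\<^sub>A x) \<ominus>\<^sub>A \<iota> (r \<otimes> a) = \<iota> r \<otimes>\<^sub>A (x \<ominus>\<^sub>A \<iota> a)"
   using c iota_simps(1)[OF x(1)] iota_simps(1)[OF r] unfolding iota_simps(3)[OF r x(1)] by algebra
  then have "(\<iota> r \<otimes>\<^sub>A x) \<ominus>\<^sub>A \<iota> (r \<otimes> a) \<in> H (Suc n)" using A.ideal_mult_l[OF H_ideal x(4)] r by simp
  then show "r \<otimes> a \<in> K I n"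
   using x r A.ideal_mult_l[OF I x(2)] A.ideal_mult_l[OF H_ideal x(3)] by (auto simp: K_def)
 qed
 have Km: "K I n \<subseteq> ipow \<mm> n" for n
 proof
  fix a assume "a \<in> K I n"
  then obtain x where x: "a \<in> carrier R" "x \<in> H n" "x \<ominus>\<^sub>A \<iota> a \<in> H (Suc n)" by (auto simp: K_def)
  have "\<iota> a = x \<ominus>\<^sub>A (x \<ominus>\<^sub>A \<iota> a)" using H_carr[OF x(2)] iota_simps(1)[OF x(1)] by algebra
  also have "\<dots> \<in> H n" using A.ideal_minus[OF H_ideal x(2)] x(3) H_Suc[of n] by auto
  finally show "a \<in> ipow \<mm> n" using H_iota x(1) by simp
 qed
 have mK: "\<mm> \<cdot> K I n \<subseteq> K I (Suc n)" for n
 proof (rule ideal_prod_subset[OF Kid[OF I]])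
  fix p a assume p: "p \<in> \<mm>" and "a \<in> K I n"
  then obtain x where x: "a \<in> carrier R" "x \<in> I" "x \<in> H n" "x \<ominus>\<^sub>A \<iota> a \<in> H (Suc n)" by (auto simp: K_def)
  have pc: "p \<in> carrier R" using p ideal_carr[OF mm_ideal] by auto
  have c: "x \<in> carrier A" using x H_carr by auto
  have "(\<iota> p \<otimes>\<^sub>A x) \<ominus>\<^sub>A \<iota> (p \<otimes> a) = \<iota> p \<otimes>\<^sub>A (x \<ominus>\<^sub>A \<iota> a)"
   using c iota_simps(1)[OF x(1)] iota_simps(1)[OF pc] unfolding iota_simps(3)[OF pc x(1)] by algebra
  then have "(\<iota> p \<otimes>\<^sub>A x) \<ominus>\<^sub>A \<iota> (p \<otimes> a) \<in> H (Suc (Suc n))" using H_mult[OF im1[OF p] x(4)] by simp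
  then show "p \<otimes> a \<in> K I (Suc n)"
   using x pc A.ideal_mult_l[OF I x(2)] H_mult[OF im1[OF p] x(3)] by (auto simp: K_def)
 qed
 obtain c where c: "\<And>n. n \<ge> c \<Longrightarrow> K I n \<subseteq> ipow \<mm> (n - c) \<cdot> K I c"
  using rees_filtration'[of \<mm> "K I", OF mm_ideal Kid[OF I] Km mK] by auto
 have "\<forall>n. \<exists>F. F \<subseteq> carrier R \<and> finite F \<and> K I n = Idl F" using finetely_gen[OF Kid[OF I]] by blast
 then obtain F where F: "\<And>n. F n \<subseteq> carrier R" "\<And>n. finite (F n)" "\<And>n. K I n = Idl (F n)" by metis
 have "F n \<subseteq> K I n" for n using genideal_self[OF F(1)] F(3) by simp
 then have "\<forall>n. \<forall>a\<in>F n. \<exists>x\<in>I \<inter> H n. x \<ominus>\<^sub>A \<iota> a \<in> H (Suc n)" unfolding K_def by blast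
 then obtain e where e: "\<And>n a. a \<in> F n \<Longrightarrow> e n a \<in> I \<inter> H n \<and> e n a \<ominus>\<^sub>A \<iota> a \<in> H (Suc n)" by metis
 define G where "G = (\<Union>n\<in>{..c}. e n ` F n)"
 have GI: "G \<subseteq> I" using e by (auto simp: G_def)
 have Gf: "finite G" using F(2) by (simp add: G_def)
 have Gc: "G \<subseteq> carrier A" using GI A.ideal_subset_carr[OF I] by auto
 note iG = A.genideal_ideal[OF Gc]
 have GI': "genideal A G \<subseteq> I" by (rule A.genideal_minimal[OF I GI])
 have lift: "K I n \<subseteq> K (genideal A G) n" if n: "n \<le> c" for n
 proof -
  have "F n \<subseteq> K (genideal A G) n"
  proof
   fix a assume a: "a \<in> F n"
   then have "e n a \<in> G" using n by (auto simp: G_def)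
   then have "e n a \<in> genideal A G" using A.genideal_self[OF Gc] by auto
   then show "a \<in> K (genideal A G) n" using e[OF a] F(1) a by (auto simp: K_def)
  qed
  then show ?thesis unfolding F(3) by (rule genideal_minimal[OF Kid[OF iG]])
 qed
 have lead: "\<exists>a\<in>K I n. x \<ominus>\<^sub>A \<iota> a \<in> H (Suc n)" if "x \<in> I" "x \<in> H n" for x n
  using H_approx[OF H_carr[OF that(2)], of "Suc n"] that by (auto simp: K_def)
 have sub: "x \<ominus>\<^sub>A z \<in> H n" if "x \<ominus>\<^sub>A \<iota> a \<in> H n" "z \<ominus>\<^sub>A \<iota> a \<in> H n" "x \<in> carrier A" "z \<in> carrier A" "a \<in> carrier R" for x z a n
 proof -
  have "x \<ominus>\<^sub>A z = (x \<ominus>\<^sub>A \<iota> a) \<ominus>\<^sub>A (z \<ominus>\<^sub>A \<iota> a)" using that(3,4) iota_simps(1)[OF that(5)] by algebra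
  then show ?thesis using A.ideal_minus[OF H_ideal that(1,2)] by simp
 qed
 have top: "I \<inter> H c \<subseteq> genideal A G"
 proof (rule approx_Idl[OF Gf Gc I GI])
  fix n x assume n: "n \<ge> c" and x: "x \<in> I" "x \<in> H n"
  obtain a where a: "a \<in> K I n" "x \<ominus>\<^sub>A \<iota> a \<in> H (Suc n)" using lead[OF x] by auto
  have iHG: "ideal (H (n - c) \<cdot>\<^sub>A genideal A G) A" by (rule A.ideal_prod_is_ideal[OF H_ideal iG])
  have "a \<in> ipow \<mm> (n - c) \<cdot> K I c" using c[OF n] a(1) by auto
  then have "a \<in> carrier R \<and> (\<exists>z\<in>H (n - c) \<cdot>\<^sub>A genideal A G. z \<ominus>\<^sub>A \<iota> a \<in> H (Suc n))"
  proof (induct rule: ideal_prod.induct)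
   case (prod p l)
   have pc: "p \<in> carrier R" using prod(1) ideal_carr[OF im] by auto
   obtain y where y: "l \<in> carrier R" "y \<in> genideal A G" "y \<in> H c" "y \<ominus>\<^sub>A \<iota> l \<in> H (Suc c)"
    using lift[of c] prod(2) by (auto simp: K_def)
   have ip: "\<iota> p \<in> H (n - c)" using H_iota pc prod(1) by simp
   have "\<iota> p \<otimes>\<^sub>A y \<ominus>\<^sub>A \<iota> (p \<otimes> l) = \<iota> p \<otimes>\<^sub>A (y \<ominus>\<^sub>A \<iota> l)"
    using H_carr[OF y(3)] iota_simps(1)[OF pc] iota_simps(1)[OF y(1)] unfolding iota_simps(3)[OF pc y(1)] by algebra
   moreover have "\<iota> p \<otimes>\<^sub>A (y \<ominus>\<^sub>A \<iota> l) \<in> H (Suc n)" using H_mult[OF ip y(4)] n by simp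
   ultimately have "\<iota> p \<otimes>\<^sub>A y \<ominus>\<^sub>A \<iota> (p \<otimes> l) \<in> H (Suc n)" by simp
   moreover have "\<iota> p \<otimes>\<^sub>A y \<in> H (n - c) \<cdot>\<^sub>A genideal A G" using ip y(2) by (rule ideal_prod.prod)
   ultimately show ?case using pc y(1) by blast
  next
   case (sum s t)
   then obtain z w where zw: "s \<in> carrier R" "t \<in> carrier R" "z \<in> H (n - c) \<cdot>\<^sub>A genideal A G" "z \<ominus>\<^sub>A \<iota> s \<in> H (Suc n)"
    "w \<in> H (n - c) \<cdot>\<^sub>A genideal A G" "w \<ominus>\<^sub>A \<iota> t \<in> H (Suc n)" by auto
   have "(z \<oplus>\<^sub>A w) \<ominus>\<^sub>A \<iota> (s \<oplus> t) = (z \<ominus>\<^sub>A \<iota> s) \<oplus>\<^sub>A (w \<ominus>\<^sub>A \<iota> t)"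
    using A.ideal_carr[OF iHG zw(3)] A.ideal_carr[OF iHG zw(5)] iota_simps(1)[OF zw(1)] iota_simps(1)[OF zw(2)]
    unfolding iota_simps(2)[OF zw(1,2)] by algebra
   then have "(z \<oplus>\<^sub>A w) \<ominus>\<^sub>A \<iota> (s \<oplus> t) \<in> H (Suc n)" using A.ideal_add[OF H_ideal zw(4,6)] by simp
   then show ?case using zw(1,2) A.ideal_add[OF iHG zw(3,5)] by blast
  qed
  then obtain z where z: "a \<in> carrier R" "z \<in> H (n - c) \<cdot>\<^sub>A genideal A G" "z \<ominus>\<^sub>A \<iota> a \<in> H (Suc n)" by auto
  have "x \<ominus>\<^sub>A z \<in> H (Suc n)" by (rule sub[OF a(2) z(3) H_carr[OF x(2)] A.ideal_carr[OF iHG z(2)] z(1)])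
  then show "\<exists>z\<in>H (n - c) \<cdot>\<^sub>A genideal A G. x \<ominus>\<^sub>A z \<in> H (Suc n)" using z(2) by blast
 qed
 \<comment> \<open>Downwards from level c, where successive approximation has done the work: one
   correction by a lifted initial form leads from each level to the next.\<close>
 have "I \<inter> H (c - j) \<subseteq> genideal A G" for j
 proof (induct j)
  case 0 then show ?case using top by simp
 next
  case (Suc j)
  show ?case
  proof (cases "c - j = 0")
   case True then show ?thesis using Suc by simp
  next
   case False
   then have cj: "Suc (c - Suc j) = c - j" by simp
   show ?thesis
   proof
    fix x assume x: "x \<in> I \<inter> H (c - Suc j)"
    obtain a where a: "a \<in> K I (c - Suc j)" "x \<ominus>\<^sub>A \<iota> a \<in> H (c - j)" using lead[of x "c - Suc j"] x cj by auto
    obtain z where z: "a \<in> carrier R" "z \<in> genideal A G" "z \<ominus>\<^sub>A \<iota> a \<in> H (c - j)"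
     using lift[of "c - Suc j"] a(1) cj by (auto simp: K_def)
    have xc: "x \<in> carrier A" and zc: "z \<in> carrier A" using x H_carr A.ideal_carr[OF iG z(2)] by auto
    have "x \<ominus>\<^sub>A z \<in> H (c - j)" by (rule sub[OF a(2) z(3) xc zc z(1)])
    moreover have "x \<ominus>\<^sub>A z \<in> I" using A.ideal_minus[OF I] x z(2) GI' by auto
    ultimately have "x \<ominus>\<^sub>A z \<in> genideal A G" using Suc by auto
    then show "x \<in> genideal A G" by (rule A.ideal_diff_cancel[OF iG _ z(2) xc])
   qed
  qed
 qed
 from this[of c] have "I \<subseteq> genideal A G" using H_0 A.ideal_subset_carr[OF I] by auto
 then have "I = genideal A G" using GI' by auto
 then show "\<exists>F\<subseteq>carrier A. finite F \<and> I = genideal A F" using Gf Gc by blast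
qed

text \<open>H n is generated by the image of \<mm>^n, by successive approximation, and this image
  lies in the n-th power of H 1 because \<iota> maps \<mm> into H 1.\<close>

lemma H_ipow: "H n \<subseteq> A.ipow (H 1) n"
proof -
 note im = ipow_ideal[OF mm_ideal]
 obtain F where F: "F \<subseteq> carrier R" "finite F" "ipow \<mm> n = Idl F" using finetely_gen[OF im] by blast
 have Fm: "F \<subseteq> ipow \<mm> n" using F genideal_self by simp
 have c: "\<iota> ` F \<subseteq> carrier A" using F(1) by auto
 have FH: "\<iota> ` F \<subseteq> H n" using Fm F(1) H_iota by auto
 have pull: "ideal {a\<in>carrier R. \<iota> a \<in> J} R" if J: "ideal J A" for J
  by (rule idealI') (use A.ideal_zero[OF J] A.ideal_add[OF J] A.ideal_mult_l[OF J] in auto)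
 have "H n \<inter> H n \<subseteq> genideal A (\<iota> ` F)"
 proof (rule approx_Idl[OF finite_imageI[OF F(2)] c H_ideal FH])
  fix j x assume j: "j \<ge> n" and x: "x \<in> H n" "x \<in> H j"
  obtain a where a: "a \<in> carrier R" "x \<ominus>\<^sub>A \<iota> a \<in> H (Suc j)" using H_approx[OF H_carr[OF x(2)]] by blast
  have "\<iota> a = x \<ominus>\<^sub>A (x \<ominus>\<^sub>A \<iota> a)" using H_carr[OF x(2)] iota_simps(1)[OF a(1)] by algebra
  also have "\<dots> \<in> H j" using A.ideal_minus[OF H_ideal x(2)] a(2) H_Suc[of j] by auto
  finally have "a \<in> ipow \<mm> (j - n) \<cdot> ipow \<mm> n" using H_iota a(1) j ipow_add[OF mm_ideal, of "j - n" n] by simp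
  moreover have iJ: "ideal (H (j - n) \<cdot>\<^sub>A genideal A (\<iota> ` F)) A"
   by (rule A.ideal_prod_is_ideal[OF H_ideal A.genideal_ideal[OF c]])
  moreover have "ipow \<mm> (j - n) \<cdot> ipow \<mm> n \<subseteq> {a\<in>carrier R. \<iota> a \<in> H (j - n) \<cdot>\<^sub>A genideal A (\<iota> ` F)}"
  proof (rule ideal_prod_subset[OF pull[OF iJ]])
   fix p l assume p: "p \<in> ipow \<mm> (j - n)" and l: "l \<in> ipow \<mm> n"
   have pc: "p \<in> carrier R" and lc: "l \<in> carrier R" using p l ideal_carr[OF im] by auto
   have "F \<subseteq> {a\<in>carrier R. \<iota> a \<in> genideal A (\<iota> ` F)}" using F(1) A.genideal_self[OF c] by auto
   then have "l \<in> {a\<in>carrier R. \<iota> a \<in> genideal A (\<iota> ` F)}"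
    using genideal_minimal[OF pull[OF A.genideal_ideal[OF c]]] l F(3) by blast
   moreover have "\<iota> p \<in> H (j - n)" using H_iota pc p by simp
   ultimately show "p \<otimes> l \<in> {a\<in>carrier R. \<iota> a \<in> H (j - n) \<cdot>\<^sub>A genideal A (\<iota> ` F)}"
    using pc lc by (simp add: ideal_prod.prod)
  qed
  ultimately show "\<exists>z\<in>H (j - n) \<cdot>\<^sub>A genideal A (\<iota> ` F). x \<ominus>\<^sub>A z \<in> H (Suc j)" using a(2) by blast
 qed
 moreover have "genideal A (\<iota> ` F) \<subseteq> A.ipow (H 1) n"
 proof -
  note iH = A.ipow_ideal[OF H_ideal, of 1]
  have "ipow \<mm> n \<subseteq> {a\<in>carrier R. \<iota> a \<in> A.ipow (H 1) n}" for n
  proof (induct n)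
   case 0 then show ?case by auto
  next
   case (Suc n)
   show ?case unfolding ipow_Suc
   proof (rule ideal_prod_subset[OF pull[OF iH]])
    fix i j assume i: "i \<in> ipow \<mm> n" and j: "j \<in> \<mm>"
    have "j \<in> carrier R" using j ideal_carr[OF mm_ideal] by auto
    moreover have "\<iota> j \<in> H 1" using H_iota[of j 1] calculation j ipow_1[OF mm_ideal] by simp
    ultimately show "i \<otimes> j \<in> {a\<in>carrier R. \<iota> a \<in> A.ipow (H 1) (Suc n)}"
     using subsetD[OF Suc i] ideal_prod.prod[of "\<iota> i" "A.ipow (H 1) n" "\<iota> j" "H 1" A] by (simp add: A.ipow_Suc)
   qed
  qed
  then have "\<iota> ` F \<subseteq> A.ipow (H 1) n" using Fm by blast
  then show ?thesis by (rule A.genideal_minimal[OF iH])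
 qed
 ultimately show ?thesis by auto
qed

end

section \<open>Elements of infinite asymptotic order in the completion are nilpotent\<close>

context adic
begin

lemma H1_prime: "primeideal (H 1) A"
proof (rule A.primeidealI'[OF H_ideal])
 have "\<one> \<notin> \<mm>" by (rule prime_one[OF mm_prime])
 then show "\<one>\<^sub>A \<notin> H 1" using H_iota[of \<one> 1] ipow_1[OF mm_ideal] by simp
 fix x y assume xy: "x \<in> carrier A" "y \<in> carrier A" "x \<otimes>\<^sub>A y \<in> H 1"
 obtain a where a: "a \<in> carrier R" "x \<ominus>\<^sub>A \<iota> a \<in> H 1" using H_approx[OF xy(1)] by blast
 obtain b where b: "b \<in> carrier R" "y \<ominus>\<^sub>A \<iota> b \<in> H 1" using H_approx[OF xy(2)] by blast
 note ab = iota_simps(1)[OF a(1)] iota_simps(1)[OF b(1)]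
 have "\<iota> a \<otimes>\<^sub>A \<iota> b = x \<otimes>\<^sub>A y \<ominus>\<^sub>A (y \<otimes>\<^sub>A (x \<ominus>\<^sub>A \<iota> a) \<oplus>\<^sub>A \<iota> a \<otimes>\<^sub>A (y \<ominus>\<^sub>A \<iota> b))"
  using xy(1,2) ab by algebra
 also have "\<dots> \<in> H 1"
  by (intro A.ideal_minus[OF H_ideal] xy A.ideal_add[OF H_ideal] A.ideal_mult_l[OF H_ideal] a b ab)
 finally have "\<iota> (a \<otimes> b) \<in> H 1" using a b by simp
 then have "a \<otimes> b \<in> \<mm>" using H_iota[of "a \<otimes> b" 1] a b ipow_1[OF mm_ideal] by simp
 then have "a \<in> \<mm> \<or> b \<in> \<mm>" using prime_mult[OF mm_prime a(1) b(1)] by simp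
 then show "x \<in> H 1 \<or> y \<in> H 1"
 proof
  assume "a \<in> \<mm>"
  then have "\<iota> a \<in> H 1" using H_iota[of a 1] a ipow_1[OF mm_ideal] by simp
  then show ?thesis using A.ideal_diff_cancel[OF H_ideal a(2) _ xy(1)] by simp
 next
  assume "b \<in> \<mm>"
  then have "\<iota> b \<in> H 1" using H_iota[of b 1] b ipow_1[OF mm_ideal] by simp
  then show ?thesis using A.ideal_diff_cancel[OF H_ideal b(2) _ xy(2)] by simp
 qed
qed

text \<open>With b an inverse of s modulo H 1, the element y = 1 - b s lies in H 1 and satisfies y v
  = v, which forces v into every H n.\<close>

lemma H1_regular:
 assumes s: "s \<in> carrier A" "s \<notin> H 1" and v: "v \<in> carrier A" "s \<otimes>\<^sub>A v = \<zero>\<^sub>A"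
 shows "v = \<zero>\<^sub>A"
proof -
 obtain a where a: "a \<in> carrier R" "s \<ominus>\<^sub>A \<iota> a \<in> H 1" using H_approx[OF s(1)] by blast
 have "a \<notin> \<mm>"
 proof
  assume "a \<in> \<mm>"
  then have "\<iota> a \<in> H 1" using H_iota[of a 1] a ipow_1[OF mm_ideal] by simp
  then show False using A.ideal_diff_cancel[OF H_ideal a(2) _ s(1)] s(2) by simp
 qed
 then obtain b where b: "b \<in> carrier R" "b \<otimes> a = \<one>" using mm_unit[OF a(1)] by auto
 note ab = iota_simps(1)[OF a(1)] iota_simps(1)[OF b(1)]
 have ba: "\<iota> b \<otimes>\<^sub>A \<iota> a = \<one>\<^sub>A" using iota_simps(3)[OF b(1) a(1)] b(2) by simp
 let ?y = "\<iota> b \<otimes>\<^sub>A (\<iota> a \<ominus>\<^sub>A s)"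
 have "\<iota> a \<ominus>\<^sub>A s = \<ominus>\<^sub>A (s \<ominus>\<^sub>A \<iota> a)" using s ab by algebra
 then have y: "?y \<in> H 1" using A.ideal_mult_l[OF H_ideal A.ideal_uminus[OF H_ideal a(2)] ab(2)] by simp
 have yv: "?y \<otimes>\<^sub>A v = v"
 proof -
  have "?y \<otimes>\<^sub>A v = (\<iota> b \<otimes>\<^sub>A \<iota> a) \<otimes>\<^sub>A v \<ominus>\<^sub>A \<iota> b \<otimes>\<^sub>A (s \<otimes>\<^sub>A v)" using s v(1) ab by algebra
  also have "\<dots> = v" unfolding ba v(2) using v(1) ab by algebra
  finally show ?thesis .
 qed
 have "v \<in> H n" for n
 proof (induct n)
  case 0 then show ?case using v H_0 by simp
 next
  case (Suc n) then show ?case using H_mult[OF y Suc] yv by simp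
 qed
 then show ?thesis by (rule H_sep)
qed

text \<open>If u is not nilpotent, a prime Q maximal among the ideals missing all s u^n, with s
  outside H 1, has H 1 as a minimal prime over Q + (u). Then a power of H 1 lies in Q + (u) up to a
  multiplier, so elements of high order are multiples of high powers of u modulo Q. Applied to a
  power of u itself this is absurd.\<close>

lemma nilpotent_of_asymptotic:
 assumes u: "u \<in> carrier A" and asym: "\<And>G. \<exists>L. \<forall>j. u [^]\<^sub>A (L + j :: nat) \<in> H (G * j)"
 shows "\<exists>n::nat. u [^]\<^sub>A n = \<zero>\<^sub>A"
proof (rule ccontr)
 assume nn: "\<not> ?thesis"
 interpret NA: noetherian_cring A using noetherian_A A.cring_axioms by (rule noetherian_cringI)
 let ?M = "H 1"
 note M = H1_prime
 have uM: "u \<in> ?M"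
 proof -
  obtain L where "\<forall>j. u [^]\<^sub>A (L + j :: nat) \<in> H (1 * j)" using asym by blast
  then have "u [^]\<^sub>A (L + 1) \<in> H (1 * 1)" by blast
  then show ?thesis using A.prime_pow[OF M u, of "L + 1"] by simp
 qed
 let ?S = "{s \<otimes>\<^sub>A u [^]\<^sub>A n | s n::nat. s \<in> carrier A - ?M}"
 have S1: "?S \<subseteq> carrier A" using u by auto
 have S2: "\<one>\<^sub>A \<in> ?S" using A.prime_one[OF M] u by (intro CollectI exI[of _ "\<one>\<^sub>A"] exI[of _ 0]) auto
 have S3: "a \<otimes>\<^sub>A b \<in> ?S" if ab: "a \<in> ?S" "b \<in> ?S" for a b
 proof -
  from ab(1) obtain s n where s: "a = s \<otimes>\<^sub>A u [^]\<^sub>A (n::nat)" "s \<in> carrier A - ?M" by (elim CollectE exE conjE)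
  from ab(2) obtain t m where t: "b = t \<otimes>\<^sub>A u [^]\<^sub>A (m::nat)" "t \<in> carrier A - ?M" by (elim CollectE exE conjE)
  have "a \<otimes>\<^sub>A b = (s \<otimes>\<^sub>A t) \<otimes>\<^sub>A u [^]\<^sub>A (n + m)"
   using s t u by (simp add: A.nat_pow_mult[symmetric] A.m_ac)
  moreover have "s \<otimes>\<^sub>A t \<in> carrier A - ?M" using s t A.prime_mult[OF M, of s t] by auto
  ultimately show ?thesis by (intro CollectI exI conjI)
 qed
 have S4: "{\<zero>\<^sub>A} \<inter> ?S = {}"
 proof -
  have False if z: "\<zero>\<^sub>A \<in> ?S"
  proof -
   from z obtain s n where s: "\<zero>\<^sub>A = s \<otimes>\<^sub>A u [^]\<^sub>A (n::nat)" "s \<in> carrier A - ?M" by (elim CollectE exE conjE)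
   then have "u [^]\<^sub>A n = \<zero>\<^sub>A" using H1_regular[of s "u [^]\<^sub>A n"] u by auto
   then show False using nn by auto
  qed
  then show ?thesis by blast
 qed
 obtain Q where Q: "primeideal Q A" "Q \<inter> ?S = {}" "\<forall>Y. ideal Y A \<and> Q \<subset> Y \<longrightarrow> Y \<inter> ?S \<noteq> {}"
  using NA.ex_prime_disjoint[OF S1 S2 S3 A.zeroideal S4] by auto
 note iQ = A.prime_ideal[OF Q(1)]
 have QM: "Q \<subseteq> ?M"
 proof
  fix s assume s: "s \<in> Q"
  show "s \<in> ?M"
  proof (rule ccontr)
   assume "s \<notin> ?M"
   then have "s \<otimes>\<^sub>A u [^]\<^sub>A (0::nat) \<in> ?S"
    using A.ideal_carr[OF iQ s] by (intro CollectI exI[of _ s] exI[of _ 0] conjI) auto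
   moreover have "s \<otimes>\<^sub>A u [^]\<^sub>A (0::nat) = s" using A.ideal_carr[OF iQ s] by simp
   ultimately show False using Q(2) s by auto
  qed
 qed
 have "\<one>\<^sub>A \<otimes>\<^sub>A u [^]\<^sub>A (1::nat) \<in> ?S" using A.prime_one[OF M] by (intro CollectI exI[of _ "\<one>\<^sub>A"] exI[of _ 1] conjI) auto
 then have uQ: "u \<notin> Q" using u Q(2) by auto
 note cu = A.cgenideal_ideal[OF u]
 note iQu = A.add_ideals[OF iQ cu]
 have uQu: "u \<in> Q <+>\<^sub>A PIdl\<^sub>A u" using A.set_add_upper2[OF iQ cu] A.cgenideal_self[OF u] by blast
 have QuM: "Q <+>\<^sub>A PIdl\<^sub>A u \<subseteq> ?M" by (rule A.set_add_least[OF H_ideal QM A.cgenideal_minimal[OF H_ideal uM]])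
 \<comment> \<open>Otherwise take b in H 1 outside the minimal primes of Q + (u) and Q' minimal over
   Q + (b). Being larger than Q, Q' contains u by the maximality of Q, hence a minimal prime of Q +
   (u). That prime lies strictly between Q and Q', against Krull's theorem.\<close>
 have Mmin: "A.minover (Q <+>\<^sub>A PIdl\<^sub>A u) ?M"
 proof (rule ccontr)
  assume nm: "\<not> ?thesis"
  obtain F where F: "finite F" "\<forall>P\<in>F. A.minover (Q <+>\<^sub>A PIdl\<^sub>A u) P"
   "\<forall>P. primeideal P A \<and> Q <+>\<^sub>A PIdl\<^sub>A u \<subseteq> P \<longrightarrow> (\<exists>Q\<in>F. Q \<subseteq> P)"
   using NA.finite_minover[OF iQu] by auto
  have "\<not> ?M \<subseteq> P" if "P \<in> F" for P
  proof
   assume "?M \<subseteq> P"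
   then have "?M = P" using F(2) that M QuM unfolding A.minover_def by blast
   then show False using nm F(2) that by auto
  qed
  then obtain b where b: "b \<in> ?M" "b \<notin> \<Union>F"
   using A.prime_avoidance[OF F(1) _ H_ideal, of 1] F(2) unfolding A.minover_def by blast
  have bc: "b \<in> carrier A" using b H_carr by blast
  note cb = A.cgenideal_ideal[OF bc]
  have "Q <+>\<^sub>A PIdl\<^sub>A b \<subseteq> ?M" by (rule A.set_add_least[OF H_ideal QM A.cgenideal_minimal[OF H_ideal b(1)]])
  then obtain Q' where Q': "A.minover (Q <+>\<^sub>A PIdl\<^sub>A b) Q'" "Q' \<subseteq> ?M"
   using NA.ex_minover[OF A.add_ideals[OF iQ cb] M] by auto
  then have pQ': "primeideal Q' A" and QbQ': "Q <+>\<^sub>A PIdl\<^sub>A b \<subseteq> Q'" by (auto simp: A.minover_def)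
  have QQ': "Q \<subseteq> Q'" "b \<in> Q'"
   using A.set_add_upper1[OF iQ cb] A.set_add_upper2[OF iQ cb] A.cgenideal_self[OF bc] QbQ' by auto
  have "b \<notin> Q"
  proof
   assume "b \<in> Q"
   obtain P where P: "P \<in> F" using F(3) M QuM by auto
   then have "Q \<subseteq> P" using F(2) A.set_add_upper1[OF iQ cu] unfolding A.minover_def by blast
   then show False using b P \<open>b \<in> Q\<close> by auto
  qed
  then have "Q \<subset> Q'" using QQ' by auto
  then have "Q' \<inter> ?S \<noteq> {}" using Q(3) A.prime_ideal[OF pQ'] by blast
  then obtain z where z: "z \<in> Q'" "z \<in> ?S" by blast
  from z(2) obtain s n where s: "z = s \<otimes>\<^sub>A u [^]\<^sub>A (n::nat)" "s \<in> carrier A - ?M" by (elim CollectE exE conjE)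
  have "s \<notin> Q'" using s Q' by auto
  then have "u [^]\<^sub>A n \<in> Q'" using A.prime_mult[OF pQ', of s "u [^]\<^sub>A n"] s z u by auto
  then have "u \<in> Q'" by (rule A.prime_pow[OF pQ' u])
  then have "Q <+>\<^sub>A PIdl\<^sub>A u \<subseteq> Q'"
   using QQ'(1) by (intro A.set_add_least[OF A.prime_ideal[OF pQ']] A.cgenideal_minimal[OF A.prime_ideal[OF pQ']])
  then obtain Q1 where Q1: "Q1 \<in> F" "Q1 \<subseteq> Q'" using F(3) pQ' by blast
  then have pQ1: "primeideal Q1 A" and "Q <+>\<^sub>A PIdl\<^sub>A u \<subseteq> Q1" using F(2) by (auto simp: A.minover_def)
  then have "Q \<subset> Q1" using A.set_add_upper1[OF iQ cu] uQu uQ by blast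
  moreover have "Q1 \<subset> Q'" using Q1 b QQ'(2) by auto
  ultimately show False using NA.krull_principal_ideal[OF Q(1) pQ1 _ _ bc Q'(1)] by blast
 qed
 obtain s c where s: "s \<in> carrier A" "s \<notin> ?M" "\<And>z. z \<in> A.ipow ?M c \<Longrightarrow> s \<otimes>\<^sub>A z \<in> Q <+>\<^sub>A PIdl\<^sub>A u"
  using NA.minover_ipow[OF iQu Mmin] by auto
 have mult: "s [^]\<^sub>A j \<otimes>\<^sub>A z \<in> Q <+>\<^sub>A PIdl\<^sub>A (u [^]\<^sub>A j)" if "z \<in> A.ipow ?M (c * j)" for z and j :: nat
  using that
 proof (induct j arbitrary: z)
  case 0
  have "z \<in> carrier A" using 0 by simp
  moreover have "PIdl\<^sub>A \<one>\<^sub>A = carrier A" using A.genideal_one A.cgenideal_eq_genideal[of "\<one>\<^sub>A"] by simp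
  ultimately show ?case using A.set_add_upper2[OF iQ A.oneideal] by auto
 next
  case (Suc j)
  note cj = A.cgenideal_ideal[OF A.nat_pow_closed[OF u]]
  let ?Z = "{z\<in>carrier A. s [^]\<^sub>A Suc j \<otimes>\<^sub>A z \<in> Q <+>\<^sub>A PIdl\<^sub>A (u [^]\<^sub>A Suc j)}"
  note iZ' = A.add_ideals[OF iQ cj[of "Suc j"]]
  have sc: "s [^]\<^sub>A Suc j \<in> carrier A" using s by (intro A.nat_pow_closed)
  have iZ: "ideal ?Z A"
  proof (rule A.idealI')
   show "\<zero>\<^sub>A \<in> ?Z" using A.ideal_zero[OF iZ'] sc by simp
   show "a \<oplus>\<^sub>A b \<in> ?Z" if "a \<in> ?Z" "b \<in> ?Z" for a b
    using that A.ideal_add[OF iZ'] sc by (simp add: A.r_distr del: A.nat_pow_Suc)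
   show "r \<otimes>\<^sub>A a \<in> ?Z" if "a \<in> ?Z" "r \<in> carrier A" for a r
    using that A.ideal_mult_l[OF iZ', of "s [^]\<^sub>A Suc j \<otimes>\<^sub>A a" r] sc by (simp add: A.m_lcomm del: A.nat_pow_Suc)
  qed auto
  have "A.ipow ?M (c * j) \<cdot>\<^sub>A A.ipow ?M c \<subseteq> ?Z"
  proof (rule A.ideal_prod_subset[OF iZ])
   fix x y assume x: "x \<in> A.ipow ?M (c * j)" and y: "y \<in> A.ipow ?M c"
   have xc: "x \<in> carrier A" and yc: "y \<in> carrier A" using x y A.ideal_carr[OF A.ipow_ideal[OF H_ideal]] by auto
   obtain q r where q: "q \<in> Q" "r \<in> carrier A" "s [^]\<^sub>A j \<otimes>\<^sub>A x = q \<oplus>\<^sub>A r \<otimes>\<^sub>A u [^]\<^sub>A j"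
    using Suc(1)[OF x] unfolding A.mem_add_cgen by blast
   obtain q' r' where q': "q' \<in> Q" "r' \<in> carrier A" "s \<otimes>\<^sub>A y = q' \<oplus>\<^sub>A r' \<otimes>\<^sub>A u"
    using s(3)[OF y] unfolding A.mem_add_cgen by blast
   have qc: "q \<in> carrier A" "q' \<in> carrier A" using q q' A.ideal_carr[OF iQ] by auto
   have "s [^]\<^sub>A Suc j \<otimes>\<^sub>A (x \<otimes>\<^sub>A y) = (s [^]\<^sub>A j \<otimes>\<^sub>A x) \<otimes>\<^sub>A (s \<otimes>\<^sub>A y)"
    using xc yc s(1) by (simp add: A.m_ac)
   also have "\<dots> = ((q' \<oplus>\<^sub>A r' \<otimes>\<^sub>A u) \<otimes>\<^sub>A q \<oplus>\<^sub>A (r \<otimes>\<^sub>A u [^]\<^sub>A j) \<otimes>\<^sub>A q') \<oplus>\<^sub>A (r \<otimes>\<^sub>A r') \<otimes>\<^sub>A (u [^]\<^sub>A j \<otimes>\<^sub>A u)"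
    unfolding q(3) q'(3) using qc q(2) q'(2) u A.nat_pow_closed[OF u, of j] by algebra
   finally have "s [^]\<^sub>A Suc j \<otimes>\<^sub>A (x \<otimes>\<^sub>A y) = ((q' \<oplus>\<^sub>A r' \<otimes>\<^sub>A u) \<otimes>\<^sub>A q \<oplus>\<^sub>A (r \<otimes>\<^sub>A u [^]\<^sub>A j) \<otimes>\<^sub>A q') \<oplus>\<^sub>A (r \<otimes>\<^sub>A r') \<otimes>\<^sub>A u [^]\<^sub>A Suc j" by simp
   moreover have "(q' \<oplus>\<^sub>A r' \<otimes>\<^sub>A u) \<otimes>\<^sub>A q \<oplus>\<^sub>A (r \<otimes>\<^sub>A u [^]\<^sub>A j) \<otimes>\<^sub>A q' \<in> Q"
    using q q' qc u by (intro A.ideal_add[OF iQ] A.ideal_mult_l[OF iQ]) auto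
   ultimately have "s [^]\<^sub>A Suc j \<otimes>\<^sub>A (x \<otimes>\<^sub>A y) \<in> Q <+>\<^sub>A PIdl\<^sub>A (u [^]\<^sub>A Suc j)"
    unfolding A.mem_add_cgen using q(2) q'(2) by blast
   then show "x \<otimes>\<^sub>A y \<in> ?Z" using xc yc by simp
  qed
  moreover have "A.ipow ?M (c * Suc j) = A.ipow ?M (c * j) \<cdot>\<^sub>A A.ipow ?M c"
   using A.ipow_add[OF H_ideal, of 1 "c * j" c] by (simp add: add.commute)
  ultimately show ?case using Suc(2) by blast
 qed
 obtain L where L: "\<And>j. u [^]\<^sub>A (L + j :: nat) \<in> H ((2 * c) * j)" using asym by blast
 \<comment> \<open>With G = 2c and j = L+1 the power u^n, n = 2L+1, lies in H (2c(L+1)) and so in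
   the (cm)-th power of H 1, where m = 2(L+1) = n+1. Thus s^m u^n is a multiple of u^(n+1) modulo Q,
   and cancelling u^n leaves s^m - r u in Q.\<close>
 let ?n = "L + (L + 1)" and ?m = "2 * (L + 1)"
 have "u [^]\<^sub>A ?n \<in> A.ipow ?M (c * ?m)"
  using L[of "L + 1"] H_ipow[of "(2 * c) * (L + 1)"] by (auto simp: algebra_simps)
 from mult[OF this] obtain q r where q: "q \<in> Q" "r \<in> carrier A" "s [^]\<^sub>A ?m \<otimes>\<^sub>A u [^]\<^sub>A ?n = q \<oplus>\<^sub>A r \<otimes>\<^sub>A u [^]\<^sub>A ?m"
  unfolding A.mem_add_cgen by blast
 have um: "u [^]\<^sub>A ?m = u [^]\<^sub>A ?n \<otimes>\<^sub>A u"
 proof -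
  have "?m = Suc ?n" by simp
  then show ?thesis by (simp only: A.nat_pow_Suc)
 qed
 have qc: "q \<in> carrier A" using q A.ideal_carr[OF iQ] by auto
 have "u [^]\<^sub>A ?n \<otimes>\<^sub>A (s [^]\<^sub>A ?m \<ominus>\<^sub>A r \<otimes>\<^sub>A u) = (s [^]\<^sub>A ?m \<otimes>\<^sub>A u [^]\<^sub>A ?n) \<ominus>\<^sub>A r \<otimes>\<^sub>A (u [^]\<^sub>A ?n \<otimes>\<^sub>A u)"
  using A.nat_pow_closed[OF u, of ?n] A.nat_pow_closed[OF s(1), of ?m] u q(2) by algebra
 also have "\<dots> = q" unfolding q(3) um using A.nat_pow_closed[OF u, of ?n] u q(2) qc by algebra
 finally have "u [^]\<^sub>A ?n \<in> Q \<or> s [^]\<^sub>A ?m \<ominus>\<^sub>A r \<otimes>\<^sub>A u \<in> Q"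
  using A.prime_mult[OF Q(1), of "u [^]\<^sub>A ?n" "s [^]\<^sub>A ?m \<ominus>\<^sub>A r \<otimes>\<^sub>A u"] q u s(1) by simp
 then have "s [^]\<^sub>A ?m \<ominus>\<^sub>A r \<otimes>\<^sub>A u \<in> ?M" using A.prime_pow[OF Q(1) u] uQ QM by blast
 then have "s [^]\<^sub>A ?m \<in> ?M"
  using A.ideal_diff_cancel[OF H_ideal _ A.ideal_mult_l[OF H_ideal uM q(2)]] s(1) by blast
 then show False using A.prime_pow[OF M s(1)] s(2) by blast
qed

text \<open>A compactness argument in the style of Chevalley. If no C G lay in \<mm>^N, the images
  of the C G in the Artinian rings R/\<mm>^n would become stationary outside \<mm>^N, and a coherent
  choice of elements would converge to a nonzero element of infinite asymptotic order, which is
  nilpotent.\<close>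

theorem asym_int_small:
 assumes red: "reduced_ring A"
 shows "\<exists>G. \<forall>I. asym_int G I \<longrightarrow> I \<subseteq> ipow \<mm> N"
proof (rule ccontr)
 assume neg: "\<not> ?thesis"
 have "\<forall>G. \<exists>C. asym_int G C \<and> (\<forall>I. asym_int G I \<longrightarrow> I \<subseteq> C)" using ex_greatest_asym_int by blast
 then obtain C where C: "\<And>G. asym_int G (C G)" "\<And>G I. asym_int G I \<Longrightarrow> I \<subseteq> C G" by metis
 note im = ipow_ideal[OF mm_ideal]
 have iC: "ideal (C G) R" for G using C(1) by (simp add: asym_int_def)
 have CN: "\<not> C G \<subseteq> ipow \<mm> N" for G using neg C(2) by (meson order_trans)
 have Cdec: "C (Suc G) \<subseteq> C G" for G using C(2)[OF asym_int_Suc[OF C(1)]] .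
 have stab: "\<exists>G0. \<forall>G\<ge>G0. C G <+> ipow \<mm> n = C G0 <+> ipow \<mm> n" for n
 proof (rule psat_dcc[OF mm_prime im[of n] mm_psat[OF im] _ _ mm_psat])
  fix G
  show "ideal (C G <+> ipow \<mm> n) R" by (intro add_ideals iC im)
  then show "ideal (C G <+> ipow \<mm> n) R" .
  show "ipow \<mm> n \<subseteq> C G <+> ipow \<mm> n" by (rule set_add_upper2[OF iC im])
  show "C (Suc G) <+> ipow \<mm> n \<subseteq> C G <+> ipow \<mm> n" by (intro set_add_mono Cdec order_refl)
 qed
 then obtain g where g: "\<And>n G. G \<ge> g n \<Longrightarrow> C G <+> ipow \<mm> n = C (g n) <+> ipow \<mm> n" by metis
 \<comment> \<open>The stable image of the decreasing ideals C G in R/\<mm>^n. Stability makes the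
   maps between these images surjective (\<open>Snext\<close>), so an element outside \<mm>^N can be
   continued to a coherent sequence.\<close>
 define S where "S n = C (g n) <+> ipow \<mm> n" for n
 have SC: "S n \<subseteq> C G <+> ipow \<mm> n" for n G
 proof -
  have "S n = C (max G (g n)) <+> ipow \<mm> n" using g[of n "max G (g n)"] by (simp add: S_def)
  also have "\<dots> \<subseteq> C G <+> ipow \<mm> n"
   using lift_Suc_antimono_le[of C, OF Cdec, of G "max G (g n)"] by (intro set_add_mono) auto
  finally show ?thesis .
 qed
 have Snext: "\<exists>y\<in>S (Suc n). y \<ominus> x \<in> ipow \<mm> n" if x: "x \<in> S n" for x n
 proof -
  obtain y z where yz: "y \<in> C (g (Suc n))" "z \<in> ipow \<mm> n" "x = y \<oplus> z"
   using subsetD[OF SC[of n "g (Suc n)"] x] unfolding mem_set_add by auto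
  have yc: "y \<in> carrier R" "z \<in> carrier R" using yz ideal_carr[OF iC] ideal_carr[OF im] by auto
  have "y \<ominus> x = \<ominus> z" unfolding yz(3) using yc by algebra
  then have "y \<ominus> x \<in> ipow \<mm> n" using ideal_uminus[OF im yz(2)] by simp
  moreover have "y \<in> S (Suc n)" using yz(1) set_add_upper1[OF iC im] by (auto simp: S_def)
  ultimately show ?thesis by blast
 qed
 obtain x0 where x0: "x0 \<in> S N" "x0 \<notin> ipow \<mm> N"
  using CN[of "g N"] set_add_upper1[OF iC im, of "g N" N] by (auto simp: S_def)
 have "\<forall>n x. \<exists>y. x \<in> S n \<longrightarrow> y \<in> S (Suc n) \<and> y \<ominus> x \<in> ipow \<mm> n" using Snext by blast
 then obtain nx where nx: "\<And>n x. x \<in> S n \<Longrightarrow> nx n x \<in> S (Suc n) \<and> nx n x \<ominus> x \<in> ipow \<mm> n" by metis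
 define a where "a = rec_nat x0 (\<lambda>n v. nx (N + n) v)"
 have a0: "a 0 = x0" and aS: "a (Suc n) = nx (N + n) (a n)" for n by (simp_all add: a_def)
 have a: "a n \<in> S (N + n)" for n by (induct n) (use x0 a0 aS nx in auto)
 have iS: "ideal (S n) R" for n unfolding S_def by (intro add_ideals iC im)
 have ac: "a n \<in> carrier R" for n using a ideal_carr[OF iS] by blast
 have adiff: "a (Suc n) \<ominus> a n \<in> ipow \<mm> (N + n)" for n using nx[OF a] aS by simp
 have iotadiff: "\<iota> b \<ominus>\<^sub>A \<iota> b' \<in> H n" if "b \<in> carrier R" "b' \<in> carrier R" "b \<ominus> b' \<in> ipow \<mm> n" for b b' n
 proof -
  have "\<iota> b = \<iota> ((b \<ominus> b') \<oplus> b')" using that(1,2) by (metis add.inv_solve_right minus_closed minus_eq a_comm)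
  then have "\<iota> b = \<iota> (b \<ominus> b') \<oplus>\<^sub>A \<iota> b'" using that by simp
  moreover have "\<iota> (b \<ominus> b') \<in> H n" using H_iota that by simp
  moreover have "(\<iota> (b \<ominus> b') \<oplus>\<^sub>A \<iota> b') \<ominus>\<^sub>A \<iota> b' = \<iota> (b \<ominus> b')"
   using iota_simps(1)[of "b \<ominus> b'"] iota_simps(1)[OF that(2)] that(1,2) by (simp add: A.minus_eq A.a_assoc A.r_neg)
  ultimately show ?thesis by simp
 qed
 obtain u where u: "u \<in> carrier A" "\<And>n. u \<ominus>\<^sub>A \<iota> (a n) \<in> H n"
 proof -
  have "\<exists>s\<in>carrier A. \<forall>n. s \<ominus>\<^sub>A \<iota> (a n) \<in> H n"
  proof (rule H_complete)
   show "\<iota> (a n) \<in> carrier A" for n using ac by simp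
   show "\<iota> (a (Suc n)) \<ominus>\<^sub>A \<iota> (a n) \<in> H n" for n
    using iotadiff[OF ac ac adiff[of n]] H_decr[of n "N + n"] by auto
  qed
  then show ?thesis using that by blast
 qed
 have aN: "a n \<notin> ipow \<mm> N" for n
 proof (induct n)
  case 0 then show ?case using a0 x0 by simp
 next
  case (Suc n)
  have "a n \<ominus> a (Suc n) \<in> ipow \<mm> N"
  proof -
   have "a n \<ominus> a (Suc n) = \<ominus> (a (Suc n) \<ominus> a n)" using ac[of n] ac[of "Suc n"] by algebra
   then show ?thesis using ideal_uminus[OF im adiff[of n]] ipow_decr[OF mm_ideal, of N "N + n"] by auto
  qed
  then show ?case using ideal_diff_cancel[OF im _ _ ac[of n]] Suc by blast
 qed
 have "u \<noteq> \<zero>\<^sub>A"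
 proof
  assume "u = \<zero>\<^sub>A"
  then have "\<iota> (a N) = \<ominus>\<^sub>A (u \<ominus>\<^sub>A \<iota> (a N))" using ac by (simp add: A.minus_eq)
  then have "\<iota> (a N) \<in> H N" using A.ideal_uminus[OF H_ideal u(2)[of N]] by metis
  then show False using aN H_iota[OF ac] by simp
 qed
 moreover have "\<exists>n::nat. u [^]\<^sub>A n = \<zero>\<^sub>A"
 proof (rule nilpotent_of_asymptotic[OF u(1)])
  fix G
  obtain L where L: "\<And>j. ipow (C G) (L + j) \<subseteq> ipow \<mm> (G * j)" using C(1)[of G] by (auto simp: asym_int_def)
  have "u [^]\<^sub>A (L + j) \<in> H (G * j)" for j
  proof -
   let ?n = "G * j"
   \<comment> \<open>Modulo H (Gj) the limit u agrees with an element v of C G, and v^(L+j) lies in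
     \<mm>^(Gj).\<close>
   obtain v w where vw: "v \<in> C G" "w \<in> ipow \<mm> (N + ?n)" "a ?n = v \<oplus> w"
    using subsetD[OF SC[of "N + ?n" G] a[of ?n]] unfolding mem_set_add by auto
   have vc: "v \<in> carrier R" and wc: "w \<in> carrier R" using vw ideal_carr[OF iC] ideal_carr[OF im] by auto
   have "\<iota> v = \<iota> (a ?n) \<ominus>\<^sub>A \<iota> w" using vw(3) vc wc by (simp add: A.minus_eq A.a_assoc A.r_neg)
   then have "u \<ominus>\<^sub>A \<iota> v = (u \<ominus>\<^sub>A \<iota> (a ?n)) \<oplus>\<^sub>A \<iota> w"
    using u(1) iota_simps(1)[OF ac[of ?n]] iota_simps(1)[OF wc] by (simp only:) algebra
   moreover have "\<iota> w \<in> H ?n" using H_iota[OF wc] vw(2) ipow_decr[OF mm_ideal, of ?n "N + ?n"] by auto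
   ultimately have d: "u \<ominus>\<^sub>A \<iota> v \<in> H ?n" using A.ideal_add[OF H_ideal u(2)] by simp
   have pd: "u [^]\<^sub>A m \<ominus>\<^sub>A \<iota> (v [^] m) \<in> H ?n" for m :: nat
   proof (induct m)
    case 0 then show ?case using A.ideal_zero[OF H_ideal] by (simp add: A.minus_eq A.r_neg)
   next
    case (Suc m)
    have c: "\<iota> v \<in> carrier A" "\<iota> (v [^] m) \<in> carrier A" using vc by auto
    have "u [^]\<^sub>A Suc m \<ominus>\<^sub>A \<iota> (v [^] Suc m) = u \<otimes>\<^sub>A (u [^]\<^sub>A m \<ominus>\<^sub>A \<iota> (v [^] m)) \<oplus>\<^sub>A \<iota> (v [^] m) \<otimes>\<^sub>A (u \<ominus>\<^sub>A \<iota> v)"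
     using vc iota_simps(3)[of "v [^] m" v] A.nat_pow_closed[OF u(1), of m] c u(1) by (simp only: A.nat_pow_Suc nat_pow_Suc nat_pow_closed) algebra
    then show ?case using A.ideal_add[OF H_ideal A.ideal_mult_l[OF H_ideal Suc u(1)] A.ideal_mult_l[OF H_ideal d c(2)]] by simp
   qed
   have "v [^] (L + j) \<in> ipow \<mm> ?n" using pow_mem_ipow[OF iC vw(1), of "L + j"] L by blast
   then have "\<iota> (v [^] (L + j)) \<in> H ?n" using H_iota vc by simp
   then show ?thesis using A.ideal_diff_cancel[OF H_ideal pd] u(1) by blast
  qed
  then show "\<exists>L. \<forall>j. u [^]\<^sub>A (L + j) \<in> H (G * j)" by blast
 qed
 ultimately show False using red u(1) by (auto simp: reduced_ring_def)
qed

end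

section \<open>The inverse limit of the rings R/\<mm>^n as a complete filtered ring\<close>

context noeth_local
begin

lemma coset_iff: "ideal I R \<Longrightarrow> a \<in> carrier R \<Longrightarrow> x \<in> I +> a \<longleftrightarrow> x \<in> carrier R \<and> x \<ominus> a \<in> I"
proof
 assume I: "ideal I R" and a: "a \<in> carrier R"
 { assume "x \<in> I +> a"
  then obtain i where i: "i \<in> I" "x = i \<oplus> a" by (auto simp: a_r_coset_def')
  have ic: "i \<in> carrier R" using ideal_carr[OF I i(1)] .
  have "(i \<oplus> a) \<ominus> a = i" using ic a by algebra
  then show "x \<in> carrier R \<and> x \<ominus> a \<in> I" using i ic a by auto }
 { assume x: "x \<in> carrier R \<and> x \<ominus> a \<in> I"
  have "x = (x \<ominus> a) \<oplus> a" using x a by algebra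
  then show "x \<in> I +> a" using x by (auto simp: a_r_coset_def') }
qed

definition q :: "nat \<Rightarrow> 'a \<Rightarrow> 'a set"
 where "q n r = ipow \<mm> n +> r"

abbreviation Q :: "nat \<Rightarrow> 'a set ring"
 where "Q n \<equiv> R Quot (ipow \<mm> n)"

abbreviation Rhat :: "(nat \<Rightarrow> 'a set) ring"
 where "Rhat \<equiv> adic_completion R \<mm>"

lemma im: "ideal (ipow \<mm> n) R" by (rule ipow_ideal[OF mm_ideal])

lemma Q_cring: "cring (Q n)" by (rule ideal.quotient_is_cring[OF im is_cring])

lemma q_hom: "q n \<in> ring_hom R (Q n)"
 unfolding q_def using ideal.rcos_ring_hom[OF im] .

lemma q_simps:
 assumes "r \<in> carrier R" "s \<in> carrier R"
 shows "q n r \<in> carrier (Q n)" "q n (r \<oplus> s) = q n r \<oplus>\<^bsub>Q n\<^esub> q n s" "q n (r \<otimes> s) = q n r \<otimes>\<^bsub>Q n\<^esub> q n s"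
  "q n \<one> = \<one>\<^bsub>Q n\<^esub>" "q n \<zero> = \<zero>\<^bsub>Q n\<^esub>"
 using q_hom[of n] assms ring_hom_zero[OF q_hom ring_axioms cring.axioms(1)[OF Q_cring]] by (auto simp: ring_hom_def)

lemma q_carr: "r \<in> carrier R \<Longrightarrow> q n r \<in> carrier (Q n)"
 using q_simps(1)[of r \<zero>] by simp

lemma q_one: "q n \<one> = \<one>\<^bsub>Q n\<^esub>"
 using q_simps(4)[of \<zero> \<zero>] by simp

lemma q_eq: "r \<in> carrier R \<Longrightarrow> s \<in> carrier R \<Longrightarrow> q n r = q n s \<longleftrightarrow> r \<ominus> s \<in> ipow \<mm> n"
 unfolding q_def using quotient_eq_iff_same_a_r_cos[OF im] by blast

lemma q_zero: "r \<in> carrier R \<Longrightarrow> q n r = \<zero>\<^bsub>Q n\<^esub> \<longleftrightarrow> r \<in> ipow \<mm> n"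
 using q_eq[of r \<zero> n] q_simps(5)[of \<zero> \<zero> n] by (simp add: minus_eq)

lemma Q_carr: "X \<in> carrier (Q n) \<longleftrightarrow> (\<exists>r\<in>carrier R. X = q n r)"
 by (auto simp: FactRing_def A_RCOSETS_def' q_def)

lemma q_subset: "r \<in> carrier R \<Longrightarrow> s \<in> carrier R \<Longrightarrow> q (Suc n) s \<subseteq> q n r \<longleftrightarrow> s \<ominus> r \<in> ipow \<mm> n"
proof
 assume rs: "r \<in> carrier R" "s \<in> carrier R"
 { assume "q (Suc n) s \<subseteq> q n r"
  moreover have "s \<in> q (Suc n) s" using rs ideal_zero[OF im] by (simp add: q_def coset_iff[OF im] minus_eq r_neg)
  ultimately show "s \<ominus> r \<in> ipow \<mm> n" using rs by (auto simp: q_def coset_iff[OF im]) }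
 { assume d: "s \<ominus> r \<in> ipow \<mm> n"
  show "q (Suc n) s \<subseteq> q n r"
  proof
   fix x assume "x \<in> q (Suc n) s"
   then have x: "x \<in> carrier R" "x \<ominus> s \<in> ipow \<mm> n"
    using rs ipow_decr[OF mm_ideal, of n "Suc n"] by (auto simp: q_def coset_iff[OF im])
   have "x \<ominus> r = (x \<ominus> s) \<oplus> (s \<ominus> r)" using x rs by algebra
   then show "x \<in> q n r" using ideal_add[OF im x(2) d] x rs by (simp add: q_def coset_iff[OF im])
  qed }
qed

text \<open>Coherent sequences of representatives: by \<open>q_subset\<close> the inclusion of
  cosets in \<open>adic_completion\<close> is the congruence of r (n+1) and r n modulo
  \<mm>^n.\<close>

definition coh :: "(nat \<Rightarrow> 'a) \<Rightarrow> bool"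
 where "coh r \<longleftrightarrow> (\<forall>n. r n \<in> carrier R) \<and> (\<forall>n. r (Suc n) \<ominus> r n \<in> ipow \<mm> n)"

lemma Rhat_simps:
 "carrier Rhat = {x. \<forall>n. x n \<in> carrier (Q n) \<and> x (Suc n) \<subseteq> x n}"
 "x \<otimes>\<^bsub>Rhat\<^esub> y = (\<lambda>n. x n \<otimes>\<^bsub>Q n\<^esub> y n)"
 "x \<oplus>\<^bsub>Rhat\<^esub> y = (\<lambda>n. x n \<oplus>\<^bsub>Q n\<^esub> y n)"
 "\<one>\<^bsub>Rhat\<^esub> = (\<lambda>n. \<one>\<^bsub>Q n\<^esub>)" "\<zero>\<^bsub>Rhat\<^esub> = (\<lambda>n. \<zero>\<^bsub>Q n\<^esub>)"
 by (simp_all add: adic_completion_def ipow_def Let_def)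

lemma Rhat_carr: "x \<in> carrier Rhat \<longleftrightarrow> (\<exists>r. coh r \<and> x = (\<lambda>n. q n (r n)))"
proof
 assume x: "x \<in> carrier Rhat"
 then have "\<forall>n. \<exists>r\<in>carrier R. x n = q n r" by (simp add: Rhat_simps Q_carr)
 then obtain r where r: "\<And>n. r n \<in> carrier R" "\<And>n. x n = q n (r n)" by metis
 have "q (Suc n) (r (Suc n)) \<subseteq> q n (r n)" for n using x r(2) by (auto simp: Rhat_simps)
 then have "coh r" using r(1) q_subset by (auto simp: coh_def)
 then show "\<exists>r. coh r \<and> x = (\<lambda>n. q n (r n))" using r(2) by blast
next
 assume "\<exists>r. coh r \<and> x = (\<lambda>n. q n (r n))"
 then obtain r where r: "coh r" "x = (\<lambda>n. q n (r n))" by auto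
 then have "r n \<in> carrier R" "r (Suc n) \<ominus> r n \<in> ipow \<mm> n" for n by (auto simp: coh_def)
 then show "x \<in> carrier Rhat" using q_subset q_carr unfolding Rhat_simps r(2) by blast
qed

lemma coh_add: "coh r \<Longrightarrow> coh s \<Longrightarrow> coh (\<lambda>n. r n \<oplus> s n)"
 unfolding coh_def
proof (intro conjI allI)
 fix n assume *: "(\<forall>n. r n \<in> carrier R) \<and> (\<forall>n. r (Suc n) \<ominus> r n \<in> ipow \<mm> n)" "(\<forall>n. s n \<in> carrier R) \<and> (\<forall>n. s (Suc n) \<ominus> s n \<in> ipow \<mm> n)"
 then have c: "r n \<in> carrier R" "r (Suc n) \<in> carrier R" "s n \<in> carrier R" "s (Suc n) \<in> carrier R" by auto
 then show "r n \<oplus> s n \<in> carrier R" by simp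
 have "(r (Suc n) \<oplus> s (Suc n)) \<ominus> (r n \<oplus> s n) = (r (Suc n) \<ominus> r n) \<oplus> (s (Suc n) \<ominus> s n)" using c by algebra
 then show "(r (Suc n) \<oplus> s (Suc n)) \<ominus> (r n \<oplus> s n) \<in> ipow \<mm> n" using * ideal_add[OF im] by simp
qed

lemma coh_mult: "coh r \<Longrightarrow> coh s \<Longrightarrow> coh (\<lambda>n. r n \<otimes> s n)"
 unfolding coh_def
proof (intro conjI allI)
 fix n assume *: "(\<forall>n. r n \<in> carrier R) \<and> (\<forall>n. r (Suc n) \<ominus> r n \<in> ipow \<mm> n)" "(\<forall>n. s n \<in> carrier R) \<and> (\<forall>n. s (Suc n) \<ominus> s n \<in> ipow \<mm> n)"
 then have c: "r n \<in> carrier R" "r (Suc n) \<in> carrier R" "s n \<in> carrier R" "s (Suc n) \<in> carrier R" by auto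
 then show "r n \<otimes> s n \<in> carrier R" by simp
 have "(r (Suc n) \<otimes> s (Suc n)) \<ominus> (r n \<otimes> s n) = s (Suc n) \<otimes> (r (Suc n) \<ominus> r n) \<oplus> r n \<otimes> (s (Suc n) \<ominus> s n)" using c by algebra
 then show "(r (Suc n) \<otimes> s (Suc n)) \<ominus> (r n \<otimes> s n) \<in> ipow \<mm> n" using * c ideal_add[OF im] ideal_mult_l[OF im] by simp
qed

lemma coh_const: "a \<in> carrier R \<Longrightarrow> coh (\<lambda>n. a)"
 using ideal_zero[OF im] by (simp add: coh_def minus_eq r_neg)

lemma coh_le:
 assumes r: "coh r" and "n \<le> m"
 shows "r m \<ominus> r n \<in> ipow \<mm> n"
 using assms(2)
proof (induct m rule: dec_induct)
 case base then show ?case using r ideal_zero[OF im] by (simp add: coh_def minus_eq r_neg)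
next
 case (step m)
 have c: "r m \<in> carrier R" "r (Suc m) \<in> carrier R" "r n \<in> carrier R" using r by (auto simp: coh_def)
 have "r (Suc m) \<ominus> r n = (r (Suc m) \<ominus> r m) \<oplus> (r m \<ominus> r n)" using c by algebra
 moreover have "r (Suc m) \<ominus> r m \<in> ipow \<mm> n" using r step(1) ipow_decr[OF mm_ideal, of n m] by (auto simp: coh_def)
 ultimately show ?case using ideal_add[OF im] step by simp
qed

lemma Rhat_comp: "x \<in> carrier Rhat \<Longrightarrow> x n \<in> carrier (Q n)" by (simp add: Rhat_simps)

lemma Rhat_closed:
 assumes "x \<in> carrier Rhat" "y \<in> carrier Rhat"
 shows "x \<oplus>\<^bsub>Rhat\<^esub> y \<in> carrier Rhat" "x \<otimes>\<^bsub>Rhat\<^esub> y \<in> carrier Rhat"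
proof -
 obtain r s where rs: "coh r" "coh s" "x = (\<lambda>n. q n (r n))" "y = (\<lambda>n. q n (s n))" using assms by (auto simp: Rhat_carr)
 then have c: "r n \<in> carrier R" "s n \<in> carrier R" for n by (auto simp: coh_def)
 show "x \<oplus>\<^bsub>Rhat\<^esub> y \<in> carrier Rhat"
  unfolding Rhat_carr using coh_add[OF rs(1,2)] c by (intro exI[of _ "\<lambda>n. r n \<oplus> s n"]) (simp add: Rhat_simps q_simps rs)
 show "x \<otimes>\<^bsub>Rhat\<^esub> y \<in> carrier Rhat"
  unfolding Rhat_carr using coh_mult[OF rs(1,2)] c by (intro exI[of _ "\<lambda>n. r n \<otimes> s n"]) (simp add: Rhat_simps q_simps rs)
qed

lemma Rhat_consts: "a \<in> carrier R \<Longrightarrow> (\<lambda>n. q n a) \<in> carrier Rhat"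
 unfolding Rhat_carr using coh_const by (intro exI[of _ "\<lambda>n. a"]) simp

lemma Rhat_cring: "cring Rhat"
proof (rule cringI)
 have z: "\<zero>\<^bsub>Rhat\<^esub> \<in> carrier Rhat" using Rhat_consts[of \<zero>] q_simps(5)[of \<zero> \<zero>] by (simp add: Rhat_simps)
 have o: "\<one>\<^bsub>Rhat\<^esub> \<in> carrier Rhat" using Rhat_consts[of \<one>] q_simps(4)[of \<zero> \<zero>] by (simp add: Rhat_simps)
 note Qr = cring.axioms(1)[OF Q_cring]
 note ag = ring.is_abelian_group[OF Qr]
 note am = abelian_group.axioms(1)[OF ag]
 show "abelian_group Rhat"
 proof (rule abelian_groupI)
  show "\<zero>\<^bsub>Rhat\<^esub> \<in> carrier Rhat" by (rule z)
  show "x \<oplus>\<^bsub>Rhat\<^esub> y \<in> carrier Rhat" if "x \<in> carrier Rhat" "y \<in> carrier Rhat" for x y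
   by (rule Rhat_closed[OF that])
  show "x \<oplus>\<^bsub>Rhat\<^esub> y = y \<oplus>\<^bsub>Rhat\<^esub> x" if "x \<in> carrier Rhat" "y \<in> carrier Rhat" for x y
   using abelian_monoid.a_comm[OF am that[THEN Rhat_comp]] by (simp add: Rhat_simps)
  show "\<zero>\<^bsub>Rhat\<^esub> \<oplus>\<^bsub>Rhat\<^esub> x = x" if "x \<in> carrier Rhat" for x
   using abelian_monoid.l_zero[OF am Rhat_comp[OF that]] by (simp add: Rhat_simps)
  show "x \<oplus>\<^bsub>Rhat\<^esub> y \<oplus>\<^bsub>Rhat\<^esub> w = x \<oplus>\<^bsub>Rhat\<^esub> (y \<oplus>\<^bsub>Rhat\<^esub> w)"
   if "x \<in> carrier Rhat" "y \<in> carrier Rhat" "w \<in> carrier Rhat" for x y w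
   using abelian_monoid.a_assoc[OF am that[THEN Rhat_comp]] by (simp add: Rhat_simps)
 next
  fix x assume x: "x \<in> carrier Rhat"
  then obtain r where r: "coh r" "x = (\<lambda>n. q n (r n))" by (auto simp: Rhat_carr)
  then have c: "r n \<in> carrier R" for n by (auto simp: coh_def)
  let ?y = "(\<lambda>n. q n (\<ominus> \<one> \<otimes> r n))"
  have "?y \<in> carrier Rhat" unfolding Rhat_carr using coh_mult[OF coh_const[of "\<ominus> \<one>"] r(1)] by auto
  moreover have "?y \<oplus>\<^bsub>Rhat\<^esub> x = \<zero>\<^bsub>Rhat\<^esub>"
  proof
   fix n
   have "?y n \<oplus>\<^bsub>Q n\<^esub> x n = q n (\<ominus> \<one> \<otimes> r n \<oplus> r n)" using c r(2) by (simp add: q_simps)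
   also have "\<ominus> \<one> \<otimes> r n \<oplus> r n = \<zero>" using c[of n] by algebra
   finally show "(?y \<oplus>\<^bsub>Rhat\<^esub> x) n = \<zero>\<^bsub>Rhat\<^esub> n" using q_simps(5)[of \<zero> \<zero>] by (simp add: Rhat_simps)
  qed
  ultimately show "\<exists>y\<in>carrier Rhat. y \<oplus>\<^bsub>Rhat\<^esub> x = \<zero>\<^bsub>Rhat\<^esub>" by blast
 qed
 show "comm_monoid Rhat"
 proof (rule comm_monoidI)
  show "\<one>\<^bsub>Rhat\<^esub> \<in> carrier Rhat" by (rule o)
  show "x \<otimes>\<^bsub>Rhat\<^esub> y \<in> carrier Rhat" if "x \<in> carrier Rhat" "y \<in> carrier Rhat" for x y
   by (rule Rhat_closed[OF that])
  show "x \<otimes>\<^bsub>Rhat\<^esub> y = y \<otimes>\<^bsub>Rhat\<^esub> x" if "x \<in> carrier Rhat" "y \<in> carrier Rhat" for x y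
   using comm_monoid.m_comm[OF cring.axioms(2)[OF Q_cring] that[THEN Rhat_comp]] by (simp add: Rhat_simps)
  show "\<one>\<^bsub>Rhat\<^esub> \<otimes>\<^bsub>Rhat\<^esub> x = x" if "x \<in> carrier Rhat" for x
   using monoid.l_one[OF ring.is_monoid[OF Qr] Rhat_comp[OF that]] by (simp add: Rhat_simps)
  show "x \<otimes>\<^bsub>Rhat\<^esub> y \<otimes>\<^bsub>Rhat\<^esub> w = x \<otimes>\<^bsub>Rhat\<^esub> (y \<otimes>\<^bsub>Rhat\<^esub> w)"
   if "x \<in> carrier Rhat" "y \<in> carrier Rhat" "w \<in> carrier Rhat" for x y w
   using monoid.m_assoc[OF ring.is_monoid[OF Qr] that[THEN Rhat_comp]] by (simp add: Rhat_simps)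
 qed
 fix x y w assume x: "x \<in> carrier Rhat" and y: "y \<in> carrier Rhat" and w: "w \<in> carrier Rhat"
 show "(x \<oplus>\<^bsub>Rhat\<^esub> y) \<otimes>\<^bsub>Rhat\<^esub> w = x \<otimes>\<^bsub>Rhat\<^esub> w \<oplus>\<^bsub>Rhat\<^esub> y \<otimes>\<^bsub>Rhat\<^esub> w"
  using ring.ring_simprules(13)[OF Qr Rhat_comp[OF x] Rhat_comp[OF y] Rhat_comp[OF w]] by (simp add: Rhat_simps)
qed

definition Hhat :: "nat \<Rightarrow> (nat \<Rightarrow> 'a set) set"
 where "Hhat n = {x\<in>carrier Rhat. x n = \<zero>\<^bsub>Q n\<^esub>}"

lemma comp_hom: "ring_hom_ring Rhat (Q n) (\<lambda>x. x n)"
 by (rule ring_hom_ringI2[OF cring.axioms(1)[OF Rhat_cring] cring.axioms(1)[OF Q_cring]])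
  (auto simp: ring_hom_def Rhat_comp, auto simp: Rhat_simps)

lemma Hhat_ideal: "ideal (Hhat n) Rhat"
 using ring_hom_ring.kernel_is_ideal[OF comp_hom] by (simp add: Hhat_def a_kernel_def')

lemma Hhat_minus:
 assumes "x \<in> carrier Rhat" "y \<in> carrier Rhat"
 shows "x \<ominus>\<^bsub>Rhat\<^esub> y \<in> Hhat n \<longleftrightarrow> x n = y n"
proof -
 interpret h: ring_hom_ring Rhat "Q n" "\<lambda>x. x n" by (rule comp_hom)
 have "(x \<ominus>\<^bsub>Rhat\<^esub> y) n = x n \<ominus>\<^bsub>Q n\<^esub> y n" using assms by (simp add: h.R.minus_eq h.S.minus_eq)
 then show ?thesis using assms h.S.r_right_minus_eq by (simp add: Hhat_def)
qed

lemma Hhat_mk: "coh r \<Longrightarrow> (\<lambda>n. q n (r n)) \<in> Hhat n \<longleftrightarrow> r n \<in> ipow \<mm> n"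
 unfolding Hhat_def using Rhat_carr q_zero by (auto simp: coh_def)

lemma adic_Rhat: "adic R \<mm> Rhat (\<lambda>a n. q n a) Hhat"
proof (intro adic.intro adic_axioms.intro)
 show "noeth_local R \<mm>" by (rule noeth_local_axioms)
 show "cring Rhat" by (rule Rhat_cring)
 show "(\<lambda>a n. q n a) \<in> ring_hom R Rhat"
 proof (rule ring_hom_memI)
  show "(\<lambda>n. q n a) \<in> carrier Rhat" if "a \<in> carrier R" for a by (rule Rhat_consts[OF that])
 qed (simp_all add: Rhat_simps q_simps q_one)
 show "ideal (Hhat n) Rhat" for n by (rule Hhat_ideal)
 show "Hhat 0 = carrier Rhat"
  unfolding Hhat_def using Rhat_carr q_zero[of _ 0] by (auto simp: coh_def)
 show "Hhat (Suc n) \<subseteq> Hhat n" for n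
 proof
  fix x assume x: "x \<in> Hhat (Suc n)"
  then obtain r where r: "coh r" "x = (\<lambda>n. q n (r n))" by (auto simp: Hhat_def Rhat_carr)
  have "r (Suc n) \<in> ipow \<mm> n" using x r Hhat_mk ipow_decr[OF mm_ideal, of n "Suc n"] by auto
  moreover have "r n = r (Suc n) \<ominus> (r (Suc n) \<ominus> r n)"
  proof -
   have "r n \<in> carrier R" "r (Suc n) \<in> carrier R" using r by (auto simp: coh_def)
   then show ?thesis by algebra
  qed
  ultimately have "r n \<in> ipow \<mm> n" using ideal_minus[OF im, of "r (Suc n)" n "r (Suc n) \<ominus> r n"] r(1) by (simp add: coh_def)
  then show "x \<in> Hhat n" using r Hhat_mk by simp
 qed
 show "x \<otimes>\<^bsub>Rhat\<^esub> y \<in> Hhat (i + j)" if x: "x \<in> Hhat i" and y: "y \<in> Hhat j" for x i y j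
 proof -
  obtain r where r: "coh r" "x = (\<lambda>n. q n (r n))" using x by (auto simp: Hhat_def Rhat_carr)
  obtain s where s: "coh s" "y = (\<lambda>n. q n (s n))" using y by (auto simp: Hhat_def Rhat_carr)
  have c: "r n \<in> carrier R" "s n \<in> carrier R" for n using r s by (auto simp: coh_def)
  have "r i \<in> ipow \<mm> i" "s j \<in> ipow \<mm> j" using x y r s Hhat_mk by auto
  then have "r (i + j) \<in> ipow \<mm> i" "s (i + j) \<in> ipow \<mm> j"
   using ideal_diff_cancel[OF im coh_le[OF r(1), of i "i+j"]] ideal_diff_cancel[OF im coh_le[OF s(1), of j "i+j"]] c by auto
  then have "r (i + j) \<otimes> s (i + j) \<in> ipow \<mm> (i + j)" by (rule ipow_mult_mem[OF mm_ideal])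
  then have "(\<lambda>n. q n (r n \<otimes> s n)) \<in> Hhat (i + j)" using Hhat_mk[OF coh_mult[OF r(1) s(1)]] by simp
  moreover have "x \<otimes>\<^bsub>Rhat\<^esub> y = (\<lambda>n. q n (r n \<otimes> s n))" using r s c by (simp add: Rhat_simps q_simps)
  ultimately show ?thesis by simp
 qed
 show "(\<lambda>n. q n a) \<in> Hhat n \<longleftrightarrow> a \<in> ipow \<mm> n" if "a \<in> carrier R" for a n
  using Hhat_mk[OF coh_const[OF that]] by simp
 show "\<exists>a\<in>carrier R. x \<ominus>\<^bsub>Rhat\<^esub> (\<lambda>n. q n a) \<in> Hhat n" if x: "x \<in> carrier Rhat" for x n
 proof -
  obtain r where r: "coh r" "x = (\<lambda>n. q n (r n))" using x by (auto simp: Rhat_carr)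
  have c: "r n \<in> carrier R" using r by (auto simp: coh_def)
  then show ?thesis using Hhat_minus[OF x Rhat_consts[OF c]] r by auto
 qed
 show "x = \<zero>\<^bsub>Rhat\<^esub>" if "\<And>n. x \<in> Hhat n" for x
  using that by (auto simp: Hhat_def Rhat_simps)
 show "\<exists>s\<in>carrier Rhat. \<forall>n. s \<ominus>\<^bsub>Rhat\<^esub> f n \<in> Hhat n"
  if f: "\<And>n. f n \<in> carrier Rhat" "\<And>n. f (Suc n) \<ominus>\<^bsub>Rhat\<^esub> f n \<in> Hhat n" for f
 proof -
  have eq: "f (Suc n) n = f n n" for n using f Hhat_minus by blast
  \<comment> \<open>The limit is the diagonal: consecutive terms f (n+1) and f n have the same n-th
    component.\<close>
  have "(\<lambda>n. f n n) \<in> carrier Rhat"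
   unfolding Rhat_simps
  proof (intro CollectI allI conjI)
   fix n
   show "f n n \<in> carrier (Q n)" by (rule Rhat_comp[OF f(1)])
   have "f (Suc n) (Suc n) \<subseteq> f (Suc n) n" using f(1)[of "Suc n"] unfolding Rhat_simps by simp
   then show "f (Suc n) (Suc n) \<subseteq> f n n" using eq by simp
  qed
  then show ?thesis using f(1) Hhat_minus by (intro bexI[of _ "\<lambda>n. f n n"]) auto
 qed
qed

theorem asym_int_small:
 assumes "analytically_unramified R \<mm>"
 shows "\<exists>G. \<forall>I. asym_int G I \<longrightarrow> I \<subseteq> ipow \<mm> N"
 using adic.asym_int_small[OF adic_Rhat] assms by (simp add: analytically_unramified_def)

text \<open>By Krull's intersection theorem R embeds into its completion and inherits
  reducedness.\<close>

lemma reduced: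
 assumes "analytically_unramified R \<mm>" and x: "x \<in> carrier R" "x [^] (n::nat) = \<zero>"
 shows "x = \<zero>"
proof -
 interpret A: adic R \<mm> Rhat "\<lambda>a n. q n a" Hhat by (rule adic_Rhat)
 let ?u = "\<lambda>n. q n x"
 have "(\<lambda>i. q i (x [^] m)) = ?u [^]\<^bsub>Rhat\<^esub> m" for m :: nat
 proof (induct m)
  case 0 show ?case using A.iota_simps(4) by simp
 next
  case (Suc m) then show ?case using A.iota_simps(3)[of "x [^] m" x] x by simp
 qed
 then have "?u [^]\<^bsub>Rhat\<^esub> n = \<zero>\<^bsub>Rhat\<^esub>" using x A.iota_zero by metis
 then have "?u = \<zero>\<^bsub>Rhat\<^esub>" using assms(1) A.iota_simps(1)[OF x(1)] unfolding analytically_unramified_def reduced_ring_def by blast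
 then have "?u \<in> Hhat k" for k using A.A.ideal_zero[OF A.H_ideal] by simp
 then have "x \<in> ipow \<mm> k" for k using A.H_iota[OF x(1)] by simp
 then show ?thesis by (rule krull_intersection)
qed

end

section \<open>Catenary polynomial rings and integral fractions\<close>

context UP_cring
begin

lemma subr_eq_carrier:
 assumes S: "P.subr S" "\<And>a. a \<in> carrier R \<Longrightarrow> mon a 0 \<in> S" "mon \<one> 1 \<in> S"
 shows "S = carrier P"
proof -
 have "mon a n \<in> S" if a: "a \<in> carrier R" for a n
 proof (induct n)
  case 0 then show ?case using S a by auto
 next
  case (Suc n) then show ?case using monom_Suc_eq[OF a, of n] S by (simp add: P.subr_def)
 qed
 then have "p \<in> S" if "p \<in> carrier P" for p
  by (rule subr_contains_all_monoms[OF S(1) _ that]) (use that in simp)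
 then have "carrier P \<subseteq> S" by (rule subsetI)
 then show ?thesis using S by (auto simp: P.subr_def)
qed

text \<open>Coefficient lists realize R[t] on the type \<open>'a list\<close>, the one over which
  \<open>universally_catenary\<close> quantifies. The length of the list recovers the degree, which
  makes the encoding injective; the zero polynomial becomes a list with the single entry
  zero.\<close>

definition enc :: "(nat \<Rightarrow> 'a) \<Rightarrow> 'a list"
 where "enc p = map (cf p) [0..<Suc (deg R p)]"

lemma enc_inj: "inj_on enc (carrier P)"
proof (rule inj_onI)
 fix p q assume pq: "p \<in> carrier P" "q \<in> carrier P" "enc p = enc q"
 have "length (enc p) = length (enc q)" using pq(3) by simp
 then have d: "deg R p = deg R q" by (simp add: enc_def)
 show "p = q"
 proof (rule up_eqI[OF _ pq(1,2)])
  fix n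
  show "cf p n = cf q n"
  proof (cases "n \<le> deg R p")
   case True
   then have n: "n < Suc (deg R p)" by simp
   have "enc p ! n = cf p n" "enc q ! n = cf q n"
    using n d by (simp_all add: enc_def del: upt_Suc)
   then show ?thesis using pq(3) by simp
  next
   case False
   then show ?thesis using deg_aboveD[of p n] deg_aboveD[of q n] pq d by simp
  qed
 qed
qed

text \<open>The image of R[t] under \<open>enc\<close> is generated over R by the indeterminate, so
  it is catenary by hypothesis. Prime chains of R[t], saturated ones included, are carried over by
  \<open>enc\<close>.\<close>

lemma catenary_UP:
 assumes "universally_catenary R"
 shows "catenary P"
proof -
 let ?A = "image_ring enc P"
 have iso: "enc \<in> ring_iso P ?A" by (rule inj_imp_image_ring_iso[OF enc_inj])
 have "?A \<lparr> zero := enc \<zero>\<^sub>P \<rparr> = ?A" using image_ring_zero[of enc P] by simp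
 then have crA: "cring ?A" using P.ring_iso_imp_img_cring[OF iso] by simp
 interpret A: cring ?A by (rule crA)
 have hom: "enc \<in> ring_hom P ?A" using iso by (simp add: ring_iso_def)
 interpret h: ring_hom_ring P ?A enc by (rule ring_hom_ringI2[OF P.ring_axioms A.ring_axioms hom])
 have car: "carrier ?A = enc ` carrier P" by (rule image_ring_carrier)
 let ?H = "(\<lambda>a. enc (mon a 0)) ` carrier R \<union> {enc (mon \<one> 1)}"
 have Hc: "?H \<subseteq> carrier ?A" using h.hom_closed by auto
 have "generate_ring ?A ?H = carrier ?A"
 proof
  show "generate_ring ?A ?H \<subseteq> carrier ?A" by (rule A.generate_ring_incl[OF Hc])
  let ?S = "{p\<in>carrier P. enc p \<in> generate_ring ?A ?H}"
  have "?S = carrier P"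
  proof (rule subr_eq_carrier)
   show "P.subr ?S"
    unfolding P.subr_def
    by (auto simp: h.hom_zero h.hom_one h.hom_add h.hom_mult h.hom_a_inv A.zero_in_generate intro: generate_ring.intros)
   show "mon a 0 \<in> ?S" if "a \<in> carrier R" for a using that by (auto intro: generate_ring.incl)
   show "mon \<one> 1 \<in> ?S" by (auto intro: generate_ring.incl)
  qed
  then show "carrier ?A \<subseteq> generate_ring ?A ?H" unfolding car by blast
 qed
 then have gen: "generate_ring ?A ((enc \<circ> (\<lambda>a. mon a 0)) ` carrier R \<union> {enc (mon \<one> 1)}) = carrier ?A"
  by (simp only: comp_def)
 have "enc \<circ> (\<lambda>a. mon a 0) \<in> ring_hom R ?A"
  by (rule ring_hom_trans[OF const_ring_hom hom])
 moreover have "finite {enc (mon \<one> 1)} \<and> {enc (mon \<one> 1)} \<subseteq> carrier ?A \<and>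
  generate_ring ?A ((enc \<circ> (\<lambda>a. mon a 0)) ` carrier R \<union> {enc (mon \<one> 1)}) = carrier ?A"
  using Hc gen by simp
 ultimately have "finitely_generated_algebra R ?A"
  unfolding finitely_generated_algebra_def using crA by (metis (no_types, lifting))
 then have cat: "catenary ?A" using assms by (simp add: universally_catenary_def)
 have primeI: "primeideal (enc ` p) ?A" if p: "primeideal p P" for p
 proof -
  have pc: "p \<subseteq> carrier P" by (rule P.ideal_subset_carr[OF P.prime_ideal[OF p]])
  have mem: "enc z \<in> enc ` p \<longleftrightarrow> z \<in> p" if "z \<in> carrier P" for z
   using that pc enc_inj by (auto dest: inj_onD)
  note ip = P.prime_ideal[OF p]
  show ?thesis
  proof (rule A.primeidealI')
   show "ideal (enc ` p) ?A"
   proof (rule A.idealI')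
    show "enc ` p \<subseteq> carrier ?A" using pc car by auto
    show "\<zero>\<^bsub>?A\<^esub> \<in> enc ` p" using h.hom_zero P.ideal_zero[OF ip] by (metis imageI)
    show "a \<oplus>\<^bsub>?A\<^esub> b \<in> enc ` p" if "a \<in> enc ` p" "b \<in> enc ` p" for a b
    proof -
     from that obtain a' b' where *: "a = enc a'" "b = enc b'" "a' \<in> p" "b' \<in> p" by auto
     then have "a \<oplus>\<^bsub>?A\<^esub> b = enc (a' \<oplus>\<^sub>P b')" using h.hom_add[of a' b'] pc by (simp add: subset_iff)
     then show ?thesis using P.ideal_add[OF ip] * by auto
    qed
    show "r \<otimes>\<^bsub>?A\<^esub> a \<in> enc ` p" if "a \<in> enc ` p" "r \<in> carrier ?A" for a r
    proof -
     from that obtain a' r' where *: "a = enc a'" "r = enc r'" "a' \<in> p" "r' \<in> carrier P" using car by auto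
     then have "r \<otimes>\<^bsub>?A\<^esub> a = enc (r' \<otimes>\<^sub>P a')" using h.hom_mult[of r' a'] pc by (simp add: subset_iff)
     then show ?thesis using P.ideal_mult_l[OF ip] * by auto
    qed
   qed
   show "\<one>\<^bsub>?A\<^esub> \<notin> enc ` p" using mem[of "\<one>\<^sub>P"] P.prime_one[OF p] h.hom_one by simp
   fix a b assume "a \<in> carrier ?A" "b \<in> carrier ?A" "a \<otimes>\<^bsub>?A\<^esub> b \<in> enc ` p"
   then obtain a' b' where *: "a = enc a'" "b = enc b'" "a' \<in> carrier P" "b' \<in> carrier P" "a \<otimes>\<^bsub>?A\<^esub> b \<in> enc ` p"
    using car by auto
   then have "enc (a' \<otimes>\<^sub>P b') \<in> enc ` p" using h.hom_mult[of a' b'] by simp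
   then have "a' \<otimes>\<^sub>P b' \<in> p" using mem[of "a' \<otimes>\<^sub>P b'"] *(3,4) by simp
   then show "a \<in> enc ` p \<or> b \<in> enc ` p" using P.prime_mult[OF p *(3,4)] *(1,2) by auto
  qed
 qed
 have primeD: "primeideal {z\<in>carrier P. enc z \<in> q} P \<and> enc ` {z\<in>carrier P. enc z \<in> q} = q" if q: "primeideal q ?A" for q
 proof
  note iq = A.prime_ideal[OF q]
  show "primeideal {z\<in>carrier P. enc z \<in> q} P"
  proof (rule P.primeidealI'[OF P.idealI'])
   show "\<zero>\<^sub>P \<in> {z\<in>carrier P. enc z \<in> q}" using A.ideal_zero[OF iq] h.hom_zero by simp
   show "\<one>\<^sub>P \<notin> {z\<in>carrier P. enc z \<in> q}" using A.prime_one[OF q] h.hom_one by simp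
   show "a \<oplus>\<^sub>P b \<in> {z\<in>carrier P. enc z \<in> q}" if "a \<in> {z\<in>carrier P. enc z \<in> q}" "b \<in> {z\<in>carrier P. enc z \<in> q}" for a b
    using that A.ideal_add[OF iq] h.hom_add by auto
   show "r \<otimes>\<^sub>P a \<in> {z\<in>carrier P. enc z \<in> q}" if "a \<in> {z\<in>carrier P. enc z \<in> q}" "r \<in> carrier P" for a r
    using that A.ideal_mult_l[OF iq, of "enc a" "enc r"] h.hom_mult h.hom_closed by auto
   show "a \<in> {z\<in>carrier P. enc z \<in> q} \<or> b \<in> {z\<in>carrier P. enc z \<in> q}"
    if "a \<in> carrier P" "b \<in> carrier P" "a \<otimes>\<^sub>P b \<in> {z\<in>carrier P. enc z \<in> q}" for a b
    using that A.prime_mult[OF q, of "enc a" "enc b"] h.hom_mult h.hom_closed by auto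
  qed auto
  show "enc ` {z\<in>carrier P. enc z \<in> q} = q" using A.ideal_subset_carr[OF iq] car by auto
 qed
 have sub: "p \<subset> q \<longleftrightarrow> enc ` p \<subset> enc ` q" if "p \<subseteq> carrier P" "q \<subseteq> carrier P" for p q
 proof -
  have "p \<subseteq> q \<longleftrightarrow> enc ` p \<subseteq> enc ` q"
   using that enc_inj by (metis image_mono inj_on_image_mem_iff subset_iff image_eqI)
  then show ?thesis using inj_on_image_eq_iff[OF enc_inj that] by (simp add: psubset_eq)
 qed
 have pcar: "p \<subseteq> carrier P" if "primeideal p P" for p by (rule P.ideal_subset_carr[OF P.prime_ideal[OF that]])
 have chain: "prime_chain ?A n (\<lambda>i. enc ` C i)" if "prime_chain P n C" for n C
  using that primeI sub pcar unfolding prime_chain_def by (metis Suc_leI less_imp_le_nat)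
 have satchain: "saturated_prime_chain ?A n (\<lambda>i. enc ` C i)" if s: "saturated_prime_chain P n C" for n C
  unfolding saturated_prime_chain_def
 proof (intro conjI allI impI notI)
  show "prime_chain ?A n (\<lambda>i. enc ` C i)" using chain s by (simp add: saturated_prime_chain_def)
  fix i assume i: "i < n" and "\<exists>\<qq>. primeideal \<qq> ?A \<and> enc ` C i \<subset> \<qq> \<and> \<qq> \<subset> enc ` C (Suc i)"
  then obtain \<qq> where q: "primeideal \<qq> ?A" "enc ` C i \<subset> \<qq>" "\<qq> \<subset> enc ` C (Suc i)" by (elim exE conjE)
  define \<qq>' where "\<qq>' = {z\<in>carrier P. enc z \<in> \<qq>}"
  have q': "primeideal \<qq>' P" "enc ` \<qq>' = \<qq>" using primeD[OF q(1)] by (auto simp: \<qq>'_def)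
  have Cp: "primeideal (C i) P" "primeideal (C (Suc i)) P" using s i by (simp_all add: saturated_prime_chain_def prime_chain_def)
  have "C i \<subset> \<qq>'" "\<qq>' \<subset> C (Suc i)"
   using sub[OF pcar[OF Cp(1)] pcar[OF q'(1)]] sub[OF pcar[OF q'(1)] pcar[OF Cp(2)]] q(2,3) q'(2) by simp_all
  then show False using s i q'(1) by (auto simp: saturated_prime_chain_def)
 qed
 show ?thesis
  unfolding catenary_def
 proof (intro allI impI)
  fix p q assume pq: "primeideal p P \<and> primeideal q P \<and> p \<subseteq> q"
  then have *: "primeideal (enc ` p) ?A \<and> primeideal (enc ` q) ?A \<and> enc ` p \<subseteq> enc ` q" using primeI by blast
  from cat[unfolded catenary_def, rule_format, OF *]
  have c1: "\<exists>b. \<forall>n C. prime_chain ?A n C \<and> C 0 = enc ` p \<and> C n = enc ` q \<longrightarrow> n \<le> b"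
   and c2: "\<And>n C n' C'. saturated_prime_chain ?A n C \<and> C 0 = enc ` p \<and> C n = enc ` q \<and>
    saturated_prime_chain ?A n' C' \<and> C' 0 = enc ` p \<and> C' n' = enc ` q \<Longrightarrow> n = n'" by blast+
  show "(\<exists>b. \<forall>n C. prime_chain P n C \<and> C 0 = p \<and> C n = q \<longrightarrow> n \<le> b) \<and>
   (\<forall>n C n' C'. saturated_prime_chain P n C \<and> C 0 = p \<and> C n = q \<and>
    saturated_prime_chain P n' C' \<and> C' 0 = p \<and> C' n' = q \<longrightarrow> n = n')"
  proof (intro conjI allI impI)
   show "\<exists>b. \<forall>n C. prime_chain P n C \<and> C 0 = p \<and> C n = q \<longrightarrow> n \<le> b" using c1 chain by metis
   fix n C n' C' assume "saturated_prime_chain P n C \<and> C 0 = p \<and> C n = q \<and>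
    saturated_prime_chain P n' C' \<and> C' 0 = p \<and> C' n' = q"
   then show "n = n'" by (intro c2[of n "\<lambda>i. enc ` C i" n' "\<lambda>i. enc ` C' i"]) (simp add: satchain)
  qed
 qed
qed

section \<open>Extension and contraction of ideals between R and R[t]\<close>

definition ext :: "'a set \<Rightarrow> (nat \<Rightarrow> 'a) set"
 where "ext I = {F\<in>carrier P. \<forall>n. cf F n \<in> I}"

lemma ext_ideal: "ideal I R \<Longrightarrow> ideal (ext I) P"
proof (rule P.idealI')
 assume I: "ideal I R"
 show "ext I \<subseteq> carrier P" by (auto simp: ext_def)
 show "\<zero>\<^sub>P \<in> ext I" using R.ideal_zero[OF I] by (simp add: ext_def)
 show "a \<oplus>\<^sub>P b \<in> ext I" if "a \<in> ext I" "b \<in> ext I" for a b using that R.ideal_add[OF I] by (simp add: ext_def)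
 fix F H assume F: "F \<in> ext I" and H: "H \<in> carrier P"
 have "cf (H \<otimes>\<^sub>P F) n \<in> I" for n
  using F H by (intro coeff_mult_mem[OF _ _ I]) (auto simp: ext_def intro: R.ideal_mult_l[OF I])
 then show "H \<otimes>\<^sub>P F \<in> ext I" using F H by (simp add: ext_def)
qed

text \<open>As in Gauss's lemma: for the lowest coefficients of F and H outside p, all other terms
  of the corresponding coefficient of F H lie in p.\<close>

lemma ext_prime:
 assumes p: "primeideal p R"
 shows "primeideal (ext p) P"
proof (rule P.primeidealI')
 note ip = R.prime_ideal[OF p]
 show "ideal (ext p) P" by (rule ext_ideal[OF ip])
 have "cf \<one>\<^sub>P 0 \<notin> p" using R.prime_one[OF p] by simp
 then show "\<one>\<^sub>P \<notin> ext p" unfolding ext_def by blast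
 fix F H assume FH: "F \<in> carrier P" "H \<in> carrier P" "F \<otimes>\<^sub>P H \<in> ext p"
 show "F \<in> ext p \<or> H \<in> ext p"
 proof (rule ccontr)
  assume n: "\<not> ?thesis"
  define i where "i = (LEAST i. cf F i \<notin> p)"
  define j where "j = (LEAST j. cf H j \<notin> p)"
  have ij: "cf F i \<notin> p" "cf H j \<notin> p"
  proof -
   obtain i' j' where "cf F i' \<notin> p" "cf H j' \<notin> p" using n FH unfolding ext_def by blast
   then show "cf F i \<notin> p" "cf H j \<notin> p" unfolding i_def j_def by (metis (mono_tags, lifting) LeastI)+
  qed
  have lo: "cf F i' \<in> p" if "i' < i" for i' using not_less_Least that unfolding i_def by blast
  have lo': "cf H j' \<in> p" if "j' < j" for j' using not_less_Least that unfolding j_def by blast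
  let ?f = "\<lambda>k. cf F k \<otimes> cf H (i + j - k)"
  have fc: "?f \<in> {..i + j} \<rightarrow> carrier R" using FH by auto
  have "cf (F \<otimes>\<^sub>P H) (i + j) = finsum R ?f {..i + j}" using FH by simp
  also have "{..i + j} = insert i ({..i + j} - {i})" by auto
  also have "finsum R ?f \<dots> = ?f i \<oplus> finsum R ?f ({..i + j} - {i})"
   using FH by (intro R.finsum_insert) auto
  finally have eq: "cf (F \<otimes>\<^sub>P H) (i + j) = ?f i \<oplus> finsum R ?f ({..i + j} - {i})" .
  have rest: "finsum R ?f ({..i + j} - {i}) \<in> p"
  proof (rule finsum_ideal[OF ip])
   fix k assume k: "k \<in> {..i + j} - {i}"
   show "?f k \<in> p"
   proof (cases "k < i")
    case True then show ?thesis using lo FH by (auto intro: R.ideal_mult_r[OF ip])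
   next
    case False then have "i + j - k < j" using k by auto
    then show ?thesis using lo' FH by (auto intro: R.ideal_mult_l[OF ip])
   qed
  qed simp
  have "cf (F \<otimes>\<^sub>P H) (i + j) \<in> p" using FH(3) by (simp add: ext_def)
  then have "cf (F \<otimes>\<^sub>P H) (i + j) \<ominus> finsum R ?f ({..i + j} - {i}) \<in> p" using rest by (rule R.ideal_minus[OF ip])
  moreover have "(?f i \<oplus> finsum R ?f ({..i + j} - {i})) \<ominus> finsum R ?f ({..i + j} - {i}) = ?f i"
   using FH R.ideal_carr[OF ip rest] by (simp add: R.minus_eq R.a_assoc R.r_neg)
  ultimately have "?f i \<in> p" unfolding eq by simp
  then have "cf F i \<otimes> cf H j \<in> p" by simp
  then show False using R.prime_mult[OF p, of "cf F i" "cf H j"] ij FH(1,2) by auto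
 qed
qed

lemma const_in_ext: "ideal I R \<Longrightarrow> a \<in> carrier R \<Longrightarrow> mon a 0 \<in> ext I \<longleftrightarrow> a \<in> I"
proof
 assume I: "ideal I R" "a \<in> carrier R"
 show "a \<in> I" if "mon a 0 \<in> ext I"
 proof -
  have "cf (mon a 0) 0 \<in> I" using that unfolding ext_def by blast
  then show ?thesis using I by simp
 qed
 show "mon a 0 \<in> ext I" if "a \<in> I" using that I R.ideal_zero[OF I(1)] by (simp add: ext_def)
qed

lemma ext_mono: "I \<subseteq> J \<Longrightarrow> ext I \<subseteq> ext J"
 by (auto simp: ext_def)

lemma ext_strict: "ideal I R \<Longrightarrow> ideal J R \<Longrightarrow> I \<subset> J \<Longrightarrow> ext I \<subset> ext J"
proof -
 assume *: "ideal I R" "ideal J R" "I \<subset> J"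
 then obtain a where a: "a \<in> J" "a \<notin> I" by auto
 then have "a \<in> carrier R" using R.ideal_carr[OF *(2)] by auto
 then have "mon a 0 \<in> ext J" "mon a 0 \<notin> ext I" using a * const_in_ext by auto
 then show ?thesis using ext_mono[of I J] * by auto
qed

lemma contract_prime:
 assumes "primeideal Q P"
 shows "primeideal {a\<in>carrier R. mon a 0 \<in> Q} R"
proof (rule R.primeidealI'[OF R.idealI'])
 note iQ = P.prime_ideal[OF assms]
 show "\<zero> \<in> {a\<in>carrier R. mon a 0 \<in> Q}" using P.ideal_zero[OF iQ] by simp
 show "\<one> \<notin> {a\<in>carrier R. mon a 0 \<in> Q}" using P.prime_one[OF assms] by simp
 show "a \<oplus> b \<in> {a\<in>carrier R. mon a 0 \<in> Q}"
  if "a \<in> {a\<in>carrier R. mon a 0 \<in> Q}" "b \<in> {a\<in>carrier R. mon a 0 \<in> Q}" for a b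
  using that P.ideal_add[OF iQ] by simp
 show "r \<otimes> a \<in> {a\<in>carrier R. mon a 0 \<in> Q}"
  if "a \<in> {a\<in>carrier R. mon a 0 \<in> Q}" "r \<in> carrier R" for a r
  using that P.ideal_mult_l[OF iQ, of "mon a 0" "mon r 0"] monom_mult[of r a 0 0] by simp
 show "a \<in> {a\<in>carrier R. mon a 0 \<in> Q} \<or> b \<in> {a\<in>carrier R. mon a 0 \<in> Q}"
  if "a \<in> carrier R" "b \<in> carrier R" "a \<otimes> b \<in> {a\<in>carrier R. mon a 0 \<in> Q}" for a b
  using that P.prime_mult[OF assms, of "mon a 0" "mon b 0"] monom_mult[of a b 0 0] by simp
qed auto

end

text \<open>A chain of maximal length between two primes admits no insertion. Such a chain exists
  because of the length bound, which is part of \<open>catenary\<close>.\<close>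

lemma saturated_refinement:
 assumes chain: "prime_chain A n C" "C 0 = p" "C n = q"
  and bound: "\<forall>n C. prime_chain A n C \<and> C 0 = p \<and> C n = q \<longrightarrow> n \<le> b"
 shows "\<exists>m C. n \<le> m \<and> saturated_prime_chain A m C \<and> C 0 = p \<and> C m = q"
proof -
 let ?S = "{m. \<exists>C. prime_chain A m C \<and> C 0 = p \<and> C m = q}"
 have fin: "finite ?S" by (rule finite_subset[of _ "{..b}"]) (use bound in auto)
 have nS: "n \<in> ?S" using chain by blast
 define m where "m = Max ?S"
 have "m \<in> ?S" unfolding m_def using Max_in[OF fin] nS by blast
 then obtain D where D: "prime_chain A m D" "D 0 = p" "D m = q" by blast
 have nm: "n \<le> m" unfolding m_def using Max_ge[OF fin nS] .
 have "saturated_prime_chain A m D"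
  unfolding saturated_prime_chain_def
 proof (intro conjI allI impI notI)
  show "prime_chain A m D" by (rule D)
  fix i assume i: "i < m" and "\<exists>\<qq>. primeideal \<qq> A \<and> D i \<subset> \<qq> \<and> \<qq> \<subset> D (Suc i)"
  then obtain r where r: "primeideal r A" "D i \<subset> r" "r \<subset> D (Suc i)" by (elim exE conjE)
  define E where "E j = (if j \<le> i then D j else if j = Suc i then r else D (j - 1))" for j
  have "prime_chain A (Suc m) E"
   unfolding prime_chain_def
  proof (intro conjI allI impI)
   fix j assume "j \<le> Suc m"
   then show "primeideal (E j) A" using D(1) r(1) i by (auto simp: E_def prime_chain_def)
  next
   fix j assume j: "j < Suc m"
   consider "Suc j \<le> i" | "j = i" | "j = Suc i" | "Suc i < j" by linarith
   then show "E j \<subset> E (Suc j)"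
   proof cases
    case 1 then show ?thesis using D(1) i by (simp add: E_def prime_chain_def)
   next
    case 2 then show ?thesis using r by (simp add: E_def)
   next
    case 3 then show ?thesis using r by (simp add: E_def)
   next
    case 4
    then have "j - 1 < m" using j by simp
    then have "D (j - 1) \<subset> D (Suc (j - 1))" using D(1) unfolding prime_chain_def by blast
    then show ?thesis using 4 by (simp add: E_def)
   qed
  qed
  moreover have "E 0 = p" "E (Suc m) = q" using D i by (auto simp: E_def)
  ultimately have "Suc m \<in> ?S" by blast
  then show False using Max_ge[OF fin, of "Suc m"] unfolding m_def[symmetric] by simp
 qed
 then show ?thesis using nm D by blast
qed

context UP_cring
begin

lemma const_T_decomp:
 assumes F: "F \<in> carrier P"
 shows "F \<ominus>\<^sub>P mon (cf F 0) 0 \<in> PIdl\<^sub>P (mon \<one> 1)"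
proof -
 let ?T = "mon \<one> 1"
 let ?c = "\<lambda>F. mon (cf F 0) 0"
 have T: "?T \<in> carrier P" by simp
 note iT = P.cgenideal_ideal[OF T]
 let ?S = "{F\<in>carrier P. F \<ominus>\<^sub>P ?c F \<in> PIdl\<^sub>P ?T}"
 have "?S = carrier P"
 proof (rule subr_eq_carrier)
  show "P.subr ?S"
   unfolding P.subr_def
  proof (intro conjI ballI)
   show "\<zero>\<^sub>P \<in> ?S" "\<one>\<^sub>P \<in> ?S" using P.ideal_zero[OF iT] by (simp_all add: P.minus_eq P.r_neg)
   fix F assume F: "F \<in> ?S"
   have cF: "F \<in> carrier P" "?c F \<in> carrier P" using F by auto
   have "\<ominus>\<^sub>P F \<ominus>\<^sub>P \<ominus>\<^sub>P ?c F = \<ominus>\<^sub>P (F \<ominus>\<^sub>P ?c F)" using cF by algebra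
   moreover have "?c (\<ominus>\<^sub>P F) = \<ominus>\<^sub>P ?c F" using cF by simp
   ultimately show "\<ominus>\<^sub>P F \<in> ?S" using F P.ideal_uminus[OF iT] by simp
   fix G assume G: "G \<in> ?S"
   have cG: "G \<in> carrier P" "?c G \<in> carrier P" using G by auto
   have "(F \<oplus>\<^sub>P G) \<ominus>\<^sub>P (?c F \<oplus>\<^sub>P ?c G) = (F \<ominus>\<^sub>P ?c F) \<oplus>\<^sub>P (G \<ominus>\<^sub>P ?c G)" using cF cG by algebra
   moreover have "?c (F \<oplus>\<^sub>P G) = ?c F \<oplus>\<^sub>P ?c G" using cF cG by simp
   ultimately show "F \<oplus>\<^sub>P G \<in> ?S" using F G P.ideal_add[OF iT] by simp
   have "(F \<otimes>\<^sub>P G) \<ominus>\<^sub>P (?c F \<otimes>\<^sub>P ?c G) = G \<otimes>\<^sub>P (F \<ominus>\<^sub>P ?c F) \<oplus>\<^sub>P ?c F \<otimes>\<^sub>P (G \<ominus>\<^sub>P ?c G)" using cF cG by algebra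
   moreover have "?c (F \<otimes>\<^sub>P G) = ?c F \<otimes>\<^sub>P ?c G"
    using cF cG monom_mult[of "cf F 0" "cf G 0" 0 0] by simp
   moreover have "G \<otimes>\<^sub>P (F \<ominus>\<^sub>P ?c F) \<oplus>\<^sub>P ?c F \<otimes>\<^sub>P (G \<ominus>\<^sub>P ?c G) \<in> PIdl\<^sub>P ?T"
    using F G cF cG by (intro P.ideal_add[OF iT] P.ideal_mult_l[OF iT]) auto
   ultimately show "F \<otimes>\<^sub>P G \<in> ?S" using cF cG by (simp del: monom_mult)
  qed auto
  show "mon a 0 \<in> ?S" if "a \<in> carrier R" for a
   using that P.ideal_zero[OF iT] by (simp add: P.minus_eq P.r_neg)
  show "?T \<in> ?S" using P.cgenideal_self[OF T] by (simp add: P.minus_eq)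
 qed
 then show ?thesis using F by blast
qed

lemma prime_with_T:
 assumes Q: "primeideal Q P" and T: "mon \<one> 1 \<in> Q" and F: "F \<in> carrier P"
 shows "F \<in> Q \<longleftrightarrow> mon (cf F 0) 0 \<in> Q"
proof -
 note iQ = P.prime_ideal[OF Q]
 let ?c = "mon (cf F 0) 0"
 have d: "F \<ominus>\<^sub>P ?c \<in> Q" using const_T_decomp[OF F] P.cgenideal_minimal[OF iQ T] by blast
 have c: "?c \<in> carrier P" using F by simp
 show ?thesis
 proof
  assume a: "F \<in> Q"
  have "?c = F \<ominus>\<^sub>P (F \<ominus>\<^sub>P ?c)" using c F by algebra
  also have "\<dots> \<in> Q" by (rule P.ideal_minus[OF iQ a d])
  finally show "?c \<in> Q" .
 next
  assume "?c \<in> Q" then show "F \<in> Q" by (rule P.ideal_diff_cancel[OF iQ d _ F])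
 qed
qed

text \<open>
 The prime \<open>QQ\<close> in the proof below is the kernel of the evaluation of polynomials over \<open>R/p\<close> at \<open>a/\<alpha>\<close>;
 if \<open>\<alpha>/a\<close> is not integral over \<open>R/p\<close>, this kernel lies in the maximal ideal generated by \<open>\<mm>\<close> and
 the indeterminate, and catenarity of the polynomial ring is contradicted.
\<close>

theorem integral_fraction:
 assumes loc: "noeth_local R \<mm>" and cat: "catenary P"
  and p: "primeideal p R"
  and c: "a \<in> carrier R" "b \<in> carrier R" "\<alpha> \<in> carrier R" "\<beta> \<in> carrier R"
  and ap: "a \<notin> p" and rel: "\<alpha> \<otimes> b \<ominus> \<beta> \<otimes> a \<in> p"
  and ht: "\<And>p'. primeideal p' R \<Longrightarrow> p \<subseteq> p' \<Longrightarrow> a \<in> p' \<Longrightarrow> b \<in> p' \<Longrightarrow> \<exists>p1. primeideal p1 R \<and> p \<subset> p1 \<and> p1 \<subset> p'"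
 shows "\<exists>r. \<alpha> [^] Suc r \<in> (PIdl\<^bsub>R\<^esub> a) \<cdot> R.ipow (PIdl\<^bsub>R\<^esub> \<alpha> <+>\<^bsub>R\<^esub> PIdl\<^bsub>R\<^esub> a) r <+>\<^bsub>R\<^esub> p"
proof (rule ccontr)
 assume neg: "\<not> ?thesis"
 interpret L: noeth_local R \<mm> by (rule loc)
 interpret NP: noetherian_cring P using noetherian_UP[OF L.noetherian_ring_axioms] P.cring_axioms by (rule noetherian_cringI)
 note ip = R.prime_ideal[OF p]
 let ?con = "\<lambda>r. mon r 0"
 let ?T = "mon \<one> 1"
 let ?Y = "PIdl\<^bsub>R\<^esub> \<alpha> <+>\<^bsub>R\<^esub> PIdl\<^bsub>R\<^esub> a"
 let ?J = "\<lambda>r. (PIdl\<^bsub>R\<^esub> a) \<cdot> R.ipow ?Y r"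
 note ia = R.cgenideal_ideal[OF c(1)] and ial = R.cgenideal_ideal[OF c(3)]
 note iY = R.add_ideals[OF ial ia]
 note iYn = R.ipow_ideal[OF iY]
 have iJ: "ideal (?J r) R" for r by (intro R.ideal_prod_is_ideal ia iYn)
 have aY: "a \<in> ?Y" "\<alpha> \<in> ?Y"
  using R.set_add_upper1[OF ial ia] R.set_add_upper2[OF ial ia] R.cgenideal_self c(1,3) by blast+
 have Jmem: "x \<in> ?J r \<longleftrightarrow> (\<exists>y\<in>R.ipow ?Y r. x = a \<otimes> y)" for x r by (rule R.PIdl_prod[OF c(1) iYn])
 have al: "\<alpha> \<notin> p"
 proof
  assume "\<alpha> \<in> p"
  then have "\<alpha> \<in> ?J 0 <+>\<^bsub>R\<^esub> p" using R.set_add_upper2[OF iJ ip] by (rule subsetD[rotated])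
  moreover have "\<alpha> [^] Suc 0 = \<alpha>" using c by simp
  ultimately have "\<alpha> [^] Suc 0 \<in> ?J 0 <+>\<^bsub>R\<^esub> p" by (simp only:)
  then show False using neg by blast
 qed
 \<comment> \<open>g = \<alpha>T - a vanishes at T = a/\<alpha>; the constants
   \<open>con_al n\<close> = \<alpha>^n clear the denominators of that evaluation.\<close>
 define g where "g = ?con \<alpha> \<otimes>\<^sub>P ?T \<ominus>\<^sub>P ?con a"
 have gc: "g \<in> carrier P" using c by (simp add: g_def)
 note ig = P.cgenideal_ideal[OF gc]
 note iext = ext_ideal[OF ip]
 define con_al where "con_al n = ?con (\<alpha> [^] n)" for n :: nat
 have cal: "con_al n \<in> carrier P" for n using c by (simp add: con_al_def)
 have cal_add: "con_al (n + m) = con_al n \<otimes>\<^sub>P con_al m" for n m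
  unfolding con_al_def using c monom_mult[of "\<alpha> [^] n" "\<alpha> [^] m" 0 0] by (simp add: R.nat_pow_mult)
 have con_m: "?con x \<otimes>\<^sub>P ?con y = ?con (x \<otimes> y)" if "x \<in> carrier R" "y \<in> carrier R" for x y
  using monom_mult[OF that, of 0 0] by simp

 \<comment> \<open>Pseudo-division by g: modulo g, \<alpha>^(d+1) F becomes the constant r =
   \<alpha>^(d+1) F(a/\<alpha>). All terms except that of F(0) carry a factor a, so r is F(0)
   \<alpha>^(d+1) up to an element of a (\<alpha>, a)^d.\<close>
 have red: "\<exists>d r. r \<in> carrier R \<and> con_al (Suc d) \<otimes>\<^sub>P F \<ominus>\<^sub>P ?con r \<in> PIdl\<^sub>P g \<and> r \<ominus> cf F 0 \<otimes> \<alpha> [^] Suc d \<in> ?J d"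
  if F: "F \<in> carrier P" for F
 proof -
  have "\<forall>F\<in>carrier P. (\<forall>i>n. cf F i = \<zero>) \<longrightarrow> (\<exists>d. \<exists>r\<in>R.ipow ?Y (Suc d).
   con_al (Suc d) \<otimes>\<^sub>P F \<ominus>\<^sub>P ?con r \<in> PIdl\<^sub>P g \<and> r \<ominus> cf F 0 \<otimes> \<alpha> [^] Suc d \<in> ?J d)" for n
  proof (induct n)
   case 0
   show ?case
   proof (intro ballI impI exI[of _ 0])
    fix F assume F: "F \<in> carrier P" "\<forall>i>0. cf F i = \<zero>"
    let ?x = "cf F 0"
    have x: "?x \<in> carrier R" using F(1) by simp
    have "F = ?con ?x" using F by (intro up_eqI) auto
    then have "con_al (Suc 0) \<otimes>\<^sub>P F = ?con (?x \<otimes> \<alpha>)" unfolding con_al_def using c x con_m[of \<alpha> ?x] by (metis R.m_comm R.nat_pow_Suc R.nat_pow_0 R.l_one)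
    then have 1: "con_al (Suc 0) \<otimes>\<^sub>P F \<ominus>\<^sub>P ?con (?x \<otimes> \<alpha>) \<in> PIdl\<^sub>P g"
     using P.ideal_zero[OF ig] c x by (simp add: P.minus_eq P.r_neg)
    have 2: "?x \<otimes> \<alpha> \<ominus> ?x \<otimes> \<alpha> [^] Suc 0 \<in> ?J 0" using R.ideal_zero[OF iJ[of 0]] c x by (simp add: R.minus_eq R.r_neg)
    have "?x \<otimes> \<alpha> \<in> R.ipow ?Y (Suc 0)" unfolding R.ipow_1[OF iY] by (rule R.ideal_mult_l[OF iY aY(2) x])
    then show "\<exists>r\<in>R.ipow ?Y (Suc 0). con_al (Suc 0) \<otimes>\<^sub>P F \<ominus>\<^sub>P ?con r \<in> PIdl\<^sub>P g \<and> r \<ominus> ?x \<otimes> \<alpha> [^] Suc 0 \<in> ?J 0"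
     using 1 2 by (intro bexI[of _ "?x \<otimes> \<alpha>"] conjI)
   qed
  next
   case (Suc n)
   show ?case
   proof (intro ballI impI)
    fix F assume F: "F \<in> carrier P" "\<forall>i>Suc n. cf F i = \<zero>"
    let ?x = "cf F 0"
    have x: "?x \<in> carrier R" using F(1) by simp
    obtain H where H: "H \<in> carrier P" "F \<ominus>\<^sub>P ?con ?x = H \<otimes>\<^sub>P ?T" using const_T_decomp[OF F(1)] unfolding P.cgen_iff by blast
    have Hi: "cf H i = cf F (Suc i)" for i
    proof -
     have "cf (F \<ominus>\<^sub>P ?con ?x) (Suc i) = cf F (Suc i)" using F(1) x by (simp add: coeff_minus R.minus_eq)
     moreover have "H \<otimes>\<^sub>P ?T = ?T \<otimes>\<^sub>P H" using H(1) by (intro P.m_comm) simp_all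
     moreover have "cf (?T \<otimes>\<^sub>P H) (Suc i) = cf H i"
      using coeff_monom_mult[of \<one> H 1 i] H(1) by (simp del: coeff_mult)
     ultimately show ?thesis unfolding H(2) by (simp only:)
    qed
    then obtain d r where r: "r \<in> R.ipow ?Y (Suc d)" "con_al (Suc d) \<otimes>\<^sub>P H \<ominus>\<^sub>P ?con r \<in> PIdl\<^sub>P g"
     using bspec[OF Suc H(1)] F(2) by auto
    have rc: "r \<in> carrier R" by (rule R.ideal_carr[OF iYn r(1)])
    let ?p = "\<alpha> [^] Suc (Suc d)"
    have pc: "?p \<in> carrier R" using c by (intro R.nat_pow_closed)
    let ?r = "?x \<otimes> ?p \<oplus> a \<otimes> r"
    have cc: "?con ?x \<in> carrier P" "?con r \<in> carrier P" "?con a \<in> carrier P" "?con \<alpha> \<in> carrier P" "?T \<in> carrier P" using x rc c by simp_all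
    have A: "con_al (Suc (Suc d)) = con_al (Suc d) \<otimes>\<^sub>P ?con \<alpha>" using cal_add[of "Suc d" 1] c by (simp add: con_al_def)
    have r': "?con ?r = ?con ?x \<otimes>\<^sub>P con_al (Suc (Suc d)) \<oplus>\<^sub>P ?con a \<otimes>\<^sub>P ?con r"
     unfolding con_al_def con_m[OF x pc] con_m[OF c(1) rc] using x pc c(1) rc by (intro monom_add) auto
    have "F = ?con ?x \<oplus>\<^sub>P H \<otimes>\<^sub>P ?T" unfolding H(2)[symmetric] using F(1) cc(1) by algebra
    then have "con_al (Suc (Suc d)) \<otimes>\<^sub>P F \<ominus>\<^sub>P ?con ?r = con_al (Suc (Suc d)) \<otimes>\<^sub>P (?con ?x \<oplus>\<^sub>P H \<otimes>\<^sub>P ?T) \<ominus>\<^sub>P ?con ?r" by simp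
    also have "\<dots> = (con_al (Suc d) \<otimes>\<^sub>P H) \<otimes>\<^sub>P g \<oplus>\<^sub>P ?con a \<otimes>\<^sub>P (con_al (Suc d) \<otimes>\<^sub>P H \<ominus>\<^sub>P ?con r)"
     unfolding r' A g_def using cc H(1) cal[of "Suc d"] by algebra
    also have "\<dots> \<in> PIdl\<^sub>P g"
     by (intro P.ideal_add[OF ig] P.ideal_mult_l[OF ig] P.cgenideal_self gc r(2) P.m_closed cal H(1) cc)
    finally have 1: "con_al (Suc (Suc d)) \<otimes>\<^sub>P F \<ominus>\<^sub>P ?con ?r \<in> PIdl\<^sub>P g" .
    have "?r \<ominus> ?x \<otimes> ?p = a \<otimes> r" using x pc c(1) rc by algebra
    moreover have "a \<otimes> r \<in> ?J (Suc d)" unfolding Jmem using r(1) by blast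
    ultimately have 2: "?r \<ominus> ?x \<otimes> ?p \<in> ?J (Suc d)" by (simp only:)
    have "a \<otimes> r = r \<otimes> a" by (rule R.m_comm[OF c(1) rc])
    also have "r \<otimes> a \<in> R.ipow ?Y (Suc (Suc d))" unfolding R.ipow_Suc[of _ "Suc d"] using r(1) aY(1) by (rule ideal_prod.prod)
    finally have ar: "a \<otimes> r \<in> R.ipow ?Y (Suc (Suc d))" .
    have "?r \<in> R.ipow ?Y (Suc (Suc d))"
     by (rule R.ideal_add[OF iYn R.ideal_mult_l[OF iYn R.pow_mem_ipow[OF iY aY(2)] x] ar])
    then show "\<exists>d. \<exists>r\<in>R.ipow ?Y (Suc d). con_al (Suc d) \<otimes>\<^sub>P F \<ominus>\<^sub>P ?con r \<in> PIdl\<^sub>P g \<and> r \<ominus> ?x \<otimes> \<alpha> [^] Suc d \<in> ?J d"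
     using 1 2 by (intro exI[of _ "Suc d"] bexI[of _ ?r] conjI)
   qed
  qed
  from bspec[OF this[of "deg R F"] F] show ?thesis using deg_aboveD[OF _ F] R.ideal_carr[OF iYn] by blast
 qed

 let ?K = "ext p <+>\<^sub>P PIdl\<^sub>P g"
 note iK = P.add_ideals[OF iext ig]
 \<comment> \<open>The kernel of the evaluation is (p, g) saturated with respect to the powers of
   \<alpha>. It contracts to p by \<open>conQ\<close>.\<close>
 define QQ where "QQ = {F\<in>carrier P. \<exists>n. con_al n \<otimes>\<^sub>P F \<in> ?K}"
 have coeff_g: "cf (g \<otimes>\<^sub>P H) (Suc i) = \<alpha> \<otimes> cf H i \<ominus> a \<otimes> cf H (Suc i)" if H: "H \<in> carrier P" for H i
 proof -
  have "g \<otimes>\<^sub>P H = ?con \<alpha> \<otimes>\<^sub>P (mon \<one> (Suc 0) \<otimes>\<^sub>P H) \<ominus>\<^sub>P ?con a \<otimes>\<^sub>P H"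
   unfolding g_def using c H by (simp add: P.minus_eq P.l_distr P.l_minus P.m_assoc)
  also have "\<dots> = \<alpha> \<odot>\<^bsub>P\<^esub> (mon \<one> (Suc 0) \<otimes>\<^sub>P H) \<ominus>\<^sub>P a \<odot>\<^bsub>P\<^esub> H"
   using c H by (simp add: monom_mult_is_smult)
  moreover have "cf (mon \<one> (Suc 0) \<otimes>\<^sub>P H) (Suc i) = cf H i"
   using coeff_monom_mult[of \<one> H "Suc 0" i] H by simp
  ultimately show ?thesis using c H by (simp del: coeff_mult add: coeff_minus)
 qed
 have key: "cf H i \<in> p" if H: "H \<in> carrier P" "\<And>i. i \<ge> n \<Longrightarrow> cf (g \<otimes>\<^sub>P H) (Suc i) \<in> p" and i: "i \<ge> n" for H n i
 proof -
  have "\<forall>i\<ge>n. i + j \<ge> Suc (deg R H) \<longrightarrow> cf H i \<in> p" for j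
  proof (induct j)
   case 0 then show ?case using deg_aboveD[OF _ H(1)] R.ideal_zero[OF ip] by auto
  next
   case (Suc j)
   show ?case
   proof (intro allI impI)
    fix i assume i: "n \<le> i" "Suc (deg R H) \<le> i + Suc j"
    then have s: "cf H (Suc i) \<in> p" using Suc by simp
    have "\<alpha> \<otimes> cf H i \<ominus> a \<otimes> cf H (Suc i) \<in> p" using H(2)[OF i(1)] coeff_g[OF H(1)] by simp
    then have "\<alpha> \<otimes> cf H i \<in> p"
     using R.ideal_diff_cancel[OF ip _ R.ideal_mult_l[OF ip s c(1)]] c H(1) by simp
    then show "cf H i \<in> p" using R.prime_mult[OF p c(3)] al H(1) by auto
   qed
  qed
  from this[of "Suc (deg R H)"] show ?thesis using i by simp
 qed
 have conK: "x \<in> p" if x: "x \<in> carrier R" "?con x \<in> ?K" for x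
 proof -
  obtain E H where EH: "E \<in> ext p" "H \<in> carrier P" "?con x = E \<oplus>\<^sub>P H \<otimes>\<^sub>P g" using x(2) P.mem_add_cgen by blast
  have Ec: "E \<in> carrier P" using EH by (simp add: ext_def)
  have eq: "g \<otimes>\<^sub>P H = ?con x \<ominus>\<^sub>P E"
  proof -
   have "?con x \<ominus>\<^sub>P E = H \<otimes>\<^sub>P g" unfolding EH(3) using Ec EH(2) gc by algebra
   then show ?thesis using P.m_comm[OF gc EH(2)] by simp
  qed
  have Ep: "cf E i \<in> p" for i using EH(1) by (simp add: ext_def)
  have "cf H i \<in> p" for i
  proof (rule key[OF EH(2), of 0])
   fix i
   show "cf (g \<otimes>\<^sub>P H) (Suc i) \<in> p"
    unfolding eq using x(1) Ec R.ideal_uminus[OF ip Ep[of "Suc i"]] R.ideal_carr[OF ip Ep[of "Suc i"]] by (simp add: coeff_minus R.minus_eq)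
  qed simp
  then have "H \<in> ext p" using EH(2) by (simp add: ext_def)
  then have "H \<otimes>\<^sub>P g \<in> ext p" by (rule P.ideal_mult_r[OF iext _ gc])
  then have "?con x \<in> ext p" unfolding EH(3) by (rule P.ideal_add[OF iext EH(1)])
  then show ?thesis using const_in_ext[OF ip x(1)] by simp
 qed
 have conQ: "x \<in> p" if x: "x \<in> carrier R" "?con x \<in> QQ" for x
 proof -
  obtain n where "con_al n \<otimes>\<^sub>P ?con x \<in> ?K" using x(2) by (auto simp: QQ_def)
  then have "?con (\<alpha> [^] n \<otimes> x) \<in> ?K" using con_m x(1) c by (simp add: con_al_def)
  then have "\<alpha> [^] n \<otimes> x \<in> p" using conK x(1) c by simp
  then show ?thesis using R.prime_mult[OF p, of "\<alpha> [^] n" x] R.prime_pow[OF p c(3)] al x(1) c by auto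
 qed
 have KQ: "?K \<subseteq> QQ"
 proof
  fix z assume z: "z \<in> ?K"
  then have "z \<in> carrier P" using P.ideal_carr[OF iK] by blast
  moreover from this have "con_al 0 \<otimes>\<^sub>P z = z" by (simp add: con_al_def)
  ultimately show "z \<in> QQ" using z unfolding QQ_def by (intro CollectI conjI exI[of _ 0]) simp_all
 qed
 have eQ: "ext p \<subseteq> QQ" using P.set_add_upper1[OF iext ig] KQ by blast
 have gQ: "g \<in> QQ" using P.set_add_upper2[OF iext ig] P.cgenideal_self[OF gc] KQ by blast
 have iQQ: "ideal QQ P"
 proof (rule P.idealI')
  show "QQ \<subseteq> carrier P" by (auto simp: QQ_def)
  show "\<zero>\<^sub>P \<in> QQ" using KQ P.ideal_zero[OF iK] by blast
  fix F G assume "F \<in> QQ" "G \<in> QQ"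
  then obtain n m where nm: "F \<in> carrier P" "con_al n \<otimes>\<^sub>P F \<in> ?K" "G \<in> carrier P" "con_al m \<otimes>\<^sub>P G \<in> ?K"
   by (auto simp: QQ_def)
  have "con_al (n + m) \<otimes>\<^sub>P (F \<oplus>\<^sub>P G) = con_al m \<otimes>\<^sub>P (con_al n \<otimes>\<^sub>P F) \<oplus>\<^sub>P con_al n \<otimes>\<^sub>P (con_al m \<otimes>\<^sub>P G)"
   unfolding cal_add using cal[of n] cal[of m] nm(1,3) by algebra
  also have "\<dots> \<in> ?K" by (intro P.ideal_add[OF iK] P.ideal_mult_l[OF iK] nm cal)
  finally show "F \<oplus>\<^sub>P G \<in> QQ" using nm by (auto simp: QQ_def)
 next
  fix F H assume "F \<in> QQ" and H: "H \<in> carrier P"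
  then obtain n where n: "F \<in> carrier P" "con_al n \<otimes>\<^sub>P F \<in> ?K" by (auto simp: QQ_def)
  have "con_al n \<otimes>\<^sub>P (H \<otimes>\<^sub>P F) = H \<otimes>\<^sub>P (con_al n \<otimes>\<^sub>P F)" using cal[of n] n(1) H by algebra
  also have "\<dots> \<in> ?K" by (intro P.ideal_mult_l[OF iK] n H)
  finally show "H \<otimes>\<^sub>P F \<in> QQ" using n H by (auto simp: QQ_def)
 qed
 have redQ: "\<exists>d r. r \<in> carrier R \<and> con_al (Suc d) \<otimes>\<^sub>P F \<ominus>\<^sub>P ?con r \<in> PIdl\<^sub>P g \<and> r \<ominus> cf F 0 \<otimes> \<alpha> [^] Suc d \<in> ?J d \<and> (F \<in> QQ \<longleftrightarrow> r \<in> p)"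
  if F: "F \<in> carrier P" for F
 proof -
  obtain d r where d: "r \<in> carrier R" "con_al (Suc d) \<otimes>\<^sub>P F \<ominus>\<^sub>P ?con r \<in> PIdl\<^sub>P g" "r \<ominus> cf F 0 \<otimes> \<alpha> [^] Suc d \<in> ?J d"
   using red[OF F] by blast
  have cr: "?con r \<in> carrier P" using d(1) by simp
  have dQ: "con_al (Suc d) \<otimes>\<^sub>P F \<ominus>\<^sub>P ?con r \<in> ?K" using P.set_add_upper2[OF iext ig] d(2) by blast
  have "r \<in> p" if "F \<in> QQ"
  proof -
   have "con_al (Suc d) \<otimes>\<^sub>P F \<in> QQ" by (rule P.ideal_mult_l[OF iQQ that cal])
   moreover have "?con r = con_al (Suc d) \<otimes>\<^sub>P F \<ominus>\<^sub>P (con_al (Suc d) \<otimes>\<^sub>P F \<ominus>\<^sub>P ?con r)" using cal[of "Suc d"] F cr by algebra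
   moreover have "con_al (Suc d) \<otimes>\<^sub>P F \<ominus>\<^sub>P ?con r \<in> QQ" using KQ dQ by blast
   ultimately have "?con r \<in> QQ" using P.ideal_minus[OF iQQ] by metis
   then show ?thesis by (rule conQ[OF d(1)])
  qed
  moreover have "F \<in> QQ" if "r \<in> p"
  proof -
   have "?con r \<in> ext p" using const_in_ext[OF ip d(1)] that by simp
   then have "?con r \<in> ?K" using P.set_add_upper1[OF iext ig] by blast
   then have "con_al (Suc d) \<otimes>\<^sub>P F \<in> ?K" using P.ideal_diff_cancel[OF iK dQ] cal F by simp
   then show ?thesis using F by (auto simp: QQ_def)
  qed
  ultimately show ?thesis using d by blast
 qed
 have QQp: "primeideal QQ P"
 proof (rule P.primeidealI'[OF iQQ])
  show "\<one>\<^sub>P \<notin> QQ" using conQ[of \<one>] R.prime_one[OF p] by auto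
  fix F G assume FG: "F \<in> carrier P" "G \<in> carrier P" "F \<otimes>\<^sub>P G \<in> QQ"
  obtain d r where d: "r \<in> carrier R" "con_al (Suc d) \<otimes>\<^sub>P F \<ominus>\<^sub>P ?con r \<in> PIdl\<^sub>P g" "F \<in> QQ \<longleftrightarrow> r \<in> p" using redQ[OF FG(1)] by blast
  obtain e s where e: "s \<in> carrier R" "con_al (Suc e) \<otimes>\<^sub>P G \<ominus>\<^sub>P ?con s \<in> PIdl\<^sub>P g" "G \<in> QQ \<longleftrightarrow> s \<in> p" using redQ[OF FG(2)] by blast
  have cr: "?con r \<in> carrier P" and cs: "?con s \<in> carrier P" using d e by auto
  have gQ': "z \<in> QQ" if "z \<in> PIdl\<^sub>P g" for z using that P.set_add_upper2[OF iext ig] KQ by blast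
  have "?con (r \<otimes> s) = (con_al (Suc d) \<otimes>\<^sub>P con_al (Suc e)) \<otimes>\<^sub>P (F \<otimes>\<^sub>P G) \<ominus>\<^sub>P
   ((con_al (Suc e) \<otimes>\<^sub>P G) \<otimes>\<^sub>P (con_al (Suc d) \<otimes>\<^sub>P F \<ominus>\<^sub>P ?con r) \<oplus>\<^sub>P ?con r \<otimes>\<^sub>P (con_al (Suc e) \<otimes>\<^sub>P G \<ominus>\<^sub>P ?con s))"
   unfolding con_m[OF d(1) e(1), symmetric] using cal[of "Suc d"] cal[of "Suc e"] FG(1,2) cr cs by algebra
  also have "\<dots> \<in> QQ"
   by (intro P.ideal_minus[OF iQQ] P.ideal_add[OF iQQ] P.ideal_mult_l[OF iQQ] FG gQ' d(2) e(2) P.m_closed cal cr)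
  finally have "r \<otimes> s \<in> p" using conQ d(1) e(1) by simp
  then show "F \<in> QQ \<or> G \<in> QQ" using R.prime_mult[OF p d(1) e(1)] d(3) e(3) by blast
 qed
 \<comment> \<open>If F(0) were a unit, then r in p together with the congruence from
   \<open>red\<close> would be the equation of integral dependence that \<open>neg\<close>
   excludes.\<close>
 have Q0: "cf F 0 \<in> \<mm>" if F: "F \<in> QQ" for F
 proof (rule ccontr)
  assume n: "cf F 0 \<notin> \<mm>"
  have Fc: "F \<in> carrier P" using F by (simp add: QQ_def)
  obtain d r where d: "r \<in> carrier R" "r \<ominus> cf F 0 \<otimes> \<alpha> [^] Suc d \<in> ?J d" "r \<in> p" using redQ[OF Fc] F by blast
  let ?f = "cf F 0"
  have fc: "?f \<in> carrier R" using Fc by simp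
  have pc: "\<alpha> [^] Suc d \<in> carrier R" using c by (intro R.nat_pow_closed)
  note iJp = R.add_ideals[OF iJ ip]
  have "?f \<otimes> \<alpha> [^] Suc d = r \<ominus> (r \<ominus> ?f \<otimes> \<alpha> [^] Suc d)" using d(1) fc pc by algebra
  moreover have "r \<in> ?J d <+>\<^bsub>R\<^esub> p" using R.set_add_upper2[OF iJ ip] d(3) by blast
  moreover have "r \<ominus> ?f \<otimes> \<alpha> [^] Suc d \<in> ?J d <+>\<^bsub>R\<^esub> p" using R.set_add_upper1[OF iJ ip] d(2) by blast
  ultimately have "?f \<otimes> \<alpha> [^] Suc d \<in> ?J d <+>\<^bsub>R\<^esub> p" using R.ideal_minus[OF iJp] by metis
  then have "\<alpha> [^] Suc d \<in> ?J d <+>\<^bsub>R\<^esub> p" by (rule R.psatD[OF L.mm_psat[OF iJp] pc fc n])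
  then show False using neg by blast
 qed
 have Tc: "?T \<in> carrier P" by simp
 note iT = P.cgenideal_ideal[OF Tc]
 note iQT = P.add_ideals[OF iQQ iT]
 have gT: "cf z 0 = \<zero>" if "z \<in> PIdl\<^sub>P ?T" for z using that by (auto simp: P.cgen_iff)
 have "\<one>\<^sub>P \<notin> QQ <+>\<^sub>P PIdl\<^sub>P ?T"
 proof
  assume "\<one>\<^sub>P \<in> QQ <+>\<^sub>P PIdl\<^sub>P ?T"
  then obtain F z where F: "F \<in> QQ" "z \<in> PIdl\<^sub>P ?T" "\<one>\<^sub>P = F \<oplus>\<^sub>P z" unfolding P.mem_set_add by blast
  have Fc: "F \<in> carrier P" "z \<in> carrier P" using F P.ideal_carr[OF iQQ] P.ideal_carr[OF iT] by auto
  have "cf \<one>\<^sub>P 0 = cf F 0 \<oplus> cf z 0" unfolding F(3) using Fc by simp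
  then have "\<one> = cf F 0" using gT[OF F(2)] Fc by simp
  then show False using Q0[OF F(1)] R.prime_one[OF L.mm_prime] by simp
 qed
 then have "\<exists>M. primeideal M P \<and> QQ <+>\<^sub>P PIdl\<^sub>P ?T \<subseteq> M"
  using NP.ex_prime_disjoint[of "{\<one>\<^sub>P}" "QQ <+>\<^sub>P PIdl\<^sub>P ?T"] iQT by auto
 then obtain M0 where M0: "primeideal M0 P" "QQ <+>\<^sub>P PIdl\<^sub>P ?T \<subseteq> M0" by blast
 obtain M where M: "P.minover (QQ <+>\<^sub>P PIdl\<^sub>P ?T) M" using NP.ex_minover[OF iQT M0] by blast
 then have pM: "primeideal M P" and QTM: "QQ <+>\<^sub>P PIdl\<^sub>P ?T \<subseteq> M" by (auto simp: P.minover_def)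
 note iM = P.prime_ideal[OF pM]
 have QM: "QQ \<subseteq> M" and TM: "?T \<in> M"
  using QTM P.set_add_upper1[OF iQQ iT] P.set_add_upper2[OF iQQ iT] P.cgenideal_self[OF Tc] by blast+
 define p' where "p' = {x\<in>carrier R. ?con x \<in> M}"
 have pp': "primeideal p' R" unfolding p'_def by (rule contract_prime[OF pM])
 have sub: "p \<subseteq> p'" using eQ QM const_in_ext[OF ip] R.ideal_carr[OF ip] by (auto simp: p'_def)
 have conT: "?con x \<in> M" if x: "x \<in> carrier R" "y \<in> carrier R" "?con y \<otimes>\<^sub>P ?T \<ominus>\<^sub>P ?con x \<in> M" for x y
 proof -
  have "?con x = ?con y \<otimes>\<^sub>P ?T \<ominus>\<^sub>P (?con y \<otimes>\<^sub>P ?T \<ominus>\<^sub>P ?con x)"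
   using monom_closed[OF x(1), of 0] monom_closed[OF x(2), of 0] Tc by algebra
  also have "\<dots> \<in> M" by (rule P.ideal_minus[OF iM P.ideal_mult_l[OF iM TM monom_closed[OF x(2)]] x(3)])
  finally show ?thesis .
 qed
 have a': "a \<in> p'" using conT[of a \<alpha>] gQ QM c unfolding g_def p'_def by auto
 \<comment> \<open>As \<alpha> b and \<beta> a agree modulo p, the polynomial \<beta>T - b vanishes
   at a/\<alpha> too. So M contains both a and b, and \<open>ht\<close> supplies a prime strictly
   between p and p'.\<close>
 have b': "b \<in> p'"
 proof -
  let ?h = "?con \<beta> \<otimes>\<^sub>P ?T \<ominus>\<^sub>P ?con b"
  have cc: "?con \<beta> \<in> carrier P" "?con b \<in> carrier P" "?con \<alpha> \<in> carrier P" "?con a \<in> carrier P" using c by auto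
  have "?con \<alpha> \<otimes>\<^sub>P ?h = ?con \<beta> \<otimes>\<^sub>P g \<ominus>\<^sub>P (?con \<alpha> \<otimes>\<^sub>P ?con b \<ominus>\<^sub>P ?con \<beta> \<otimes>\<^sub>P ?con a)"
   unfolding g_def using cc Tc by algebra
  also have "?con \<alpha> \<otimes>\<^sub>P ?con b \<ominus>\<^sub>P ?con \<beta> \<otimes>\<^sub>P ?con a = ?con (\<alpha> \<otimes> b \<ominus> \<beta> \<otimes> a)"
   using c con_m by (simp add: P.minus_eq R.minus_eq)
  finally have "?con \<alpha> \<otimes>\<^sub>P ?h = ?con \<beta> \<otimes>\<^sub>P g \<ominus>\<^sub>P ?con (\<alpha> \<otimes> b \<ominus> \<beta> \<otimes> a)" .
  moreover have "?con (\<alpha> \<otimes> b \<ominus> \<beta> \<otimes> a) \<in> QQ" using eQ const_in_ext[OF ip] rel c by auto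
  ultimately have "?con \<alpha> \<otimes>\<^sub>P ?h \<in> QQ" using P.ideal_minus[OF iQQ P.ideal_mult_l[OF iQQ gQ cc(1)]] by simp
  moreover have "?con \<alpha> \<notin> QQ" using conQ c al by blast
  ultimately have "?h \<in> QQ" using P.prime_mult[OF QQp cc(3), of ?h] cc by auto
  then show ?thesis using conT[of b \<beta>] QM c unfolding p'_def by auto
 qed
 obtain p1 where p1: "primeideal p1 R" "p \<subset> p1" "p1 \<subset> p'" using ht[OF pp' sub a' b'] by blast
 have g_next: "g \<notin> ext p"
 proof
  assume "g \<in> ext p"
  then have "cf g (Suc 0) \<in> p" unfolding ext_def by blast
  moreover have "cf g (Suc 0) = \<alpha>" using coeff_g[of "\<one>\<^sub>P" 0] gc c by (simp add: R.minus_eq)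
  ultimately show False using al by simp
 qed
 have TQ: "?T \<notin> QQ"
 proof
  assume "?T \<in> QQ"
  have cc: "?con \<alpha> \<in> carrier P" "?con a \<in> carrier P" using c by auto
  have "?con a = ?con \<alpha> \<otimes>\<^sub>P ?T \<ominus>\<^sub>P g" unfolding g_def using cc Tc by algebra
  also have "\<dots> \<in> QQ" by (intro P.ideal_minus[OF iQQ] P.ideal_mult_l[OF iQQ] gQ \<open>?T \<in> QQ\<close> cc)
  finally show False using conQ c(1) ap by blast
 qed
 have lt1: "ext p \<subset> QQ" using eQ gQ g_next by blast
 have lt2: "QQ \<subset> M" using QM TM TQ by blast
 have no1: "\<not> (\<exists>q. primeideal q P \<and> QQ \<subset> q \<and> q \<subset> M)"
  using NP.krull_principal_ideal[OF QQp _ _ _ Tc M] by blast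
 \<comment> \<open>A prime q strictly in between cannot contain g. Writing \<alpha>^(d+1) F - r = g
   H for F in q puts H into q and lowers by one the index from which the coefficients lie in p; by
   induction q would be \<open>ext p\<close>.\<close>
 have no2: "\<not> (\<exists>q. primeideal q P \<and> ext p \<subset> q \<and> q \<subset> QQ)"
 proof
  assume "\<exists>q. primeideal q P \<and> ext p \<subset> q \<and> q \<subset> QQ"
  then obtain q where q: "primeideal q P" "ext p \<subset> q" "q \<subset> QQ" by blast
  note iq = P.prime_ideal[OF q(1)]
  have cal_q: "con_al n \<notin> q" for n
  proof
   assume "con_al n \<in> q"
   then have "\<alpha> [^] n \<in> p" using q(3) conQ[of "\<alpha> [^] n"] c unfolding con_al_def by auto
   then show False using R.prime_pow[OF p c(3)] al by blast
  qed
  have gq: "g \<notin> q"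
  proof
   assume g: "g \<in> q"
   have "?K \<subseteq> q" using q(2) g by (intro P.set_add_least[OF iq] P.cgenideal_minimal[OF iq]) auto
   then have "QQ \<subseteq> q" using P.prime_mult[OF q(1) cal] cal_q unfolding QQ_def by blast
   then show False using q(3) by blast
  qed
  have none: "\<forall>F\<in>q. (\<forall>i\<ge>n. cf F i \<in> p) \<longrightarrow> F \<in> ext p" for n
  proof (induct n)
   case 0 then show ?case using P.ideal_carr[OF iq] by (auto simp: ext_def)
  next
   case (Suc n)
   show ?case
   proof (intro ballI impI)
    fix F assume F: "F \<in> q" "\<forall>i\<ge>Suc n. cf F i \<in> p"
    have Fc: "F \<in> carrier P" using F P.ideal_carr[OF iq] by blast
    obtain d r where d: "r \<in> carrier R" "con_al (Suc d) \<otimes>\<^sub>P F \<ominus>\<^sub>P ?con r \<in> PIdl\<^sub>P g" "r \<in> p" using redQ[OF Fc] F(1) q(3) by blast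
    then obtain H where H: "H \<in> carrier P" "con_al (Suc d) \<otimes>\<^sub>P F \<ominus>\<^sub>P ?con r = g \<otimes>\<^sub>P H"
     unfolding P.cgen_iff using P.m_comm[OF gc] by metis
    have rp: "?con r \<in> ext p" using const_in_ext[OF ip d(1)] d(3) by simp
    have cr: "?con r \<in> carrier P" using d(1) by simp
    have "con_al (Suc d) \<otimes>\<^sub>P F \<ominus>\<^sub>P ?con r \<in> q" using rp q(2) by (intro P.ideal_minus[OF iq] P.ideal_mult_l[OF iq F(1)] cal) auto
    then have Hq: "H \<in> q" using P.prime_mult[OF q(1) gc H(1)] gq H(2) by auto
    have "cf H i \<in> p" if "i \<ge> n" for i
    proof (rule key[OF H(1) _ that])
     fix i assume "i \<ge> n"
     then have "cf F (Suc i) \<in> p" using F(2) by simp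
     then have "\<alpha> [^] Suc d \<otimes> cf F (Suc i) \<in> p" using c by (intro R.ideal_mult_l[OF ip]) auto
     moreover have "cf (con_al (Suc d) \<otimes>\<^sub>P F \<ominus>\<^sub>P ?con r) (Suc i) = \<alpha> [^] Suc d \<otimes> cf F (Suc i)"
     proof -
      have "con_al (Suc d) \<otimes>\<^sub>P F = (\<alpha> [^] Suc d) \<odot>\<^bsub>P\<^esub> F" unfolding con_al_def using c Fc by (intro monom_mult_is_smult) auto
      then show ?thesis using Fc c d(1) cal[of "Suc d"] by (simp add: coeff_minus R.minus_eq)
     qed
     ultimately show "cf (g \<otimes>\<^sub>P H) (Suc i) \<in> p" using H(2) by simp
    qed
    then have "H \<in> ext p" using Suc Hq by blast
    then have "con_al (Suc d) \<otimes>\<^sub>P F \<ominus>\<^sub>P ?con r \<in> ext p" unfolding H(2) by (rule P.ideal_mult_l[OF iext _ gc])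
    then have "con_al (Suc d) \<otimes>\<^sub>P F \<in> ext p" using P.ideal_diff_cancel[OF iext _ rp] cal Fc by simp
    moreover have "con_al (Suc d) \<notin> ext p" using cal_q q(2) by blast
    ultimately show "F \<in> ext p" using P.prime_mult[OF ext_prime[OF p] cal Fc] by blast
   qed
  qed
  have "q \<subseteq> ext p"
  proof
   fix F assume F: "F \<in> q"
   have Fc: "F \<in> carrier P" using F P.ideal_carr[OF iq] by blast
   have "\<forall>i\<ge>Suc (deg R F). cf F i \<in> p" using deg_aboveD[OF _ Fc] R.ideal_zero[OF ip] by auto
   then show "F \<in> ext p" using none F by blast
  qed
  then show False using q(2) by blast
 qed
 \<comment> \<open>Two chains from \<open>ext p\<close> to M: the first has length 2 and is
   saturated by \<open>no1\<close> and \<open>no2\<close>, the second has length 3 and is refined to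
   a saturated one. Catenarity excludes this.\<close>
 let ?C1 = "\<lambda>i::nat. if i = 0 then ext p else if i = 1 then QQ else M"
 let ?C2 = "\<lambda>i::nat. if i = 0 then ext p else if i = 1 then ext p1 else if i = 2 then ext p' else M"
 have "prime_chain P 2 ?C1" using ext_prime[OF p] QQp pM lt1 lt2 by (auto simp: prime_chain_def less_Suc_eq numeral_2_eq_2)
 then have s1: "saturated_prime_chain P 2 ?C1"
  using no1 no2 by (auto simp: saturated_prime_chain_def less_Suc_eq numeral_2_eq_2)
 have ep'M: "ext p' \<subset> M"
 proof -
  have "F \<in> M" if F: "F \<in> ext p'" for F
  proof -
   have "cf F 0 \<in> p'" "F \<in> carrier P" using F unfolding ext_def by blast+
   then show ?thesis unfolding p'_def prime_with_T[OF pM TM \<open>F \<in> carrier P\<close>] by blast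
  qed
  moreover have "?T \<notin> ext p'"
  proof
   assume "?T \<in> ext p'"
   then have "cf ?T 1 \<in> p'" unfolding ext_def by blast
   then show False using R.prime_one[OF pp'] by simp
  qed
  ultimately show ?thesis using TM by blast
 qed
 have "prime_chain P 3 ?C2"
  using ext_prime[OF p] ext_prime[OF p1(1)] ext_prime[OF pp'] pM ep'M
   ext_strict[OF ip R.prime_ideal[OF p1(1)] p1(2)] ext_strict[OF R.prime_ideal[OF p1(1)] R.prime_ideal[OF pp'] p1(3)]
  by (auto simp: prime_chain_def less_Suc_eq numeral_3_eq_3)
 moreover have eM: "primeideal (ext p) P \<and> primeideal M P \<and> ext p \<subseteq> M" using ext_prime[OF p] pM lt1 lt2 by blast
 moreover obtain bb where "\<forall>n C. prime_chain P n C \<and> C 0 = ext p \<and> C n = M \<longrightarrow> n \<le> bb"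
  using cat[unfolded catenary_def, rule_format, OF eM] by blast
 ultimately obtain m C where C: "3 \<le> m" "saturated_prime_chain P m C" "C 0 = ext p" "C m = M"
  using saturated_refinement[of P 3 ?C2 "ext p" M bb] by auto
 have "2 = m"
  using cat[unfolded catenary_def, rule_format, OF eM] s1 C(2-4) by (elim conjE) (erule allE[of _ 2], erule allE[of _ ?C1], erule allE[of _ m], erule allE[of _ C], simp)
 then show False using C(1) by simp
qed

end

section \<open>Limit closures of parameters\<close>

context cring
begin

lemma mem_cgen_add: "x \<in> PIdl a <+> I \<longleftrightarrow> (\<exists>r\<in>carrier R. \<exists>i\<in>I. x = r \<otimes> a \<oplus> i)"
 unfolding mem_set_add Bex_def cgen_iff by blast

lemma mem_set_addI: "i \<in> I \<Longrightarrow> j \<in> J \<Longrightarrow> i \<oplus> j \<in> I <+> J"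
 by (auto simp: mem_set_add)

text \<open>In (e, J)^(r+1) every product of generators other than e^(r+1) has a factor from
  J.\<close>

lemma ipow_PIdl_add_Suc:
 assumes e: "e \<in> carrier R" and J: "ideal J R"
 shows "ipow (PIdl e <+> J) (Suc r) \<subseteq> PIdl (e [^] Suc r) <+> J \<cdot> ipow (PIdl e <+> J) r"
proof -
 note ie = cgenideal_ideal[OF e]
 let ?Y = "PIdl e <+> J"
 have iY: "ideal ?Y R" by (intro add_ideals ie J)
 note iYn = ipow_ideal[OF iY]
 show ?thesis
 proof (induct r)
  case 0 then show ?case using J e by (simp add: ipow_1[OF iY] ideal_prod_one)
 next
  case (Suc r)
  let ?Z = "PIdl (e [^] Suc (Suc r)) <+> J \<cdot> ipow ?Y (Suc r)"
  have ip: "ideal (PIdl (e [^] k)) R" for k :: nat by (intro cgenideal_ideal nat_pow_closed e)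
  have iJY: "ideal (J \<cdot> ipow ?Y k) R" for k by (intro ideal_prod_is_ideal J iYn)
  have iZ: "ideal ?Z R" by (intro add_ideals ip iJY)
  have "(PIdl (e [^] Suc r) <+> J \<cdot> ipow ?Y r) \<cdot> ?Y \<subseteq> ?Z"
  proof (rule ideal_prod_subset[OF iZ])
   fix i j assume "i \<in> PIdl (e [^] Suc r) <+> J \<cdot> ipow ?Y r" and j: "j \<in> ?Y"
   then obtain s w where s: "s \<in> carrier R" "w \<in> J \<cdot> ipow ?Y r" "i = s \<otimes> e [^] Suc r \<oplus> w"
    unfolding mem_cgen_add by (elim bexE)
   obtain t v where t: "t \<in> carrier R" "v \<in> J" "j = t \<otimes> e \<oplus> v" using j unfolding mem_cgen_add by (elim bexE)
   have c: "w \<in> carrier R" "v \<in> carrier R" "j \<in> carrier R" using ideal_carr[OF iJY s(2)] ideal_carr[OF J t(2)] ideal_carr[OF iY j] by auto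
   define E where "E = e [^] Suc r"
   have p: "E \<in> carrier R" unfolding E_def by (intro nat_pow_closed e)
   have "i \<otimes> j = ((s \<otimes> t) \<otimes> (E \<otimes> e)) \<oplus> (s \<otimes> (v \<otimes> E) \<oplus> w \<otimes> j)"
    unfolding s(3) t(3) E_def[symmetric] using s(1) t(1) c(1,2) p e by algebra
   moreover have "(s \<otimes> t) \<otimes> (E \<otimes> e) \<in> PIdl (e [^] Suc (Suc r))"
    unfolding cgen_iff E_def nat_pow_Suc[of e "Suc r"] using s(1) t(1) by blast
   moreover have "s \<otimes> (v \<otimes> E) \<oplus> w \<otimes> j \<in> J \<cdot> ipow ?Y (Suc r)"
   proof (rule ideal_add[OF iJY])
    have "e \<in> ?Y" using set_add_upper1[OF ie J] cgenideal_self[OF e] by blast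
    then have "E \<in> ipow ?Y (Suc r)" unfolding E_def by (rule pow_mem_ipow[OF iY])
    then show "s \<otimes> (v \<otimes> E) \<in> J \<cdot> ipow ?Y (Suc r)"
     using t(2) s(1) by (intro ideal_mult_l[OF iJY] ideal_prod.prod)
    have "w \<otimes> j \<in> (J \<cdot> ipow ?Y r) \<cdot> ?Y" using s(2) j by (rule ideal_prod.prod)
    then show "w \<otimes> j \<in> J \<cdot> ipow ?Y (Suc r)" by (simp add: ipow_Suc ideal_prod_assoc[OF J iYn iY])
   qed
   ultimately show "i \<otimes> j \<in> ?Z" unfolding mem_set_add by blast
  qed
  moreover have "ipow ?Y (Suc (Suc r)) \<subseteq> (PIdl (e [^] Suc r) <+> J \<cdot> ipow ?Y r) \<cdot> ?Y"
   unfolding ipow_Suc[of _ "Suc r"] by (rule ideal_prod_mono[OF Suc order_refl])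
  ultimately show ?case by blast
 qed
qed

text \<open>The hypothesis \<open>int\<close> is an equation of integral dependence of e over J
  modulo p, written with ideals. It makes J a reduction of (e) + J, so that the powers of J control
  all powers of (e) + J.\<close>

lemma integral_powers:
 assumes e: "e \<in> carrier R" and J: "ideal J R" and p: "ideal p R"
  and int: "e [^] Suc r \<in> J \<cdot> ipow (PIdl e <+> J) r <+> p"
 shows "ipow (PIdl e <+> J) (r + j) \<subseteq> ipow J j \<cdot> ipow (PIdl e <+> J) r <+> p"
proof -
 note ie = cgenideal_ideal[OF e]
 let ?Y = "PIdl e <+> J"
 have iY: "ideal ?Y R" by (intro add_ideals ie J)
 note iYn = ipow_ideal[OF iY] and iJn = ipow_ideal[OF J]
 have iZ: "ideal (ipow J k \<cdot> ipow ?Y r <+> p) R" for k by (intro add_ideals ideal_prod_is_ideal iJn iYn p)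
 have step: "ipow ?Y (Suc r) \<subseteq> J \<cdot> ipow ?Y r <+> p"
 proof -
  have "PIdl (e [^] Suc r) \<subseteq> J \<cdot> ipow ?Y r <+> p"
   using iZ[of 1] int ipow_1[OF J] by (intro cgenideal_minimal) auto
  then have "PIdl (e [^] Suc r) <+> J \<cdot> ipow ?Y r \<subseteq> J \<cdot> ipow ?Y r <+> p"
   using iZ[of 1] ipow_1[OF J] set_add_upper1[OF ideal_prod_is_ideal[OF J iYn] p] by (intro set_add_least) auto
  then show ?thesis using ipow_PIdl_add_Suc[OF e J] by blast
 qed
 show ?thesis
 proof (induct j)
  case 0
  show ?case using set_add_upper1[OF iYn p] by (simp add: ideal_prod_one_left[OF iYn])
 next
  case (Suc j)
  have "ipow ?Y (r + Suc j) = ipow ?Y (r + j) \<cdot> ?Y" by (simp add: ipow_Suc)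
  also have "\<dots> \<subseteq> (ipow J j \<cdot> ipow ?Y r <+> p) \<cdot> ?Y" by (rule ideal_prod_mono[OF Suc order_refl])
  also have "\<dots> \<subseteq> ipow J (Suc j) \<cdot> ipow ?Y r <+> p"
  proof (rule ideal_prod_subset[OF iZ])
   fix i y assume "i \<in> ipow J j \<cdot> ipow ?Y r <+> p" and y: "y \<in> ?Y"
   then obtain w q where w: "w \<in> ipow J j \<cdot> ipow ?Y r" "q \<in> p" "i = w \<oplus> q" unfolding mem_set_add by blast
   have yc: "y \<in> carrier R" using ideal_carr[OF iY y] .
   have c: "w \<in> carrier R" "q \<in> carrier R" using ideal_carr[OF ideal_prod_is_ideal[OF iJn iYn] w(1)] ideal_carr[OF p w(2)] by auto
   have "w \<otimes> y \<in> (ipow J j \<cdot> ipow ?Y r) \<cdot> ?Y" using w(1) y by (rule ideal_prod.prod)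
   also have "\<dots> = ipow J j \<cdot> ipow ?Y (Suc r)" by (simp add: ipow_Suc ideal_prod_assoc[OF iJn iYn iY])
   also have "\<dots> \<subseteq> ipow J j \<cdot> (J \<cdot> ipow ?Y r <+> p)" by (rule ideal_prod_mono[OF order_refl step])
   also have "\<dots> = ipow J j \<cdot> (J \<cdot> ipow ?Y r) <+> ipow J j \<cdot> p"
    by (rule ideal_prod_r_distr[OF iJn ideal_prod_is_ideal[OF J iYn] p])
   also have "\<dots> \<subseteq> ipow J (Suc j) \<cdot> ipow ?Y r <+> p"
    using ideal_prod_le2[OF iJn p] by (intro set_add_mono) (auto simp: ipow_Suc ideal_prod_assoc[OF iJn J iYn])
   finally have 1: "w \<otimes> y \<in> ipow J (Suc j) \<cdot> ipow ?Y r <+> p" .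
   have "q \<otimes> y \<in> ipow J (Suc j) \<cdot> ipow ?Y r <+> p"
    using ideal_mult_r[OF p w(2) yc] set_add_upper2[OF ideal_prod_is_ideal[OF iJn iYn] p] by blast
   then show "i \<otimes> y \<in> ipow J (Suc j) \<cdot> ipow ?Y r <+> p"
    unfolding w(3) using ideal_add[OF iZ 1] c yc by (simp add: l_distr)
  qed
  finally show ?case .
 qed
qed

text \<open>If \<alpha>/a is integral over R/p, then a^r is a common denominator of all its
  powers.\<close>

lemma fraction_powers:
 assumes c: "\<alpha> \<in> carrier R" "a \<in> carrier R" and p: "ideal p R"
  and int: "\<alpha> [^] Suc r \<in> (PIdl a) \<cdot> ipow (PIdl \<alpha> <+> PIdl a) r <+> p"
 shows "a [^] r \<otimes> \<alpha> [^] j \<in> PIdl (a [^] (j::nat)) <+> p"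
proof -
 note ia = cgenideal_ideal[OF c(2)] and ial = cgenideal_ideal[OF c(1)]
 let ?Y = "PIdl \<alpha> <+> PIdl a"
 have iY: "ideal ?Y R" by (intro add_ideals ia ial)
 have "a \<in> ?Y" "\<alpha> \<in> ?Y" using set_add_upper1[OF ial ia] set_add_upper2[OF ial ia] cgenideal_self c by blast+
 then have "a [^] r \<otimes> \<alpha> [^] j \<in> ipow ?Y (r + j)" by (intro ipow_mult_mem[OF iY] pow_mem_ipow[OF iY])
 also have "\<dots> \<subseteq> ipow (PIdl a) j \<cdot> ipow ?Y r <+> p" by (rule integral_powers[OF c(1) ia p int])
 also have "\<dots> \<subseteq> PIdl (a [^] j) <+> p"
  using ideal_prod_le1[OF ipow_ideal[OF ia] ipow_ideal[OF iY]] ipow_PIdl[OF c(2)] by (intro set_add_mono) auto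
 finally show ?thesis .
qed

lemma binomial_mem:
 fixes n :: nat
 assumes c: "s \<in> carrier R" "t \<in> carrier R" "d \<in> carrier R" and Z: "ideal Z R"
  and st: "\<And>i j. i + j = n \<Longrightarrow> d \<otimes> (s [^] i \<otimes> t [^] j) \<in> Z"
 shows "d \<otimes> (s \<oplus> t) [^] n \<in> Z"
proof -
 note i_s = cgenideal_ideal[OF c(1)] and it = cgenideal_ideal[OF c(2)] and id = cgenideal_ideal[OF c(3)]
 note ist = add_ideals[OF i_s it]
 have "ipow (PIdl s <+> PIdl t) n \<cdot> (PIdl d) \<subseteq> Z"
 proof (rule ipow_set_add_subset[OF i_s it Z id])
  fix i j assume ij: "i + j = n"
  have d: "d \<otimes> (s [^] i \<otimes> t [^] j) \<in> Z" by (rule st[OF ij])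
  show "ipow (PIdl s) i \<cdot> (ipow (PIdl t) j \<cdot> (PIdl d)) \<subseteq> Z"
  proof (rule ideal_prod_subset[OF Z])
   fix x y assume "x \<in> ipow (PIdl s) i" and y: "y \<in> ipow (PIdl t) j \<cdot> (PIdl d)"
   then obtain f where f: "f \<in> carrier R" "x = f \<otimes> s [^] i" using ipow_PIdl[OF c(1)] by (auto simp: cgen_iff)
   have "y \<in> (PIdl (t [^] j)) \<cdot> (PIdl d)" using y ipow_PIdl[OF c(2)] by simp
   then obtain h where h: "h \<in> carrier R" "y = t [^] j \<otimes> (h \<otimes> d)"
    unfolding PIdl_prod[OF nat_pow_closed[OF c(2)] id] by (auto simp: cgen_iff)
   have "x \<otimes> y = (f \<otimes> h) \<otimes> (d \<otimes> (s [^] i \<otimes> t [^] j))"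
    unfolding f(2) h(2) using f(1) h(1) c by (simp add: m_ac)
   then show "x \<otimes> y \<in> Z" using ideal_mult_l[OF Z d] f(1) h(1) by simp
  qed
 qed
 moreover have "s \<oplus> t \<in> PIdl s <+> PIdl t" using cgenideal_self c by (auto simp: mem_set_add)
 then have "(s \<oplus> t) [^] n \<otimes> d \<in> ipow (PIdl s <+> PIdl t) n \<cdot> (PIdl d)"
  using cgenideal_self[OF c(3)] by (intro ideal_prod.prod pow_mem_ipow[OF ist])
 ultimately show ?thesis using c m_comm[of d "(s \<oplus> t) [^] n"] by auto
qed

lemma pow_congruent:
 assumes "ideal p R" "w \<in> carrier R" "v \<in> carrier R" "w \<ominus> v \<in> p"
 shows "w [^] (n::nat) \<ominus> v [^] n \<in> p"
proof (induct n)
 case 0 then show ?case using ideal_zero[OF assms(1)] by (simp add: minus_eq r_neg)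
next
 case (Suc n)
 have "w [^] n \<otimes> w \<ominus> v [^] n \<otimes> v = w \<otimes> (w [^] n \<ominus> v [^] n) \<oplus> v [^] n \<otimes> (w \<ominus> v)"
  using assms(2,3) nat_pow_closed[OF assms(2), of n] nat_pow_closed[OF assms(3), of n] by algebra
 also have "\<dots> \<in> p" using assms Suc by (intro ideal_add ideal_mult_l) auto
 finally show ?case by simp
qed

end

context noetherian_cring
begin

text \<open>A common multiplier d for all powers of u forces integrality: L n = (d (u, \<bb>)^n + p)
  \<inter> \<bb>^n is a filtration, so L (c+1) lies in \<bb> L c. Modulo p, d u^(c+1) belongs to L
  (c+1), and cancelling d gives the equation.\<close>

lemma integral_of_almost_integral:
 assumes p: "primeideal p R" and \<bb>: "ideal \<bb> R" and u: "u \<in> carrier R" and d: "d \<in> carrier R" "d \<notin> p"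
  and du: "\<And>n::nat. d \<otimes> u [^] n \<in> ipow \<bb> n <+> p"
 shows "\<exists>r. \<exists>\<eta>\<in>\<bb> \<cdot> ipow (PIdl u <+> \<bb>) r. u [^] Suc r \<ominus> \<eta> \<in> p"
proof -
 note ip = prime_ideal[OF p] and iu = cgenideal_ideal[OF u] and id = cgenideal_ideal[OF d(1)] and ib = ipow_ideal[OF \<bb>]
 let ?X = "PIdl u <+> \<bb>"
 have iX: "ideal ?X R" by (intro add_ideals iu \<bb>)
 note iXn = ipow_ideal[OF iX]
 define L where "L n = ((PIdl d) \<cdot> ipow ?X n <+> p) \<inter> ipow \<bb> n" for n
 have idX: "ideal ((PIdl d) \<cdot> ipow ?X n) R" for n by (intro ideal_prod_is_ideal id iXn)
 have iL: "ideal (L n) R" for n unfolding L_def by (intro i_intersect add_ideals idX ip ib)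
 have bX: "b \<in> ?X" if "b \<in> \<bb>" for b using that set_add_upper2[OF iu \<bb>] by blast
 have "\<exists>c. \<forall>n\<ge>c. L n \<subseteq> ipow \<bb> (n - c) \<cdot> L c"
 proof (rule rees_filtration'[OF \<bb> iL])
  show "L n \<subseteq> ipow \<bb> n" for n by (auto simp: L_def)
  show "\<bb> \<cdot> L n \<subseteq> L (Suc n)" for n
  proof (rule ideal_prod_subset[OF iL])
   fix b l assume b: "b \<in> \<bb>" and l: "l \<in> L n"
   have bc: "b \<in> carrier R" using ideal_carr[OF \<bb> b] .
   obtain w q where w: "w \<in> (PIdl d) \<cdot> ipow ?X n" "q \<in> p" "l = w \<oplus> q" and lb: "l \<in> ipow \<bb> n"
    using l by (auto simp: L_def mem_set_add)
   obtain z where z: "z \<in> ipow ?X n" "w = d \<otimes> z" using w(1) unfolding PIdl_prod[OF d(1) iXn] by blast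
   have c: "z \<in> carrier R" "q \<in> carrier R" using ideal_carr[OF iXn z(1)] ideal_carr[OF ip w(2)] by auto
   have "b \<otimes> l = d \<otimes> (z \<otimes> b) \<oplus> b \<otimes> q" unfolding w(3) z(2) using bc c d by algebra
   moreover have "z \<otimes> b \<in> ipow ?X (Suc n)" using z(1) bX[OF b] by (simp add: ipow_Suc ideal_prod.prod)
   then have "d \<otimes> (z \<otimes> b) \<in> (PIdl d) \<cdot> ipow ?X (Suc n)" unfolding PIdl_prod[OF d(1) iXn] by blast
   moreover have "b \<otimes> q \<in> p" by (rule ideal_mult_l[OF ip w(2) bc])
   ultimately have "b \<otimes> l \<in> (PIdl d) \<cdot> ipow ?X (Suc n) <+> p" unfolding mem_set_add by blast
   moreover have "b \<otimes> l \<in> ipow \<bb> (Suc n)" using ipow_mult_mem[OF \<bb>, of b 1 l n] b lb ipow_1[OF \<bb>] by simp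
   ultimately show "b \<otimes> l \<in> L (Suc n)" by (simp add: L_def)
  qed
 qed
 then obtain c where "L (Suc c) \<subseteq> ipow \<bb> (Suc c - c) \<cdot> L c" by (meson le_SucI order_refl)
 then have c: "L (Suc c) \<subseteq> \<bb> \<cdot> L c" using ipow_1[OF \<bb>] by simp
 have uX: "u \<in> ?X" using set_add_upper1[OF iu \<bb>] cgenideal_self[OF u] by blast
 let ?up = "u [^] Suc c"
 have upc: "?up \<in> carrier R" by (intro nat_pow_closed u)
 obtain e q where e: "e \<in> ipow \<bb> (Suc c)" "q \<in> p" "d \<otimes> ?up = e \<oplus> q" using du[of "Suc c"] unfolding mem_set_add by blast
 have ec: "e \<in> carrier R" "q \<in> carrier R" using ideal_carr[OF ib e(1)] ideal_carr[OF ip e(2)] by auto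
 have "e = d \<otimes> ?up \<oplus> \<ominus> q" unfolding e(3) using ec by algebra
 moreover have "d \<otimes> ?up \<in> (PIdl d) \<cdot> ipow ?X (Suc c)"
  unfolding PIdl_prod[OF d(1) iXn] using pow_mem_ipow[OF iX uX, of "Suc c"] by blast
 moreover have "\<ominus> q \<in> p" by (rule ideal_uminus[OF ip e(2)])
 ultimately have "e \<in> (PIdl d) \<cdot> ipow ?X (Suc c) <+> p" unfolding mem_set_add by blast
 then have "e \<in> L (Suc c)" using e(1) by (simp add: L_def)
 then have "e \<in> \<bb> \<cdot> L c" using c by blast
 also have "\<bb> \<cdot> L c \<subseteq> \<bb> \<cdot> ((PIdl d) \<cdot> ipow ?X c <+> p)" unfolding L_def by (intro ideal_prod_mono) auto
 also have "\<dots> = \<bb> \<cdot> ((PIdl d) \<cdot> ipow ?X c) <+> \<bb> \<cdot> p" by (rule ideal_prod_r_distr[OF \<bb> idX ip])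
 also have "\<dots> = (PIdl d) \<cdot> (\<bb> \<cdot> ipow ?X c) <+> \<bb> \<cdot> p" using ideal_prod_left_comm[OF \<bb> id iXn] by simp
 finally obtain w q' where w: "w \<in> (PIdl d) \<cdot> (\<bb> \<cdot> ipow ?X c)" "q' \<in> \<bb> \<cdot> p" "e = w \<oplus> q'" unfolding mem_set_add by blast
 note iBX = ideal_prod_is_ideal[OF \<bb> iXn]
 obtain \<eta> where \<eta>: "\<eta> \<in> \<bb> \<cdot> ipow ?X c" "w = d \<otimes> \<eta>" using w(1) unfolding PIdl_prod[OF d(1) iBX] by blast
 have q': "q' \<in> p" using w(2) ideal_prod_le2[OF \<bb> ip] by blast
 have cc: "\<eta> \<in> carrier R" "q' \<in> carrier R" using ideal_carr[OF iBX \<eta>(1)] ideal_carr[OF ip q'] by auto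
 have "d \<otimes> (?up \<ominus> \<eta>) = d \<otimes> ?up \<ominus> d \<otimes> \<eta>" using d upc cc by algebra
 also have "\<dots> = q' \<oplus> q" unfolding e(3) w(3) \<eta>(2) using cc ec d by algebra
 also have "\<dots> \<in> p" by (rule ideal_add[OF ip q' e(2)])
 finally have "?up \<ominus> \<eta> \<in> p" using prime_mult[OF p d(1), of "?up \<ominus> \<eta>"] d(2) upc cc by auto
 then show ?thesis using \<eta>(1) by blast
qed

end

section \<open>Two parameters and their limit closure\<close>

context noeth_local
begin

text \<open>y is taken outside all p, and x outside the minimal primes of all p + (y); these differ
  from \<mm> by Krull's theorem, since some prime lies strictly between p and \<mm>. A prime
  containing p, x and y then lies strictly above one of these minimal primes, which itself lies
  strictly above p.\<close>

lemma ex_parameters: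
 assumes fin: "finite \<P>" and prime: "\<And>p. p \<in> \<P> \<Longrightarrow> primeideal p R"
  and ht: "\<And>p. p \<in> \<P> \<Longrightarrow> \<exists>p1. primeideal p1 R \<and> p \<subset> p1 \<and> p1 \<subset> \<mm>"
 shows "\<exists>x\<in>\<mm>. \<exists>y\<in>\<mm>. \<forall>p\<in>\<P>. x \<notin> p \<and> y \<notin> p \<and>
  (\<forall>p'. primeideal p' R \<and> p \<subseteq> p' \<and> x \<in> p' \<and> y \<in> p' \<longrightarrow> (\<exists>p1. primeideal p1 R \<and> p \<subset> p1 \<and> p1 \<subset> p'))"
proof -
 have "\<exists>y\<in>\<mm>. y \<notin> \<Union>\<P>"
  by (rule prime_avoidance[OF fin prime mm_ideal]) (use ht in blast)+
 then obtain y where y: "y \<in> \<mm>" "\<And>p. p \<in> \<P> \<Longrightarrow> y \<notin> p" by blast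
 have yc: "y \<in> carrier R" using ideal_carr[OF mm_ideal y(1)] .
 note iy = cgenideal_ideal[OF yc]
 have ipy: "ideal (p <+> PIdl y) R" if "p \<in> \<P>" for p by (intro add_ideals iy prime_ideal prime that)
 have "\<forall>p\<in>\<P>. \<exists>F. finite F \<and> (\<forall>P\<in>F. minover (p <+> PIdl y) P) \<and> (\<forall>P. primeideal P R \<and> p <+> PIdl y \<subseteq> P \<longrightarrow> (\<exists>Q\<in>F. Q \<subseteq> P))"
  using finite_minover[OF ipy] by blast
 then obtain F where F: "\<And>p. p \<in> \<P> \<Longrightarrow> finite (F p) \<and> (\<forall>P\<in>F p. minover (p <+> PIdl y) P) \<and> (\<forall>P. primeideal P R \<and> p <+> PIdl y \<subseteq> P \<longrightarrow> (\<exists>Q\<in>F p. Q \<subseteq> P))"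
  by metis
 have py: "p <+> PIdl y \<subseteq> p'" if "p \<subseteq> p'" "y \<in> p'" "primeideal p' R" for p p'
  by (rule set_add_least[OF prime_ideal[OF that(3)] that(1) cgenideal_minimal[OF prime_ideal[OF that(3)] that(2)]])
 have Fp: "primeideal Q R \<and> p \<subset> Q" if pQ: "p \<in> \<P>" "Q \<in> F p" for p Q
 proof -
  have m: "minover (p <+> PIdl y) Q" using F[OF pQ(1)] pQ(2) by blast
  have "p \<subseteq> p <+> PIdl y" by (rule set_add_upper1[OF prime_ideal[OF prime[OF pQ(1)]] iy])
  moreover have "y \<in> p <+> PIdl y" using set_add_upper2[OF prime_ideal[OF prime[OF pQ(1)]] iy] cgenideal_self[OF yc] by blast
  ultimately show ?thesis using m y(2)[OF pQ(1)] unfolding minover_def by blast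
 qed
 have "\<exists>x\<in>\<mm>. x \<notin> \<Union>(\<Union>p\<in>\<P>. F p)"
 proof (rule prime_avoidance[OF _ _ mm_ideal])
  show "finite (\<Union>p\<in>\<P>. F p)" using fin F by blast
  show "primeideal Q R" if "Q \<in> (\<Union>p\<in>\<P>. F p)" for Q using that Fp by blast
  fix Q assume "Q \<in> (\<Union>p\<in>\<P>. F p)"
  then obtain p where p: "p \<in> \<P>" "Q \<in> F p" by blast
  have m: "minover (p <+> PIdl y) Q" using F[OF p(1)] p(2) by blast
  show "\<not> \<mm> \<subseteq> Q"
  proof
   assume "\<mm> \<subseteq> Q"
   moreover have "Q \<subseteq> \<mm>" using m proper_ideal_sub_mm prime_ideal prime_one unfolding minover_def by blast
   ultimately have "Q = \<mm>" by blast
   then have mm: "minover (p <+> PIdl y) \<mm>" using m by simp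
   obtain p1 where p1: "primeideal p1 R" "p \<subset> p1" "p1 \<subset> \<mm>" using ht[OF p(1)] by blast
   show False by (rule krull_principal_ideal[OF prime[OF p(1)] p1 yc mm])
  qed
 qed
 then obtain x where x: "x \<in> \<mm>" "\<And>p Q. p \<in> \<P> \<Longrightarrow> Q \<in> F p \<Longrightarrow> x \<notin> Q" by blast
 have main: "\<exists>p1. primeideal p1 R \<and> p \<subset> p1 \<and> p1 \<subset> p'" if p: "p \<in> \<P>" "primeideal p' R" "p \<subseteq> p'" "x \<in> p'" "y \<in> p'" for p p'
 proof -
  obtain Q where Q: "Q \<in> F p" "Q \<subseteq> p'" using F[OF p(1)] py[OF p(3,5,2)] p(2) by blast
  moreover have "x \<notin> Q" by (rule x(2)[OF p(1) Q(1)])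
  ultimately show ?thesis using Fp[OF p(1) Q(1)] p(4) by blast
 qed
 have "x \<notin> p" if p: "p \<in> \<P>" for p
 proof -
  have "p \<subseteq> \<mm>" using ht[OF p] by blast
  then obtain Q where Q: "Q \<in> F p" using F[OF p] py[of p \<mm>] y(1) mm_prime by blast
  then show ?thesis using x(2)[OF p Q] Fp[OF p Q] by blast
 qed
 then show ?thesis using x(1) y main by blast
qed

text \<open>Over R/p the relation reads u = x^G (a/y^n) + y^G (b/x^n). By the same relation each of
  the two fractions can also be written with a power of the other parameter as denominator, so
  \<open>integral_fraction\<close> makes it integral, and u becomes integral over \<mm>^G.\<close>

lemma limit_closure_integral:
 assumes cat: "catenary (UP R)" and p: "primeideal p R"
  and x: "x \<in> \<mm>" "x \<notin> p" and y: "y \<in> \<mm>" "y \<notin> p"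
  and ht: "\<And>p'. primeideal p' R \<Longrightarrow> p \<subseteq> p' \<Longrightarrow> x \<in> p' \<Longrightarrow> y \<in> p' \<Longrightarrow> \<exists>p1. primeideal p1 R \<and> p \<subset> p1 \<and> p1 \<subset> p'"
  and c: "u \<in> carrier R" "a \<in> carrier R" "b \<in> carrier R"
  and rel: "u \<otimes> (x \<otimes> y) [^] n \<ominus> (x [^] (n + G) \<otimes> a \<oplus> y [^] (n + G) \<otimes> b) \<in> p"
 shows "\<exists>r. \<exists>\<eta>\<in>ipow \<mm> G \<cdot> ipow (PIdl u <+> ipow \<mm> G) r. u [^] Suc r \<ominus> \<eta> \<in> p"
proof -
 note ip = prime_ideal[OF p]
 interpret U: UP_cring R "UP R" by (rule UP_cring_R)
 have xc: "x \<in> carrier R" and yc: "y \<in> carrier R" using x y ideal_carr[OF mm_ideal] by auto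
 define X where "X = x [^] n" define X' where "X' = x [^] G" define Y where "Y = y [^] n" define Y' where "Y' = y [^] G"
 have cc: "X \<in> carrier R" "X' \<in> carrier R" "Y \<in> carrier R" "Y' \<in> carrier R" using xc yc by (simp_all add: X_def X'_def Y_def Y'_def)
 have XX: "x [^] (n + G) = X \<otimes> X'" "y [^] (n + G) = Y \<otimes> Y'" "(x \<otimes> y) [^] n = X \<otimes> Y"
  using xc yc by (simp_all add: X_def X'_def Y_def Y'_def nat_pow_mult nat_pow_distrib)
 have rel': "u \<otimes> (X \<otimes> Y) \<ominus> ((X \<otimes> X') \<otimes> a \<oplus> (Y \<otimes> Y') \<otimes> b) \<in> p" using rel unfolding XX .
 have pmem: "z \<in> p'" if "primeideal p' R" "z \<in> carrier R" "z [^] (k::nat) \<in> p'" for z p' k using prime_pow[OF that] .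
 have nX: "X \<notin> p" "Y \<notin> p" using prime_pow[OF p xc] prime_pow[OF p yc] x y by (auto simp: X_def Y_def)
 have "b \<otimes> (Y \<otimes> Y') \<ominus> (u \<otimes> Y \<ominus> X' \<otimes> a) \<otimes> X = \<ominus> (u \<otimes> (X \<otimes> Y) \<ominus> ((X \<otimes> X') \<otimes> a \<oplus> (Y \<otimes> Y') \<otimes> b))"
  using cc c by algebra
 then have r2: "b \<otimes> (Y \<otimes> Y') \<ominus> (u \<otimes> Y \<ominus> X' \<otimes> a) \<otimes> X \<in> p" using ideal_uminus[OF ip rel'] by simp
 have "\<exists>r. b [^] Suc r \<in> (PIdl X) \<cdot> ipow (PIdl b <+> PIdl X) r <+> p"
 proof (rule U.integral_fraction[OF noeth_local_axioms cat p _ _ _ _ nX(1) r2])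
  fix p' assume *: "primeideal p' R" "p \<subseteq> p'" "X \<in> p'" "Y \<otimes> Y' \<in> p'"
  have "x \<in> p'" using pmem[OF *(1) xc] *(3) unfolding X_def by blast
  moreover have "y \<in> p'" using pmem[OF *(1) yc] *(4) XX(2) by metis
  ultimately show "\<exists>p1. primeideal p1 R \<and> p \<subset> p1 \<and> p1 \<subset> p'" using ht * by blast
 qed (use cc c in auto)
 then obtain r2 where r2: "b [^] Suc r2 \<in> (PIdl X) \<cdot> ipow (PIdl b <+> PIdl X) r2 <+> p" by blast
 have "a \<otimes> (X \<otimes> X') \<ominus> (u \<otimes> X \<ominus> Y' \<otimes> b) \<otimes> Y = \<ominus> (u \<otimes> (X \<otimes> Y) \<ominus> ((X \<otimes> X') \<otimes> a \<oplus> (Y \<otimes> Y') \<otimes> b))"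
  using cc c by algebra
 then have r1: "a \<otimes> (X \<otimes> X') \<ominus> (u \<otimes> X \<ominus> Y' \<otimes> b) \<otimes> Y \<in> p" using ideal_uminus[OF ip rel'] by simp
 have "\<exists>r. a [^] Suc r \<in> (PIdl Y) \<cdot> ipow (PIdl a <+> PIdl Y) r <+> p"
 proof (rule U.integral_fraction[OF noeth_local_axioms cat p _ _ _ _ nX(2) r1])
  fix p' assume *: "primeideal p' R" "p \<subseteq> p'" "Y \<in> p'" "X \<otimes> X' \<in> p'"
  have "y \<in> p'" using pmem[OF *(1) yc] *(3) unfolding Y_def by blast
  moreover have "x \<in> p'" using pmem[OF *(1) xc] *(4) XX(1) by metis
  ultimately show "\<exists>p1. primeideal p1 R \<and> p \<subset> p1 \<and> p1 \<subset> p'" using ht * by blast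
 qed (use cc c in auto)
 then obtain r1 where r1: "a [^] Suc r1 \<in> (PIdl Y) \<cdot> ipow (PIdl a <+> PIdl Y) r1 <+> p" by blast
 \<comment> \<open>The two powers clear the denominators of all powers of a/Y and of b/X at once, so
   a single d serves for every power of u.\<close>
 define d where "d = Y [^] r1 \<otimes> X [^] r2"
 have dc: "d \<in> carrier R" using cc by (simp add: d_def)
 have dp: "d \<notin> p"
  using prime_mult[OF p, of "Y [^] r1" "X [^] r2"] prime_pow[OF p cc(1)] prime_pow[OF p cc(3)] nX cc unfolding d_def by auto
 note im = ipow_ideal[OF mm_ideal]
 have "d \<otimes> u [^] N \<in> ipow (ipow \<mm> G) N <+> p" for N
 proof -
  let ?s = "(X \<otimes> X') \<otimes> a" and ?t = "(Y \<otimes> Y') \<otimes> b" and ?xy = "X \<otimes> Y"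
  have sc: "?s \<in> carrier R" "?t \<in> carrier R" "?xy \<in> carrier R" using cc c by auto
  let ?B = "ipow \<mm> (G * N)"
  let ?Z = "(PIdl (?xy [^] N)) \<cdot> ?B <+> p"
  have pxy: "?xy [^] N \<in> carrier R" using sc by simp
  note ixy = cgenideal_ideal[OF pxy]
  have iZ: "ideal ?Z R" by (intro add_ideals ideal_prod_is_ideal ixy im ip)
  have "d \<otimes> (?s \<oplus> ?t) [^] N \<in> ?Z"
  proof (rule binomial_mem[OF sc(1,2) dc iZ])
   fix i j assume ij: "i + j = N"
   obtain e q where e: "e \<in> carrier R" "q \<in> p" "Y [^] r1 \<otimes> a [^] i = e \<otimes> Y [^] i \<oplus> q"
    using fraction_powers[OF c(2) cc(3) ip r1, of i] unfolding mem_cgen_add by (elim bexE)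
   obtain e' q' where e': "e' \<in> carrier R" "q' \<in> p" "X [^] r2 \<otimes> b [^] j = e' \<otimes> X [^] j \<oplus> q'"
    using fraction_powers[OF c(3) cc(1) ip r2, of j] unfolding mem_cgen_add by (elim bexE)
   have qc: "q \<in> carrier R" "q' \<in> carrier R" using ideal_carr[OF ip] e e' by auto
   define P1 where "P1 = X [^] i \<otimes> Y [^] j"
   define P2 where "P2 = X' [^] i \<otimes> Y' [^] j"
   have Pc: "P1 \<in> carrier R" "P2 \<in> carrier R" using cc by (auto simp: P1_def P2_def)
   have "d \<otimes> (?s [^] i \<otimes> ?t [^] j) = (P1 \<otimes> P2) \<otimes> ((Y [^] r1 \<otimes> a [^] i) \<otimes> (X [^] r2 \<otimes> b [^] j))"
    unfolding d_def P1_def P2_def using cc c by (simp add: nat_pow_distrib m_ac)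
   also have "\<dots> = (P1 \<otimes> (Y [^] i \<otimes> X [^] j)) \<otimes> (P2 \<otimes> (e \<otimes> e')) \<oplus> ((P1 \<otimes> P2) \<otimes> (e \<otimes> Y [^] i) \<otimes> q' \<oplus> (P1 \<otimes> P2) \<otimes> (e' \<otimes> X [^] j \<oplus> q') \<otimes> q)"
    unfolding e(3) e'(3) using Pc e(1) e'(1) qc nat_pow_closed[OF cc(1), of j] nat_pow_closed[OF cc(3), of i] by algebra
   also have "P1 \<otimes> (Y [^] i \<otimes> X [^] j) = ?xy [^] N"
    unfolding P1_def ij[symmetric] using cc by (simp add: nat_pow_distrib nat_pow_mult[symmetric] m_ac)
   finally have eq: "d \<otimes> (?s [^] i \<otimes> ?t [^] j) = ?xy [^] N \<otimes> (P2 \<otimes> (e \<otimes> e')) \<oplus> ((P1 \<otimes> P2) \<otimes> (e \<otimes> Y [^] i) \<otimes> q' \<oplus> (P1 \<otimes> P2) \<otimes> (e' \<otimes> X [^] j \<oplus> q') \<otimes> q)" .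
   have "P2 = x [^] (G * i) \<otimes> y [^] (G * j)" unfolding P2_def X'_def Y'_def using xc yc by (simp add: nat_pow_pow)
   also have "\<dots> \<in> ipow \<mm> (G * i + G * j)" by (intro ipow_mult_mem[OF mm_ideal] pow_mem_ipow[OF mm_ideal] x y)
   also have "G * i + G * j = G * N" using ij by (simp add: add_mult_distrib2[symmetric])
   finally have "P2 \<otimes> (e \<otimes> e') \<in> ?B" using e(1) e'(1) by (intro ideal_mult_r[OF im]) auto
   then have "?xy [^] N \<otimes> (P2 \<otimes> (e \<otimes> e')) \<in> (PIdl (?xy [^] N)) \<cdot> ?B" unfolding PIdl_prod[OF pxy im] by blast
   moreover have "(P1 \<otimes> P2) \<otimes> (e \<otimes> Y [^] i) \<otimes> q' \<oplus> (P1 \<otimes> P2) \<otimes> (e' \<otimes> X [^] j \<oplus> q') \<otimes> q \<in> p"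
    using Pc e e' qc cc by (intro ideal_add[OF ip] ideal_mult_l[OF ip]) auto
   ultimately show "d \<otimes> (?s [^] i \<otimes> ?t [^] j) \<in> ?Z" unfolding eq mem_set_add by blast
  qed
  moreover have "(u \<otimes> ?xy) [^] N \<ominus> (?s \<oplus> ?t) [^] N \<in> p"
   using rel' cc c by (intro pow_congruent[OF ip]) auto
  then have "d \<otimes> ((u \<otimes> ?xy) [^] N \<ominus> (?s \<oplus> ?t) [^] N) \<in> ?Z"
   using ideal_mult_l[OF ip _ dc] set_add_upper2[OF ideal_prod_is_ideal[OF ixy im] ip] by blast
  moreover have "d \<otimes> (u \<otimes> ?xy) [^] N = d \<otimes> ((u \<otimes> ?xy) [^] N \<ominus> (?s \<oplus> ?t) [^] N) \<oplus> d \<otimes> (?s \<oplus> ?t) [^] N"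
   using dc nat_pow_closed[of "u \<otimes> ?xy" N] nat_pow_closed[of "?s \<oplus> ?t" N] sc c by algebra
  ultimately have "d \<otimes> (u \<otimes> ?xy) [^] N \<in> ?Z" using ideal_add[OF iZ] by simp
  then obtain w q where w: "w \<in> (PIdl (?xy [^] N)) \<cdot> ?B" "q \<in> p" "d \<otimes> (u \<otimes> ?xy) [^] N = w \<oplus> q" unfolding mem_set_add by blast
  obtain v where v: "v \<in> ?B" "w = ?xy [^] N \<otimes> v" using w(1) unfolding PIdl_prod[OF pxy im] by blast
  have vc: "v \<in> carrier R" "q \<in> carrier R" using ideal_carr[OF im v(1)] ideal_carr[OF ip w(2)] by auto
  have uN: "u [^] N \<in> carrier R" using c by simp
  have "?xy [^] N \<otimes> (d \<otimes> u [^] N \<ominus> v) = d \<otimes> (u [^] N \<otimes> ?xy [^] N) \<ominus> ?xy [^] N \<otimes> v"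
   using pxy dc uN vc by algebra
  also have "u [^] N \<otimes> ?xy [^] N = (u \<otimes> ?xy) [^] N" using c(1) sc(3) by (simp add: nat_pow_distrib)
  also have "d \<otimes> (u \<otimes> ?xy) [^] N \<ominus> ?xy [^] N \<otimes> v = q" unfolding w(3) v(2) using pxy vc by algebra
  finally have "?xy [^] N \<in> p \<or> d \<otimes> u [^] N \<ominus> v \<in> p" using prime_mult[OF p pxy, of "d \<otimes> u [^] N \<ominus> v"] w(2) dc uN vc by auto
  moreover have "?xy [^] N \<notin> p" using prime_pow[OF p sc(3)] prime_mult[OF p cc(1,3)] nX by blast
  ultimately have "d \<otimes> u [^] N \<ominus> v \<in> p" by blast
  moreover have "d \<otimes> u [^] N = v \<oplus> (d \<otimes> u [^] N \<ominus> v)" using dc uN vc by algebra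
  ultimately have "d \<otimes> u [^] N \<in> ?B <+> p" using v(1) unfolding mem_set_add by blast
  then show ?thesis by (simp add: ipow_mult[OF mm_ideal])
 qed
 then show ?thesis by (rule integral_of_almost_integral[OF p im c(1) dc dp])
qed

text \<open>The equations of integral dependence of u modulo the single primes are multiplied into
  one modulo their intersection, and \<gamma> turns this into an equation for \<gamma>u in R itself.
  Analytic unramifiedness then makes \<gamma>u small, and Artin-Rees for (\<gamma>) removes the
  factor \<gamma>.\<close>

theorem limit_closure_small:
 assumes cat: "catenary (UP R)" and unr: "analytically_unramified R \<mm>"
  and fin: "finite \<P>" and prime: "\<And>p. p \<in> \<P> \<Longrightarrow> primeideal p R"
  and ht: "\<And>p. p \<in> \<P> \<Longrightarrow> \<exists>p1. primeideal p1 R \<and> p \<subset> p1 \<and> p1 \<subset> \<mm>"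
  and \<gamma>: "\<gamma> \<in> carrier R" "\<And>p. p \<in> \<P> \<Longrightarrow> \<gamma> \<notin> p"
   "\<And>z. z \<in> carrier R \<Longrightarrow> (\<And>p. p \<in> \<P> \<Longrightarrow> z \<in> p) \<Longrightarrow> \<gamma> \<otimes> z = \<zero>"
 shows "\<exists>x\<in>\<mm>. \<exists>y\<in>\<mm>. \<forall>N. \<exists>G. \<forall>(n::nat) u a b. u \<in> carrier R \<and> a \<in> carrier R \<and> b \<in> carrier R \<and>
  (\<forall>p\<in>\<P>. u \<otimes> (x \<otimes> y) [^] n \<ominus> (x [^] (n + G) \<otimes> a \<oplus> y [^] (n + G) \<otimes> b) \<in> p) \<longrightarrow>
  (\<exists>v\<in>ipow \<mm> N. \<forall>p\<in>\<P>. u \<ominus> v \<in> p)"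
proof -
 note im = ipow_ideal[OF mm_ideal]
 have "\<exists>x\<in>\<mm>. \<exists>y\<in>\<mm>. \<forall>p\<in>\<P>. x \<notin> p \<and> y \<notin> p \<and>
  (\<forall>p'. primeideal p' R \<and> p \<subseteq> p' \<and> x \<in> p' \<and> y \<in> p' \<longrightarrow> (\<exists>p1. primeideal p1 R \<and> p \<subset> p1 \<and> p1 \<subset> p'))"
  by (rule ex_parameters[OF fin prime ht])
 then obtain x y where xy12: "x \<in> \<mm>" "y \<in> \<mm>" and xy0: "\<forall>p\<in>\<P>. x \<notin> p \<and> y \<notin> p \<and>
  (\<forall>p'. primeideal p' R \<and> p \<subseteq> p' \<and> x \<in> p' \<and> y \<in> p' \<longrightarrow> (\<exists>p1. primeideal p1 R \<and> p \<subset> p1 \<and> p1 \<subset> p'))"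
  by (elim bexE)
 have xy3: "x \<notin> p" "y \<notin> p" if "p \<in> \<P>" for p using bspec[OF xy0 that] by blast+
 have xy5: "\<exists>p1. primeideal p1 R \<and> p \<subset> p1 \<and> p1 \<subset> p'"
  if "p \<in> \<P>" "primeideal p' R" "p \<subseteq> p'" "x \<in> p'" "y \<in> p'" for p p'
  using bspec[OF xy0 that(1)] that(2-5) by blast
 note xy = xy12 xy3 xy5
 have "\<exists>G. \<forall>(n::nat) u a b. u \<in> carrier R \<and> a \<in> carrier R \<and> b \<in> carrier R \<and>
  (\<forall>p\<in>\<P>. u \<otimes> (x \<otimes> y) [^] n \<ominus> (x [^] (n + G) \<otimes> a \<oplus> y [^] (n + G) \<otimes> b) \<in> p) \<longrightarrow>
  (\<exists>v\<in>ipow \<mm> N. \<forall>p\<in>\<P>. u \<ominus> v \<in> p)" for N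
 proof -
  note ig = cgenideal_ideal[OF \<gamma>(1)]
  obtain c0 where c0: "\<And>n. n \<ge> c0 \<Longrightarrow> PIdl \<gamma> \<inter> ipow \<mm> n \<subseteq> ipow \<mm> (n - c0) \<cdot> (PIdl \<gamma>)"
   using artin_rees[OF mm_ideal ig] by blast
  \<comment> \<open>G belongs to N + c0, because \<gamma>u in \<mm>^(N+c0) gives \<gamma>u =
    \<gamma>v with v in \<mm>^N.\<close>
  obtain G where G: "\<And>I. asym_int G I \<Longrightarrow> I \<subseteq> ipow \<mm> (N + c0)" using asym_int_small[OF unr] by blast
  have main: "\<exists>v\<in>ipow \<mm> N. \<forall>p\<in>\<P>. u \<ominus> v \<in> p"
   if c: "u \<in> carrier R" "a \<in> carrier R" "b \<in> carrier R"
    and rel: "\<And>p. p \<in> \<P> \<Longrightarrow> u \<otimes> (x \<otimes> y) [^] n \<ominus> (x [^] (n + G) \<otimes> a \<oplus> y [^] (n + G) \<otimes> b) \<in> p" for n :: nat and u a b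
  proof -
   let ?b = "ipow \<mm> G"
   let ?X = "PIdl u <+> ?b"
   note iu = cgenideal_ideal[OF c(1)]
   have iX: "ideal ?X R" by (intro add_ideals iu im)
   note iXn = ipow_ideal[OF iX]
   have iBX: "ideal (?b \<cdot> ipow ?X r) R" for r by (intro ideal_prod_is_ideal im iXn)
   have bX: "?b \<subseteq> ?X" "u \<in> ?X" using set_add_upper1[OF iu im] set_add_upper2[OF iu im] cgenideal_self[OF c(1)] by blast+
   have mono: "w \<otimes> \<eta> \<in> ?b \<cdot> ipow ?X (k + r)" if "w \<in> ipow ?X k" "\<eta> \<in> ?b \<cdot> ipow ?X r" for w \<eta> k r
   proof -
    have "w \<otimes> \<eta> \<in> ipow ?X k \<cdot> (?b \<cdot> ipow ?X r)" using that by (rule ideal_prod.prod)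
    then show ?thesis using ideal_prod_left_comm[OF iXn im iXn] by (simp add: ipow_add[OF iX])
   qed
   have eX: "\<eta> \<in> ipow ?X (Suc r)" if "\<eta> \<in> ?b \<cdot> ipow ?X r" for \<eta> r
    using that ideal_prod_mono[OF bX(1) order_refl, of "ipow ?X r"] ideal_prod_commute[OF iX iXn] by (auto simp: ipow_Suc)
   have one: "\<exists>r. \<exists>\<eta>\<in>?b \<cdot> ipow ?X r. u [^] Suc r \<ominus> \<eta> \<in> p" if "p \<in> \<P>" for p
    by (rule limit_closure_integral[OF cat prime[OF that] xy(1) xy(3)[OF that] xy(2) xy(4)[OF that] xy(5)[OF that] c rel[OF that]])
   \<comment> \<open>The product of u^(r+1) - \<eta> and u^(s+1) - \<theta> is u^(r+s+2) minus an
     element of the same kind.\<close>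
   have all: "\<exists>r. \<exists>\<eta>\<in>?b \<cdot> ipow ?X r. \<forall>p\<in>F. u [^] Suc r \<ominus> \<eta> \<in> p" if "finite F" "F \<subseteq> \<P>" for F
    using that
   proof (induct F rule: finite_induct)
    case empty then show ?case using ideal_zero[OF iBX] by blast
   next
    case (insert p F)
    then obtain r \<eta> where r: "\<eta> \<in> ?b \<cdot> ipow ?X r" "\<And>p. p \<in> F \<Longrightarrow> u [^] Suc r \<ominus> \<eta> \<in> p" by blast
    obtain s \<theta> where s: "\<theta> \<in> ?b \<cdot> ipow ?X s" "u [^] Suc s \<ominus> \<theta> \<in> p" using one insert(4) by blast
    have cc: "\<eta> \<in> carrier R" "\<theta> \<in> carrier R" using ideal_carr[OF iBX r(1)] ideal_carr[OF iBX s(1)] by auto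
    have pc: "u [^] Suc r \<in> carrier R" "u [^] Suc s \<in> carrier R" by (intro nat_pow_closed c)+
    let ?z = "(u [^] Suc r \<otimes> \<theta> \<oplus> u [^] Suc s \<otimes> \<eta>) \<ominus> \<eta> \<otimes> \<theta>"
    have "(u [^] Suc r \<ominus> \<eta>) \<otimes> (u [^] Suc s \<ominus> \<theta>) = u [^] Suc r \<otimes> u [^] Suc s \<ominus> ?z" using cc pc by algebra
    also have "u [^] Suc r \<otimes> u [^] Suc s = u [^] Suc (Suc (r + s))"
    proof -
     have "Suc (Suc (r + s)) = Suc r + Suc s" by simp
     then show ?thesis using c by (simp only: nat_pow_mult)
    qed
    finally have eq: "u [^] Suc (Suc (r + s)) \<ominus> ?z = (u [^] Suc r \<ominus> \<eta>) \<otimes> (u [^] Suc s \<ominus> \<theta>)" by simp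
    have "?z \<in> ?b \<cdot> ipow ?X (Suc (r + s))"
    proof (intro ideal_minus[OF iBX] ideal_add[OF iBX])
     show "u [^] Suc r \<otimes> \<theta> \<in> ?b \<cdot> ipow ?X (Suc (r + s))" using mono[OF pow_mem_ipow[OF iX bX(2), of "Suc r"] s(1)] by simp
     show "u [^] Suc s \<otimes> \<eta> \<in> ?b \<cdot> ipow ?X (Suc (r + s))" using mono[OF pow_mem_ipow[OF iX bX(2), of "Suc s"] r(1)] by (simp add: add.commute)
     show "\<eta> \<otimes> \<theta> \<in> ?b \<cdot> ipow ?X (Suc (r + s))" using mono[OF eX[OF r(1)] s(1)] by simp
    qed
    moreover have "u [^] Suc (Suc (r + s)) \<ominus> ?z \<in> p'" if "p' \<in> insert p F" for p'
    proof -
     have i: "ideal p' R" using that insert(4) prime prime_ideal by blast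
     show ?thesis unfolding eq
      using that r(2) s(2) pc cc ideal_mult_r[OF i, of "u [^] Suc r \<ominus> \<eta>" "u [^] Suc s \<ominus> \<theta>"] ideal_mult_l[OF i, of "u [^] Suc s \<ominus> \<theta>" "u [^] Suc r \<ominus> \<eta>"]
      by (auto simp del: nat_pow_Suc)
    qed
    ultimately show ?case by blast
   qed
   obtain r \<eta> where r: "\<eta> \<in> ?b \<cdot> ipow ?X r" "\<And>p. p \<in> \<P> \<Longrightarrow> u [^] Suc r \<ominus> \<eta> \<in> p" using all[OF fin] by blast
   have ec: "\<eta> \<in> carrier R" using ideal_carr[OF iBX r(1)] .
   have upc: "u [^] Suc r \<in> carrier R" by (intro nat_pow_closed c)
   have "\<gamma> \<otimes> (u [^] Suc r \<ominus> \<eta>) = \<zero>" using \<gamma>(3)[OF _ r(2)] upc ec by simp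
   moreover have "\<gamma> \<otimes> u [^] Suc r = \<gamma> \<otimes> (u [^] Suc r \<ominus> \<eta>) \<oplus> \<gamma> \<otimes> \<eta>" using \<gamma>(1) upc ec by algebra
   ultimately have geq: "\<gamma> \<otimes> u [^] Suc r = \<gamma> \<otimes> \<eta>" using \<gamma>(1) ec by simp
   let ?w = "\<gamma> \<otimes> u"
   have wc: "?w \<in> carrier R" using \<gamma>(1) c by simp
   let ?X' = "PIdl ?w <+> ?b"
   note iw = cgenideal_ideal[OF wc]
   have iX': "ideal ?X' R" by (intro add_ideals iw im)
   note iXn' = ipow_ideal[OF iX']
   have X'w: "?w \<in> ?X'" using set_add_upper1[OF iw im] cgenideal_self[OF wc] by blast
   have gX: "(PIdl \<gamma>) \<cdot> ?X \<subseteq> ?X'"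
   proof (rule ideal_prod_subset[OF iX'])
    fix i z assume i: "i \<in> PIdl \<gamma>" and z: "z \<in> ?X"
    obtain t where t: "t \<in> carrier R" "i = t \<otimes> \<gamma>" using i unfolding cgen_iff by blast
    obtain s e where s: "s \<in> carrier R" "e \<in> ?b" "z = s \<otimes> u \<oplus> e" using z unfolding mem_cgen_add by (elim bexE)
    have e: "e \<in> carrier R" using ideal_carr[OF im s(2)] .
    have "i \<otimes> z = (t \<otimes> s) \<otimes> ?w \<oplus> (t \<otimes> \<gamma>) \<otimes> e" unfolding t(2) s(3) using t(1) s(1) e c(1) \<gamma>(1) by algebra
    moreover have "(t \<otimes> \<gamma>) \<otimes> e \<in> ?b" by (rule ideal_mult_l[OF im s(2) m_closed[OF t(1) \<gamma>(1)]])
    ultimately show "i \<otimes> z \<in> ?X'" using m_closed[OF t(1) s(1)] unfolding mem_cgen_add by blast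
   qed
   have "?w [^] Suc r \<in> ?b \<cdot> ipow ?X' r <+> {\<zero>}"
   proof -
    have gr: "\<gamma> [^] r \<in> carrier R" using \<gamma>(1) by simp
    have "?w [^] Suc r = \<gamma> [^] r \<otimes> (\<gamma> \<otimes> u [^] Suc r)"
     using \<gamma>(1) c(1) upc by (simp add: nat_pow_distrib m_ac)
    also have "\<dots> = \<gamma> \<otimes> (\<gamma> [^] r \<otimes> \<eta>)" unfolding geq using \<gamma>(1) ec gr by algebra
    finally have eq: "?w [^] Suc r = \<gamma> \<otimes> (\<gamma> [^] r \<otimes> \<eta>)" .
    have iBX': "ideal (?b \<cdot> ipow ?X' r) R" by (intro ideal_prod_is_ideal im iXn')
    have "\<gamma> [^] r \<otimes> \<eta> \<in> ipow (PIdl \<gamma>) r \<cdot> (?b \<cdot> ipow ?X r)"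
     using cgenideal_self[OF gr] r(1) unfolding ipow_PIdl[OF \<gamma>(1)] by (rule ideal_prod.prod)
    also have "\<dots> = ?b \<cdot> ipow ((PIdl \<gamma>) \<cdot> ?X) r"
     unfolding ipow_prod[OF ig iX] by (rule ideal_prod_left_comm[OF ipow_ideal[OF ig] im iXn])
    also have "\<dots> \<subseteq> ?b \<cdot> ipow ?X' r" by (intro ideal_prod_mono ipow_mono gX order_refl)
    finally have "\<gamma> [^] r \<otimes> \<eta> \<in> ?b \<cdot> ipow ?X' r" .
    then have "\<gamma> \<otimes> (\<gamma> [^] r \<otimes> \<eta>) \<in> ?b \<cdot> ipow ?X' r" by (rule ideal_mult_l[OF iBX' _ \<gamma>(1)])
    then show ?thesis unfolding eq using set_add_upper1[OF iBX' zeroideal] by blast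
   qed
   then have "ipow ?X' (r + j) \<subseteq> ipow ?b j \<cdot> ipow ?X' r <+> {\<zero>}" for j by (rule integral_powers[OF wc im zeroideal])
   moreover have "ipow ?b j \<cdot> ipow ?X' r <+> {\<zero>} \<subseteq> ipow \<mm> (G * j)" for j
   proof (rule set_add_least[OF im])
    show "ipow ?b j \<cdot> ipow ?X' r \<subseteq> ipow \<mm> (G * j)"
     using ideal_prod_le1[OF ipow_ideal[OF im, of G j] iXn', of r] unfolding ipow_mult[OF mm_ideal] .
    show "{\<zero>} \<subseteq> ipow \<mm> (G * j)" using ideal_zero[OF im] by simp
   qed
   ultimately have "asym_int G ?X'" unfolding asym_int_def using iX' by blast
   then have "?w \<in> ipow \<mm> (N + c0)" using G X'w by blast
   moreover have "?w \<in> PIdl \<gamma>" using c(1) \<gamma>(1) m_comm[of \<gamma> u] by (auto simp: cgen_iff)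
   ultimately have "?w \<in> ipow \<mm> N \<cdot> (PIdl \<gamma>)" using c0[of "N + c0"] by auto
   then have "?w \<in> (PIdl \<gamma>) \<cdot> ipow \<mm> N" using ideal_prod_commute[OF im ig] by simp
   then obtain v where v: "v \<in> ipow \<mm> N" "?w = \<gamma> \<otimes> v" unfolding PIdl_prod[OF \<gamma>(1) im] by blast
   have vc: "v \<in> carrier R" using ideal_carr[OF im v(1)] .
   have "\<gamma> \<otimes> (u \<ominus> v) = \<gamma> \<otimes> u \<ominus> \<gamma> \<otimes> v" using \<gamma>(1) c(1) vc by algebra
   then have z: "\<gamma> \<otimes> (u \<ominus> v) = \<zero>" unfolding v(2) using \<gamma>(1) vc by (simp add: minus_eq r_neg)
   have "u \<ominus> v \<in> p" if p: "p \<in> \<P>" for p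
    using prime_mult[OF prime[OF p] \<gamma>(1), of "u \<ominus> v"] z \<gamma>(2)[OF p] ideal_zero[OF prime_ideal[OF prime[OF p]]] c(1) vc by auto
   then show ?thesis using v(1) by blast
  qed
  show ?thesis
  proof (rule exI[of _ G], intro allI impI, elim conjE)
   fix n :: nat and u a b
   assume c: "u \<in> carrier R" "a \<in> carrier R" "b \<in> carrier R"
    and rel: "\<forall>p\<in>\<P>. u \<otimes> (x \<otimes> y) [^] n \<ominus> (x [^] (n + G) \<otimes> a \<oplus> y [^] (n + G) \<otimes> b) \<in> p"
   show "\<exists>v\<in>ipow \<mm> N. \<forall>p\<in>\<P>. u \<ominus> v \<in> p" by (rule main[OF c bspec[OF rel]])
  qed
 qed
 then show ?thesis using xy(1,2) by (intro bexI[of _ x] bexI[of _ y] allI)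
qed

end

section \<open>Counting generators\<close>

context cring
begin

lemma ideal_finsum:
 assumes I: "ideal I R" shows "finite A \<Longrightarrow> \<forall>i\<in>A. f i \<in> I \<Longrightarrow> finsum R f A \<in> I"
proof (induct A rule: finite_induct)
 case empty then show ?case using ideal_zero[OF I] by simp
next
 case (insert x A)
 have "f \<in> A \<rightarrow> carrier R" "f x \<in> carrier R" using insert ideal_carr[OF I] by auto
 then show ?case using insert ideal_add[OF I] by simp
qed

lemma finsum_Times:
 assumes "finite B" "finite A" "h \<in> A \<times> B \<rightarrow> carrier R"
 shows "finsum R h (A \<times> B) = (\<Oplus>a\<in>A. \<Oplus>b\<in>B. h (a, b))"
 using assms(2,3)
proof (induct A rule: finite_induct)
 case (insert a A)
 have eq: "insert a A \<times> B = Pair a ` B \<union> A \<times> B" by auto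
 have "finsum R h (insert a A \<times> B) = finsum R h (Pair a ` B) \<oplus> finsum R h (A \<times> B)"
  unfolding eq by (rule finsum_Un_disjoint) (use insert assms(1) in auto)
 also have "finsum R h (Pair a ` B) = (\<Oplus>b\<in>B. h (a, b))"
  by (rule finsum_reindex) (use insert in \<open>auto simp: inj_on_def\<close>)
 also have "finsum R h (A \<times> B) = (\<Oplus>a\<in>A. \<Oplus>b\<in>B. h (a, b))" using insert by auto
 also have "(\<Oplus>b\<in>B. h (a, b)) \<oplus> (\<Oplus>a\<in>A. \<Oplus>b\<in>B. h (a, b)) = (\<Oplus>a\<in>insert a A. \<Oplus>b\<in>B. h (a, b))"
  using insert by (subst finsum_insert) (auto intro!: finsum_closed)
 finally show ?case .
qed simp

lemma ideal_residual:
 assumes I: "ideal I R" and C: "C \<subseteq> carrier R"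
 shows "ideal {x\<in>carrier R. \<forall>c\<in>C. c \<otimes> x \<in> I} R"
proof (rule idealI')
 have c: "c \<in> carrier R" if "c \<in> C" for c using that C by blast
 show "\<zero> \<in> {x\<in>carrier R. \<forall>c\<in>C. c \<otimes> x \<in> I}" using c ideal_zero[OF I] by simp
 fix a b assume a: "a \<in> {x\<in>carrier R. \<forall>c\<in>C. c \<otimes> x \<in> I}"
 show "a \<oplus> b \<in> {x\<in>carrier R. \<forall>c\<in>C. c \<otimes> x \<in> I}" if b: "b \<in> {x\<in>carrier R. \<forall>c\<in>C. c \<otimes> x \<in> I}"
  using a b c ideal_add[OF I] by (simp add: r_distr)
 show "b \<otimes> a \<in> {x\<in>carrier R. \<forall>c\<in>C. c \<otimes> x \<in> I}" if b: "b \<in> carrier R"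
 proof -
  have "d \<otimes> (b \<otimes> a) = b \<otimes> (d \<otimes> a)" if "d \<in> C" for d using c[OF that] a b by (intro m_lcomm) auto
  then show ?thesis using a b ideal_mult_l[OF I] by simp
 qed
qed auto

lemma Idl_prod_subset:
 assumes "A \<subseteq> carrier R" "B \<subseteq> carrier R"
 shows "(Idl A) \<cdot> (Idl B) \<subseteq> Idl {a \<otimes> b | a b. a \<in> A \<and> b \<in> B}"
proof -
 let ?H = "{a \<otimes> b | a b. a \<in> A \<and> b \<in> B}"
 have H: "?H \<subseteq> carrier R" using assms by auto
 note iH = genideal_ideal[OF H]
 have m: "b \<otimes> a \<in> Idl ?H" if ab: "a \<in> A" "b \<in> B" for a b
 proof -
  have "b \<otimes> a = a \<otimes> b" using ab assms m_comm by blast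
  then show ?thesis using genideal_self[OF H] ab by auto
 qed
 have "Idl A \<subseteq> {x\<in>carrier R. \<forall>b\<in>B. b \<otimes> x \<in> Idl ?H}"
  by (rule genideal_minimal[OF ideal_residual[OF iH assms(2)]]) (use assms m in blast)
 then have sub: "x \<in> carrier R \<and> (\<forall>b\<in>B. b \<otimes> x \<in> Idl ?H)" if "x \<in> Idl A" for x using that by blast
 have 1: "x \<otimes> b \<in> Idl ?H" if x: "x \<in> Idl A" and b: "b \<in> B" for x b
 proof -
  have "b \<in> carrier R" using assms(2) b by blast
  then have "x \<otimes> b = b \<otimes> x" using sub[OF x] m_comm by blast
  then show ?thesis using sub[OF x] b by simp
 qed
 have c: "Idl A \<subseteq> carrier R" using sub by blast
 have "B \<subseteq> {y\<in>carrier R. \<forall>x\<in>Idl A. x \<otimes> y \<in> Idl ?H}"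
 proof
  fix b assume "b \<in> B"
  then show "b \<in> {y\<in>carrier R. \<forall>x\<in>Idl A. x \<otimes> y \<in> Idl ?H}" using assms(2) 1 by simp blast
 qed
 then have "Idl B \<subseteq> {y\<in>carrier R. \<forall>x\<in>Idl A. x \<otimes> y \<in> Idl ?H}"
  by (rule genideal_minimal[OF ideal_residual[OF iH c]])
 then have "x \<otimes> y \<in> Idl ?H" if "x \<in> Idl A" "y \<in> Idl B" for x y using that by blast
 then show ?thesis by (rule ideal_prod_subset[OF iH])
qed

lemma Idl_image_prod:
 assumes K: "ideal K R" and S: "finite S" "X \<in> S \<rightarrow> carrier R" and z: "z \<in> (Idl (X ` S)) \<cdot> K"
 shows "\<exists>h\<in>S \<rightarrow> K. z = (\<Oplus>s\<in>S. X s \<otimes> h s)"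
 using S z
proof (induct S arbitrary: z rule: finite_induct)
 case empty
 have "{\<zero>} \<cdot> K \<subseteq> {\<zero>}" by (rule ideal_prod_le1[OF zeroideal K])
 then show ?case using empty by (auto simp: Idl_empty)
next
 case (insert a S)
 have Xc: "X a \<in> carrier R" "X ` S \<subseteq> carrier R" "X \<in> S \<rightarrow> carrier R" using insert by auto
 note iS = genideal_ideal[OF Xc(2)] and ia = cgenideal_ideal[OF Xc(1)]
 have "z \<in> (Idl (X ` S) <+> PIdl (X a)) \<cdot> K" using insert(5) Idl_insert[OF Xc(1,2)] by simp
 then have "z \<in> (Idl (X ` S)) \<cdot> K <+> (PIdl (X a)) \<cdot> K" using ideal_prod_r_distr[OF K iS ia] ideal_prod_commute[OF K] iS ia add_ideals[OF iS ia] by simp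
 then obtain z1 z2 where z1: "z1 \<in> (Idl (X ` S)) \<cdot> K" and z2: "z2 \<in> (PIdl (X a)) \<cdot> K" and z: "z = z1 \<oplus> z2"
  unfolding mem_set_add by (elim bexE)
 obtain h where h: "h \<in> S \<rightarrow> K" "z1 = (\<Oplus>s\<in>S. X s \<otimes> h s)" using insert(3)[OF Xc(3) z1] by blast
 obtain i where i: "i \<in> K" "z2 = X a \<otimes> i" using z2 unfolding PIdl_prod[OF Xc(1) K] by blast
 have ic: "i \<in> carrier R" and hc: "h s \<in> carrier R" if "s \<in> S" for s using ideal_carr[OF K] i h(1) that by auto
 have ic: "i \<in> carrier R" using ideal_carr[OF K i(1)] .
 have mc: "(\<lambda>s. X s \<otimes> h s) \<in> S \<rightarrow> carrier R" using hc Xc by auto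
 let ?h = "h(a := i)"
 have "(\<Oplus>s\<in>insert a S. X s \<otimes> ?h s) = X a \<otimes> i \<oplus> (\<Oplus>s\<in>S. X s \<otimes> ?h s)"
  using insert(1,2) mc Xc ic by (subst finsum_insert) auto
 also have "(\<Oplus>s\<in>S. X s \<otimes> ?h s) = (\<Oplus>s\<in>S. X s \<otimes> h s)"
  by (rule finsum_cong') (use insert(2) mc in auto)
 finally have "z = (\<Oplus>s\<in>insert a S. X s \<otimes> ?h s)" unfolding z h(2) i(2) using finsum_closed[OF mc] Xc ic by (simp add: a_comm)
 moreover have "?h \<in> insert a S \<rightarrow> K" using h(1) i(1) by auto
 ultimately show ?case by blast
qed

end

section \<open>Independence over the residue field\<close>

context noeth_local
begin

text \<open>When N contains \<mm> v t for all t, this is linear independence of the classes of the v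
  t modulo N over R/\<mm>. It concerns families: equal values at two indices count as
  dependent.\<close>

definition indep :: "'a set \<Rightarrow> 'c set \<Rightarrow> ('c \<Rightarrow> 'a) \<Rightarrow> bool"
 where "indep N T v \<longleftrightarrow> (\<forall>u\<in>T \<rightarrow> carrier R. (\<Oplus>t\<in>T. u t \<otimes> v t) \<in> N \<longrightarrow> (\<forall>t\<in>T. u t \<in> \<mm>))"

lemma indepD: "indep N T v \<Longrightarrow> u \<in> T \<rightarrow> carrier R \<Longrightarrow> (\<Oplus>t\<in>T. u t \<otimes> v t) \<in> N \<Longrightarrow> t \<in> T \<Longrightarrow> u t \<in> \<mm>"
 by (auto simp: indep_def)

lemma one_notin_mm: "\<one> \<notin> \<mm>" by (rule prime_one[OF mm_prime])

text \<open>Gaussian elimination. A generator h disappears either because all coefficients at h lie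
  in \<mm>, so that h contributes only to N, or by means of some v s with a unit coefficient at h: v
  s clears h from the other members and is then dropped.\<close>

lemma indep_card_le:
 assumes N: "ideal N R" and H: "finite H" "H \<subseteq> carrier R" "\<And>h r. h \<in> H \<Longrightarrow> r \<in> \<mm> \<Longrightarrow> r \<otimes> h \<in> N"
  and T: "finite T" "v \<in> T \<rightarrow> Idl H <+> N" "indep N T v"
 shows "card T \<le> card H"
 using H T
proof (induct H arbitrary: T v rule: finite_induct)
 case empty
 have "T = {}"
 proof (rule ccontr)
  assume "T \<noteq> {}"
  then obtain t where t: "t \<in> T" by blast
  have vN: "v s \<in> N" if "s \<in> T" for s using empty(4) that set_add_least[OF N, of "{\<zero>}" N] ideal_zero[OF N] by (auto simp: Idl_empty)
  have "(\<Oplus>s\<in>T. \<one> \<otimes> v s) \<in> N" by (rule ideal_finsum[OF N empty(3)]) (use vN ideal_carr[OF N] in auto)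
  then have "\<one> \<in> \<mm>" using indepD[OF empty(5), of "\<lambda>_. \<one>"] t by auto
  then show False using one_notin_mm by blast
 qed
 then show ?case by simp
next
 case (insert h H)
 have hc: "h \<in> carrier R" and Hc: "H \<subseteq> carrier R" using insert(4) by auto
 note iH = genideal_ideal[OF Hc]
 have iHN: "ideal (Idl H <+> N) R" by (intro add_ideals iH N)
 have "\<exists>r\<in>carrier R. \<exists>y\<in>Idl H <+> N. v t = r \<otimes> h \<oplus> y" if "t \<in> T" for t
 proof -
  have "v t \<in> (Idl H <+> PIdl h) <+> N" using insert(7) that Idl_insert[OF hc Hc] by auto
  then obtain a n where a: "a \<in> Idl H <+> PIdl h" and n: "n \<in> N" "v t = a \<oplus> n" unfolding mem_set_add[of _ _ N] by (elim bexE)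
  obtain b r where b: "b \<in> Idl H" "r \<in> carrier R" "a = b \<oplus> r \<otimes> h" using a unfolding mem_add_cgen by (elim bexE)
  have bc: "b \<in> carrier R" "n \<in> carrier R" using ideal_carr[OF iH b(1)] ideal_carr[OF N n(1)] by auto
  have "v t = r \<otimes> h \<oplus> (b \<oplus> n)" unfolding n(2) b(3) using bc b(2) hc by algebra
  moreover have "b \<oplus> n \<in> Idl H <+> N" using b(1) n(1) by (rule mem_set_addI)
  ultimately show ?thesis using b(2) by blast
 qed
 then obtain r y where r: "\<And>t. t \<in> T \<Longrightarrow> r t \<in> carrier R" and y: "\<And>t. t \<in> T \<Longrightarrow> y t \<in> Idl H <+> N"
  and v: "\<And>t. t \<in> T \<Longrightarrow> v t = r t \<otimes> h \<oplus> y t" by metis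
 have yc: "y t \<in> carrier R" if "t \<in> T" for t using ideal_carr[OF iHN y[OF that]] .
 have vc: "v t \<in> carrier R" if "t \<in> T" for t using v[OF that] r[OF that] yc[OF that] hc by simp
 show ?case
 proof (cases "\<forall>t\<in>T. r t \<in> \<mm>")
  case True
  have "v t \<in> Idl H <+> N" if t: "t \<in> T" for t
  proof -
   have "r t \<otimes> h \<in> N" using insert(5)[of h] True t by blast
   then have "r t \<otimes> h \<in> Idl H <+> N" using set_add_upper2[OF iH N] by blast
   then show ?thesis unfolding v[OF t] by (rule ideal_add[OF iHN _ y[OF t]])
  qed
  then have "card T \<le> card H" using insert(3)[OF Hc insert(5) insert(6) _ insert(8)] by blast
  then show ?thesis using insert(1,2) by simp
 next
  case False
  then obtain s where s: "s \<in> T" "r s \<notin> \<mm>" by blast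
  obtain b where b: "b \<in> carrier R" "b \<otimes> r s = \<one>" using mm_unit[OF r[OF s(1)] s(2)] by blast
  let ?T = "T - {s}"
  let ?v = "\<lambda>t. v t \<ominus> (r t \<otimes> b) \<otimes> v s"
  have vH: "?v t \<in> Idl H <+> N" if t: "t \<in> T" for t
  proof -
   have "?v t = y t \<ominus> (r t \<otimes> b) \<otimes> y s \<oplus> (r t \<otimes> h \<ominus> (r t \<otimes> h) \<otimes> (b \<otimes> r s))"
    unfolding v[OF t] v[OF s(1)] using r[OF t] r[OF s(1)] yc[OF t] yc[OF s(1)] b(1) hc by algebra
   also have "\<dots> = y t \<ominus> (r t \<otimes> b) \<otimes> y s" unfolding b(2) using r[OF t] yc[OF t] yc[OF s(1)] b(1) hc by algebra
   also have "\<dots> \<in> Idl H <+> N" using y[OF t] y[OF s(1)] r[OF t] b(1) by (intro ideal_minus[OF iHN] ideal_mult_l[OF iHN]) auto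
   finally show ?thesis .
  qed
  have ind: "indep N ?T ?v"
   unfolding indep_def
  proof (intro ballI impI)
   fix u t assume u: "u \<in> ?T \<rightarrow> carrier R" and sum: "(\<Oplus>t\<in>?T. u t \<otimes> ?v t) \<in> N" and t: "t \<in> ?T"
   let ?c = "\<Oplus>t\<in>?T. u t \<otimes> (r t \<otimes> b)"
   have c1: "(\<lambda>t. u t \<otimes> (r t \<otimes> b)) \<in> ?T \<rightarrow> carrier R" using u r b(1) by auto
   have cc: "?c \<in> carrier R" by (rule finsum_closed[OF c1])
   have c2: "(\<lambda>t. u t \<otimes> v t) \<in> ?T \<rightarrow> carrier R" using u vc by auto
   have c3: "(\<lambda>t. (\<ominus> v s) \<otimes> (u t \<otimes> (r t \<otimes> b))) \<in> ?T \<rightarrow> carrier R" using c1 vc[OF s(1)] by auto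
   let ?u = "\<lambda>t. if t = s then \<ominus> ?c else u t"
   have c4: "(\<lambda>t. ?u t \<otimes> v t) \<in> ?T \<rightarrow> carrier R"
   proof
    fix t assume t: "t \<in> ?T"
    have "u t \<otimes> v t \<in> carrier R" using funcset_mem[OF u t] vc t by simp
    then show "?u t \<otimes> v t \<in> carrier R" using t by simp
   qed
   have "(\<Oplus>t\<in>?T. u t \<otimes> ?v t) = (\<Oplus>t\<in>?T. u t \<otimes> v t \<oplus> (\<ominus> v s) \<otimes> (u t \<otimes> (r t \<otimes> b)))"
   proof (rule finsum_cong')
    show "u t \<otimes> ?v t = u t \<otimes> v t \<oplus> (\<ominus> v s) \<otimes> (u t \<otimes> (r t \<otimes> b))" if "t \<in> ?T" for t
    proof -
     have "u t \<in> carrier R" "v t \<in> carrier R" "r t \<in> carrier R" "v s \<in> carrier R" using that u vc r s(1) by auto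
     then show ?thesis using b(1) by algebra
    qed
   qed (use c2 c3 in auto)
   also have "\<dots> = (\<Oplus>t\<in>?T. u t \<otimes> v t) \<oplus> (\<Oplus>t\<in>?T. (\<ominus> v s) \<otimes> (u t \<otimes> (r t \<otimes> b)))"
    by (rule finsum_addf[OF c2 c3])
   also have "(\<Oplus>t\<in>?T. (\<ominus> v s) \<otimes> (u t \<otimes> (r t \<otimes> b))) = (\<ominus> v s) \<otimes> ?c"
    using finsum_rdistr[OF _ _ c1, of "\<ominus> v s"] insert(6) vc[OF s(1)] by simp
   also have "(\<Oplus>t\<in>?T. u t \<otimes> v t) \<oplus> (\<ominus> v s) \<otimes> ?c = (\<ominus> ?c) \<otimes> v s \<oplus> (\<Oplus>t\<in>?T. u t \<otimes> v t)"
    using cc vc[OF s(1)] finsum_closed[OF c2] by (simp add: a_comm l_minus r_minus m_comm)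
   also have "(\<Oplus>t\<in>?T. u t \<otimes> v t) = (\<Oplus>t\<in>?T. ?u t \<otimes> v t)"
    by (rule finsum_cong'[OF refl c4]) auto
   also have "(\<ominus> ?c) \<otimes> v s \<oplus> (\<Oplus>t\<in>?T. ?u t \<otimes> v t) = (\<Oplus>t\<in>insert s ?T. ?u t \<otimes> v t)"
    using insert(6) vc[OF s(1)] cc by (subst finsum_insert[OF _ _ c4]) simp_all
   also have "insert s ?T = T" using s(1) by blast
   finally have eq: "(\<Oplus>t\<in>?T. u t \<otimes> ?v t) = (\<Oplus>t\<in>T. ?u t \<otimes> v t)" .
   have "?u t \<in> \<mm>"
    by (rule indepD[OF insert(8)]) (use u cc t sum eq in auto)
   then show "u t \<in> \<mm>" using t by auto
  qed
  have "card ?T \<le> card H" by (rule insert(3)[OF Hc insert(5) _ _ ind]) (use vH insert(6) in auto)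
  then show ?thesis using insert(1,2,6) s(1) by simp
 qed
qed

end

text \<open>
 The sums of \<open>j\<close> powers \<open>(k + 1)\<^sup>i\<close> with \<open>i \<le> d\<close>.  For \<open>j \<le> k\<close> there are no carries in base \<open>k + 1\<close>, so the sum
 determines its terms.
\<close>

primrec expset :: "nat \<Rightarrow> nat \<Rightarrow> nat \<Rightarrow> nat set"
 where "expset k d 0 = {0}"
 | "expset k d (Suc j) = (\<lambda>(s, i). s + (k + 1) ^ i) ` (expset k d j \<times> {..d})"

lemma finite_expset: "finite (expset k d j)"
 by (induct j) auto

lemma expset_le: "s \<in> expset k d j \<Longrightarrow> s \<le> j * (k + 1) ^ d"
proof (induct j arbitrary: s)
 case (Suc j)
 then obtain t i where t: "t \<in> expset k d j" "i \<le> d" "s = t + (k + 1) ^ i" by auto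
 have "(k + 1) ^ i \<le> (k + 1) ^ d" using t(2) by (intro power_increasing) auto
 then show ?case using Suc(1)[OF t(1)] t(3) by simp
qed simp

text \<open>Numerals in base k+1 with the least significant digit first; the entries are genuine
  digits only under the bound k assumed in \<open>digits_val_inj\<close>.\<close>

primrec digits_val :: "nat \<Rightarrow> nat list \<Rightarrow> nat"
 where "digits_val k [] = 0"
 | "digits_val k (a # l) = a + (k + 1) * digits_val k l"

lemma digits_val_update: "i < length l \<Longrightarrow> digits_val k (l[i := Suc (l ! i)]) = digits_val k l + (k + 1) ^ i"
proof (induct l arbitrary: i)
 case (Cons a l)
 show ?case
 proof (cases i)
  case (Suc i')
  then have "digits_val k (l[i' := Suc (l ! i')]) = digits_val k l + (k + 1) ^ i'" using Cons by simp
  then show ?thesis using Suc by (simp add: algebra_simps)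
 qed simp
qed simp

lemma digits_val_inj: "length l = length l' \<Longrightarrow> set l \<subseteq> {..k} \<Longrightarrow> set l' \<subseteq> {..k} \<Longrightarrow> digits_val k l = digits_val k l' \<Longrightarrow> l = l'"
proof (induct l l' rule: list_induct2)
 case (Cons a l a' l')
 have a: "a < k + 1" "a' < k + 1" using Cons by auto
 have eq: "a + (k + 1) * digits_val k l = a' + (k + 1) * digits_val k l'" using Cons(5) by simp
 have m: "(b + (k + 1) * q) mod (k + 1) = b" if "b < k + 1" for b q using that by (simp only: mod_mult_self2 mod_less)
 have "a = a'" using arg_cong[OF eq, of "\<lambda>z. z mod (k + 1)"] unfolding m[OF a(1)] m[OF a(2)] .
 then have "(k + 1) * digits_val k l = (k + 1) * digits_val k l'" using eq by linarith
 then have "digits_val k l = digits_val k l'" by (metis Suc_eq_plus1 Suc_mult_cancel1)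
 then show ?case using Cons \<open>a = a'\<close> by auto
qed simp

text \<open>Adding (k+1)^i raises entry i by one, so sums of j powers correspond to lists of length
  d+1 with entry sum j; for j \<le> k these are counted by stars and bars in
  \<open>card_expset\<close>.\<close>

lemma expset_eq: "expset k d j = digits_val k ` {l. length l = d + 1 \<and> sum_list l = j}"
proof (induct j)
 case 0
 have z: "digits_val k l = 0" if "set l \<subseteq> {0}" for l using that by (induct l) auto
 have r: "sum_list (replicate m 0) = (0::nat)" for m by (induct m) auto
 have "digits_val k ` {l. length l = d + 1 \<and> sum_list l = 0} = (\<lambda>_. 0) ` {l::nat list. length l = d + 1 \<and> sum_list l = 0}"
 proof (rule image_cong[OF refl])
  fix l :: "nat list" assume "l \<in> {l. length l = d + 1 \<and> sum_list l = 0}"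
  then have "set l \<subseteq> {0}" by (auto simp: sum_list_eq_0_iff)
  then show "digits_val k l = 0" by (rule z)
 qed
 also have "\<dots> = {0}"
  by (rule image_constant[of "replicate (d + 1) 0"]) (simp add: r)
 finally show ?case by simp
next
 case (Suc j)
 show ?case
 proof (intro equalityI subsetI)
  fix s assume "s \<in> expset k d (Suc j)"
  then obtain l i where l: "length l = d + 1" "sum_list l = j" "i \<le> d" "s = digits_val k l + (k + 1) ^ i"
   using Suc by auto
  have "s = digits_val k (l[i := Suc (l ! i)])" using digits_val_update[of i l k] l by simp
  moreover have "sum_list (l[i := Suc (l ! i)]) = Suc j"
   using l sum_list_update[of i l "Suc (l ! i)"] member_le_sum_list[of "l ! i" l] by simp
  ultimately show "s \<in> digits_val k ` {l. length l = d + 1 \<and> sum_list l = Suc j}" using l(1) by auto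
 next
  fix s assume "s \<in> digits_val k ` {l. length l = d + 1 \<and> sum_list l = Suc j}"
  then obtain l where l: "length l = d + 1" "sum_list l = Suc j" "s = digits_val k l" by auto
  have "\<exists>x\<in>set l. x \<noteq> 0" using l(2) by (metis Zero_not_Suc sum_list_eq_0_iff)
  then obtain i where i: "i < length l" "l ! i \<noteq> 0" by (metis in_set_conv_nth)
  let ?l = "l[i := l ! i - 1]"
  have "l = ?l[i := Suc (?l ! i)]" using i by simp
  then have s: "s = digits_val k ?l + (k + 1) ^ i" using digits_val_update[of i ?l k] i l(3) by simp
  have "sum_list ?l = j" using l(2) i sum_list_update[of i l "l ! i - 1"] member_le_sum_list[of "l ! i" l] by simp
  then have "digits_val k ?l \<in> expset k d j" using Suc l(1) by auto
  then show "s \<in> expset k d (Suc j)" using i(1) l(1) by (auto simp: s)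
 qed
qed

lemma card_expset: "j \<le> k \<Longrightarrow> card (expset k d j) = (j + d) choose j"
proof -
 assume j: "j \<le> k"
 have "set l \<subseteq> {..k}" if "sum_list l = j" for l using that j member_le_sum_list[of _ l] by fastforce
 then have "inj_on (digits_val k) {l. length l = d + 1 \<and> sum_list l = j}"
  by (intro inj_onI digits_val_inj) auto
 then show ?thesis unfolding expset_eq using card_length_sum_list[of "d + 1" j] by (simp add: card_image)
qed

text \<open>Here \<open>Suc k\<close> is the Dedekind--Mertens number k of the overview and n is the
  degree of g. The left side counts coefficients of fg times generators of a power of c(f); the
  right side counts the elements whose independence is to be contradicted.\<close>

lemma binomial_comparison:
 assumes "Suc k < s"
 shows "(Suc k * n + n + 1) * ((k + Suc k * n) choose k) < s * ((Suc k + Suc k * n) choose Suc k)"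
proof -
 define C where "C = (k + Suc k * n) choose k"
 have C: "C > 0" unfolding C_def by simp
 have "Suc (k + Suc k * n) * C = ((Suc k + Suc k * n) choose Suc k) * Suc k"
  unfolding C_def using Suc_times_binomial_eq[of "k + Suc k * n" k] by simp
 then have "((Suc k + Suc k * n) choose Suc k) * Suc k = Suc k * ((n + 1) * C)" by (simp add: algebra_simps)
 then have B: "((Suc k + Suc k * n) choose Suc k) = (n + 1) * C" by (metis mult.commute mult_cancel_right nat.distinct(1))
 have "(Suc k * n + n + 1) < (k + 2) * (n + 1)" by (simp add: algebra_simps)
 also have "\<dots> \<le> s * (n + 1)" using assms by (intro mult_right_mono) auto
 finally have "(Suc k * n + n + 1) * C < s * (n + 1) * C" using C by (intro mult_strict_right_mono)
 then show ?thesis unfolding B C_def[symmetric] by (simp only: mult.assoc)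
qed

section \<open>The generator count for a polynomial with monomial coefficients\<close>

context noeth_local
begin

abbreviation (input) cf where "cf \<equiv> up_ring.coeff (UP R)"

lemma content_bounded:
 assumes f: "f \<in> carrier (UP R)" and d: "\<And>i. i > d \<Longrightarrow> cf f i = \<zero>"
 shows "content_ideal R f = Idl (cf f ` {..d})"
proof
 interpret U: UP_cring R "UP R" by (rule UP_cring_R)
 have c: "cf f ` {..d} \<subseteq> carrier R" "range (cf f) \<subseteq> carrier R" using f by auto
 note i = genideal_ideal[OF c(1)]
 show "content_ideal R f \<subseteq> Idl (cf f ` {..d})"
  unfolding content_ideal_def
 proof (rule genideal_minimal[OF i])
  show "range (cf f) \<subseteq> Idl (cf f ` {..d})"
  proof
   fix z assume "z \<in> range (cf f)"
   then obtain j where j: "z = cf f j" by blast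
   show "z \<in> Idl (cf f ` {..d})"
    using genideal_self[OF c(1)] ideal_zero[OF i] d[of j] by (cases "j \<le> d") (auto simp: j)
  qed
 qed
 show "Idl (cf f ` {..d}) \<subseteq> content_ideal R f"
  unfolding content_ideal_def by (rule Idl_mono[OF _ c(2)]) auto
qed

lemma content_ideal_ideal: "f \<in> carrier (UP R) \<Longrightarrow> ideal (content_ideal R f) R"
proof -
 assume f: "f \<in> carrier (UP R)"
 interpret U: UP_cring R "UP R" by (rule UP_cring_R)
 show ?thesis unfolding content_ideal_def using f by (intro genideal_ideal) auto
qed

lemma coeff_in_content: "f \<in> carrier (UP R) \<Longrightarrow> cf f i \<in> content_ideal R f"
proof -
 assume f: "f \<in> carrier (UP R)"
 interpret U: UP_cring R "UP R" by (rule UP_cring_R)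
 have "range (cf f) \<subseteq> carrier R" using f by auto
 then show ?thesis unfolding content_ideal_def using genideal_self by blast
qed

lemma ex_polynomial:
 assumes "b \<in> {..d} \<rightarrow> carrier R"
 shows "\<exists>f\<in>carrier (UP R). \<forall>i. cf f i = (if i \<le> d then b i else \<zero>)"
proof -
 let ?f = "\<lambda>i. if i \<le> d then b i else \<zero>"
 have "?f \<in> up R"
 proof (rule mem_upI)
  show "\<exists>n. bound \<zero> n ?f" by (rule exI[of _ d]) (auto intro!: bound.intro)
 qed (use assms in auto)
 then show ?thesis by (intro bexI[of _ ?f]) (auto simp: UP_def)
qed

text \<open>The small limit closures of x, y replace a regular sequence: a relation between the
  products X k s w t can be tested one monomial at a time. The ideal \<pp> allows the components on
  which no such x, y exist to be disregarded.\<close>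

theorem indep_content_card_le:
 assumes x: "x \<in> carrier R" and y: "y \<in> carrier R" and pp: "ideal \<pp> R"
  and limit: "\<And>N. \<exists>G. \<forall>(n::nat) u a b. u \<in> carrier R \<and> a \<in> carrier R \<and> b \<in> carrier R \<and>
   u \<otimes> (x \<otimes> y) [^] n \<ominus> (x [^] (n + G) \<otimes> a \<oplus> y [^] (n + G) \<otimes> b) \<in> \<pp> \<longrightarrow> u \<in> ipow \<mm> N <+> \<pp>"
  and g: "g \<in> carrier (UP R)"
  and DM: "\<And>f. f \<in> carrier (UP R) \<Longrightarrow> content_ideal R (f \<otimes>\<^bsub>UP R\<^esub> g) \<cdot> ipow (content_ideal R f) k' =
   ipow (content_ideal R f) (Suc k') \<cdot> content_ideal R g"
  and T: "finite T" "w \<in> T \<rightarrow> content_ideal R g" "indep (\<mm> \<cdot> content_ideal R g <+> \<pp>) T w"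
 shows "card T \<le> Suc k'"
proof (rule ccontr)
 assume "\<not> ?thesis"
 then have s: "Suc k' < card T" by simp
 interpret U: UP_cring R "UP R" by (rule UP_cring_R)
 let ?I = "content_ideal R g"
 have iI: "ideal ?I R" by (rule content_ideal_ideal[OF g])
 have iIp: "ideal (?I <+> \<pp>) R" by (intro add_ideals iI pp)
 have iN: "ideal (\<mm> \<cdot> ?I <+> \<pp>) R" by (intro add_ideals ideal_prod_is_ideal mm_ideal iI pp)
 have imI: "ideal (\<mm> \<cdot> ?I) R" by (intro ideal_prod_is_ideal mm_ideal iI)
 \<comment> \<open>By Artin-Rees, elements of I + \<pp> in \<mm>^(c+1) lie in \<mm>(I + \<pp>). So
   limit closures inside \<mm>^(c+1) + \<pp> are small enough, and this fixes G.\<close>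
 obtain c where c: "\<And>n. n \<ge> c \<Longrightarrow> (?I <+> \<pp>) \<inter> ipow \<mm> n \<subseteq> ipow \<mm> (n - c) \<cdot> (?I <+> \<pp>)"
  using artin_rees[OF mm_ideal iIp] by blast
 obtain G where G: "\<forall>(n::nat) u a b. u \<in> carrier R \<and> a \<in> carrier R \<and> b \<in> carrier R \<and>
   u \<otimes> (x \<otimes> y) [^] n \<ominus> (x [^] (n + G) \<otimes> a \<oplus> y [^] (n + G) \<otimes> b) \<in> \<pp> \<longrightarrow> u \<in> ipow \<mm> (Suc c) <+> \<pp>"
  using limit by blast
 let ?k = "Suc k'"
 let ?n = "deg R g"
 let ?d = "?k * ?n"
 let ?B = "(?k + 1) ^ ?d"
 let ?S = "expset ?k ?d"
 \<comment> \<open>B is the largest of the powers (k+1)^i with i \<le> d. X j s is a monomial of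
   degree GjB in x and y, and the factor G keeps different exponents at least G apart. Products of j
   coefficients of f are exactly the X j s with s in the exponent set for j, by
   \<open>Xb\<close>.\<close>
 define X where "X j s = x [^] (G * s) \<otimes> y [^] (G * (j * ?B - s))" for j s :: nat
 have Xc: "X j s \<in> carrier R" for j s using x y by (simp add: X_def)
 define b where "b i = X 1 ((?k + 1) ^ i)" for i
 have bc: "b i \<in> carrier R" for i by (simp add: b_def Xc)
 have Xb: "X j s \<otimes> b i = X (Suc j) (s + (?k + 1) ^ i)" if s: "s \<in> ?S j" "i \<le> ?d" for j s i
 proof -
  define q where "q = (?k + 1) ^ i"
  define B where "B = ?B"
  have "q \<le> B" unfolding q_def B_def using s(2) by (intro power_increasing) auto
  moreover have "s \<le> j * B" using expset_le[OF s(1)] unfolding B_def .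
  ultimately have e: "Suc j * B - (s + q) = (j * B - s) + (1 * B - q)" by simp
  have "X j s \<otimes> b i = (x [^] (G * s) \<otimes> x [^] (G * q)) \<otimes> (y [^] (G * (j * B - s)) \<otimes> y [^] (G * (1 * B - q)))"
   unfolding b_def X_def q_def[symmetric] B_def[symmetric] using x y by (simp add: m_ac)
  also have "\<dots> = x [^] (G * (s + q)) \<otimes> y [^] (G * (Suc j * B - (s + q)))"
   unfolding e using x y by (simp only: nat_pow_mult add_mult_distrib2)
  finally show ?thesis unfolding X_def q_def B_def .
 qed
 have XSc: "X j ` ?S j' \<subseteq> carrier R" for j j' using Xc by auto
 obtain f where f: "f \<in> carrier (UP R)" and fb: "\<And>i. cf f i = (if i \<le> ?d then b i else \<zero>)"
  using ex_polynomial[of b ?d] bc by auto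
 let ?J = "content_ideal R f"
 have iJ: "ideal ?J R" by (rule content_ideal_ideal[OF f])
 note iJn = ipow_ideal[OF iJ]
 have bJ: "b i \<in> ?J" if "i \<le> ?d" for i using coeff_in_content[OF f, of i] fb[of i] that by simp
 have J: "?J = Idl (b ` {..?d})" using content_bounded[OF f, of ?d] fb by simp
 have XJ: "s \<in> ?S j \<Longrightarrow> X j s \<in> ipow ?J j" for j s
 proof (induct j arbitrary: s)
  case (Suc j)
  then obtain t i where t: "t \<in> ?S j" "i \<le> ?d" "s = t + (?k + 1) ^ i" by auto
  show ?case unfolding t(3) Xb[OF t(1,2), symmetric] ipow_Suc using Suc(1)[OF t(1)] bJ[OF t(2)] by (rule ideal_prod.prod)
 qed (use Xc in simp)
 have JX: "ipow ?J j \<subseteq> Idl (X j ` ?S j)" for j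
 proof (induct j)
  case 0
  have "X 0 0 = \<one>" using x y by (simp add: X_def)
  then show ?case using genideal_one by simp
 next
  case (Suc j)
  have bS: "b ` {..?d} \<subseteq> carrier R" using bc by auto
  have "ipow ?J (Suc j) \<subseteq> (Idl (X j ` ?S j)) \<cdot> (Idl (b ` {..?d}))"
   unfolding ipow_Suc using Suc J by (intro ideal_prod_mono) auto
  also have "\<dots> \<subseteq> Idl {p \<otimes> q | p q. p \<in> X j ` ?S j \<and> q \<in> b ` {..?d}}"
   by (rule Idl_prod_subset[OF XSc bS])
  also have "\<dots> \<subseteq> Idl (X (Suc j) ` ?S (Suc j))"
  proof (rule Idl_mono[OF _ XSc], rule subsetI)
   fix z assume "z \<in> {p \<otimes> q | p q. p \<in> X j ` ?S j \<and> q \<in> b ` {..?d}}"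
   then obtain s i where si: "s \<in> ?S j" "i \<le> ?d" "z = X j s \<otimes> b i" by auto
   then show "z \<in> X (Suc j) ` ?S (Suc j)" unfolding si(3) Xb[OF si(1,2)] by force
  qed
  finally show ?case .
 qed
 let ?h = "f \<otimes>\<^bsub>UP R\<^esub> g"
 have hc: "?h \<in> carrier (UP R)" using f g by simp
 let ?C = "cf ?h ` {..?d + ?n}"
 have Cc: "?C \<subseteq> carrier R" using hc by auto
 have ch: "content_ideal R ?h = Idl ?C"
 proof (rule content_bounded[OF hc])
  fix m assume m: "m > ?d + ?n"
  have "cf ?h m \<in> {\<zero>}"
  proof (rule U.coeff_mult_mem[OF f g zeroideal])
   fix i assume "i \<le> m"
   show "cf f i \<otimes> cf g (m - i) \<in> {\<zero>}"
   proof (cases "i \<le> ?d")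
    case True
    then have "?n < m - i" using m by simp
    then show ?thesis using U.deg_aboveD[OF _ g] U.coeff_closed[OF f] by simp
   qed (use fb g in simp)
  qed
  then show "cf ?h m = \<zero>" by simp
 qed
 let ?H = "(\<lambda>(p, s). p \<otimes> X k' s) ` (?C \<times> ?S k')"
 have Hc: "?H \<subseteq> carrier R" using Cc Xc by auto
 have Hf: "finite ?H" using finite_expset by simp
 let ?M = "ipow ?J ?k \<cdot> ?I"
 have iM: "ideal ?M R" by (intro ideal_prod_is_ideal iJn iI)
 have MH: "?M \<subseteq> Idl ?H"
 proof -
  have "?M = (Idl ?C) \<cdot> ipow ?J k'" using DM[OF f] ch by simp
  also have "\<dots> \<subseteq> (Idl ?C) \<cdot> (Idl (X k' ` ?S k'))" by (rule ideal_prod_mono[OF order_refl JX])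
  also have "\<dots> \<subseteq> Idl {p \<otimes> q | p q. p \<in> ?C \<and> q \<in> X k' ` ?S k'}" by (rule Idl_prod_subset[OF Cc XSc])
  also have "\<dots> \<subseteq> Idl ?H" by (rule Idl_mono[OF _ Hc]) auto
  finally show ?thesis .
 qed
 have HM: "?H \<subseteq> ?M"
 proof -
  have "p \<otimes> X k' s \<in> content_ideal R ?h \<cdot> ipow ?J k'" if "p \<in> ?C" "s \<in> ?S k'" for p s
   using that coeff_in_content[OF hc] by (intro ideal_prod.prod XJ) auto
  then show ?thesis using DM[OF f] by auto
 qed
 let ?N = "\<mm> \<cdot> ?M"
 have iN': "ideal ?N R" by (intro ideal_prod_is_ideal mm_ideal iM)
 let ?T = "?S ?k \<times> T"
 let ?v = "\<lambda>(s, t). X ?k s \<otimes> w t"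
 have wI: "w t \<in> ?I" if "t \<in> T" for t using T(2) that by auto
 have wc: "w t \<in> carrier R" if "t \<in> T" for t using ideal_carr[OF iI wI[OF that]] .
 have "card ?T \<le> card ?H"
 proof (rule indep_card_le[OF iN' Hf Hc])
  show "r \<otimes> h \<in> ?N" if "h \<in> ?H" "r \<in> \<mm>" for h r using HM that by (intro ideal_prod.prod) auto
  show "finite ?T" using T(1) finite_expset by simp
  show "?v \<in> ?T \<rightarrow> Idl ?H <+> ?N"
  proof
   fix z assume "z \<in> ?T"
   then obtain s t where st: "s \<in> ?S ?k" "t \<in> T" "z = (s, t)" by auto
   have "X ?k s \<otimes> w t \<in> ?M" using XJ[OF st(1)] wI[OF st(2)] by (rule ideal_prod.prod)
   then show "?v z \<in> Idl ?H <+> ?N" using MH set_add_upper1[OF genideal_ideal[OF Hc] iN'] by (auto simp: st(3))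
  qed
  show "indep ?N ?T ?v"
   unfolding indep_def
  proof (intro ballI impI)
   fix u z assume u: "u \<in> ?T \<rightarrow> carrier R" and sum: "(\<Oplus>z\<in>?T. u z \<otimes> ?v z) \<in> ?N" and z: "z \<in> ?T"
   obtain s0 t0 where st0: "s0 \<in> ?S ?k" "t0 \<in> T" "z = (s0, t0)" using z by auto
   have uc: "u (s, t) \<in> carrier R" if "s \<in> ?S ?k" "t \<in> T" for s t using u that by auto
   \<comment> \<open>Elements of \<mm> c(f)^k I are combinations of the monomials X k s with
     coefficients h s in \<mm>I. The relation thus compares two combinations of the same monomials,
     with coefficients q s and h s.\<close>
   have "?N = ipow ?J ?k \<cdot> (\<mm> \<cdot> ?I)" by (rule ideal_prod_left_comm[OF mm_ideal iJn iI])
   also have "\<dots> \<subseteq> (Idl (X ?k ` ?S ?k)) \<cdot> (\<mm> \<cdot> ?I)" by (rule ideal_prod_mono[OF JX order_refl])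
   finally have "(\<Oplus>z\<in>?T. u z \<otimes> ?v z) \<in> (Idl (X ?k ` ?S ?k)) \<cdot> (\<mm> \<cdot> ?I)" using sum by blast
   then have "\<exists>h\<in>?S ?k \<rightarrow> \<mm> \<cdot> ?I. (\<Oplus>z\<in>?T. u z \<otimes> ?v z) = (\<Oplus>s\<in>?S ?k. X ?k s \<otimes> h s)"
    by (rule Idl_image_prod[OF imI finite_expset, rotated]) (use Xc in auto)
   then obtain h where h: "h \<in> ?S ?k \<rightarrow> \<mm> \<cdot> ?I" "(\<Oplus>z\<in>?T. u z \<otimes> ?v z) = (\<Oplus>s\<in>?S ?k. X ?k s \<otimes> h s)" by blast
   have hI: "h s \<in> \<mm> \<cdot> ?I" if "s \<in> ?S ?k" for s using h(1) that by auto
   have hsc: "h s \<in> carrier R" if "s \<in> ?S ?k" for s using ideal_carr[OF imI hI[OF that]] .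
   define q where "q s = (\<Oplus>t\<in>T. u (s, t) \<otimes> w t)" for s
   have qI: "q s \<in> ?I" if "s \<in> ?S ?k" for s
    unfolding q_def using uc[OF that] wI by (intro ideal_finsum[OF iI T(1)]) (auto intro: ideal_mult_l[OF iI])
   have qc: "q s \<in> carrier R" if "s \<in> ?S ?k" for s using ideal_carr[OF iI qI[OF that]] .
   have "(\<Oplus>z\<in>?T. u z \<otimes> ?v z) = (\<Oplus>s\<in>?S ?k. \<Oplus>t\<in>T. u (s, t) \<otimes> ?v (s, t))"
   proof (rule finsum_Times[OF T(1) finite_expset], rule funcsetI)
    fix z assume "z \<in> ?T"
    then obtain s t where st: "s \<in> ?S ?k" "t \<in> T" "z = (s, t)" by (elim SigmaE)
    show "u z \<otimes> ?v z \<in> carrier R" using uc[OF st(1,2)] wc[OF st(2)] Xc by (simp add: st(3))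
   qed
   also have "\<dots> = (\<Oplus>s\<in>?S ?k. X ?k s \<otimes> q s)"
   proof (rule finsum_cong')
    show "(\<lambda>s. X ?k s \<otimes> q s) \<in> ?S ?k \<rightarrow> carrier R" using qc Xc by auto
    fix s assume s: "s \<in> ?S ?k"
    have c1: "(\<lambda>t. u (s, t) \<otimes> w t) \<in> T \<rightarrow> carrier R" using uc[OF s] wc by auto
    have "X ?k s \<otimes> q s = (\<Oplus>t\<in>T. X ?k s \<otimes> (u (s, t) \<otimes> w t))"
     unfolding q_def by (rule finsum_rdistr[OF T(1) Xc c1])
    also have "\<dots> = (\<Oplus>t\<in>T. u (s, t) \<otimes> ?v (s, t))"
     by (rule finsum_cong') (use uc[OF s] wc Xc m_lcomm in auto)
    finally show "(\<Oplus>t\<in>T. u (s, t) \<otimes> ?v (s, t)) = X ?k s \<otimes> q s" by simp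
   qed simp
   finally have qh: "(\<Oplus>s\<in>?S ?k. X ?k s \<otimes> q s) = (\<Oplus>s\<in>?S ?k. X ?k s \<otimes> h s)" using h(2) by simp
   let ?P = "G * s0" and ?Q = "G * (?k * ?B - s0)"
   let ?a = "x [^] (?P + G)" and ?b = "y [^] (?Q + G)"
   have abc: "?a \<in> carrier R" "?b \<in> carrier R" using x y by simp_all
   let ?Y = "PIdl ?a <+> PIdl ?b"
   have iY: "ideal ?Y R" by (intro add_ideals cgenideal_ideal abc)
   have abY: "?a \<in> ?Y" "?b \<in> ?Y"
    using set_add_upper1[OF cgenideal_ideal[OF abc(1)] cgenideal_ideal[OF abc(2)]]
     set_add_upper2[OF cgenideal_ideal[OF abc(1)] cgenideal_ideal[OF abc(2)]] cgenideal_self[OF abc(1)] cgenideal_self[OF abc(2)] by blast+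
   \<comment> \<open>All X k s have the same degree, so one with s different from s0 exceeds X k s0
     by at least G in the exponent of x or in that of y.\<close>
   have XY: "X ?k s \<in> ?Y" if s: "s \<in> ?S ?k" "s \<noteq> s0" for s
   proof (cases "s0 < s")
    case True
    then obtain e0 where "s = Suc (s0 + e0)" using less_imp_Suc_add by blast
    then have "G * s = (?P + G) + G * e0" by (simp add: algebra_simps)
    then obtain e where "G * s = (?P + G) + e" by blast
    then have "X ?k s = ?a \<otimes> (x [^] e \<otimes> y [^] (G * (?k * ?B - s)))"
     unfolding X_def using x y by (simp add: nat_pow_mult[symmetric] m_assoc)
    then show ?thesis using ideal_mult_r[OF iY abY(1)] x y by simp
   next
    case False
    then have "s < s0" using s(2) by simp
    moreover have "s0 \<le> ?k * ?B" by (rule expset_le[OF st0(1)])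
    ultimately have "?k * ?B - s = Suc (?k * ?B - s0) + (s0 - Suc s)" by simp
    then have "G * (?k * ?B - s) = (?Q + G) + G * (s0 - Suc s)" by (simp only: add_mult_distrib2 mult_Suc_right)
    then have "X ?k s = ?b \<otimes> (y [^] (G * (s0 - Suc s)) \<otimes> x [^] (G * s))"
     unfolding X_def using x y by (simp add: nat_pow_mult[symmetric] m_ac)
    then show ?thesis using ideal_mult_r[OF iY abY(2)] x y by simp
   qed
   let ?e = "q s0 \<ominus> h s0"
   have ec: "?e \<in> carrier R" using qc hsc st0(1) by simp
   have "X ?k s0 \<otimes> ?e \<in> ?Y"
   proof -
    let ?S' = "?S ?k - {s0}"
    have S: "?S ?k = insert s0 ?S'" using st0(1) by blast
    have fS: "finite ?S'" using finite_expset by blast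
    have sp: "(\<Oplus>s\<in>?S ?k. X ?k s \<otimes> r s) = X ?k s0 \<otimes> r s0 \<oplus> (\<Oplus>s\<in>?S'. X ?k s \<otimes> r s) \<and> (\<Oplus>s\<in>?S'. X ?k s \<otimes> r s) \<in> ?Y"
     if r: "\<forall>s\<in>?S ?k. r s \<in> carrier R" for r
    proof
     show "(\<Oplus>s\<in>?S ?k. X ?k s \<otimes> r s) = X ?k s0 \<otimes> r s0 \<oplus> (\<Oplus>s\<in>?S'. X ?k s \<otimes> r s)"
      by (subst S, subst finsum_insert) (use fS r Xc st0(1) in auto)
     show "(\<Oplus>s\<in>?S'. X ?k s \<otimes> r s) \<in> ?Y"
     proof (rule ideal_finsum[OF iY fS], rule ballI)
      fix s assume "s \<in> ?S'"
      then have s: "s \<in> ?S ?k" "s \<noteq> s0" by blast+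
      show "X ?k s \<otimes> r s \<in> ?Y" by (rule ideal_mult_r[OF iY XY[OF s] bspec[OF r s(1)]])
     qed
    qed
    let ?q = "\<Oplus>s\<in>?S'. X ?k s \<otimes> q s" and ?h = "\<Oplus>s\<in>?S'. X ?k s \<otimes> h s"
    have 1: "X ?k s0 \<otimes> q s0 \<oplus> ?q = X ?k s0 \<otimes> h s0 \<oplus> ?h" "?q \<in> ?Y" "?h \<in> ?Y"
     using sp[of q] sp[of h] qc hsc qh by auto
    have eq: "A \<otimes> (q' \<ominus> h') = z2 \<ominus> z1" if "A \<otimes> q' \<oplus> z1 = A \<otimes> h' \<oplus> z2"
     and "A \<in> carrier R" "q' \<in> carrier R" "h' \<in> carrier R" "z1 \<in> carrier R" "z2 \<in> carrier R" for A q' h' z1 z2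
    proof -
     have "A \<otimes> (q' \<ominus> h') = (A \<otimes> q' \<oplus> z1) \<ominus> z1 \<ominus> A \<otimes> h'" using that(2-) by algebra
     also have "\<dots> = z2 \<ominus> z1" unfolding that(1) using that(2-) by algebra
     finally show ?thesis .
    qed
    have "X ?k s0 \<otimes> ?e = ?h \<ominus> ?q"
     by (rule eq[OF 1(1) Xc qc[OF st0(1)] hsc[OF st0(1)] ideal_carr[OF iY 1(2)] ideal_carr[OF iY 1(3)]])
    then show ?thesis using ideal_minus[OF iY 1(3,2)] by simp
   qed
   then obtain r1 r2 where r: "r1 \<in> carrier R" "r2 \<in> carrier R" "X ?k s0 \<otimes> ?e = r1 \<otimes> ?a \<oplus> r2 \<otimes> ?b"
    unfolding mem_cgen_add[of _ ?a] Bex_def cgen_iff by blast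
   \<comment> \<open>Multiplication by x^Q y^P turns X k s0 = x^P y^Q into (xy)^(P+Q), the form in
     which the limit closure is controlled.\<close>
   let ?x = "x [^] ?Q" and ?y = "y [^] ?P"
   have xyc: "?x \<in> carrier R" "?y \<in> carrier R" using x y by simp_all
   have "?e \<otimes> (x \<otimes> y) [^] (?P + ?Q) = (?x \<otimes> ?y) \<otimes> (X ?k s0 \<otimes> ?e)"
    unfolding X_def using x y ec by (simp add: nat_pow_mult[symmetric] nat_pow_distrib m_ac)
   also have "\<dots> = (?x \<otimes> ?a) \<otimes> (r1 \<otimes> ?y) \<oplus> (?y \<otimes> ?b) \<otimes> (r2 \<otimes> ?x)"
    unfolding r(3) using r(1,2) abc xyc by algebra
   also have "?x \<otimes> ?a = x [^] ((?P + ?Q) + G)" using x by (simp add: nat_pow_mult add_ac)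
   also have "?y \<otimes> ?b = y [^] ((?P + ?Q) + G)" using y by (simp add: nat_pow_mult add_ac)
   finally have lim: "?e \<otimes> (x \<otimes> y) [^] (?P + ?Q) = x [^] ((?P + ?Q) + G) \<otimes> (r1 \<otimes> ?y) \<oplus> y [^] ((?P + ?Q) + G) \<otimes> (r2 \<otimes> ?x)" .
   have "?e \<otimes> (x \<otimes> y) [^] (?P + ?Q) \<ominus> (x [^] ((?P + ?Q) + G) \<otimes> (r1 \<otimes> ?y) \<oplus> y [^] ((?P + ?Q) + G) \<otimes> (r2 \<otimes> ?x)) = \<zero>"
    unfolding lim using x y r(1,2) xyc by (simp add: minus_eq r_neg)
   then have "?e \<in> ipow \<mm> (Suc c) <+> \<pp>"
    using G[rule_format, of ?e "r1 \<otimes> ?y" "r2 \<otimes> ?x" "?P + ?Q"] ideal_zero[OF pp] ec r(1,2) xyc by simp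
   then obtain e1 e2 where e: "e1 \<in> ipow \<mm> (Suc c)" "e2 \<in> \<pp>" "?e = e1 \<oplus> e2" unfolding mem_set_add by (elim bexE)
   have ecc: "e1 \<in> carrier R" "e2 \<in> carrier R" using ideal_carr[OF ipow_ideal[OF mm_ideal] e(1)] ideal_carr[OF pp e(2)] by auto
   have eI: "?e \<in> ?I"
    by (rule ideal_minus[OF iI qI[OF st0(1)] subsetD[OF ideal_prod_le2[OF mm_ideal iI] hI[OF st0(1)]]])
   have "e1 = ?e \<ominus> e2" unfolding e(3) using ecc by algebra
   also have "\<dots> \<in> ?I <+> \<pp>"
    by (intro ideal_minus[OF iIp] subsetD[OF set_add_upper1[OF iI pp] eI] subsetD[OF set_add_upper2[OF iI pp] e(2)])
   finally have "e1 \<in> (?I <+> \<pp>) \<inter> ipow \<mm> (Suc c)" using e(1) by blast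
   then have "e1 \<in> ipow \<mm> (Suc c - c) \<cdot> (?I <+> \<pp>)" using c[of "Suc c"] by auto
   then have "e1 \<in> \<mm> \<cdot> (?I <+> \<pp>)" using ipow_1[OF mm_ideal] by simp
   also have "\<dots> = \<mm> \<cdot> ?I <+> \<mm> \<cdot> \<pp>" by (rule ideal_prod_r_distr[OF mm_ideal iI pp])
   also have "\<dots> \<subseteq> \<mm> \<cdot> ?I <+> \<pp>" by (rule set_add_mono[OF order_refl ideal_prod_le2[OF mm_ideal pp]])
   finally have e1N: "e1 \<in> \<mm> \<cdot> ?I <+> \<pp>" .
   have up: "\<mm> \<cdot> ?I \<subseteq> \<mm> \<cdot> ?I <+> \<pp>" "\<pp> \<subseteq> \<mm> \<cdot> ?I <+> \<pp>"
    by (rule set_add_upper1[OF imI pp], rule set_add_upper2[OF imI pp])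
   have "q s0 = (e1 \<oplus> e2) \<oplus> h s0" unfolding e(3)[symmetric] using qc[OF st0(1)] hsc[OF st0(1)] by algebra
   also have "\<dots> \<in> \<mm> \<cdot> ?I <+> \<pp>"
    by (intro ideal_add[OF iN] e1N subsetD[OF up(2) e(2)] subsetD[OF up(1) hI[OF st0(1)]])
   finally have "(\<Oplus>t\<in>T. u (s0, t) \<otimes> w t) \<in> \<mm> \<cdot> ?I <+> \<pp>" unfolding q_def .
   then have "u (s0, t0) \<in> \<mm>"
    using indepD[OF T(3), of "\<lambda>t. u (s0, t)" t0] uc[OF st0(1)] st0(2) by auto
   then show "u z \<in> \<mm>" unfolding st0(3) .
  qed
 qed
 also have "card ?H \<le> card (?C \<times> ?S k')" by (rule card_image_le) (use finite_expset in simp)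
 also have "\<dots> = card ?C * card (?S k')" by (rule card_cartesian_product)
 also have "\<dots> \<le> (?d + ?n + 1) * card (?S k')" using card_image_le[of "{..?d + ?n}" "cf ?h"] by (intro mult_right_mono) auto
 also have "\<dots> = (?d + ?n + 1) * ((k' + ?d) choose k')" using card_expset[of k' ?k ?d] by simp
 also have "\<dots> < card T * ((?k + ?d) choose ?k)" by (rule binomial_comparison[OF s])
 also have "\<dots> = card ?T" using card_expset[of ?k ?k ?d] by (simp add: card_cartesian_product mult.commute)
 finally show False by simp
qed

end

section \<open>Generators of the content ideal modulo the components of large dimension\<close>

context UP_cring
begin

lemma ext_subset:
 assumes Q: "ideal Q P" and I: "ideal I R" and c: "\<And>a. a \<in> I \<Longrightarrow> mon a 0 \<in> Q"
 shows "ext I \<subseteq> Q"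
proof
 fix F assume F: "F \<in> ext I"
 then have Fc: "F \<in> carrier P" and FI: "\<And>n. cf F n \<in> I" by (auto simp: ext_def)
 have "mon (cf F i) i \<in> Q" for i
 proof -
  have ci: "cf F i \<in> carrier R" using Fc by simp
  have "mon (cf F i) i = mon \<one> i \<otimes>\<^sub>P mon (cf F i) 0"
   using monom_mult[of \<one> "cf F i" i 0] ci by simp
  then show ?thesis using P.ideal_mult_l[OF Q c[OF FI]] by simp
 qed
 then have "(\<Oplus>\<^bsub>P\<^esub> i \<in> {..deg R F}. mon (cf F i) i) \<in> Q"
  by (intro P.ideal_finsum[OF Q]) auto
 then show "F \<in> Q" using up_repr[OF Fc] by simp
qed

end

section \<open>Minimal primes and the components of dimension at least two\<close>

context noeth_local
begin

lemma content_subset: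
 assumes "ideal J R" "\<And>i. cf f i \<in> J"
 shows "content_ideal R f \<subseteq> J"
 unfolding content_ideal_def by (rule genideal_minimal) (use assms in auto)

lemma minimal_prime_below: "primeideal P R \<Longrightarrow> \<exists>Q. minimal_prime R Q \<and> Q \<subseteq> P"
proof -
 assume P: "primeideal P R"
 obtain Q where Q: "minover {\<zero>} Q" "Q \<subseteq> P" using ex_minover[OF zeroideal P] ideal_zero[OF prime_ideal[OF P]] by blast
 have "minimal_prime R Q"
  unfolding minimal_prime_def
 proof (intro conjI allI impI)
  show "primeideal Q R" using Q(1) by (simp add: minover_def)
  fix q assume q: "primeideal q R \<and> q \<subseteq> Q"
  have "\<zero> \<in> q" using ideal_zero prime_ideal q by blast
  then show "q = Q" using Q(1) q unfolding minover_def by blast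
 qed
 then show ?thesis using Q(2) by blast
qed

lemma finite_minimal_primes: "finite {p. minimal_prime R p}"
proof -
 obtain F where F: "finite F" "\<forall>P. primeideal P R \<and> {\<zero>} \<subseteq> P \<longrightarrow> (\<exists>Q\<in>F. Q \<subseteq> P)" "\<forall>P\<in>F. minover {\<zero>} P"
  using finite_minover[OF zeroideal] by blast
 have "{p. minimal_prime R p} \<subseteq> F"
 proof
  fix p assume "p \<in> {p. minimal_prime R p}"
  then have p: "primeideal p R" "\<forall>q. primeideal q R \<and> q \<subseteq> p \<longrightarrow> q = p" unfolding minimal_prime_def by auto
  have "{\<zero>} \<subseteq> p" using ideal_zero[OF prime_ideal[OF p(1)]] by simp
  then obtain Q where Q: "Q \<in> F" "Q \<subseteq> p" using F(2) p(1) by blast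
  have "primeideal Q R" using F(3) Q(1) unfolding minover_def by blast
  then show "p \<in> F" using p(2) Q by blast
 qed
 then show ?thesis using F(1) finite_subset by blast
qed

text \<open>R is reduced, so no power of a nonzero z vanishes, and some prime misses z; so does a
  minimal prime inside it.\<close>

lemma zero_if_in_minimal_primes:
 assumes unr: "analytically_unramified R \<mm>" and z: "z \<in> carrier R" "\<And>p. minimal_prime R p \<Longrightarrow> z \<in> p"
 shows "z = \<zero>"
proof (rule ccontr)
 assume nz: "z \<noteq> \<zero>"
 let ?S = "{z [^] n | n :: nat. True}"
 have "\<exists>P. primeideal P R \<and> {\<zero>} \<subseteq> P \<and> P \<inter> ?S = {} \<and> (\<forall>Y. ideal Y R \<and> P \<subset> Y \<longrightarrow> Y \<inter> ?S \<noteq> {})"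
 proof (rule ex_prime_disjoint[OF _ _ _ zeroideal])
  show "?S \<subseteq> carrier R" using z(1) by auto
  show "\<one> \<in> ?S" using nat_pow_0[of z] by (metis (mono_tags, lifting) mem_Collect_eq)
  show "a \<otimes> b \<in> ?S" if "a \<in> ?S" "b \<in> ?S" for a b
  proof -
   obtain m n :: nat where "a = z [^] m" "b = z [^] n" using \<open>a \<in> ?S\<close> \<open>b \<in> ?S\<close> by auto
   then have "a \<otimes> b = z [^] (m + n)" using z(1) by (simp add: nat_pow_mult)
   then show ?thesis by blast
  qed
  show "{\<zero>} \<inter> ?S = {}" using reduced[OF unr z(1)] nz by force
 qed
 then obtain P where P: "primeideal P R" "P \<inter> ?S = {}" by blast
 obtain Q where Q: "minimal_prime R Q" "Q \<subseteq> P" using minimal_prime_below[OF P(1)] by blast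
 have "z \<in> P" using z(2)[OF Q(1)] Q(2) by blast
 moreover have "z \<in> ?S" using nat_pow_eone[OF z(1)] by (metis (mono_tags, lifting) mem_Collect_eq)
 ultimately show False using P(2) by blast
qed

lemma prime_contains_Inter:
 assumes p: "primeideal p R"
 shows "finite F \<Longrightarrow> \<forall>Q\<in>F. ideal Q R \<and> \<not> Q \<subseteq> p \<Longrightarrow> \<exists>a\<in>carrier R - p. \<forall>Q\<in>F. a \<in> Q"
proof (induct F rule: finite_induct)
 case empty then show ?case using prime_one[OF p] by blast
next
 case (insert Q F)
 then obtain a where a: "a \<in> carrier R" "a \<notin> p" "\<forall>Q\<in>F. a \<in> Q" by blast
 have Q: "ideal Q R" and "\<exists>b. b \<in> Q \<and> b \<notin> p" using insert(4) by auto
 then obtain b where b: "b \<in> Q" "b \<notin> p" by blast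
 have bc: "b \<in> carrier R" by (rule ideal_carr[OF Q b(1)])
 have "a \<otimes> b \<notin> p" using prime_mult[OF p a(1) bc] a(2) b(2) by blast
 moreover have "a \<otimes> b \<in> Q" by (rule ideal_mult_l[OF Q b(1) a(1)])
 moreover have "\<forall>Q'\<in>F. a \<otimes> b \<in> Q'"
 proof
  fix Q' assume Q': "Q' \<in> F"
  have "ideal Q' R" using insert(4) Q' by simp
  then show "a \<otimes> b \<in> Q'" by (rule ideal_mult_r[OF _ bspec[OF a(3) Q'] bc])
 qed
 ultimately show ?case using m_closed[OF a(1) bc] by (intro bexI[of _ "a \<otimes> b"]) auto
qed

text \<open>The minimal primes p with dim R/p at least 2, expressed by a prime strictly between p
  and \<mm>. Under the dimension hypothesis these are all minimal primes if k \<ge> 2; for k = 1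
  some may be missing.\<close>

definition big_primes :: "'a set set"
 where "big_primes = {p. minimal_prime R p \<and> (\<exists>p1. primeideal p1 R \<and> p \<subset> p1 \<and> p1 \<subset> \<mm>)}"

definition big_Inter :: "'a set"
 where "big_Inter = {z\<in>carrier R. \<forall>p\<in>big_primes. z \<in> p}"

lemma big_prime: "p \<in> big_primes \<Longrightarrow> primeideal p R"
 by (simp add: big_primes_def minimal_prime_def)

lemma ideal_big_Inter: "ideal big_Inter R"
proof (rule idealI')
 have i: "ideal p R" if "p \<in> big_primes" for p by (rule prime_ideal[OF big_prime[OF that]])
 show "\<zero> \<in> big_Inter" using i ideal_zero by (simp add: big_Inter_def)
 show "a \<oplus> b \<in> big_Inter" if "a \<in> big_Inter" "b \<in> big_Inter" for a b
  using that i ideal_add by (simp add: big_Inter_def)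
 show "r \<otimes> a \<in> big_Inter" if "a \<in> big_Inter" "r \<in> carrier R" for a r
  using that i ideal_mult_l by (simp add: big_Inter_def)
qed (auto simp: big_Inter_def)

text \<open>The multiplier \<gamma> for \<open>limit_closure_small\<close> is taken in all minimal
  primes that are not big, but in no big one. Then \<gamma> times \<open>big_Inter\<close> lies in
  every minimal prime and vanishes.\<close>

theorem indep_card_le_dm:
 assumes cat: "catenary (UP R)" and unr: "analytically_unramified R \<mm>"
  and g: "g \<in> carrier (UP R)"
  and DM: "\<And>f. f \<in> carrier (UP R) \<Longrightarrow> content_ideal R (f \<otimes>\<^bsub>UP R\<^esub> g) \<cdot> ipow (content_ideal R f) k' =
   ipow (content_ideal R f) (Suc k') \<cdot> content_ideal R g"
  and T: "finite T" "w \<in> T \<rightarrow> content_ideal R g" "indep (\<mm> \<cdot> content_ideal R g <+> big_Inter) T w"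
 shows "card T \<le> Suc k'"
proof -
 let ?F = "{p. minimal_prime R p} - big_primes"
 have fin: "finite big_primes" by (rule finite_subset[OF _ finite_minimal_primes]) (auto simp: big_primes_def)
 have finF: "finite ?F" using finite_minimal_primes by simp
 let ?I = "{z\<in>carrier R. \<forall>p\<in>?F. z \<in> p}"
 have iF: "ideal p R" if "p \<in> ?F" for p using that prime_ideal by (auto simp: minimal_prime_def)
 have iI: "ideal ?I R"
 proof (rule idealI')
  show "\<zero> \<in> ?I" using iF ideal_zero by simp
  show "a \<oplus> b \<in> ?I" if "a \<in> ?I" "b \<in> ?I" for a b using that iF ideal_add by simp
  show "r \<otimes> a \<in> ?I" if "a \<in> ?I" "r \<in> carrier R" for a r using that iF ideal_mult_l by simp
 qed auto
 have "\<exists>\<gamma>\<in>?I. \<gamma> \<notin> \<Union>big_primes"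
 proof (rule prime_avoidance[OF fin big_prime iI])
  fix p assume p: "p \<in> big_primes"
  have "\<forall>Q\<in>?F. ideal Q R \<and> \<not> Q \<subseteq> p"
  proof
   fix Q assume Q: "Q \<in> ?F"
   have "Q \<noteq> p" using Q p by blast
   moreover have "Q \<subseteq> p \<Longrightarrow> Q = p" using p Q unfolding big_primes_def minimal_prime_def by blast
   ultimately show "ideal Q R \<and> \<not> Q \<subseteq> p" using iF[OF Q] by blast
  qed
  then obtain a where "a \<in> carrier R - p" "\<forall>Q\<in>?F. a \<in> Q" using prime_contains_Inter[OF big_prime[OF p] finF] by blast
  then show "\<not> ?I \<subseteq> p" by blast
 qed
 then obtain \<gamma> where \<gamma>: "\<gamma> \<in> carrier R" "\<forall>p\<in>?F. \<gamma> \<in> p" "\<gamma> \<notin> \<Union>big_primes" by blast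
 have \<gamma>z: "\<gamma> \<otimes> z = \<zero>" if z: "z \<in> carrier R" "\<And>p. p \<in> big_primes \<Longrightarrow> z \<in> p" for z
 proof (rule zero_if_in_minimal_primes[OF unr])
  show "\<gamma> \<otimes> z \<in> carrier R" using \<gamma>(1) z(1) by simp
  fix p assume p: "minimal_prime R p"
  have ip: "ideal p R" using p prime_ideal by (auto simp: minimal_prime_def)
  show "\<gamma> \<otimes> z \<in> p"
  proof (cases "p \<in> big_primes")
   case True then show ?thesis by (intro ideal_mult_l[OF ip z(2)] \<gamma>(1))
  next
   case False then show ?thesis using p \<gamma>(2) by (intro ideal_mult_r[OF ip _ z(1)]) blast
  qed
 qed
 have "\<exists>x\<in>\<mm>. \<exists>y\<in>\<mm>. \<forall>N. \<exists>G. \<forall>(n::nat) u a b. u \<in> carrier R \<and> a \<in> carrier R \<and> b \<in> carrier R \<and>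
  (\<forall>p\<in>big_primes. u \<otimes> (x \<otimes> y) [^] n \<ominus> (x [^] (n + G) \<otimes> a \<oplus> y [^] (n + G) \<otimes> b) \<in> p) \<longrightarrow>
  (\<exists>v\<in>ipow \<mm> N. \<forall>p\<in>big_primes. u \<ominus> v \<in> p)"
 proof (rule limit_closure_small[OF cat unr fin big_prime _ \<gamma>(1) _ \<gamma>z])
  show "\<exists>p1. primeideal p1 R \<and> p \<subset> p1 \<and> p1 \<subset> \<mm>" if "p \<in> big_primes" for p using that by (simp add: big_primes_def)
  show "\<gamma> \<notin> p" if "p \<in> big_primes" for p using that \<gamma>(3) by blast
 qed
 then obtain x y where xy: "x \<in> \<mm>" "y \<in> \<mm>" and lim: "\<forall>N. \<exists>G. \<forall>(n::nat) u a b. u \<in> carrier R \<and> a \<in> carrier R \<and> b \<in> carrier R \<and>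
  (\<forall>p\<in>big_primes. u \<otimes> (x \<otimes> y) [^] n \<ominus> (x [^] (n + G) \<otimes> a \<oplus> y [^] (n + G) \<otimes> b) \<in> p) \<longrightarrow>
  (\<exists>v\<in>ipow \<mm> N. \<forall>p\<in>big_primes. u \<ominus> v \<in> p)" by (elim bexE)
 have xyc: "x \<in> carrier R" "y \<in> carrier R" using xy ideal_carr[OF mm_ideal] by auto
 show ?thesis
 proof (rule indep_content_card_le[OF xyc ideal_big_Inter _ g DM T])
  fix N
  obtain G where G: "\<forall>(n::nat) u a b. u \<in> carrier R \<and> a \<in> carrier R \<and> b \<in> carrier R \<and>
   (\<forall>p\<in>big_primes. u \<otimes> (x \<otimes> y) [^] n \<ominus> (x [^] (n + G) \<otimes> a \<oplus> y [^] (n + G) \<otimes> b) \<in> p) \<longrightarrow>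
   (\<exists>v\<in>ipow \<mm> N. \<forall>p\<in>big_primes. u \<ominus> v \<in> p)" using spec[OF lim, of N] by (elim exE)
  show "\<exists>G. \<forall>(n::nat) u a b. u \<in> carrier R \<and> a \<in> carrier R \<and> b \<in> carrier R \<and>
   u \<otimes> (x \<otimes> y) [^] n \<ominus> (x [^] (n + G) \<otimes> a \<oplus> y [^] (n + G) \<otimes> b) \<in> big_Inter \<longrightarrow> u \<in> ipow \<mm> N <+> big_Inter"
  proof (rule exI[of _ G], intro allI impI, elim conjE)
   fix n :: nat and u a b
   assume c: "u \<in> carrier R" "a \<in> carrier R" "b \<in> carrier R"
    and r: "u \<otimes> (x \<otimes> y) [^] n \<ominus> (x [^] (n + G) \<otimes> a \<oplus> y [^] (n + G) \<otimes> b) \<in> big_Inter"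
   have "\<forall>p\<in>big_primes. u \<otimes> (x \<otimes> y) [^] n \<ominus> (x [^] (n + G) \<otimes> a \<oplus> y [^] (n + G) \<otimes> b) \<in> p"
    using r unfolding big_Inter_def by blast
   then have "\<exists>v\<in>ipow \<mm> N. \<forall>p\<in>big_primes. u \<ominus> v \<in> p" using G[rule_format, OF conjI[OF c(1) conjI[OF c(2) conjI[OF c(3)]]]] by simp
   then obtain v where v: "v \<in> ipow \<mm> N" "\<forall>p\<in>big_primes. u \<ominus> v \<in> p" by blast
   have vc: "v \<in> carrier R" using ideal_carr[OF ipow_ideal[OF mm_ideal] v(1)] .
   have "u \<ominus> v \<in> big_Inter" unfolding big_Inter_def using v(2) c(1) vc by simp
   then have "v \<oplus> (u \<ominus> v) \<in> ipow \<mm> N <+> big_Inter" using v(1) by (intro mem_set_addI)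
   moreover have "v \<oplus> (u \<ominus> v) = u" using c(1) vc by algebra
   ultimately show "u \<in> ipow \<mm> N <+> big_Inter" by simp
  qed
 qed
qed

text \<open>The bound says that I modulo \<mm>I + \<pp> has dimension at most one over the residue
  field; by Nakayama a representative of a basis generates I modulo \<pp>.\<close>

lemma principal_mod:
 assumes I: "ideal I R" and pp: "ideal \<pp> R"
  and two: "\<And>(T :: nat set) w. finite T \<Longrightarrow> w \<in> T \<rightarrow> I \<Longrightarrow> indep (\<mm> \<cdot> I <+> \<pp>) T w \<Longrightarrow> card T \<le> 1"
 shows "\<exists>w\<in>I. I \<subseteq> PIdl w <+> \<pp>"
proof -
 let ?N = "\<mm> \<cdot> I <+> \<pp>"
 have imI: "ideal (\<mm> \<cdot> I) R" by (intro ideal_prod_is_ideal mm_ideal I)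
 have iN: "ideal ?N R" by (intro add_ideals imI pp)
 show ?thesis
 proof (cases "I \<subseteq> ?N")
  case True
  have "?N = \<pp> <+> \<mm> \<cdot> I" by (rule set_add_comm[OF ideal_subset_carr[OF imI] ideal_subset_carr[OF pp]])
  then have "I \<subseteq> \<pp>" using nakayama[OF I pp] True by simp
  then have "I \<subseteq> PIdl \<zero> <+> \<pp>" using set_add_upper2[OF cgenideal_ideal[OF zero_closed] pp] by blast
  then show ?thesis using ideal_zero[OF I] by blast
 next
  case False
  then obtain w where w: "w \<in> I" "w \<notin> ?N" by blast
  have wc: "w \<in> carrier R" by (rule ideal_carr[OF I w(1)])
  note iw = cgenideal_ideal[OF wc]
  have "I \<subseteq> PIdl w <+> ?N"
  proof
   fix z assume z: "z \<in> I"
   have zc: "z \<in> carrier R" by (rule ideal_carr[OF I z])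
   let ?v = "\<lambda>i::nat. if i = 0 then w else z"
   have "\<not> indep ?N {0, 1} ?v"
   proof
    assume "indep ?N {0, 1} ?v"
    then have "card {0, 1::nat} \<le> 1" using w(1) z by (intro two) auto
    then show False by simp
   qed
   then obtain u i where u: "u \<in> {0, 1} \<rightarrow> carrier R" "(\<Oplus>t\<in>{0, 1}. u t \<otimes> ?v t) \<in> ?N" "i \<in> {0, 1::nat}" "u i \<notin> \<mm>"
    unfolding indep_def by blast
   have uc: "u 0 \<in> carrier R" "u 1 \<in> carrier R" using u(1) by auto
   have "(\<Oplus>t\<in>{0, 1}. u t \<otimes> ?v t) = u 0 \<otimes> w \<oplus> u 1 \<otimes> z"
    using uc wc zc by (simp add: finsum_insert)
   then have s: "u 0 \<otimes> w \<oplus> u 1 \<otimes> z \<in> ?N" using u(2) by simp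
   have "u 1 \<notin> \<mm>"
   proof
    assume u1: "u 1 \<in> \<mm>"
    then have "u 0 \<notin> \<mm>" using u(3,4) by auto
    then obtain b where b: "b \<in> carrier R" "b \<otimes> u 0 = \<one>" using mm_unit[OF uc(1)] by blast
    have "u 1 \<otimes> z \<in> \<mm> \<cdot> I" using u1 z by (rule ideal_prod.prod)
    then have uz: "u 1 \<otimes> z \<in> ?N" by (rule subsetD[OF set_add_upper1[OF imI pp]])
    have "w = (b \<otimes> u 0) \<otimes> w" unfolding b(2) using wc by simp
    also have "\<dots> = b \<otimes> ((u 0 \<otimes> w \<oplus> u 1 \<otimes> z) \<ominus> u 1 \<otimes> z)" using b(1) uc wc zc by algebra
    also have "\<dots> \<in> ?N" by (intro ideal_mult_l[OF iN] ideal_minus[OF iN] s uz b(1))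
    finally show False using w(2) by blast
   qed
   then obtain b where b: "b \<in> carrier R" "b \<otimes> u 1 = \<one>" using mm_unit[OF uc(2)] by blast
   have "z = (b \<otimes> u 1) \<otimes> z" unfolding b(2) using zc by simp
   also have "\<dots> = (\<ominus> (b \<otimes> u 0)) \<otimes> w \<oplus> b \<otimes> (u 0 \<otimes> w \<oplus> u 1 \<otimes> z)" using b(1) uc wc zc by algebra
   also have "\<dots> \<in> PIdl w <+> ?N"
    by (intro mem_set_addI ideal_mult_l[OF iw cgenideal_self[OF wc]] ideal_mult_l[OF iN s] b(1)) (use b(1) uc in simp)
   finally show "z \<in> PIdl w <+> ?N" .
  qed
  also have "PIdl w <+> ?N \<subseteq> (PIdl w <+> \<pp>) <+> \<mm> \<cdot> I"
  proof -
   have iwp: "ideal (PIdl w <+> \<pp>) R" by (intro add_ideals iw pp)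
   note iK = add_ideals[OF iwp imI]
   have "PIdl w \<subseteq> PIdl w <+> \<pp>" "\<pp> \<subseteq> PIdl w <+> \<pp>" by (rule set_add_upper1[OF iw pp], rule set_add_upper2[OF iw pp])
   then show ?thesis
    using set_add_upper1[OF iwp imI] set_add_upper2[OF iwp imI] by (intro set_add_least[OF iK]) blast+
  qed
  finally have "I \<subseteq> PIdl w <+> \<pp>" by (rule nakayama[OF I add_ideals[OF iw pp]])
  then show ?thesis using w(1) by blast
 qed
qed

text \<open>Take a minimal prime p inside the contraction of Q. If I is not in p and p is big, then
  g = w G modulo p with a coefficient of G outside \<mm>, so Q contains w and all of I. If dim R/p =
  1, then Q contracts to \<mm>, for otherwise Q would lie strictly between pR[t] and \<mm>R[t], and
  \<mm>R[t] is minimal over pR[t] + (y) for any y in \<mm> outside p.\<close>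

lemma const_in_primes_over:
 fixes Q :: "(nat \<Rightarrow> 'a) set"
 assumes g: "g \<in> carrier (UP R)" and w: "w \<in> content_ideal R g" "content_ideal R g \<subseteq> PIdl w <+> big_Inter"
  and dim: "\<And>p. minimal_prime R p \<Longrightarrow> p \<noteq> \<mm>"
  and a: "a \<in> content_ideal R g" "\<And>p. minimal_prime R p \<Longrightarrow> a \<in> p \<Longrightarrow> content_ideal R g \<subseteq> p"
  and Q: "primeideal Q (UP R)" "g \<in> Q" "\<And>F n. F \<in> Q \<Longrightarrow> cf F n \<in> \<mm>"
 shows "up_ring.monom (UP R) a 0 \<in> Q"
proof -
 interpret U: UP_cring R "UP R" by (rule UP_cring_R)
 interpret V: noetherian_cring "UP R" by (rule noetherian_cring_UP)
 let ?I = "content_ideal R g"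
 let ?C = "\<lambda>a. up_ring.monom (UP R) a 0"
 let ?p' = "{a\<in>carrier R. ?C a \<in> Q}"
 note iQ = U.P.prime_ideal[OF Q(1)] and iI = content_ideal_ideal[OF g]
 have p': "primeideal ?p' R" by (rule U.contract_prime[OF Q(1)])
 obtain p where p: "minimal_prime R p" "p \<subseteq> ?p'" using minimal_prime_below[OF p'] by blast
 have pp: "primeideal p R" using p(1) by (simp add: minimal_prime_def)
 note ip = prime_ideal[OF pp]
 have eQ: "U.ext p \<subseteq> Q" by (rule U.ext_subset[OF iQ ip]) (use p(2) in blast)
 show ?thesis
 proof (cases "?I \<subseteq> p")
  case True then show ?thesis using a(1) p(2) by blast
 next
  case False
  have Im: "?I \<subseteq> \<mm>"
   by (rule content_subset[OF mm_ideal Q(3)[OF Q(2)]])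
  show ?thesis
  proof (cases "p \<in> big_primes")
   case True
   have bp: "big_Inter \<subseteq> p" using True by (auto simp: big_Inter_def)
   have wc: "w \<in> carrier R" by (rule ideal_carr[OF iI w(1)])
   have "\<exists>r\<in>carrier R. \<exists>z\<in>big_Inter. cf g i = r \<otimes> w \<oplus> z" for i
    using subsetD[OF w(2) coeff_in_content[OF g, of i]] unfolding mem_cgen_add .
   then obtain r z where r: "\<And>i. r i \<in> carrier R" and z: "\<And>i. z i \<in> big_Inter"
    and rz: "\<And>i. cf g i = r i \<otimes> w \<oplus> z i" by metis
   have zc: "z i \<in> carrier R" for i using ideal_carr[OF ideal_big_Inter z] .
   let ?n = "deg R g"
   obtain G where G: "G \<in> carrier (UP R)" "\<forall>i. cf G i = (if i \<le> ?n then r i else \<zero>)"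
    using ex_polynomial[of r ?n] r by auto
   \<comment> \<open>Otherwise the coefficients of g lie in \<mm>I modulo \<open>big_Inter\<close>,
     and Nakayama puts I into \<open>big_Inter\<close>, hence into p.\<close>
   have nG: "\<exists>i. cf G i \<notin> \<mm>"
   proof (rule ccontr)
    assume "\<not> ?thesis"
    then have rm: "r i \<in> \<mm>" if "i \<le> ?n" for i using G(2) that by metis
    have imI: "ideal (\<mm> \<cdot> ?I) R" by (intro ideal_prod_is_ideal mm_ideal iI)
    have iN: "ideal (big_Inter <+> \<mm> \<cdot> ?I) R" by (intro add_ideals imI ideal_big_Inter)
    have "cf g i \<in> big_Inter <+> \<mm> \<cdot> ?I" for i
    proof (cases "i \<le> ?n")
     case True
     have "r i \<otimes> w \<in> \<mm> \<cdot> ?I" using rm[OF True] w(1) by (rule ideal_prod.prod)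
     then have "z i \<oplus> r i \<otimes> w \<in> big_Inter <+> \<mm> \<cdot> ?I" by (rule mem_set_addI[OF z])
     then show ?thesis unfolding rz using a_comm[OF zc m_closed[OF r wc]] by simp
    next
     case False
     then have "cf g i = \<zero>" using U.deg_aboveD[OF _ g] by simp
     then show ?thesis using ideal_zero[OF iN] by simp
    qed
    then have "?I \<subseteq> big_Inter <+> \<mm> \<cdot> ?I" by (rule content_subset[OF iN])
    then have "?I \<subseteq> big_Inter" by (rule nakayama[OF iI ideal_big_Inter])
    then show False using bp \<open>\<not> ?I \<subseteq> p\<close> by blast
   qed
   have CwG: "?C w \<otimes>\<^bsub>UP R\<^esub> G \<in> carrier (UP R)" using wc G(1) by simp
   have "g \<ominus>\<^bsub>UP R\<^esub> ?C w \<otimes>\<^bsub>UP R\<^esub> G \<in> U.ext p"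
    unfolding U.ext_def
   proof (intro CollectI conjI allI)
    show "g \<ominus>\<^bsub>UP R\<^esub> ?C w \<otimes>\<^bsub>UP R\<^esub> G \<in> carrier (UP R)" using g CwG by simp
    fix i
    have "cf (?C w \<otimes>\<^bsub>UP R\<^esub> G) i = w \<otimes> cf G i"
     using U.coeff_monom_mult[OF wc G(1), of 0 i] by simp
    then have eq: "cf (g \<ominus>\<^bsub>UP R\<^esub> ?C w \<otimes>\<^bsub>UP R\<^esub> G) i = cf g i \<ominus> w \<otimes> cf G i"
     using g CwG by (simp add: U.coeff_minus)
    show "cf (g \<ominus>\<^bsub>UP R\<^esub> ?C w \<otimes>\<^bsub>UP R\<^esub> G) i \<in> p"
    proof (cases "i \<le> ?n")
     case True
     have "(r i \<otimes> w \<oplus> z i) \<ominus> w \<otimes> r i = z i" using r[of i] wc zc[of i] by algebra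
     moreover have "cf G i = r i" using G(2) True by simp
     ultimately have "cf (g \<ominus>\<^bsub>UP R\<^esub> ?C w \<otimes>\<^bsub>UP R\<^esub> G) i = z i" unfolding eq rz by (simp only:)
     then show ?thesis using z bp by auto
    next
     case False
     then have "cf g i = \<zero>" "cf G i = \<zero>" using U.deg_aboveD[OF _ g] G(2) by auto
     then show ?thesis unfolding eq using ideal_zero[OF ip] wc by (simp add: minus_eq)
    qed
   qed
   then have "g \<ominus>\<^bsub>UP R\<^esub> ?C w \<otimes>\<^bsub>UP R\<^esub> G \<in> Q" using eQ by blast
   then have "g \<ominus>\<^bsub>UP R\<^esub> (g \<ominus>\<^bsub>UP R\<^esub> ?C w \<otimes>\<^bsub>UP R\<^esub> G) \<in> Q" by (rule U.P.ideal_minus[OF iQ Q(2)])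
   moreover have "g \<ominus>\<^bsub>UP R\<^esub> (g \<ominus>\<^bsub>UP R\<^esub> ?C w \<otimes>\<^bsub>UP R\<^esub> G) = ?C w \<otimes>\<^bsub>UP R\<^esub> G" using g CwG by algebra
   ultimately have "?C w \<otimes>\<^bsub>UP R\<^esub> G \<in> Q" by simp
   then have "?C w \<in> Q \<or> G \<in> Q" by (rule U.P.prime_mult[OF Q(1) _ G(1), rotated]) (use wc in simp)
   then have wp: "w \<in> ?p'" using Q(3) nG wc by blast
   note ip' = prime_ideal[OF p']
   have "PIdl w <+> big_Inter \<subseteq> ?p'"
    by (rule set_add_least[OF ip' cgenideal_minimal[OF ip' wp]]) (use bp p(2) in blast)
   then show ?thesis using w(2) a(1) by blast
  next
   case F: False
   have pm: "p \<subseteq> \<mm>" by (rule proper_ideal_sub_mm[OF ip prime_one[OF pp]])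
   have pnm: "p \<noteq> \<mm>" by (rule dim[OF p(1)])
   have between: "q = \<mm>" if "primeideal q R" "p \<subset> q" for q
   proof -
    have "q \<subseteq> \<mm>" by (rule proper_ideal_sub_mm[OF prime_ideal[OF that(1)] prime_one[OF that(1)]])
    then show ?thesis using F p(1) that unfolding big_primes_def by blast
   qed
   show ?thesis
   proof (cases "?p' = p")
    case False
    then have "?p' = \<mm>" using between[OF p'] p(2) by blast
    then show ?thesis using Im a(1) by blast
   next
    case True
    obtain y where y: "y \<in> \<mm>" "y \<notin> p" using pm pnm by blast
    have yc: "y \<in> carrier R" by (rule ideal_carr[OF mm_ideal y(1)])
    have Cy: "?C y \<in> carrier (UP R)" using yc by simp
    have Qm: "Q \<subseteq> U.ext \<mm>" unfolding U.ext_def using U.P.ideal_carr[OF iQ] Q(3) by blast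
    have "?C y \<in> U.ext \<mm>" using U.const_in_ext[OF mm_ideal yc] y(1) by simp
    moreover have "?C y \<notin> Q" using True y(2) yc by blast
    ultimately have Qm': "Q \<subset> U.ext \<mm>" using Qm by blast
    have "g \<notin> U.ext p"
    proof
     assume "g \<in> U.ext p"
     then have "?I \<subseteq> p" unfolding U.ext_def by (intro content_subset[OF ip]) blast
     then show False using \<open>\<not> ?I \<subseteq> p\<close> by blast
    qed
    then have pQ: "U.ext p \<subset> Q" using eQ Q(2) by blast
    note ie = U.ext_ideal[OF ip] and iy = U.P.cgenideal_ideal[OF Cy]
    have mo: "U.P.minover (U.ext p <+>\<^bsub>UP R\<^esub> PIdl\<^bsub>UP R\<^esub> (?C y)) (U.ext \<mm>)"
     unfolding U.P.minover_def
    proof (intro conjI allI impI)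
     show "primeideal (U.ext \<mm>) (UP R)" by (rule U.ext_prime[OF mm_prime])
     show "U.ext p <+>\<^bsub>UP R\<^esub> PIdl\<^bsub>UP R\<^esub> (?C y) \<subseteq> U.ext \<mm>"
      using U.const_in_ext[OF mm_ideal yc] y(1)
      by (intro U.P.set_add_least U.ext_ideal mm_ideal U.ext_mono pm U.P.cgenideal_minimal) simp
     fix Q' assume Q': "primeideal Q' (UP R) \<and> U.ext p <+>\<^bsub>UP R\<^esub> PIdl\<^bsub>UP R\<^esub> (?C y) \<subseteq> Q' \<and> Q' \<subseteq> U.ext \<mm>"
     then have pQ': "primeideal Q' (UP R)" by blast
     let ?q = "{a\<in>carrier R. ?C a \<in> Q'}"
     have "U.ext p \<subseteq> Q'" "?C y \<in> Q'"
      using Q' U.P.set_add_upper1[OF ie iy] U.P.set_add_upper2[OF ie iy] U.P.cgenideal_self[OF Cy] by blast+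
     then have "p \<subseteq> ?q" "y \<in> ?q" using U.const_in_ext[OF ip] ideal_carr[OF ip] yc by blast+
     then have "?q = \<mm>" using between[OF U.contract_prime[OF pQ']] y(2) by blast
     then have "U.ext \<mm> \<subseteq> Q'" by (intro U.ext_subset[OF U.P.prime_ideal[OF pQ'] mm_ideal]) blast
     then show "Q' = U.ext \<mm>" using Q' by blast
    qed
    show ?thesis
     using V.krull_principal_ideal[OF U.ext_prime[OF pp] Q(1) pQ Qm' Cy mo] by blast
   qed
  qed
 qed
qed

theorem principal_of_dm_one:
 assumes cat: "catenary (UP R)" and unr: "analytically_unramified R \<mm>"
  and g: "g \<in> carrier (UP R)" and dim: "\<And>p. minimal_prime R p \<Longrightarrow> p \<noteq> \<mm>"
  and DM: "\<And>f. f \<in> carrier (UP R) \<Longrightarrow> content_ideal R (f \<otimes>\<^bsub>UP R\<^esub> g) = content_ideal R f \<cdot> content_ideal R g"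
 shows "\<exists>A. A \<subseteq> carrier R \<and> finite A \<and> card A \<le> 1 \<and> content_ideal R g = Idl A"
proof -
 interpret U: UP_cring R "UP R" by (rule UP_cring_R)
 interpret V: noetherian_cring "UP R" by (rule noetherian_cring_UP)
 let ?I = "content_ideal R g"
 let ?C = "\<lambda>a. up_ring.monom (UP R) a 0"
 note iI = content_ideal_ideal[OF g]
 have DM': "content_ideal R (f \<otimes>\<^bsub>UP R\<^esub> g) \<cdot> ipow (content_ideal R f) 0 = ipow (content_ideal R f) (Suc 0) \<cdot> ?I"
  if f: "f \<in> carrier (UP R)" for f
  using DM[OF f] ideal_prod_one[OF content_ideal_ideal[OF U.P.m_closed[OF f g]]] ipow_1[OF content_ideal_ideal[OF f]] by simp
 obtain w where w: "w \<in> ?I" "?I \<subseteq> PIdl w <+> big_Inter"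
 proof -
  have "\<exists>w\<in>?I. ?I \<subseteq> PIdl w <+> big_Inter"
  proof (rule principal_mod[OF iI ideal_big_Inter])
   fix T :: "nat set" and w
   assume "finite T" "w \<in> T \<rightarrow> ?I" "indep (\<mm> \<cdot> ?I <+> big_Inter) T w"
   from indep_card_le_dm[OF cat unr g DM' this] show "card T \<le> 1" by simp
  qed
  then show thesis using that by blast
 qed
 let ?F = "{p. minimal_prime R p \<and> \<not> ?I \<subseteq> p}"
 have "\<exists>a\<in>?I. a \<notin> \<Union>?F"
 proof (rule prime_avoidance[OF _ _ iI])
  show "finite ?F" by (rule finite_subset[OF _ finite_minimal_primes]) auto
 qed (auto simp: minimal_prime_def)
 then obtain a where a: "a \<in> ?I" "a \<notin> \<Union>?F" by blast
 have ac: "a \<in> carrier R" by (rule ideal_carr[OF iI a(1)])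
 have ap: "?I \<subseteq> p" if "minimal_prime R p" "a \<in> p" for p using a(2) that by blast
 let ?e = "U.ext \<mm>"
 note pe = U.ext_prime[OF mm_prime]
 \<comment> \<open>If (g) missed this set, some prime Q containing g would miss it too. Missing all
   b, Q lies in \<mm>R[t], so \<open>const_in_primes_over\<close> puts a into Q, although a belongs
   to the set.\<close>
 let ?S = "{b \<otimes>\<^bsub>UP R\<^esub> ?C (a [^] r) | b r :: nat. b \<in> carrier (UP R) \<and> b \<notin> ?e}"
 have arc: "a [^] (r::nat) \<in> carrier R" for r using ac by simp
 have Cr: "?C (a [^] (r::nat)) \<in> carrier (UP R)" for r using arc by simp
 have one: "\<one>\<^bsub>UP R\<^esub> \<notin> ?e" by (rule U.P.prime_one[OF pe])
 have C1: "?C (a [^] (0::nat)) = \<one>\<^bsub>UP R\<^esub>" by simp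
 have "\<exists>b h. \<exists>r::nat. b \<in> carrier (UP R) \<and> b \<notin> ?e \<and> h \<in> carrier (UP R) \<and> b \<otimes>\<^bsub>UP R\<^esub> ?C (a [^] r) = h \<otimes>\<^bsub>UP R\<^esub> g"
 proof (rule ccontr)
  assume n: "\<not> ?thesis"
  have "\<exists>Q. primeideal Q (UP R) \<and> PIdl\<^bsub>UP R\<^esub> g \<subseteq> Q \<and> Q \<inter> ?S = {} \<and> (\<forall>Y. ideal Y (UP R) \<and> Q \<subset> Y \<longrightarrow> Y \<inter> ?S \<noteq> {})"
  proof (rule V.ex_prime_disjoint[OF _ _ _ U.P.cgenideal_ideal[OF g]])
   show "?S \<subseteq> carrier (UP R)" using Cr by auto
   show "\<one>\<^bsub>UP R\<^esub> \<in> ?S"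
    by (intro CollectI exI[of _ "\<one>\<^bsub>UP R\<^esub>"] exI[of _ "0::nat"] conjI one) (simp_all add: C1)
   show "s \<otimes>\<^bsub>UP R\<^esub> t \<in> ?S" if s: "s \<in> ?S" and t: "t \<in> ?S" for s t
   proof -
    obtain b r where b: "s = b \<otimes>\<^bsub>UP R\<^esub> ?C (a [^] (r::nat))" "b \<in> carrier (UP R)" "b \<notin> ?e" using s by (elim CollectE exE conjE)
    obtain b' r' where b': "t = b' \<otimes>\<^bsub>UP R\<^esub> ?C (a [^] (r'::nat))" "b' \<in> carrier (UP R)" "b' \<notin> ?e" using t by (elim CollectE exE conjE)
    have "?C (a [^] (r + r')) = ?C (a [^] r) \<otimes>\<^bsub>UP R\<^esub> ?C (a [^] r')"
     using U.monom_mult[of "a [^] r" "a [^] r'" 0 0] ac by (simp add: nat_pow_mult)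
    then have eq: "s \<otimes>\<^bsub>UP R\<^esub> t = (b \<otimes>\<^bsub>UP R\<^esub> b') \<otimes>\<^bsub>UP R\<^esub> ?C (a [^] (r + r'))"
     unfolding b(1) b'(1) using b(2) b'(2) Cr by (simp only: U.P.m_ac U.P.m_closed)
    have "b \<otimes>\<^bsub>UP R\<^esub> b' \<notin> ?e" using U.P.prime_mult[OF pe b(2) b'(2)] b(3) b'(3) by blast
    then show ?thesis using b(2) b'(2) by (intro CollectI exI[of _ "b \<otimes>\<^bsub>UP R\<^esub> b'"] exI[of _ "r + r'"] conjI eq) simp_all
   qed
   show "PIdl\<^bsub>UP R\<^esub> g \<inter> ?S = {}"
   proof (rule ccontr)
    assume "PIdl\<^bsub>UP R\<^esub> g \<inter> ?S \<noteq> {}"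
    then obtain s where s: "s \<in> PIdl\<^bsub>UP R\<^esub> g" "s \<in> ?S" by blast
    obtain h where h: "h \<in> carrier (UP R)" "s = h \<otimes>\<^bsub>UP R\<^esub> g" using s(1) unfolding U.P.cgen_iff by blast
    obtain b r where b: "s = b \<otimes>\<^bsub>UP R\<^esub> ?C (a [^] (r::nat))" "b \<in> carrier (UP R)" "b \<notin> ?e" using s(2) by (elim CollectE exE conjE)
    show False using n b h by metis
   qed
  qed
  then obtain Q where Q: "primeideal Q (UP R)" "PIdl\<^bsub>UP R\<^esub> g \<subseteq> Q" "Q \<inter> ?S = {}" by blast
  note iQ = U.P.prime_ideal[OF Q(1)]
  have gQ: "g \<in> Q" using Q(2) U.P.cgenideal_self[OF g] by blast
  have Qe: "F \<in> ?e" if F: "F \<in> Q" for F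
  proof (rule ccontr)
   assume nF: "F \<notin> ?e"
   have Fc: "F \<in> carrier (UP R)" by (rule U.P.ideal_carr[OF iQ F])
   have "F = F \<otimes>\<^bsub>UP R\<^esub> ?C (a [^] (0::nat))" unfolding C1 using Fc by simp
   then have "F \<in> ?S" using Fc nF by blast
   then show False using F Q(3) by blast
  qed
  have "?C a \<in> Q"
  proof (rule const_in_primes_over[OF g w dim a(1) ap Q(1) gQ])
   show "cf F i \<in> \<mm>" if "F \<in> Q" for F i using Qe[OF that] unfolding U.ext_def by blast
  qed
  moreover have "?C a \<in> ?S"
   using one ac by (intro CollectI exI[of _ "\<one>\<^bsub>UP R\<^esub>"] exI[of _ "Suc 0"] conjI) simp_all
  ultimately show False using Q(3) by blast
 qed
 then obtain b h and r :: nat where b: "b \<in> carrier (UP R)" "b \<notin> ?e" and h: "h \<in> carrier (UP R)"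
  and bh: "b \<otimes>\<^bsub>UP R\<^esub> ?C (a [^] r) = h \<otimes>\<^bsub>UP R\<^esub> g" by blast
 let ?K = "content_ideal R h" and ?e = "a [^] r"
 note iK = content_ideal_ideal[OF h]
 have ec: "?e \<in> carrier R" using ac by simp
 note iE = cgenideal_ideal[OF ec]
 have KI: "?K \<cdot> ?I = PIdl ?e"
 proof
  have co: "cf (h \<otimes>\<^bsub>UP R\<^esub> g) i = cf b i \<otimes> ?e" for i
  proof -
   have "h \<otimes>\<^bsub>UP R\<^esub> g = ?C ?e \<otimes>\<^bsub>UP R\<^esub> b" unfolding bh[symmetric] by (rule U.P.m_comm[OF b(1) Cr])
   then show ?thesis using U.coeff_monom_mult[OF ec b(1), of 0 i] m_comm[OF ec U.coeff_closed[OF b(1)]] by simp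
  qed
  show "?K \<cdot> ?I \<subseteq> PIdl ?e"
   unfolding DM[OF h, symmetric]
  proof (rule content_subset[OF iE])
   show "cf (h \<otimes>\<^bsub>UP R\<^esub> g) i \<in> PIdl ?e" for i
    unfolding co by (rule ideal_mult_l[OF iE cgenideal_self[OF ec] U.coeff_closed[OF b(1)]])
  qed
  obtain i where i: "cf b i \<notin> \<mm>" using b by (auto simp: U.ext_def)
  have bc: "cf b i \<in> carrier R" using b(1) by simp
  obtain v where v: "v \<in> carrier R" "v \<otimes> cf b i = \<one>" using mm_unit[OF bc i] by blast
  have "?e = (v \<otimes> cf b i) \<otimes> ?e" unfolding v(2) using ec by simp
  also have "\<dots> = v \<otimes> cf (h \<otimes>\<^bsub>UP R\<^esub> g) i" unfolding co using v(1) bc ec by (simp add: m_assoc)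
  also have "\<dots> \<in> content_ideal R (h \<otimes>\<^bsub>UP R\<^esub> g)"
   using h g by (intro ideal_mult_l[OF content_ideal_ideal] coeff_in_content v(1)) simp_all
  finally show "PIdl ?e \<subseteq> ?K \<cdot> ?I"
   using cgenideal_minimal[OF ideal_prod_is_ideal[OF iK iI]] DM[OF h] by simp
 qed
 have ep: "?I \<subseteq> p" if p: "minimal_prime R p" "?e \<in> p" for p
 proof -
  have "primeideal p R" using p(1) by (simp add: minimal_prime_def)
  from prime_pow[OF this ac p(2)] show ?thesis by (rule ap[OF p(1)])
 qed
 show ?thesis
 \<comment> \<open>The products k i generate (a^r). If all lie in \<mm>(a^r), then a^r = 0 by
   Nakayama, and I lies in every minimal prime. Otherwise some k i is a unit multiple of a^r, and
   this i generates I: for z in I a multiple of i can be subtracted so that k kills the difference,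
   which then lies in every minimal prime. Where k is in p, so is a^r, and I \<subseteq> p by the
   choice of a.\<close>
 proof (cases "\<forall>k\<in>?K. \<forall>i\<in>?I. k \<otimes> i \<in> \<mm> \<cdot> (PIdl ?e)")
  case True
  have iM: "ideal (\<mm> \<cdot> (PIdl ?e)) R" by (intro ideal_prod_is_ideal mm_ideal iE)
  have "PIdl ?e \<subseteq> \<mm> \<cdot> (PIdl ?e)" unfolding KI[symmetric] by (rule ideal_prod_subset) (use iM KI True in auto)
  then have "PIdl ?e \<subseteq> {\<zero>} <+> \<mm> \<cdot> (PIdl ?e)" using set_add_upper2[OF zeroideal iM] by blast
  then have "PIdl ?e \<subseteq> {\<zero>}" by (rule nakayama[OF iE zeroideal])
  then have e0: "?e = \<zero>" using cgenideal_self[OF ec] by blast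
  have "z = \<zero>" if z: "z \<in> ?I" for z
  proof (rule zero_if_in_minimal_primes[OF unr ideal_carr[OF iI z]])
   fix p assume p: "minimal_prime R p"
   have "\<zero> \<in> p" using p ideal_zero prime_ideal unfolding minimal_prime_def by blast
   then show "z \<in> p" using ep[OF p] e0 z by auto
  qed
  then have "?I = {\<zero>}" using ideal_zero[OF iI] by blast
  then show ?thesis by (intro exI[of _ "{}"]) (simp add: Idl_empty)
 next
  case False
  then obtain k i where k: "k \<in> ?K" and i: "i \<in> ?I" and ki: "k \<otimes> i \<notin> \<mm> \<cdot> (PIdl ?e)" by blast
  have kc: "k \<in> carrier R" and ic: "i \<in> carrier R" by (rule ideal_carr[OF iK k], rule ideal_carr[OF iI i])
  have "k \<otimes> i \<in> PIdl ?e" unfolding KI[symmetric] using k i by (rule ideal_prod.prod)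
  then obtain d where d: "d \<in> carrier R" "k \<otimes> i = d \<otimes> ?e" unfolding cgen_iff by blast
  have "d \<notin> \<mm>" using ki d(2) cgenideal_self[OF ec] ideal_prod.prod[of d \<mm> ?e "PIdl ?e" R] by auto
  then obtain v where v: "v \<in> carrier R" "v \<otimes> d = \<one>" using mm_unit[OF d(1)] by blast
  have "?e = (v \<otimes> d) \<otimes> ?e" unfolding v(2) using ec by simp
  also have "\<dots> = v \<otimes> (d \<otimes> ?e)" using v(1) d(1) ec by (rule m_assoc)
  finally have e: "?e = v \<otimes> (k \<otimes> i)" unfolding d(2) .
  have "?I \<subseteq> PIdl i"
  proof
   fix z assume z: "z \<in> ?I"
   have zc: "z \<in> carrier R" by (rule ideal_carr[OF iI z])
   have "k \<otimes> z \<in> PIdl ?e" unfolding KI[symmetric] using k z by (rule ideal_prod.prod)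
   then obtain c where c: "c \<in> carrier R" "k \<otimes> z = c \<otimes> ?e" unfolding cgen_iff by blast
   let ?z = "z \<ominus> (c \<otimes> v) \<otimes> i"
   have "k \<otimes> ?z = k \<otimes> z \<ominus> c \<otimes> (v \<otimes> (k \<otimes> i))" using kc zc c(1) v(1) ic by algebra
   also have "\<dots> = \<zero>" unfolding e[symmetric] c(2) using c(1) ec by (simp add: minus_eq r_neg)
   finally have kz: "k \<otimes> ?z = \<zero>" .
   have zzc: "?z \<in> carrier R" using zc c(1) v(1) ic by simp
   have "?z = \<zero>"
   proof (rule zero_if_in_minimal_primes[OF unr zzc])
    fix p assume p: "minimal_prime R p"
    have pp: "primeideal p R" using p by (simp add: minimal_prime_def)
    note ip = prime_ideal[OF pp]
    show "?z \<in> p"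
    proof (cases "k \<in> p")
     case True
     have "?e \<in> p" unfolding e by (intro ideal_mult_l[OF ip _ v(1)] ideal_mult_r[OF ip True ic])
     then have Ip: "?I \<subseteq> p" by (rule ep[OF p])
     show ?thesis using Ip z i c(1) v(1) by (intro ideal_minus[OF ip] ideal_mult_l[OF ip]) auto
    next
     case False
     have "k \<otimes> ?z \<in> p" unfolding kz by (rule ideal_zero[OF ip])
     then show ?thesis using prime_mult[OF pp kc zzc] False by blast
    qed
   qed
   moreover have "z = ?z \<oplus> (c \<otimes> v) \<otimes> i" using zc c(1) v(1) ic by algebra
   ultimately have "z = (c \<otimes> v) \<otimes> i" using c(1) v(1) ic by simp
   then show "z \<in> PIdl i" unfolding cgen_iff using c(1) v(1) by blast
  qed
  moreover have "PIdl i \<subseteq> ?I" by (rule cgenideal_minimal[OF iI i])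
  ultimately have "?I = Idl {i}" using cgenideal_eq_genideal[OF ic] by blast
  then show ?thesis using ic by (intro exI[of _ "{i}"]) simp
 qed
qed

end

section \<open>The polarized Dedekind--Mertens identity\<close>

context cring
begin

lemma min_num_gens_le: "A \<subseteq> carrier R \<Longrightarrow> finite A \<Longrightarrow> min_num_gens R (Idl A) \<le> card A"
 unfolding min_num_gens_def by (rule Least_le) blast

lemma prime_preimage_quotient:
 assumes p: "ideal p R" and q: "primeideal q (R Quot p)"
 shows "primeideal {a\<in>carrier R. p +> a \<in> q} R"
proof -
 interpret H: ring_hom_cring R "R Quot p" "(+>) p" by (rule ideal.rcos_ring_hom_cring[OF p cring_axioms])
 have Q: "cring (R Quot p)" by (rule ideal.quotient_is_cring[OF p cring_axioms])
 note iq = cring.prime_ideal[OF Q q]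
 show ?thesis
 proof (rule primeidealI'[OF idealI'])
  show "\<zero> \<in> {a\<in>carrier R. p +> a \<in> q}" using cring.ideal_zero[OF Q iq] by simp
  show "a \<oplus> b \<in> {a\<in>carrier R. p +> a \<in> q}" if "a \<in> {a\<in>carrier R. p +> a \<in> q}" "b \<in> {a\<in>carrier R. p +> a \<in> q}" for a b
   using that cring.ideal_add[OF Q iq] by simp
  show "r \<otimes> a \<in> {a\<in>carrier R. p +> a \<in> q}" if "a \<in> {a\<in>carrier R. p +> a \<in> q}" "r \<in> carrier R" for a r
   using that cring.ideal_mult_l[OF Q iq] by simp
  show "\<one> \<notin> {a\<in>carrier R. p +> a \<in> q}" using cring.prime_one[OF Q q] by simp
  show "a \<in> {a\<in>carrier R. p +> a \<in> q} \<or> b \<in> {a\<in>carrier R. p +> a \<in> q}"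
   if "a \<in> carrier R" "b \<in> carrier R" "a \<otimes> b \<in> {a\<in>carrier R. p +> a \<in> q}" for a b
   using that cring.prime_mult[OF Q q, of "p +> a" "p +> b"] by auto
 qed auto
qed

text \<open>If all chains in R/p were shorter than k, the supremum would be at most k - 1, which is
  less than k since k is positive. The first k + 1 members of a long chain are pulled back to
  R.\<close>

lemma chain_over_of_krull_dim:
 assumes p: "ideal p R" and dim: "enat k \<le> krull_dim (R Quot p)" and k: "0 < k"
 shows "\<exists>P. (\<forall>i\<le>k. primeideal (P i) R \<and> p \<subseteq> P i) \<and> (\<forall>i<k. P i \<subset> P (Suc i))"
proof -
 have "\<exists>n\<ge>k. \<exists>P. prime_chain (R Quot p) n P"
 proof (rule ccontr)
  assume "\<not> ?thesis"
  then have "krull_dim (R Quot p) \<le> enat (k - 1)"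
   unfolding krull_dim_def
  proof (intro Sup_least, elim CollectE exE conjE)
   fix x n P assume "\<not> (\<exists>n\<ge>k. \<exists>P. prime_chain (R Quot p) n P)" "x = enat n" "prime_chain (R Quot p) n P"
   then have "\<not> n \<ge> k" "x = enat n" by blast+
   then show "x \<le> enat (k - 1)" by simp
  qed
  then have "enat k \<le> enat (k - 1)" using dim by (rule order_trans[rotated])
  then show False using k by simp
 qed
 then obtain n P where n: "n \<ge> k" and P: "prime_chain (R Quot p) n P" by blast
 have Q: "cring (R Quot p)" by (rule ideal.quotient_is_cring[OF p cring_axioms])
 have pr: "primeideal (P i) (R Quot p)" if "i \<le> k" for i using P n that unfolding prime_chain_def by simp
 have inc: "P i \<subset> P (Suc i)" if "i < k" for i using P n that unfolding prime_chain_def by simp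
 let ?P = "\<lambda>i. {a\<in>carrier R. p +> a \<in> P i}"
 have 1: "p \<subseteq> ?P i" if "i \<le> k" for i
 proof
  fix a assume a: "a \<in> p"
  have "p +> a = p" by (rule a_rcos_zero[OF p a])
  also have "p = \<zero>\<^bsub>R Quot p\<^esub>" by (simp add: FactRing_def)
  also have "\<zero>\<^bsub>R Quot p\<^esub> \<in> P i" by (rule cring.ideal_zero[OF Q cring.prime_ideal[OF Q pr[OF that]]])
  finally show "a \<in> ?P i" using ideal_carr[OF p a] by simp
 qed
 have 2: "primeideal (?P i) R" if "i \<le> k" for i by (rule prime_preimage_quotient[OF p pr[OF that]])
 have 3: "?P i \<subset> ?P (Suc i)" if i: "i < k" for i
 proof
  show "?P i \<subseteq> ?P (Suc i)" using inc[OF i] by blast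
  obtain z where z: "z \<in> P (Suc i)" "z \<notin> P i" using inc[OF i] by blast
  have "Suc i \<le> k" using i by simp
  then have "z \<in> carrier (R Quot p)" using cring.ideal_carr[OF Q cring.prime_ideal[OF Q pr] z(1)] by blast
  then obtain a where a: "a \<in> carrier R" "z = p +> a" by (auto simp: FactRing_def A_RCOSETS_def')
  then have "a \<in> ?P (Suc i)" "a \<notin> ?P i" using z by auto
  then show "?P i \<noteq> ?P (Suc i)" by blast
 qed
 show ?thesis by (rule exI[of _ ?P]) (intro conjI allI impI 1 2 3)
qed

lemma ideals_set_simps [simp]:
 "carrier (ideals_set R) = {I. ideal I R}" "I \<otimes>\<^bsub>ideals_set R\<^esub> J = I \<cdot> J" "\<one>\<^bsub>ideals_set R\<^esub> = carrier R"
 "\<zero>\<^bsub>ideals_set R\<^esub> = {\<zero>}" "I \<oplus>\<^bsub>ideals_set R\<^esub> J = I <+> J"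
 by (simp_all add: ideals_set_def)

lemma set_add_idem: "ideal I R \<Longrightarrow> I <+> I = I"
 using set_add_least[of I I I] set_add_upper1[of I I] by blast

end

section \<open>Sums and products of content ideals over finite index sets; pivots\<close>

context noeth_local
begin

text \<open>General index sets, so that induction can remove one polynomial; for {1..k} these are
  the expressions in \<open>polarized_dedekind_mertens_number\<close>.\<close>

definition cprod :: "('c \<Rightarrow> nat \<Rightarrow> 'a) \<Rightarrow> 'c set \<Rightarrow> 'a set"
 where "cprod f S = (\<Otimes>\<^bsub>ideals_set R\<^esub> j \<in> S. content_ideal R (f j))"

definition csum :: "(nat \<Rightarrow> 'a) \<Rightarrow> ('c \<Rightarrow> nat \<Rightarrow> 'a) \<Rightarrow> 'c set \<Rightarrow> 'a set"
 where "csum g f S = (\<Oplus>\<^bsub>ideals_set R\<^esub> i \<in> S. content_ideal R (f i \<otimes>\<^bsub>UP R\<^esub> g) \<cdot> cprod f (S - {i}))"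

lemma content_mult_ideal: "f \<in> carrier (UP R) \<Longrightarrow> g \<in> carrier (UP R) \<Longrightarrow> ideal (content_ideal R (f \<otimes>\<^bsub>UP R\<^esub> g)) R"
proof -
 assume "f \<in> carrier (UP R)" "g \<in> carrier (UP R)"
 interpret U: UP_cring R "UP R" by (rule UP_cring_R)
 show ?thesis using \<open>f \<in> carrier (UP R)\<close> \<open>g \<in> carrier (UP R)\<close> by (intro content_ideal_ideal U.P.m_closed)
qed

lemma cprod_ideal: "f \<in> S \<rightarrow> carrier (UP R) \<Longrightarrow> ideal (cprod f S) R"
proof -
 assume f: "f \<in> S \<rightarrow> carrier (UP R)"
 interpret C: comm_monoid "ideals_set R" by (rule ideals_set_is_comm_monoid)
 have "(\<lambda>j. content_ideal R (f j)) \<in> S \<rightarrow> carrier (ideals_set R)" using f content_ideal_ideal by auto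
 from C.finprod_closed[OF this] show ?thesis by (simp add: cprod_def)
qed

lemma cprod_insert:
 assumes "finite S" "s \<notin> S" "f \<in> insert s S \<rightarrow> carrier (UP R)"
 shows "cprod f (insert s S) = content_ideal R (f s) \<cdot> cprod f S"
proof -
 interpret C: comm_monoid "ideals_set R" by (rule ideals_set_is_comm_monoid)
 have "(\<lambda>j. content_ideal R (f j)) \<in> S \<rightarrow> carrier (ideals_set R)" "content_ideal R (f s) \<in> carrier (ideals_set R)"
  using assms(3) content_ideal_ideal by auto
 from C.finprod_insert[OF assms(1,2) this] show ?thesis by (simp add: cprod_def)
qed

lemma csum_term_ideal:
 "g \<in> carrier (UP R) \<Longrightarrow> f \<in> S \<rightarrow> carrier (UP R) \<Longrightarrow> i \<in> S \<Longrightarrow> T \<subseteq> S \<Longrightarrow>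
  ideal (content_ideal R (f i \<otimes>\<^bsub>UP R\<^esub> g) \<cdot> cprod f T) R"
 by (intro ideal_prod_is_ideal content_mult_ideal cprod_ideal) auto

lemma csum_ideal: "g \<in> carrier (UP R) \<Longrightarrow> f \<in> S \<rightarrow> carrier (UP R) \<Longrightarrow> ideal (csum g f S) R"
proof -
 assume g: "g \<in> carrier (UP R)" and f: "f \<in> S \<rightarrow> carrier (UP R)"
 interpret C: semiring "ideals_set R" by (rule ideals_set_is_semiring)
 have "(\<lambda>i. content_ideal R (f i \<otimes>\<^bsub>UP R\<^esub> g) \<cdot> cprod f (S - {i})) \<in> S \<rightarrow> carrier (ideals_set R)"
  using csum_term_ideal[OF g f] by auto
 from C.finsum_closed[OF this] show ?thesis by (simp add: csum_def)
qed

lemma csum_empty: "csum g f {} = {\<zero>}"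
proof -
 interpret C: semiring "ideals_set R" by (rule ideals_set_is_semiring)
 show ?thesis by (simp add: csum_def)
qed

text \<open>A Leibniz rule: \<open>csum\<close> behaves like the derivative of the product
  \<open>cprod\<close>, with c(f g) in the place of the derivative of c(f).\<close>

lemma csum_insert:
 assumes S: "finite S" "s \<notin> S" and f: "f \<in> insert s S \<rightarrow> carrier (UP R)" and g: "g \<in> carrier (UP R)"
 shows "csum g f (insert s S) = content_ideal R (f s \<otimes>\<^bsub>UP R\<^esub> g) \<cdot> cprod f S <+> content_ideal R (f s) \<cdot> csum g f S"
proof -
 interpret C: semiring "ideals_set R" by (rule ideals_set_is_semiring)
 let ?t = "\<lambda>S i. content_ideal R (f i \<otimes>\<^bsub>UP R\<^esub> g) \<cdot> cprod f (S - {i})"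
 let ?C = "content_ideal R (f s)"
 have f': "f \<in> S \<rightarrow> carrier (UP R)" using f by auto
 have iC: "ideal ?C R" by (rule content_ideal_ideal) (use f in auto)
 have t1: "?t (insert s S) \<in> S \<rightarrow> carrier (ideals_set R)"
  by (rule funcsetI) (use csum_term_ideal[OF g f] in auto)
 have t2: "?t (insert s S) s \<in> carrier (ideals_set R)" using csum_term_ideal[OF g f, of s "insert s S - {s}"] by auto
 have t3: "?t S \<in> S \<rightarrow> carrier (ideals_set R)" by (rule funcsetI) (use csum_term_ideal[OF g f'] in auto)
 have eq: "?t (insert s S) i = ?C \<cdot> ?t S i" if i: "i \<in> S" for i
 proof -
  have "insert s S - {i} = insert s (S - {i})" using i S(2) by auto
  moreover have "cprod f (insert s (S - {i})) = ?C \<cdot> cprod f (S - {i})" by (rule cprod_insert) (use S f in auto)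
  moreover have "ideal (content_ideal R (f i \<otimes>\<^bsub>UP R\<^esub> g)) R" by (rule content_mult_ideal) (use f g i in auto)
  moreover have "ideal (cprod f (S - {i})) R" by (rule cprod_ideal) (use f in auto)
  ultimately show ?thesis using iC by (simp add: ideal_prod_left_comm)
 qed
 have "csum g f (insert s S) = ?t (insert s S) s <+> (\<Oplus>\<^bsub>ideals_set R\<^esub> i \<in> S. ?t (insert s S) i)"
  unfolding csum_def using C.finsum_insert[OF S t1 t2] by simp
 also have "?t (insert s S) s = content_ideal R (f s \<otimes>\<^bsub>UP R\<^esub> g) \<cdot> cprod f S" using S(2) by simp
 also have "(\<Oplus>\<^bsub>ideals_set R\<^esub> i \<in> S. ?t (insert s S) i) = (\<Oplus>\<^bsub>ideals_set R\<^esub> i \<in> S. ?C \<cdot> ?t S i)"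
 proof (rule C.finsum_cong'[OF refl funcsetI eq])
  fix i assume "i \<in> S"
  from funcset_mem[OF t3 this] show "?C \<cdot> ?t S i \<in> carrier (ideals_set R)" using ideal_prod_is_ideal[OF iC] by simp
 qed
 also have "\<dots> = ?C \<cdot> (\<Oplus>\<^bsub>ideals_set R\<^esub> i \<in> S. ?t S i)"
  using C.finsum_rdistr[OF S(1) _ t3, of ?C] iC by simp
 finally show ?thesis unfolding csum_def .
qed

definition pivots :: "(nat \<Rightarrow> 'a) \<Rightarrow> nat set"
 where "pivots g = {j. cf g j \<notin> Idl (cf g ` {..<j}) <+> \<mm> \<cdot> content_ideal R g}"

text \<open>The elements that Y multiplies into \<Omega> form an ideal. It contains the earlier
  coefficients and \<mm>I, hence also a coefficient that is not a pivot.\<close>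

lemma nonpivot:
 assumes g: "g \<in> carrier (UP R)" and Y: "ideal Y R" and \<Omega>: "ideal \<Omega> R" and m: "Y \<cdot> (\<mm> \<cdot> content_ideal R g) \<subseteq> \<Omega>"
  and j: "j \<notin> pivots g" and lower: "\<forall>i<j. \<forall>z\<in>Y. z \<otimes> cf g i \<in> \<Omega>"
 shows "\<forall>z\<in>Y. z \<otimes> cf g j \<in> \<Omega>"
proof -
 interpret U: UP_cring R "UP R" by (rule UP_cring_R)
 let ?X = "{x\<in>carrier R. \<forall>z\<in>Y. z \<otimes> x \<in> \<Omega>}"
 have iX: "ideal ?X R" by (rule ideal_residual[OF \<Omega> ideal_subset_carr[OF Y]])
 have imI: "ideal (\<mm> \<cdot> content_ideal R g) R" by (intro ideal_prod_is_ideal mm_ideal content_ideal_ideal g)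
 have "Idl (cf g ` {..<j}) \<subseteq> ?X"
  by (rule genideal_minimal[OF iX]) (use lower g in auto)
 moreover have "\<mm> \<cdot> content_ideal R g \<subseteq> ?X"
 proof
  fix x assume x: "x \<in> \<mm> \<cdot> content_ideal R g"
  have "z \<otimes> x \<in> \<Omega>" if z: "z \<in> Y" for z by (rule subsetD[OF m ideal_prod.prod[OF z x]])
  then show "x \<in> ?X" using ideal_carr[OF imI x] by simp
 qed
 ultimately have "Idl (cf g ` {..<j}) <+> \<mm> \<cdot> content_ideal R g \<subseteq> ?X" by (rule set_add_least[OF iX])
 then show ?thesis using j unfolding pivots_def by blast
qed

lemma nonpivots:
 assumes g: "g \<in> carrier (UP R)" and Y: "ideal Y R" and \<Omega>: "ideal \<Omega> R" and m: "Y \<cdot> (\<mm> \<cdot> content_ideal R g) \<subseteq> \<Omega>"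
  and c: "\<forall>j<c. \<forall>z\<in>Y. z \<otimes> cf g j \<in> \<Omega>" and b: "\<forall>i. c \<le> i \<and> i < b \<longrightarrow> i \<notin> pivots g"
 shows "j < b \<Longrightarrow> \<forall>z\<in>Y. z \<otimes> cf g j \<in> \<Omega>"
proof (induct j rule: less_induct)
 case (less j)
 show ?case
 proof (cases "j < c")
  case True then show ?thesis using c by blast
 next
  case False
  have "\<forall>i<j. \<forall>z\<in>Y. z \<otimes> cf g i \<in> \<Omega>"
   using less(1) less_trans[OF _ less(2)] by simp
  then show ?thesis using b less(2) False by (intro nonpivot[OF g Y \<Omega> m]) simp_all
 qed
qed

lemma finite_pivots: "g \<in> carrier (UP R) \<Longrightarrow> finite (pivots g)"
proof -
 assume g: "g \<in> carrier (UP R)"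
 interpret U: UP_cring R "UP R" by (rule UP_cring_R)
 have "pivots g \<subseteq> {..deg R g}"
 proof
  fix j assume j: "j \<in> pivots g"
  have "ideal (Idl (cf g ` {..<j}) <+> \<mm> \<cdot> content_ideal R g) R"
   using g by (intro add_ideals genideal_ideal ideal_prod_is_ideal mm_ideal content_ideal_ideal) auto
  then have "cf g j \<noteq> \<zero>" using j ideal_zero unfolding pivots_def by auto
  then have "\<not> deg R g < j" using U.deg_aboveD[OF _ g] by blast
  then show "j \<in> {..deg R g}" by simp
 qed
 then show ?thesis using finite_subset by blast
qed

text \<open>
 One factor \<open>f\<^sub>s\<close> is removed together with the least pivot \<open>\<beta> \<ge> c\<close>: the coefficient of \<open>t\<^sup>e\<^sup>+\<^sup>\<beta>\<close> in \<open>f\<^sub>s g\<close> is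
 \<open>f\<^sub>s\<^sub>e g\<^sub>\<beta>\<close> up to terms that are handled by induction on \<open>e\<close> or involve only \<open>g\<^sub>i\<close> with \<open>i < \<beta>\<close>.
\<close>

lemma polarized_induct:
 fixes f :: "'c \<Rightarrow> nat \<Rightarrow> 'a"
 assumes g: "g \<in> carrier (UP R)" and S: "finite S"
 shows "\<forall>\<Omega> c. f \<in> S \<rightarrow> carrier (UP R) \<and> ideal \<Omega> R \<and> csum g f S \<subseteq> \<Omega> \<and> cprod f S \<cdot> (\<mm> \<cdot> content_ideal R g) \<subseteq> \<Omega> \<and>
  card (pivots g \<inter> {c..}) \<le> card S \<and> (\<forall>j<c. \<forall>z\<in>cprod f S. z \<otimes> cf g j \<in> \<Omega>) \<longrightarrow>
  (\<forall>j. \<forall>z\<in>cprod f S. z \<otimes> cf g j \<in> \<Omega>)"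
 using S
proof (induct S rule: finite_induct)
 case empty
 show ?case
 proof (intro allI impI, elim conjE)
  fix \<Omega> c j assume f: "f \<in> {} \<rightarrow> carrier (UP R)" and \<Omega>: "ideal \<Omega> R" and m: "cprod f {} \<cdot> (\<mm> \<cdot> content_ideal R g) \<subseteq> \<Omega>"
   and card: "card (pivots g \<inter> {c..}) \<le> card {}" and c: "\<forall>j<c. \<forall>z\<in>cprod f {}. z \<otimes> cf g j \<in> \<Omega>"
  have "pivots g \<inter> {c..} = {}" using card finite_pivots[OF g] by simp
  then have "\<forall>i. c \<le> i \<and> i < Suc j \<longrightarrow> i \<notin> pivots g" by auto
  from nonpivots[OF g cprod_ideal[OF f] \<Omega> m c this, of j]
  show "\<forall>z\<in>cprod f {}. z \<otimes> cf g j \<in> \<Omega>" by simp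
 qed
next
 case (insert s S)
 interpret U: UP_cring R "UP R" by (rule UP_cring_R)
 let ?g = "cf g"
 let ?I = "content_ideal R g"
 show ?case
 proof (intro allI impI, elim conjE)
  fix \<Omega> c j assume f: "f \<in> insert s S \<rightarrow> carrier (UP R)" and \<Omega>: "ideal \<Omega> R"
   and sum: "csum g f (insert s S) \<subseteq> \<Omega>" and m: "cprod f (insert s S) \<cdot> (\<mm> \<cdot> ?I) \<subseteq> \<Omega>"
   and card: "card (pivots g \<inter> {c..}) \<le> card (insert s S)" and c: "\<forall>j<c. \<forall>z\<in>cprod f (insert s S). z \<otimes> ?g j \<in> \<Omega>"
  have f': "f \<in> S \<rightarrow> carrier (UP R)" and fs: "f s \<in> carrier (UP R)" using f by auto
  let ?f = "cf (f s)"
  let ?C = "content_ideal R (f s)" and ?P = "cprod f S"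
  have P: "cprod f (insert s S) = ?C \<cdot> ?P" by (rule cprod_insert[OF insert(1,2) f])
  have iC: "ideal ?C R" by (rule content_ideal_ideal[OF fs])
  have iP: "ideal ?P R" by (rule cprod_ideal[OF f'])
  have iI: "ideal ?I R" by (rule content_ideal_ideal[OF g])
  have imI: "ideal (\<mm> \<cdot> ?I) R" by (intro ideal_prod_is_ideal mm_ideal iI)
  have iS: "ideal (csum g f S) R" by (rule csum_ideal[OF g f'])
  have iD: "ideal (content_ideal R (f s \<otimes>\<^bsub>UP R\<^esub> g) \<cdot> ?P) R" by (intro ideal_prod_is_ideal content_mult_ideal fs g iP)
  have iCS: "ideal (?C \<cdot> csum g f S) R" by (intro ideal_prod_is_ideal iC iS)
  have sum1: "content_ideal R (f s \<otimes>\<^bsub>UP R\<^esub> g) \<cdot> ?P \<subseteq> \<Omega>" and sum2: "?C \<cdot> csum g f S \<subseteq> \<Omega>"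
   using sum set_add_upper1[OF iD iCS] set_add_upper2[OF iD iCS] unfolding csum_insert[OF insert(1,2) f g] by blast+
  have iCP: "ideal (cprod f (insert s S)) R" by (rule cprod_ideal[OF f])
  have gc: "?g i \<in> carrier R" and fc: "?f i \<in> carrier R" for i using g fs by auto
  have Pc: "z \<in> carrier R" if "z \<in> ?P" for z by (rule ideal_carr[OF iP that])
  have fP: "?f e \<otimes> z \<in> cprod f (insert s S)" if "z \<in> ?P" for e z
   unfolding P using coeff_in_content[OF fs] that by (rule ideal_prod.prod)
  show "\<forall>z\<in>cprod f (insert s S). z \<otimes> ?g j \<in> \<Omega>"
  proof (cases "pivots g \<inter> {c..} = {}")
   case True
   then have "\<forall>i. c \<le> i \<and> i < Suc j \<longrightarrow> i \<notin> pivots g" by auto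
   from nonpivots[OF g iCP \<Omega> m c this, of j] show ?thesis by simp
  next
   case False
   define \<beta> where "\<beta> = Min (pivots g \<inter> {c..})"
   have fin: "finite (pivots g \<inter> {c..})" using finite_pivots[OF g] by simp
   have \<beta>: "\<beta> \<in> pivots g" "c \<le> \<beta>" using Min_in[OF fin False] unfolding \<beta>_def by auto
   have "\<forall>i. c \<le> i \<and> i < \<beta> \<longrightarrow> i \<notin> pivots g"
   proof (intro allI impI notI)
    fix i assume i: "c \<le> i \<and> i < \<beta>" "i \<in> pivots g"
    then have "\<beta> \<le> i" unfolding \<beta>_def using fin by (intro Min_le) auto
    then show False using i by simp
   qed
   note below = nonpivots[OF g iCP \<Omega> m c this]
   have "pivots g \<inter> {Suc \<beta>..} \<subset> pivots g \<inter> {c..}"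
   proof (rule psubsetI)
    show "pivots g \<inter> {Suc \<beta>..} \<subseteq> pivots g \<inter> {c..}" using \<beta>(2) by auto
    have "\<beta> \<in> pivots g \<inter> {c..}" "\<beta> \<notin> pivots g \<inter> {Suc \<beta>..}" using \<beta> by simp_all
    then show "pivots g \<inter> {Suc \<beta>..} \<noteq> pivots g \<inter> {c..}" by metis
   qed
   then have "card (pivots g \<inter> {Suc \<beta>..}) < card (pivots g \<inter> {c..})" by (rule psubset_card_mono[OF fin])
   then have card': "card (pivots g \<inter> {Suc \<beta>..}) \<le> card S" using card insert(1,2) by simp
   have "\<forall>j. \<forall>z\<in>?P. ?f e \<otimes> (z \<otimes> ?g j) \<in> \<Omega>" for e
   proof (induct e rule: less_induct)
    case (less e)
    \<comment> \<open>The induction hypothesis for S is applied to the colon ideal of \<Omega> by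
      the coefficient \<open>?f e\<close>, and to \<open>Suc \<beta>\<close> in place of c; hence
      the quantification over \<Omega> and c inside the statement.\<close>
    let ?\<Omega> = "{x\<in>carrier R. \<forall>d\<in>{?f e}. d \<otimes> x \<in> \<Omega>}"
    have i\<Omega>: "ideal ?\<Omega> R" by (rule ideal_residual[OF \<Omega>]) (use fc in simp)
    have 1: "csum g f S \<subseteq> ?\<Omega>"
    proof
     fix x assume x: "x \<in> csum g f S"
     have "?f e \<otimes> x \<in> \<Omega>" by (rule subsetD[OF sum2 ideal_prod.prod[OF coeff_in_content[OF fs] x]])
     then show "x \<in> ?\<Omega>" using ideal_carr[OF iS x] by simp
    qed
    have 2: "?P \<cdot> (\<mm> \<cdot> ?I) \<subseteq> ?\<Omega>"
    proof
     fix x assume x: "x \<in> ?P \<cdot> (\<mm> \<cdot> ?I)"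
     have "?f e \<otimes> x \<in> ?C \<cdot> (?P \<cdot> (\<mm> \<cdot> ?I))" by (rule ideal_prod.prod[OF coeff_in_content[OF fs] x])
     then have "?f e \<otimes> x \<in> \<Omega>" using m unfolding P ideal_prod_assoc[OF iC iP imI] by blast
     then show "x \<in> ?\<Omega>" using ideal_carr[OF ideal_prod_is_ideal[OF iP imI] x] by simp
    qed
    have 3: "\<forall>j<Suc \<beta>. \<forall>z\<in>?P. z \<otimes> ?g j \<in> ?\<Omega>"
    proof (intro allI impI ballI)
     fix j z assume j: "j < Suc \<beta>" and z: "z \<in> ?P"
     note zc = Pc[OF z]
     have low: "?f i \<otimes> (z \<otimes> ?g l) \<in> \<Omega>" if l: "l < \<beta>" for i l
     proof -
      have "(?f i \<otimes> z) \<otimes> ?g l \<in> \<Omega>" using below[OF l] fP[OF z] by blast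
      then show ?thesis using fc zc gc by (simp add: m_assoc)
     qed
     have "?f e \<otimes> (z \<otimes> ?g j) \<in> \<Omega>"
     proof (cases "j < \<beta>")
      case True then show ?thesis by (rule low)
     next
      case False
      then have j: "j = \<beta>" using j by simp
      let ?h = "cf (f s \<otimes>\<^bsub>UP R\<^esub> g) (e + \<beta>)"
      let ?A = "{..e + \<beta>} - {e}"
      let ?t = "\<lambda>i. ?f i \<otimes> (z \<otimes> ?g (e + \<beta> - i))"
      have tc: "?t i \<in> carrier R" for i using fc gc zc by simp
      have te: "?f e \<otimes> (z \<otimes> ?g \<beta>) \<in> carrier R" using fc gc zc by simp
      have h: "?h = (\<Oplus>i\<in>{..e + \<beta>}. ?f i \<otimes> ?g (e + \<beta> - i))" by (rule U.coeff_mult[OF fs g])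
      have "z \<otimes> ?h = (\<Oplus>i\<in>{..e + \<beta>}. z \<otimes> (?f i \<otimes> ?g (e + \<beta> - i)))"
       unfolding h by (rule finsum_rdistr[OF _ zc]) (use fc gc in auto)
      also have "\<dots> = (\<Oplus>i\<in>{..e + \<beta>}. ?t i)"
       by (rule finsum_cong') (use fc gc zc tc m_lcomm in auto)
      also have "{..e + \<beta>} = insert e ?A" by auto
      also have "(\<Oplus>i\<in>insert e ?A. ?t i) = ?t e \<oplus> (\<Oplus>i\<in>?A. ?t i)"
       by (rule finsum_insert) (use tc te in auto)
      finally have eq: "z \<otimes> ?h = ?t e \<oplus> (\<Oplus>i\<in>?A. ?t i)" .
      have rest: "(\<Oplus>i\<in>?A. ?t i) \<in> \<Omega>"
      proof (rule ideal_finsum[OF \<Omega>])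
       show "\<forall>i\<in>?A. ?t i \<in> \<Omega>"
       proof
        fix i assume i: "i \<in> ?A"
        show "?t i \<in> \<Omega>"
        proof (cases "i < e")
         case True then show ?thesis using less z by blast
        next
         case False
         then have "e + \<beta> - i < \<beta>" using i by auto
         then show ?thesis by (rule low)
        qed
       qed
      qed simp
      have hc: "?h \<in> carrier R" using fs g by simp
      have "?h \<otimes> z \<in> \<Omega>"
       using fs g z by (intro subsetD[OF sum1] ideal_prod.prod coeff_in_content) simp_all
      then have "z \<otimes> ?h \<in> \<Omega>" using m_comm[OF hc zc] by simp
      then have "(z \<otimes> ?h) \<ominus> (\<Oplus>i\<in>?A. ?t i) \<in> \<Omega>" by (rule ideal_minus[OF \<Omega> _ rest])
      moreover have "a \<oplus> b \<ominus> b = a" if "a \<in> carrier R" "b \<in> carrier R" for a b using that by algebra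
      ultimately have "?t e \<in> \<Omega>" unfolding eq using te ideal_carr[OF \<Omega> rest] by simp
      then show ?thesis by (simp add: j)
     qed
     then show "z \<otimes> ?g j \<in> ?\<Omega>" using zc gc by simp
    qed
    have "\<forall>j. \<forall>z\<in>?P. z \<otimes> ?g j \<in> ?\<Omega>" using insert(3) f' i\<Omega> 1 2 card' 3 by blast
    then show ?case by simp
   qed
   then have fin: "?f e \<otimes> (z \<otimes> ?g j) \<in> \<Omega>" if "z \<in> ?P" for e z using that by blast
   let ?Z = "(\<lambda>z. z \<otimes> ?g j) ` ?P"
   have Zc: "?Z \<subseteq> carrier R" using Pc gc by auto
   have C: "?C \<subseteq> {x\<in>carrier R. \<forall>d\<in>?Z. d \<otimes> x \<in> \<Omega>}"
   proof (rule content_subset[OF ideal_residual[OF \<Omega> Zc]])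
    fix e
    have "(z \<otimes> ?g j) \<otimes> ?f e \<in> \<Omega>" if z: "z \<in> ?P" for z
     using fin[OF z, of e] m_comm[OF fc m_closed[OF Pc[OF z] gc], of e j] by simp
    then show "?f e \<in> {x\<in>carrier R. \<forall>d\<in>?Z. d \<otimes> x \<in> \<Omega>}" using fc by auto
   qed
   have "?C \<cdot> ?P \<subseteq> {x\<in>carrier R. \<forall>d\<in>{?g j}. d \<otimes> x \<in> \<Omega>}"
   proof (rule ideal_prod_subset[OF ideal_residual[OF \<Omega>]])
    fix x z assume x: "x \<in> ?C" and z: "z \<in> ?P"
    have xc: "x \<in> carrier R" by (rule ideal_carr[OF iC x])
    have "(z \<otimes> ?g j) \<otimes> x \<in> \<Omega>" using C x z by blast
    moreover have "(z \<otimes> ?g j) \<otimes> x = ?g j \<otimes> (x \<otimes> z)" using xc Pc[OF z] gc by (simp add: m_ac)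
    ultimately show "x \<otimes> z \<in> {x\<in>carrier R. \<forall>d\<in>{?g j}. d \<otimes> x \<in> \<Omega>}" using xc Pc[OF z] by simp
   qed (use gc in simp)
   then show ?thesis unfolding P using m_comm[OF gc, of _ j] by auto
  qed
 qed
qed

lemma csum_subset:
 assumes g: "g \<in> carrier (UP R)"
 shows "finite S \<Longrightarrow> f \<in> S \<rightarrow> carrier (UP R) \<Longrightarrow> csum g f S \<subseteq> cprod f S \<cdot> content_ideal R g"
proof (induct S rule: finite_induct)
 case empty
 have "ideal (cprod f {} \<cdot> content_ideal R g) R" by (intro ideal_prod_is_ideal cprod_ideal content_ideal_ideal g) simp
 then show ?case using ideal_zero by (simp add: csum_empty)
next
 case (insert s S)
 interpret U: UP_cring R "UP R" by (rule UP_cring_R)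
 let ?I = "content_ideal R g" and ?C = "content_ideal R (f s)" and ?P = "cprod f S"
 have f': "f \<in> S \<rightarrow> carrier (UP R)" and fs: "f s \<in> carrier (UP R)" using insert(4) by auto
 have i: "ideal ?C R" "ideal ?P R" "ideal ?I R" by (rule content_ideal_ideal[OF fs], rule cprod_ideal[OF f'], rule content_ideal_ideal[OF g])
 have iCI: "ideal (?C \<cdot> ?I) R" by (intro ideal_prod_is_ideal i)
 have iX: "ideal (?C \<cdot> ?P \<cdot> ?I) R" by (intro ideal_prod_is_ideal i)
 have "content_ideal R (f s \<otimes>\<^bsub>UP R\<^esub> g) \<subseteq> ?C \<cdot> ?I"
  by (intro content_subset[OF iCI] U.coeff_mult_mem[OF fs g iCI] ideal_prod.prod coeff_in_content fs g)
 then have "content_ideal R (f s \<otimes>\<^bsub>UP R\<^esub> g) \<cdot> ?P \<subseteq> ?C \<cdot> ?I \<cdot> ?P" by (rule ideal_prod_mono[OF _ order_refl])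
 also have "\<dots> = ?C \<cdot> ?P \<cdot> ?I" using ideal_prod_assoc[OF i(1,3,2)] ideal_prod_commute[OF i(3,2)] ideal_prod_assoc[OF i(1,2,3)] by simp
 finally have 1: "content_ideal R (f s \<otimes>\<^bsub>UP R\<^esub> g) \<cdot> ?P \<subseteq> ?C \<cdot> ?P \<cdot> ?I" .
 have "?C \<cdot> csum g f S \<subseteq> ?C \<cdot> (?P \<cdot> ?I)" by (rule ideal_prod_mono[OF order_refl insert(3)[OF f']])
 also have "\<dots> = ?C \<cdot> ?P \<cdot> ?I" using i by (simp add: ideal_prod_assoc)
 finally show ?case
  unfolding csum_insert[OF insert(1,2,4) g] cprod_insert[OF insert(1,2,4)] by (rule set_add_least[OF iX 1])
qed

text \<open>\<open>polarized_induct\<close> needs an \<Omega> that contains \<mm> times the target,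
  so it gives the identity only modulo this ideal; Nakayama removes it.\<close>

theorem polarized_identity:
 assumes g: "g \<in> carrier (UP R)" and S: "finite S" "card (pivots g) \<le> card S" and f: "f \<in> S \<rightarrow> carrier (UP R)"
 shows "csum g f S = cprod f S \<cdot> content_ideal R g"
proof
 show "csum g f S \<subseteq> cprod f S \<cdot> content_ideal R g" by (rule csum_subset[OF g S(1) f])
 let ?I = "content_ideal R g" and ?P = "cprod f S"
 let ?g = "cf g"
 have i: "ideal ?P R" "ideal ?I R" "ideal (csum g f S) R" by (rule cprod_ideal[OF f], rule content_ideal_ideal[OF g], rule csum_ideal[OF g f])
 have iN: "ideal (?P \<cdot> ?I) R" by (intro ideal_prod_is_ideal i)
 have imN: "ideal (\<mm> \<cdot> (?P \<cdot> ?I)) R" by (intro ideal_prod_is_ideal mm_ideal iN)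
 let ?\<Omega> = "csum g f S <+> \<mm> \<cdot> (?P \<cdot> ?I)"
 have i\<Omega>: "ideal ?\<Omega> R" by (intro add_ideals i imN)
 have 1: "csum g f S \<subseteq> ?\<Omega>" by (rule set_add_upper1[OF i(3) imN])
 have 2: "?P \<cdot> (\<mm> \<cdot> ?I) \<subseteq> ?\<Omega>"
  using set_add_upper2[OF i(3) imN] ideal_prod_left_comm[OF i(1) mm_ideal i(2)] by simp
 have "pivots g \<inter> {0..} = pivots g" by auto
 then have 3: "card (pivots g \<inter> {0..}) \<le> card S" using S(2) by simp
 have c: "\<forall>j. \<forall>z\<in>?P. z \<otimes> ?g j \<in> ?\<Omega>"
  by (rule mp[OF spec[OF spec[OF polarized_induct[OF g S(1), of f], of ?\<Omega>], of 0]]) (use f i\<Omega> 1 2 3 in simp)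
 have "?I \<subseteq> {x\<in>carrier R. \<forall>z\<in>?P. z \<otimes> x \<in> ?\<Omega>}"
  by (rule content_subset[OF ideal_residual[OF i\<Omega> ideal_subset_carr[OF i(1)]]]) (use c ideal_carr[OF i(2) coeff_in_content[OF g]] in simp)
 then have "?P \<cdot> ?I \<subseteq> ?\<Omega>" by (intro ideal_prod_subset[OF i\<Omega>]) blast
 then show "?P \<cdot> ?I \<subseteq> csum g f S" by (rule nakayama[OF iN i(3)])
qed

section \<open>Minimal generators, and comparison of the three numbers\<close>

lemma ex_min_gens:
 assumes I: "ideal I R"
 shows "\<exists>A. A \<subseteq> carrier R \<and> finite A \<and> card A = min_num_gens R I \<and> I = Idl A"
proof -
 obtain A where A: "A \<subseteq> carrier R" "finite A" "I = Idl A" using finetely_gen[OF I] by blast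
 have "\<exists>A. A \<subseteq> carrier R \<and> finite A \<and> card A = card A \<and> I = Idl A" using A by blast
 then have "\<exists>n. \<exists>A. A \<subseteq> carrier R \<and> finite A \<and> card A = n \<and> I = Idl A" by blast
 then show ?thesis unfolding min_num_gens_def by (rule LeastI_ex)
qed

text \<open>All terms of a relation except the one at s lie in an ideal L that contains N but not v
  s, so the unit u s would put v s into L. For pivots, s is the largest index with a unit
  coefficient; for minimal generators, s is any such index and L is spanned by the other generators
  and \<mm>I.\<close>

lemma indep_triangular:
 fixes v :: "'c \<Rightarrow> 'a"
 assumes N: "ideal N R" and I: "ideal I R" and mI: "\<mm> \<cdot> I \<subseteq> N" and T: "finite T" "v \<in> T \<rightarrow> I"
  and no: "\<And>u t. u \<in> T \<rightarrow> carrier R \<Longrightarrow> t \<in> T \<Longrightarrow> u t \<notin> \<mm> \<Longrightarrow>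
   \<exists>s\<in>T. \<exists>L. ideal L R \<and> N \<subseteq> L \<and> u s \<notin> \<mm> \<and> v s \<notin> L \<and> (\<forall>r\<in>T. r \<noteq> s \<longrightarrow> u r \<in> \<mm> \<or> v r \<in> L)"
 shows "indep N T v"
 unfolding indep_def
proof (intro ballI impI, rule ccontr)
 fix u t assume u: "u \<in> T \<rightarrow> carrier R" and sum: "(\<Oplus>t\<in>T. u t \<otimes> v t) \<in> N" and t: "t \<in> T" "u t \<notin> \<mm>"
 obtain s L where s: "s \<in> T" "ideal L R" "N \<subseteq> L" "u s \<notin> \<mm>" "v s \<notin> L" "\<forall>r\<in>T. r \<noteq> s \<longrightarrow> u r \<in> \<mm> \<or> v r \<in> L"
  using no[OF u t] by blast
 have uc: "u r \<in> carrier R" and vI: "v r \<in> I" if "r \<in> T" for r using u T(2) that by auto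
 have vc: "v r \<in> carrier R" if "r \<in> T" for r by (rule ideal_carr[OF I vI[OF that]])
 have rest: "(\<Oplus>r\<in>T - {s}. u r \<otimes> v r) \<in> L"
 proof (rule ideal_finsum[OF s(2)])
  show "\<forall>r\<in>T - {s}. u r \<otimes> v r \<in> L"
  proof
   fix r assume r: "r \<in> T - {s}"
   then have rT: "r \<in> T" by blast
   consider "u r \<in> \<mm>" | "v r \<in> L" using s(6) r by blast
   then show "u r \<otimes> v r \<in> L"
   proof cases
    case 1
    have "u r \<otimes> v r \<in> \<mm> \<cdot> I" using 1 vI[OF rT] by (rule ideal_prod.prod)
    then show ?thesis using mI s(3) by blast
   next
    case 2 then show ?thesis by (rule ideal_mult_l[OF s(2) _ uc[OF rT]])
   qed
  qed
 qed (use T(1) in simp)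
 have "T = insert s (T - {s})" using s(1) by blast
 then have "(\<Oplus>t\<in>T. u t \<otimes> v t) = (\<Oplus>t\<in>insert s (T - {s}). u t \<otimes> v t)" by simp
 also have "\<dots> = u s \<otimes> v s \<oplus> (\<Oplus>r\<in>T - {s}. u r \<otimes> v r)"
  by (rule finsum_insert) (use T(1) uc vc s(1) in auto)
 finally have eq: "(\<Oplus>t\<in>T. u t \<otimes> v t) = u s \<otimes> v s \<oplus> (\<Oplus>r\<in>T - {s}. u r \<otimes> v r)" .
 have "(u s \<otimes> v s \<oplus> (\<Oplus>r\<in>T - {s}. u r \<otimes> v r)) \<ominus> (\<Oplus>r\<in>T - {s}. u r \<otimes> v r) \<in> L"
  using sum s(3) unfolding eq by (intro ideal_minus[OF s(2) _ rest]) blast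
 moreover have "a \<oplus> b \<ominus> b = a" if "a \<in> carrier R" "b \<in> carrier R" for a b using that by algebra
 ultimately have us: "u s \<otimes> v s \<in> L" using uc[OF s(1)] vc[OF s(1)] ideal_carr[OF s(2) rest] by simp
 obtain b where b: "b \<in> carrier R" "b \<otimes> u s = \<one>" using mm_unit[OF uc[OF s(1)] s(4)] by blast
 have "v s = (b \<otimes> u s) \<otimes> v s" unfolding b(2) using vc[OF s(1)] by simp
 also have "\<dots> = b \<otimes> (u s \<otimes> v s)" using b(1) uc[OF s(1)] vc[OF s(1)] by (rule m_assoc)
 also have "\<dots> \<in> L" by (rule ideal_mult_l[OF s(2) us b(1)])
 finally show False using s(5) by blast
qed

lemma card_pivots_le:
 assumes g: "g \<in> carrier (UP R)"
 shows "card (pivots g) \<le> min_num_gens R (content_ideal R g)"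
proof -
 interpret U: UP_cring R "UP R" by (rule UP_cring_R)
 let ?I = "content_ideal R g" and ?g = "cf g"
 have iI: "ideal ?I R" by (rule content_ideal_ideal[OF g])
 have imI: "ideal (\<mm> \<cdot> ?I) R" by (intro ideal_prod_is_ideal mm_ideal iI)
 obtain A where A: "A \<subseteq> carrier R" "finite A" "card A = min_num_gens R ?I" "?I = Idl A" using ex_min_gens[OF iI] by blast
 have gI: "?g j \<in> ?I" for j by (rule coeff_in_content[OF g])
 have "card (pivots g) \<le> card A"
 proof (rule indep_card_le[OF imI A(2,1) _ finite_pivots[OF g]])
  show "r \<otimes> h \<in> \<mm> \<cdot> ?I" if "h \<in> A" "r \<in> \<mm>" for h r
   using that(2) subsetD[OF genideal_self[OF A(1)] that(1)] unfolding A(4) by (rule ideal_prod.prod)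
  show "?g \<in> pivots g \<rightarrow> Idl A <+> \<mm> \<cdot> ?I"
   using gI set_add_upper1[OF iI imI] unfolding A(4)[symmetric] by blast
  show "indep (\<mm> \<cdot> ?I) (pivots g) ?g"
  proof (rule indep_triangular[OF imI iI order_refl finite_pivots[OF g]])
   show "?g \<in> pivots g \<rightarrow> ?I" using gI by blast
   fix u :: "nat \<Rightarrow> 'a" and t assume t: "t \<in> pivots g" "u t \<notin> \<mm>"
   let ?B = "{j\<in>pivots g. u j \<notin> \<mm>}"
   have B: "finite ?B" "?B \<noteq> {}" using finite_pivots[OF g] t by auto
   define s where "s = Max ?B"
   have s: "s \<in> pivots g" "u s \<notin> \<mm>" using Max_in[OF B] unfolding s_def by auto
   let ?L = "Idl (?g ` {..<s}) <+> \<mm> \<cdot> ?I"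
   have lc: "?g ` {..<s} \<subseteq> carrier R" using g by auto
   note il = genideal_ideal[OF lc]
   have "u r \<in> \<mm> \<or> ?g r \<in> ?L" if r: "r \<in> pivots g" "r \<noteq> s" for r
   proof (cases "r < s")
    case True
    then have "?g r \<in> Idl (?g ` {..<s})" by (intro subsetD[OF genideal_self[OF lc]]) auto
    then show ?thesis using set_add_upper1[OF il imI] by blast
   next
    case False
    have "u r \<in> \<mm>"
    proof (rule ccontr)
     assume "u r \<notin> \<mm>"
     then have "r \<le> s" unfolding s_def using B(1) r(1) by (intro Max_ge) auto
     then show False using False r(2) by simp
    qed
    then show ?thesis by blast
   qed
   moreover have "?g s \<notin> ?L" using s(1) unfolding pivots_def by blast
   moreover have "ideal ?L R" by (intro add_ideals il imI)
   moreover have "\<mm> \<cdot> ?I \<subseteq> ?L" by (rule set_add_upper2[OF il imI])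
   ultimately show "\<exists>s\<in>pivots g. \<exists>L. ideal L R \<and> \<mm> \<cdot> ?I \<subseteq> L \<and> u s \<notin> \<mm> \<and> ?g s \<notin> L \<and> (\<forall>r\<in>pivots g. r \<noteq> s \<longrightarrow> u r \<in> \<mm> \<or> ?g r \<in> L)"
    using s by (intro bexI[of _ s] exI[of _ ?L]) simp_all
  qed
 qed
 then show ?thesis using A(3) by simp
qed

lemma indep_min_gens:
 assumes I: "ideal I R"
 shows "\<exists>A. finite A \<and> A \<subseteq> I \<and> card A = min_num_gens R I \<and> indep (\<mm> \<cdot> I) A (\<lambda>a. a)"
proof -
 obtain A where A: "A \<subseteq> carrier R" "finite A" "card A = min_num_gens R I" "I = Idl A" using ex_min_gens[OF I] by blast
 have AI: "A \<subseteq> I" unfolding A(4) by (rule genideal_self[OF A(1)])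
 have imI: "ideal (\<mm> \<cdot> I) R" by (intro ideal_prod_is_ideal mm_ideal I)
 have "indep (\<mm> \<cdot> I) A (\<lambda>a. a)"
 proof (rule indep_triangular[OF imI I order_refl A(2)])
  show "(\<lambda>a. a) \<in> A \<rightarrow> I" using AI by blast
  fix u :: "'a \<Rightarrow> 'a" and t assume t: "t \<in> A" "u t \<notin> \<mm>"
  let ?B = "A - {t}"
  have Bc: "?B \<subseteq> carrier R" using A(1) by blast
  note iB = genideal_ideal[OF Bc]
  let ?L = "Idl ?B <+> \<mm> \<cdot> I"
  have iL: "ideal ?L R" by (intro add_ideals iB imI)
  have BL: "?B \<subseteq> ?L" using genideal_self[OF Bc] set_add_upper1[OF iB imI] by blast
  have "t \<notin> ?L"
  proof
   assume "t \<in> ?L"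
   then have "A \<subseteq> ?L" using BL by blast
   then have "I \<subseteq> ?L" unfolding A(4) using genideal_minimal[OF iL] A(4) by simp
   then have "I \<subseteq> Idl ?B" by (rule nakayama[OF I iB])
   moreover have "Idl ?B \<subseteq> I" unfolding A(4) by (rule Idl_mono[OF _ A(1)]) blast
   ultimately have "I = Idl ?B" by blast
   then have "min_num_gens R I \<le> card ?B" using min_num_gens_le[OF Bc] A(2) by simp
   then show False using A(2,3) t(1) by (metis card_Diff1_less not_le)
  qed
  moreover have "\<mm> \<cdot> I \<subseteq> ?L" by (rule set_add_upper2[OF iB imI])
  moreover have "\<forall>r\<in>A. r \<noteq> t \<longrightarrow> u r \<in> \<mm> \<or> r \<in> ?L" using BL by blast
  ultimately show "\<exists>s\<in>A. \<exists>L. ideal L R \<and> \<mm> \<cdot> I \<subseteq> L \<and> u s \<notin> \<mm> \<and> s \<notin> L \<and> (\<forall>r\<in>A. r \<noteq> s \<longrightarrow> u r \<in> \<mm> \<or> r \<in> L)"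
   using t iL by (intro bexI[of _ t] exI[of _ ?L]) simp_all
 qed
 then show ?thesis using A AI by blast
qed

lemma cprod_const: "f \<in> carrier (UP R) \<Longrightarrow> cprod (\<lambda>_. f) S = ipow (content_ideal R f) (card S)"
proof -
 assume f: "f \<in> carrier (UP R)"
 interpret C: comm_monoid "ideals_set R" by (rule ideals_set_is_comm_monoid)
 show ?thesis unfolding cprod_def ipow_def by (rule C.finprod_const) (simp add: content_ideal_ideal f)
qed

text \<open>Addition of ideals is idempotent, so for equal polynomials the summands collapse to one.
  The polarized identity thus specializes to the Dedekind--Mertens identity with the same k.\<close>

lemma csum_const:
 assumes f: "f \<in> carrier (UP R)" and g: "g \<in> carrier (UP R)" and S: "finite S" "S \<noteq> {}"
 shows "csum g (\<lambda>_. f) S = content_ideal R (f \<otimes>\<^bsub>UP R\<^esub> g) \<cdot> ipow (content_ideal R f) (card S - 1)"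
proof -
 interpret C: semiring "ideals_set R" by (rule ideals_set_is_semiring)
 let ?X = "content_ideal R (f \<otimes>\<^bsub>UP R\<^esub> g) \<cdot> ipow (content_ideal R f) (card S - 1)"
 have X: "ideal ?X R" by (intro ideal_prod_is_ideal content_mult_ideal ipow_ideal content_ideal_ideal f g)
 have idem: "T \<noteq> {} \<longrightarrow> (\<Oplus>\<^bsub>ideals_set R\<^esub> i \<in> T. ?X) = ?X" if "finite T" for T :: "'c set"
  using that
 proof (induct T rule: finite_induct)
  case (insert t T)
  have "(\<Oplus>\<^bsub>ideals_set R\<^esub> i \<in> insert t T. ?X) = ?X <+> (\<Oplus>\<^bsub>ideals_set R\<^esub> i \<in> T. ?X)"
   using C.finsum_insert[OF insert(1,2), of "\<lambda>_. ?X"] X by simp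
  moreover have "?X <+> {\<zero>} = ?X"
   using set_add_least[OF X order_refl, of "{\<zero>}"] ideal_zero[OF X] set_add_upper1[OF X zeroideal] by simp
  ultimately show ?case using insert(3) set_add_idem[OF X] by (cases "T = {}") simp_all
 qed simp
 have "csum g (\<lambda>_. f) S = (\<Oplus>\<^bsub>ideals_set R\<^esub> i \<in> S. ?X)"
  unfolding csum_def
  by (rule C.finsum_cong') (use X S in \<open>auto simp: cprod_const[OF f]\<close>)
 then show ?thesis using idem[OF S(1)] S(2) by simp
qed

theorem dm_numbers_eq_min_num_gens:
 assumes cat: "catenary (UP R)" and unr: "analytically_unramified R \<mm>" and g: "g \<in> carrier (UP R)"
  and k: "dedekind_mertens_number R g = k"
  and dim: "\<And>p. minimal_prime R p \<Longrightarrow> enat k \<le> krull_dim (R Quot p)"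
 shows "min_num_gens R (content_ideal R g) \<le> k"
  and "polarized_dedekind_mertens_number R g = k"
  and "g \<noteq> \<zero>\<^bsub>UP R\<^esub> \<Longrightarrow> min_num_gens R (content_ideal R g) = k"
proof -
 interpret U: UP_cring R "UP R" by (rule UP_cring_R)
 let ?I = "content_ideal R g" and ?\<mu> = "min_num_gens R (content_ideal R g)"
 have iI: "ideal ?I R" by (rule content_ideal_ideal[OF g])
 define D where "D k \<longleftrightarrow> (\<forall>f\<in>carrier (UP R). content_ideal R (f \<otimes>\<^bsub>UP R\<^esub> g) \<cdot> (content_ideal R f [^]\<^bsub>ideals_set R\<^esub> (k - 1)) =
  (content_ideal R f [^]\<^bsub>ideals_set R\<^esub> k) \<cdot> ?I)" for k :: nat
 define Q' where "Q' k \<longleftrightarrow> (\<forall>f\<in>{1..k} \<rightarrow> carrier (UP R). csum g f {1..k} = cprod f {1..k} \<cdot> ?I)" for k :: nat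
 let ?d = "dedekind_mertens_number R g" and ?p = "polarized_dedekind_mertens_number R g"
 have d: "?d = (LEAST k. 1 \<le> k \<and> D k)" unfolding dedekind_mertens_number_def D_def ..
 have p: "?p = (LEAST k. 1 \<le> k \<and> Q' k)" unfolding polarized_dedekind_mertens_number_def Q'_def csum_def cprod_def ..
 \<comment> \<open>The maximum takes care of I = 0, where \<mu> is 0 while the numbers are at least
   1 by definition.\<close>
 have Q: "1 \<le> max 1 ?\<mu> \<and> Q' (max 1 ?\<mu>)"
 proof
  show "Q' (max 1 ?\<mu>)"
   unfolding Q'_def using card_pivots_le[OF g] by (intro ballI polarized_identity[OF g]) auto
 qed simp
 have p1: "1 \<le> ?p" "Q' ?p" unfolding p using LeastI[of "\<lambda>k. 1 \<le> k \<and> Q' k", OF Q] by blast+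
 have p2: "?p \<le> max 1 ?\<mu>" unfolding p by (rule Least_le[of "\<lambda>k. 1 \<le> k \<and> Q' k", OF Q])
 \<comment> \<open>Besides bounding the Dedekind--Mertens number this shows that some k satisfies
   the identity, so that the least one is meaningful.\<close>
 have "D ?p"
  unfolding D_def
 proof
  fix f assume f: "f \<in> carrier (UP R)"
  have "csum g (\<lambda>_. f) {1..?p} = cprod (\<lambda>_. f) {1..?p} \<cdot> ?I" using p1(2) f unfolding Q'_def by blast
  then show "content_ideal R (f \<otimes>\<^bsub>UP R\<^esub> g) \<cdot> (content_ideal R f [^]\<^bsub>ideals_set R\<^esub> (?p - 1)) = (content_ideal R f [^]\<^bsub>ideals_set R\<^esub> ?p) \<cdot> ?I"
   using p1(1) csum_const[OF f g, of "{1..?p}"] cprod_const[OF f, of "{1..?p}"] by (simp add: ipow_def)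
 qed
 then have pD: "1 \<le> ?p \<and> D ?p" using p1(1) by blast
 have d1: "1 \<le> ?d" "D ?d" unfolding d using LeastI[of "\<lambda>k. 1 \<le> k \<and> D k", OF pD] by blast+
 have d2: "?d \<le> ?p" unfolding d by (rule Least_le[of "\<lambda>k. 1 \<le> k \<and> D k", OF pD])
 have k1: "1 \<le> k" using d1(1) k by simp
 then obtain k' where k': "k = Suc k'" by (cases k) auto
 have DM: "content_ideal R (f \<otimes>\<^bsub>UP R\<^esub> g) \<cdot> ipow (content_ideal R f) k' = ipow (content_ideal R f) (Suc k') \<cdot> ?I"
  if "f \<in> carrier (UP R)" for f
  using d1(2) that unfolding k k' D_def ipow_def by simp
 have chain: "\<exists>P. (\<forall>i\<le>k. primeideal (P i) R \<and> p \<subseteq> P i \<and> P i \<subseteq> \<mm>) \<and> (\<forall>i<k. P i \<subset> P (Suc i))" if p: "minimal_prime R p" for p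
 proof -
  have ip: "ideal p R" using p prime_ideal unfolding minimal_prime_def by blast
  have "0 < k" using k1 by simp
  from chain_over_of_krull_dim[OF ip dim[OF p] this] obtain P where P: "\<forall>i\<le>k. primeideal (P i) R \<and> p \<subseteq> P i" "\<forall>i<k. P i \<subset> P (Suc i)" by blast
  have "P i \<subseteq> \<mm>" if "i \<le> k" for i using proper_ideal_sub_mm[OF prime_ideal prime_one] P(1) that by blast
  then show ?thesis using P by blast
 qed
 show \<mu>k: "?\<mu> \<le> k"
 proof (cases "k' = 0")
  case True
  have dm: "content_ideal R (f \<otimes>\<^bsub>UP R\<^esub> g) = content_ideal R f \<cdot> ?I" if f: "f \<in> carrier (UP R)" for f
   using DM[OF f] unfolding True
   by (simp add: ideal_prod_one[OF content_mult_ideal[OF f g]] ipow_1[OF content_ideal_ideal[OF f]])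
  have np: "p \<noteq> \<mm>" if p: "minimal_prime R p" for p
  proof -
   obtain P where P: "\<forall>i\<le>k. primeideal (P i) R \<and> p \<subseteq> P i \<and> P i \<subseteq> \<mm>" "\<forall>i<k. P i \<subset> P (Suc i)" using chain[OF p] by blast
   have "p \<subseteq> P 0" "P 0 \<subset> P 1" "P 1 \<subseteq> \<mm>" using P k1 by auto
   then show ?thesis by blast
  qed
  obtain A where A: "A \<subseteq> carrier R" "finite A" "card A \<le> 1" "?I = Idl A"
   using principal_of_dm_one[OF cat unr g np dm] by blast
  have "?\<mu> \<le> card A" unfolding A(4) by (rule min_num_gens_le[OF A(1,2)])
  then show ?thesis using A(3) k1 by simp
 next
  case False
  \<comment> \<open>For k \<ge> 2 the member P 1 of the chain lies strictly between p and \<mm>. So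
    all minimal primes are big, and their intersection is zero because R is reduced.\<close>
  have big: "p \<in> big_primes" if p: "minimal_prime R p" for p
  proof -
   obtain P where P: "\<forall>i\<le>k. primeideal (P i) R \<and> p \<subseteq> P i \<and> P i \<subseteq> \<mm>" "\<forall>i<k. P i \<subset> P (Suc i)" using chain[OF p] by blast
   have "1 \<le> k" "0 < k" "1 < k" "2 \<le> k" using False k' by auto
   then have "primeideal (P 1) R" "p \<subseteq> P 0" "P 0 \<subset> P 1" "P 1 \<subset> P 2" "P 2 \<subseteq> \<mm>" using P by (auto simp: numeral_2_eq_2)
   then have "\<exists>p1. primeideal p1 R \<and> p \<subset> p1 \<and> p1 \<subset> \<mm>" by (intro exI[of _ "P 1"]) blast
   then show ?thesis using p unfolding big_primes_def by blast
  qed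
  have "z = \<zero>" if z: "z \<in> big_Inter" for z
   using z big by (intro zero_if_in_minimal_primes[OF unr]) (auto simp: big_Inter_def)
  then have bI: "big_Inter = {\<zero>}" using ideal_zero[OF ideal_big_Inter] by blast
  obtain A where A: "finite A" "A \<subseteq> ?I" "card A = ?\<mu>" "indep (\<mm> \<cdot> ?I) A (\<lambda>a. a)" using indep_min_gens[OF iI] by blast
  have imI: "ideal (\<mm> \<cdot> ?I) R" by (intro ideal_prod_is_ideal mm_ideal iI)
  have "\<mm> \<cdot> ?I <+> big_Inter = \<mm> \<cdot> ?I"
   unfolding bI using set_add_least[OF imI order_refl, of "{\<zero>}"] ideal_zero[OF imI] set_add_upper1[OF imI zeroideal] by simp
  then have "indep (\<mm> \<cdot> ?I <+> big_Inter) A (\<lambda>a. a)" using A(4) by simp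
  moreover have "(\<lambda>a. a) \<in> A \<rightarrow> ?I" using A(2) by blast
  ultimately have "card A \<le> Suc k'" using indep_card_le_dm[OF cat unr g DM A(1)] by blast
  then show ?thesis using A(3) k' by simp
 qed
 then have "?p \<le> k" using p2 k1 by simp
 then show pk: "?p = k" using d2 k by simp
 \<comment> \<open>For g = 0 the content ideal has 0 generators while both numbers are 1. Otherwise
   \<mu> is positive and max 1 \<mu> = \<mu>.\<close>
 show "?\<mu> = k" if g0: "g \<noteq> \<zero>\<^bsub>UP R\<^esub>"
 proof -
  have "?\<mu> \<noteq> 0"
  proof
   assume z: "?\<mu> = 0"
   obtain A where A: "finite A" "card A = ?\<mu>" "?I = Idl A" using ex_min_gens[OF iI] by blast
   then have "?I = {\<zero>}" using z by (simp add: Idl_empty)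
   then have "cf g i = \<zero>" for i using coeff_in_content[OF g, of i] by simp
   then have "g = \<zero>\<^bsub>UP R\<^esub>" by (intro U.up_eqI g) simp_all
   then show False using g0 by blast
  qed
  then show ?thesis using p2 pk \<mu>k by simp
 qed
qed

end

theorem theorem4p2:
  fixes R :: "('a, 'b) ring_scheme" and \<mm> :: "'a set"
    and g :: "nat \<Rightarrow> 'a" and k :: nat
  assumes "local_ring R \<mm>"
    and "noetherian_ring R"
    and "universally_catenary R"
    and "analytically_unramified R \<mm>"
    and "g \<in> carrier (UP R)"
    and "dedekind_mertens_number R g = k"
    and "\<And>\<pp>. minimal_prime R \<pp> \<Longrightarrow> enat k \<le> krull_dim (R Quot \<pp>)"
  shows "min_num_gens R (content_ideal R g) \<le> k \<and>
    polarized_dedekind_mertens_number R g = dedekind_mertens_number R g \<and>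
    (g \<noteq> \<zero>\<^bsub>UP R\<^esub> \<longrightarrow>
      min_num_gens R (content_ideal R g) = polarized_dedekind_mertens_number R g)"
proof -
  interpret L: local_ring R \<mm> by (rule assms(1))
  interpret N: noeth_local R \<mm>
    by (intro noeth_local.intro noeth_local_axioms.intro noetherian_cringI assms(2) L.cring_axioms L.maximal L.maximal_unique)
  interpret U: UP_cring R "UP R" by (rule N.UP_cring_R)
  note dm = N.dm_numbers_eq_min_num_gens[OF U.catenary_UP[OF assms(3)] assms(4-7)]
  show ?thesis using dm assms(6) by simp
qed

end
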